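(* Let $S$ be either $\mathbf R^d$ or a bounded open Lipschitz subset of $\mathbf R^d$. Then the spectrum of the limit two-scale operator $\mathcal A$ is $$\mathrm{Sp}(\mathcal A)=\{\lambda\in\mathbf R\setminus\mathrm{Sp}(\mathcal A^\#_{\rm soft}):\ \beta(\lambda)\in\mathrm{Sp}(\mathcal A_{\rm hom})\}\cup\mathrm{Sp}(\mathcal A^\#_{\rm soft}).$$
   Context: Geometry. $Y=[0,1)^d$, $\square=[-1,1]^d$, $\square^k=[-k,k]^d$. $Y^\#_{\rm stiff},Y^\#_{\rm soft}\subset\mathbf R^d$ are disjoint open $\mathbf Z^d$-periodic sets with $Y^\#_{\rm stiff}\ne\emptyset$ and $\overline{Y^\#_{\rm stiff}\cup Y^\#_{\rm soft}}=\mathbf R^d$; $Y_{\rm stiff}=Y^\#_{\rm stiff}\cap Y$, $Y_{\rm soft}=Y^\#_{\rm soft}\cap Y$. Kernel. $a\ge0$ is even on $\mathbf R^d$, there are $r_a,c_a>0$ with $a(x)\ge c_a$ for $|x|<r_a$, and $a(x)(1+|x|^2)\in L^1(\mathbf R^d)$. $\Lambda_0,p$ are symmetric measurable functions on $\mathbf R^d\times\mathbf R^d$, $\mathbf Z^d$-periodic in each argument, with $\Lambda_0=0$ outside $Y^\#_{\rm stiff}\times Y^\#_{\rm stiff}$, $p(x,y)=w(x,y)\,(1-\mathbf 1_{Y^\#_{\rm stiff}}(x)\mathbf 1_{Y^\#_{\rm stiff}}(y))$, and for some $0<\alpha_1<\alpha_2<\infty$: $\alpha_1<w<\alpha_2$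 everywhere and $\alpha_1<\Lambda_0<\alpha_2$ on $Y^\#_{\rm stiff}\times Y^\#_{\rm stiff}$. Connectedness assumption. There exist $r_0,\kappa_0,r_1>0$ and $k,\overline N\in\mathbf N$ with: (i) $|Y^\#_{\rm stiff}\cap B_{r_0}(x)|\ge\kappa_0|B_{r_0}|$ for all $x\in Y_{\rm stiff}$; (ii) any $\eta',\eta''\in Y^\#_{\rm stiff}\cap\square$ are joined by points $\eta_0=\eta',\eta_1,\dots,\eta_{N+1}=\eta''$ of $Y^\#_{\rm stiff}\cap\square^k$ with $N\le\overline N$ and $|\eta_{j+1}-\eta_j|\le r_1$; (iii) $r_a\ge 2r_0+r_1$. Here $B_r(x)$ is the open ball of radius $r$ centred at $x$, $B_r=B_r(0)$, and $|\cdot|$ of a set is Lebesgue measure. Spaces. $L^2_\#(Y)$ denotes $L^2(Y)$ functions extended $\mathbf Z^d$-periodically; $L^2_\#(Y_{\rm soft})$, $L^2_\#(Y_{\rm stiff})$ are the subspaces of functions vanishing on $Y^\#_{\rm stiff}$, resp. $Y^\#_{\rm soft}$. $L^2_\#(S\times Y_{\rm soft})=L^2(S;L^2_\#(Y_{\rm soft}))$. $H^1_0(\mathbf R^d)=H^1(\mathbf R^d)$. $\langle g\rangle=\int_Y g\,dy$. Operators (spectra are understood after complexification). For $i=1,\dots,d$ let $\chi^i\in L^2_\#(Y_{\rm stiff})$ be the solution, unique up to an additive constant (on $Y_{\rm stiff}$), of $$\int_Y\int_{\mathbf R^d}a(\xi)\Lambda_0(y,y+\xi)(\xi_i+\chi^i(y+\xi)-\chi^i(y))(b(y+\xi)-b(y))\,d\xi\,dy=0\quad\forall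 b\in L^2_\#(Y),$$ and $A^{\rm hom}_{ij}=\int_Y\int_{\mathbf R^d}a(\xi)\Lambda_0(y,y+\xi)(\xi_i+\chi^i(y+\xi)-\chi^i(y))\xi_j\,d\xi\,dy$. $\mathcal A_{\rm hom}$ is the self-adjoint operator in $L^2(S)$ associated with the form $\int_S A^{\rm hom}\nabla u\cdot\nabla v\,dx$ with domain $H^1_0(S)$. $\mathcal A^\#_{\rm soft}$ is the bounded self-adjoint operator on $L^2_\#(Y_{\rm soft})$ (with the $L^2(Y)$ inner product) associated with $$a^\#_{\rm soft}(z,b)=\int_{\mathbf R^d}\int_Y a(\xi)p(y,y+\xi)(z(y+\xi)-z(y))(b(y+\xi)-b(y))\,dy\,d\xi .$$ $\mathcal A$ is the self-adjoint operator in the Hilbert space $L^2(S)+L^2_\#(S\times Y_{\rm soft})\subset L^2(S\times Y)$ associated with the form $$a(u+z,v+b)=\int_S A^{\rm hom}\nabla u\cdot\nabla v\,dx+\int_S a^\#_{\rm soft}(z(x,\cdot),b(x,\cdot))\,dx,\quad u+z,v+b\in H^1_0(S)+L^2_\#(S\times Y_{\rm soft}).$$ The function $\beta:\mathbf R\setminus\mathrm{Sp}(\mathcal A^\#_{\rm soft})\to\mathbf R$ is $\beta(\lambda)=\lambda+\lambda^2\big\langle(\mathcal A^\#_{\rm soft}-\lambda I)^{-1}\mathbf 1_{Y_{\rm soft}}\big\rangle$, where $\mathbf 1_{Y_{\rm soft}}$ is extended periodically.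
   Formalization: S is taken non-empty, and L²_#(Y_soft), L²_#(Y_stiff) are read as functions vanishing a.e. outside Y_soft^#, resp. Y_stiff^# (the same as stated if the interface is a null set; otherwise the literal claim fails, since 1_{Y_soft} is not the projection of 1). *)

theory Defs
  imports "HOL-Analysis.Analysis"
begin

section \<open>Square-integrable functions, form operators, spectra\<close>

text \<open>Elements of \<open>L\<^sup>2(M)\<close> are represented by functions; all notions below
  are invariant under modification on null sets, and equality in a Hilbert space is equality
  almost everywhere.\<close>

definition L2 :: "'x measure \<Rightarrow> ('x \<Rightarrow> real) set" where
  "L2 M = {f \<in> borel_measurable M. integrable M (\<lambda>x. (f x)\<^sup>2)}"

definition L2_inner :: "'x measure \<Rightarrow> ('x \<Rightarrow> real) \<Rightarrow> ('x \<Rightarrow> real) \<Rightarrow> real" where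
  "L2_inner M f g = (LINT x|M. f x * g x)"

definition L2_norm_complex :: "'x measure \<Rightarrow> ('x \<Rightarrow> complex) \<Rightarrow> real" where
  "L2_norm_complex M f = sqrt (LINT x|M. (cmod (f x))\<^sup>2)"

text \<open>The (graph of the) operator associated with a symmetric form \<open>q\<close> on a Hilbert space
  \<open>H \<subseteq> L\<^sup>2(M)\<close>. The form domain is given as a set \<open>D\<close> together with a map \<open>j\<close> into \<open>H\<close>
  that is injective up to null sets. Thus \<open>F\<close> is in the operator domain with image \<open>f\<close> iff
  \<open>F = j e\<close> with \<open>e \<in> D\<close> and \<open>q e e' = (f, j e')\<close> for all \<open>e' \<in> D\<close>.\<close>

definition form_operator ::
  "'x measure \<Rightarrow> ('x \<Rightarrow> real) set \<Rightarrow> 'e set \<Rightarrow> ('e \<Rightarrow> 'x \<Rightarrow> real) \<Rightarrow> ('e \<Rightarrow> 'e \<Rightarrow> real)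
    \<Rightarrow> (('x \<Rightarrow> real) \<times> ('x \<Rightarrow> real)) set" where
  "form_operator M H D j q = {(F, f). F \<in> H \<and> f \<in> H \<and>
     (\<exists>e\<in>D. (AE x in M. F x = j e x) \<and> (\<forall>e'\<in>D. q e e' = L2_inner M f (j e')))}"

definition complexify_space :: "('x \<Rightarrow> real) set \<Rightarrow> ('x \<Rightarrow> complex) set" where
  "complexify_space H = {f. (\<lambda>x. Re (f x)) \<in> H \<and> (\<lambda>x. Im (f x)) \<in> H}"

definition complexify_operator ::
  "(('x \<Rightarrow> real) \<times> ('x \<Rightarrow> real)) set \<Rightarrow> (('x \<Rightarrow> complex) \<times> ('x \<Rightarrow> complex)) set" where
  "complexify_operator T = {(F, f). ((\<lambda>x. Re (F x)), (\<lambda>x. Re (f x))) \<in> T \<and>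
                                    ((\<lambda>x. Im (F x)), (\<lambda>x. Im (f x))) \<in> T}"

text \<open>\<open>lam\<close> is in the resolvent set iff \<open>T - lam\<close> (after complexification) is a bijection
  of its domain onto the complexification of \<open>H\<close> with bounded inverse. Note that
  \<open>(T - lam) F = f\<close> says \<open>(F, lam F + f) \<in> T\<close>.\<close>

definition resolvent_set ::
  "'x measure \<Rightarrow> ('x \<Rightarrow> real) set \<Rightarrow> (('x \<Rightarrow> real) \<times> ('x \<Rightarrow> real)) set \<Rightarrow> complex set" where
  "resolvent_set M H T = {lam.
     (\<forall>F. (F, \<lambda>x. lam * F x) \<in> complexify_operator T \<longrightarrow> (AE x in M. F x = 0)) \<and>
     (\<exists>C. \<forall>f \<in> complexify_space H. \<exists>F. (F, \<lambda>x. lam * F x + f x) \<in> complexify_operator T \<and>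
        L2_norm_complex M F \<le> C * L2_norm_complex M f)}"

definition spectrum ::
  "'x measure \<Rightarrow> ('x \<Rightarrow> real) set \<Rightarrow> (('x \<Rightarrow> real) \<times> ('x \<Rightarrow> real)) set \<Rightarrow> complex set" where
  "spectrum M H T = - resolvent_set M H T"

text \<open>A representative of \<open>(T - lam)\<^sup>-\<^sup>1 f\<close> for real \<open>lam\<close> outside the spectrum; it is
  unique up to null sets.\<close>

definition resolvent ::
  "(('x \<Rightarrow> real) \<times> ('x \<Rightarrow> real)) set \<Rightarrow> real \<Rightarrow> ('x \<Rightarrow> real) \<Rightarrow> 'x \<Rightarrow> real" where
  "resolvent T lam f = (SOME F. (F, \<lambda>x. lam * F x + f x) \<in> T)"


section \<open>Periodic geometry\<close>

definition cell :: "(real^'d) set" where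
  "cell = {y. \<forall>i. 0 \<le> y $ i \<and> y $ i < 1}"

definition cube :: "nat \<Rightarrow> (real^'d) set" where
  "cube k = {x. \<forall>i. - real k \<le> x $ i \<and> x $ i \<le> real k}"

definition lattice_vec :: "int^'d \<Rightarrow> real^'d" where
  "lattice_vec m = (\<chi> i. of_int (m $ i))"

definition periodic :: "(real^'d \<Rightarrow> 'b) \<Rightarrow> bool" where
  "periodic f \<longleftrightarrow> (\<forall>m x. f (x + lattice_vec m) = f x)"

definition periodic_set :: "(real^'d) set \<Rightarrow> bool" where
  "periodic_set U \<longleftrightarrow> periodic (\<lambda>x. x \<in> U)"

definition geometry :: "(real^'d) set \<Rightarrow> (real^'d) set \<Rightarrow> bool" where
  "geometry Ystiff Ysoft \<longleftrightarrow>
     open Ystiff \<and> open Ysoft \<and> periodic_set Ystiff \<and> periodic_set Ysoft \<and>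
     Ystiff \<inter> Ysoft = {} \<and> Ystiff \<noteq> {} \<and> closure (Ystiff \<union> Ysoft) = UNIV"

definition convolution_kernel :: "(real^'d \<Rightarrow> real) \<Rightarrow> real \<Rightarrow> real \<Rightarrow> bool" where
  "convolution_kernel a r_a c_a \<longleftrightarrow>
     (\<forall>x. 0 \<le> a x) \<and> (\<forall>x. a (- x) = a x) \<and>
     r_a > 0 \<and> c_a > 0 \<and> (\<forall>x. norm x < r_a \<longrightarrow> c_a \<le> a x) \<and>
     integrable lebesgue (\<lambda>x. a x * (1 + (norm x)\<^sup>2))"

definition periodic_coefficient :: "(real^'d \<Rightarrow> real^'d \<Rightarrow> real) \<Rightarrow> bool" where
  "periodic_coefficient K \<longleftrightarrow>
     (\<lambda>(x, y). K x y) \<in> borel_measurable lebesgue \<and> (\<forall>x y. K x y = K y x) \<and>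
     (\<forall>y. periodic (\<lambda>x. K x y)) \<and> (\<forall>x. periodic (K x))"

definition coefficients ::
  "(real^'d) set \<Rightarrow> (real^'d \<Rightarrow> real^'d \<Rightarrow> real) \<Rightarrow> (real^'d \<Rightarrow> real^'d \<Rightarrow> real) \<Rightarrow> bool" where
  "coefficients Ystiff Lam p \<longleftrightarrow>
     periodic_coefficient Lam \<and> periodic_coefficient p \<and>
     (\<forall>x y. (x, y) \<notin> Ystiff \<times> Ystiff \<longrightarrow> Lam x y = 0) \<and>
     (\<exists>w \<alpha>1 \<alpha>2. 0 < \<alpha>1 \<and> \<alpha>1 < \<alpha>2 \<and>
        (\<forall>x y. p x y = w x y * (1 - indicat_real Ystiff x * indicat_real Ystiff y)) \<and>
        (\<forall>x y. \<alpha>1 < w x y \<and> w x y < \<alpha>2) \<and>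
        (\<forall>x\<in>Ystiff. \<forall>y\<in>Ystiff. \<alpha>1 < Lam x y \<and> Lam x y < \<alpha>2))"

definition stiff_connected :: "(real^'d) set \<Rightarrow> real \<Rightarrow> bool" where
  "stiff_connected Ystiff r_a \<longleftrightarrow>
     (\<exists>r0 \<kappa>0 r1. \<exists>k Nbar :: nat. r0 > 0 \<and> \<kappa>0 > 0 \<and> r1 > 0 \<and>
        (\<forall>x \<in> Ystiff \<inter> cell.
           measure lebesgue (Ystiff \<inter> ball x r0) \<ge> \<kappa>0 * measure lebesgue (ball (0 :: real^'d) r0)) \<and>
        (\<forall>\<eta>' \<in> Ystiff \<inter> cube 1. \<forall>\<eta>'' \<in> Ystiff \<inter> cube 1.
           \<exists>N \<le> Nbar. \<exists>\<eta> :: nat \<Rightarrow> real^'d.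
             \<eta> 0 = \<eta>' \<and> \<eta> (N + 1) = \<eta>'' \<and>
             (\<forall>j \<le> N + 1. \<eta> j \<in> Ystiff \<inter> cube k) \<and>
             (\<forall>j \<le> N. norm (\<eta> (j + 1) - \<eta> j) \<le> r1)) \<and>
        r_a \<ge> 2 * r0 + r1)"


section \<open>Function spaces\<close>

text \<open>\<open>L2_per U\<close> consists of the periodic extensions of \<open>L\<^sup>2\<close>-functions on the cell that vanish
  outside the periodic set \<open>U\<close>; \<open>L2_per UNIV\<close> is \<open>L\<^sup>2\<close> of the cell. If the interface
  \<open>- (Ystiff \<union> Ysoft)\<close> is null, vanishing outside \<open>Ysoft\<close> is the same as vanishing on \<open>Ystiff\<close>
  (and conversely); if it is not null, functions are also required to vanish on the interface.\<close>

definition L2_per :: "(real^'d) set \<Rightarrow> (real^'d \<Rightarrow> real) set" where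
  "L2_per U = {f \<in> L2 (lebesgue_on cell). periodic f \<and>
                 (AE y in lebesgue_on cell. y \<notin> U \<longrightarrow> f y = 0)}"

text \<open>\<open>L\<^sup>2(S; L2_per U)\<close>, identified with a space of functions of two variables.\<close>

definition L2_S_per :: "(real^'d) set \<Rightarrow> (real^'d) set \<Rightarrow> ((real^'d) \<times> (real^'d) \<Rightarrow> real) set" where
  "L2_S_per S U = {z \<in> L2 (lebesgue_on (S \<times> cell)). (\<forall>x\<in>S. periodic (\<lambda>y. z (x, y))) \<and>
                     (AE (x, y) in lebesgue_on (S \<times> cell). y \<notin> U \<longrightarrow> z (x, y) = 0)}"

primrec Ck :: "nat \<Rightarrow> (real^'d \<Rightarrow> real) \<Rightarrow> bool" where
  "Ck 0 f \<longleftrightarrow> continuous_on UNIV f"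
| "Ck (Suc n) f \<longleftrightarrow> (\<forall>x. f differentiable (at x)) \<and>
     (\<forall>i. Ck n (\<lambda>x. frechet_derivative f (at x) (axis i 1)))"

definition grad :: "(real^'d \<Rightarrow> real) \<Rightarrow> real^'d \<Rightarrow> real^'d" where
  "grad f x = (\<chi> i. frechet_derivative f (at x) (axis i 1))"

definition test_functions :: "(real^'d) set \<Rightarrow> (real^'d \<Rightarrow> real) set" where
  "test_functions S = {\<phi>. (\<forall>n. Ck n \<phi>) \<and> compact (closure {x. \<phi> x \<noteq> 0}) \<and>
                          closure {x. \<phi> x \<noteq> 0} \<subseteq> S}"

definition weak_gradient :: "(real^'d) set \<Rightarrow> (real^'d \<Rightarrow> real) \<Rightarrow> (real^'d \<Rightarrow> real^'d) \<Rightarrow> bool" where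
  "weak_gradient S u g \<longleftrightarrow> (\<forall>i. (\<lambda>x. g x $ i) \<in> L2 (lebesgue_on S) \<and>
     (\<forall>\<phi> \<in> test_functions S.
        (LINT x|lebesgue_on S. u x * (grad \<phi> x $ i)) = - (LINT x|lebesgue_on S. g x $ i * \<phi> x)))"

definition H1 :: "(real^'d) set \<Rightarrow> (real^'d \<Rightarrow> real) set" where
  "H1 S = {u \<in> L2 (lebesgue_on S). \<exists>g. weak_gradient S u g}"

definition wgrad :: "(real^'d) set \<Rightarrow> (real^'d \<Rightarrow> real) \<Rightarrow> real^'d \<Rightarrow> real^'d" where
  "wgrad S u = (SOME g. weak_gradient S u g)"

text \<open>For \<open>S = UNIV\<close> the convention \<open>H1_0 UNIV = H1 UNIV\<close> is used; otherwise \<open>H1_0 S\<close> is the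
  closure of the test functions in \<open>H1 S\<close>.\<close>

definition H1_0 :: "(real^'d) set \<Rightarrow> (real^'d \<Rightarrow> real) set" where
  "H1_0 S = (if S = UNIV then H1 UNIV else
     {u \<in> H1 S. \<forall>\<epsilon>>0. \<exists>\<phi> \<in> test_functions S.
        (LINT x|lebesgue_on S. (u x - \<phi> x)\<^sup>2)
          + (LINT x|lebesgue_on S. (norm (wgrad S u x - grad \<phi> x))\<^sup>2) < \<epsilon>})"

text \<open>Near each boundary point, \<open>S\<close> is the strict epigraph of a Lipschitz function over the
  hyperplane orthogonal to a unit vector \<open>e\<close>.\<close>

definition lipschitz_set :: "(real^'d) set \<Rightarrow> bool" where
  "lipschitz_set S \<longleftrightarrow> (\<forall>x \<in> frontier S. \<exists>r>0. \<exists>e. norm e = 1 \<and>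
     (\<exists>L \<gamma>. L-lipschitz_on {v. v \<bullet> e = 0} \<gamma> \<and>
        S \<inter> ball x r = {y \<in> ball x r. y \<bullet> e > \<gamma> (y - (y \<bullet> e) *\<^sub>R e)}))"


section \<open>The operators\<close>

definition corrector ::
  "(real^'d) set \<Rightarrow> (real^'d \<Rightarrow> real) \<Rightarrow> (real^'d \<Rightarrow> real^'d \<Rightarrow> real) \<Rightarrow> 'd \<Rightarrow> (real^'d \<Rightarrow> real) \<Rightarrow> bool"
where
  "corrector Ystiff a Lam i X \<longleftrightarrow> X \<in> L2_per Ystiff \<and>
     (\<forall>b \<in> L2_per UNIV.
        (LINT y|lebesgue_on cell. (LINT \<xi>|lebesgue.
           a \<xi> * Lam y (y + \<xi>) * (\<xi> $ i + X (y + \<xi>) - X y) * (b (y + \<xi>) - b y))) = 0)"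

definition A_hom ::
  "(real^'d \<Rightarrow> real) \<Rightarrow> (real^'d \<Rightarrow> real^'d \<Rightarrow> real) \<Rightarrow> ('d \<Rightarrow> real^'d \<Rightarrow> real) \<Rightarrow> real^'d^'d" where
  "A_hom a Lam X = (\<chi> i j. LINT y|lebesgue_on cell. (LINT \<xi>|lebesgue.
     a \<xi> * Lam y (y + \<xi>) * (\<xi> $ i + X i (y + \<xi>) - X i y) * \<xi> $ j))"

definition hom_form :: "(real^'d) set \<Rightarrow> real^'d^'d \<Rightarrow> (real^'d \<Rightarrow> real) \<Rightarrow> (real^'d \<Rightarrow> real) \<Rightarrow> real" where
  "hom_form S A u v = (LINT x|lebesgue_on S. (A *v wgrad S u x) \<bullet> wgrad S v x)"

definition hom_operator ::
  "(real^'d) set \<Rightarrow> real^'d^'d \<Rightarrow> ((real^'d \<Rightarrow> real) \<times> (real^'d \<Rightarrow> real)) set" where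
  "hom_operator S A =
     form_operator (lebesgue_on S) (L2 (lebesgue_on S)) (H1_0 S) (\<lambda>u. u) (hom_form S A)"

definition Sp_hom :: "(real^'d) set \<Rightarrow> real^'d^'d \<Rightarrow> complex set" where
  "Sp_hom S A = spectrum (lebesgue_on S) (L2 (lebesgue_on S)) (hom_operator S A)"

definition soft_form ::
  "(real^'d \<Rightarrow> real) \<Rightarrow> (real^'d \<Rightarrow> real^'d \<Rightarrow> real) \<Rightarrow> (real^'d \<Rightarrow> real) \<Rightarrow> (real^'d \<Rightarrow> real) \<Rightarrow> real" where
  "soft_form a p z b = (LINT \<xi>|lebesgue. (LINT y|lebesgue_on cell.
     a \<xi> * p y (y + \<xi>) * (z (y + \<xi>) - z y) * (b (y + \<xi>) - b y)))"

definition soft_operator ::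
  "(real^'d) set \<Rightarrow> (real^'d \<Rightarrow> real) \<Rightarrow> (real^'d \<Rightarrow> real^'d \<Rightarrow> real)
     \<Rightarrow> ((real^'d \<Rightarrow> real) \<times> (real^'d \<Rightarrow> real)) set" where
  "soft_operator Ysoft a p =
     form_operator (lebesgue_on cell) (L2_per Ysoft) (L2_per Ysoft) (\<lambda>z. z) (soft_form a p)"

definition Sp_soft ::
  "(real^'d) set \<Rightarrow> (real^'d \<Rightarrow> real) \<Rightarrow> (real^'d \<Rightarrow> real^'d \<Rightarrow> real) \<Rightarrow> complex set" where
  "Sp_soft Ysoft a p = spectrum (lebesgue_on cell) (L2_per Ysoft) (soft_operator Ysoft a p)"

text \<open>The two-scale operator. A pair \<open>(u, z)\<close> stands for the function
  \<open>(x, y) \<mapsto> u x + z (x, y)\<close>; it determines \<open>u\<close> and \<open>z\<close> because \<open>z\<close> vanishes on the nonempty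
  open set \<open>Ystiff\<close>.\<close>

definition two_scale_fun ::
  "(real^'d \<Rightarrow> real) \<times> ((real^'d) \<times> (real^'d) \<Rightarrow> real) \<Rightarrow> (real^'d) \<times> (real^'d) \<Rightarrow> real" where
  "two_scale_fun uz xy = fst uz (fst xy) + snd uz xy"

definition two_scale_space ::
  "(real^'d) set \<Rightarrow> (real^'d) set \<Rightarrow> ((real^'d) \<times> (real^'d) \<Rightarrow> real) set" where
  "two_scale_space S Ysoft = {F \<in> L2 (lebesgue_on (S \<times> cell)).
     \<exists>uz \<in> L2 (lebesgue_on S) \<times> L2_S_per S Ysoft.
       AE xy in lebesgue_on (S \<times> cell). F xy = two_scale_fun uz xy}"

definition two_scale_form ::
  "(real^'d) set \<Rightarrow> real^'d^'d \<Rightarrow> (real^'d \<Rightarrow> real) \<Rightarrow> (real^'d \<Rightarrow> real^'d \<Rightarrow> real)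
     \<Rightarrow> (real^'d \<Rightarrow> real) \<times> ((real^'d) \<times> (real^'d) \<Rightarrow> real)
     \<Rightarrow> (real^'d \<Rightarrow> real) \<times> ((real^'d) \<times> (real^'d) \<Rightarrow> real) \<Rightarrow> real" where
  "two_scale_form S A a p uz vb = hom_form S A (fst uz) (fst vb)
     + (LINT x|lebesgue_on S. soft_form a p (\<lambda>y. snd uz (x, y)) (\<lambda>y. snd vb (x, y)))"

definition two_scale_operator ::
  "(real^'d) set \<Rightarrow> (real^'d) set \<Rightarrow> real^'d^'d \<Rightarrow> (real^'d \<Rightarrow> real) \<Rightarrow> (real^'d \<Rightarrow> real^'d \<Rightarrow> real)
     \<Rightarrow> (((real^'d) \<times> (real^'d) \<Rightarrow> real) \<times> ((real^'d) \<times> (real^'d) \<Rightarrow> real)) set" where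
  "two_scale_operator S Ysoft A a p =
     form_operator (lebesgue_on (S \<times> cell)) (two_scale_space S Ysoft)
       (H1_0 S \<times> L2_S_per S Ysoft) two_scale_fun (two_scale_form S A a p)"

definition Sp_two_scale ::
  "(real^'d) set \<Rightarrow> (real^'d) set \<Rightarrow> real^'d^'d \<Rightarrow> (real^'d \<Rightarrow> real) \<Rightarrow> (real^'d \<Rightarrow> real^'d \<Rightarrow> real)
     \<Rightarrow> complex set" where
  "Sp_two_scale S Ysoft A a p = spectrum (lebesgue_on (S \<times> cell)) (two_scale_space S Ysoft)
     (two_scale_operator S Ysoft A a p)"

text \<open>Zhikov's function; meaningful for \<open>lam\<close> outside \<open>Sp_soft\<close> only.\<close>

definition zhikov_beta ::
  "(real^'d) set \<Rightarrow> (real^'d \<Rightarrow> real) \<Rightarrow> (real^'d \<Rightarrow> real^'d \<Rightarrow> real) \<Rightarrow> real \<Rightarrow> real" where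
  "zhikov_beta Ysoft a p lam = lam + lam\<^sup>2 *
     (LINT y|lebesgue_on cell. resolvent (soft_operator Ysoft a p) lam (indicat_real Ysoft) y)"

end

theory Submission
  imports Defs
begin

text \<open>The equation \<open>(\<A> - \<lambda>) (u + z) = f\<close> splits into a microscopic equation, in which \<open>x\<close> is a parameter
  and \<open>u (x)\<close> enters through \<open>\<lambda> u (x) 1\<^sub>U\<close> with \<open>U\<close> the soft phase, and a macroscopic equation for \<open>u\<close> with the
  source \<open>\<lambda> (u + \<langle>z\<rangle>) + \<langle>f\<rangle>\<close>. If \<open>\<lambda>\<close> is not in the spectrum of the soft operator, the former gives
  \<open>z = z\<^sub>0 + \<lambda> u g\<close> with \<open>g\<close> the resolvent applied to \<open>1\<^sub>U\<close>; inserted into the latter, this leaves the equation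
  \<open>(A\<^sub>h\<^sub>o\<^sub>m - \<beta>(\<lambda>)) u = h\<close>. All \<open>h\<close> arise, already from sources \<open>f\<close> concentrated off the soft phase. Conversely,
  a resolvent of \<open>\<A>\<close> at \<open>\<lambda>\<close> forces one of the soft operator: it is applied to approximate products
  \<open>\<psi>(x) z(y)\<close> whose macroscopic part has relatively small norm, because \<open>A\<^sub>h\<^sub>o\<^sub>m\<close> is unbounded on test functions.
  The matrix \<open>A\<^sub>h\<^sub>o\<^sub>m\<close> is positive definite since a vanishing energy would make \<open>e \<bullet> y + e \<bullet> \<chi>(y)\<close> constant
  along chains in the stiff phase, which connect \<open>y\<close> with its lattice translates.\<close>


section \<open>Lax-Milgram in real semi-Hilbert spaces\<close>

text \<open>Elements of all spaces are functions, identified only up to null sets. Hilbert space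
  theory is therefore set up for a positive semidefinite \<open>ip\<close> on a carrier set, and
  equations are tested against elements instead of being stated pointwise. Spectra are complex while
  all forms are real: a non-real point becomes a real system of two equations, and at a real point
  real and imaginary parts are solved for separately. The obstacle in the converse direction is
  twofold: the soft operator is bounded and nonlocal, so a point of its spectrum need not be an
  eigenvalue, and a profile \<open>z\<close> of nonzero mean disturbs the macroscopic equation. What
  is transferred is the estimate that \<open>L - lam\<close> is bounded below, which for a bounded
  symmetric operator already gives surjectivity. The number \<open>\<theta>\<close> is the measure
  of the part of the cell outside the soft phase; it is positive because the stiff phase is open,
  nonempty and periodic. It makes the splitting of \<open>u + z\<close> stable, and sources living
  there are invisible to the microscopic equation and so can be used to adjust the macroscopic one
  at will.\<close>

lemma quadratic_nonneg_imp_discriminant: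
  fixes a b c :: real
  assumes "\<And>t. 0 \<le> a + 2 * t * b + t\<^sup>2 * c" and "c \<ge> 0"
  shows "b\<^sup>2 \<le> a * c"
proof (cases "c = 0")
  case True
  have "b = 0"
  proof (rule ccontr)
    assume "b \<noteq> 0"
    then show False
      using assms(1)[of "- (a + 1) / (2 * b)"] True by (simp add: field_simps)
  qed
  then show ?thesis using True by simp
next
  case False
  then show ?thesis
    using assms(1)[of "- b / c"] assms(2) by (simp add: field_simps power2_eq_square)
qed

text \<open>Apart from closure of the carrier, every requirement on \<open>add\<close> and
  \<open>scl\<close> is read through \<open>ip\<close>, which need not be definite. This fits spaces
  of functions modulo null sets and form domains consisting of pairs, without forming quotients: two
  elements count as equal when their pairings agree.\<close>

locale semi_inner =
  fixes V :: "'v set" and add :: "'v \<Rightarrow> 'v \<Rightarrow> 'v" and scl :: "real \<Rightarrow> 'v \<Rightarrow> 'v"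
    and ip :: "'v \<Rightarrow> 'v \<Rightarrow> real"
  assumes nonempty: "V \<noteq> {}"
    and add_closed [simp, intro]: "u \<in> V \<Longrightarrow> v \<in> V \<Longrightarrow> add u v \<in> V"
    and scl_closed [simp, intro]: "u \<in> V \<Longrightarrow> scl c u \<in> V"
    and ip_add_left: "u \<in> V \<Longrightarrow> v \<in> V \<Longrightarrow> w \<in> V \<Longrightarrow> ip (add u v) w = ip u w + ip v w"
    and ip_scl_left: "u \<in> V \<Longrightarrow> w \<in> V \<Longrightarrow> ip (scl c u) w = c * ip u w"
    and ip_commute: "u \<in> V \<Longrightarrow> v \<in> V \<Longrightarrow> ip u v = ip v u"
    and ip_nonneg: "u \<in> V \<Longrightarrow> 0 \<le> ip u u"
begin

definition dif :: "'v \<Rightarrow> 'v \<Rightarrow> 'v" where "dif u v = add u (scl (- 1) v)"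

definition nrm :: "'v \<Rightarrow> real" where "nrm u = sqrt (ip u u)"

lemma ip_add_right: "u \<in> V \<Longrightarrow> v \<in> V \<Longrightarrow> w \<in> V \<Longrightarrow> ip w (add u v) = ip w u + ip w v"
  using ip_add_left ip_commute by (metis add_closed)

lemma ip_scl_right: "u \<in> V \<Longrightarrow> w \<in> V \<Longrightarrow> ip w (scl c u) = c * ip w u"
  using ip_scl_left ip_commute by (metis scl_closed)

lemma dif_closed [simp, intro]: "u \<in> V \<Longrightarrow> v \<in> V \<Longrightarrow> dif u v \<in> V"
  by (simp add: dif_def)

lemma ip_dif_left: "u \<in> V \<Longrightarrow> v \<in> V \<Longrightarrow> w \<in> V \<Longrightarrow> ip (dif u v) w = ip u w - ip v w"
  by (simp add: dif_def ip_add_left ip_scl_left)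

lemma ip_dif_right: "u \<in> V \<Longrightarrow> v \<in> V \<Longrightarrow> w \<in> V \<Longrightarrow> ip w (dif u v) = ip w u - ip w v"
  by (simp add: dif_def ip_add_right ip_scl_right)

lemmas ip_simps = ip_add_left ip_scl_left ip_add_right ip_scl_right ip_dif_left ip_dif_right

lemma cauchy_schwarz_sq:
  assumes "u \<in> V" "v \<in> V"
  shows "(ip u v)\<^sup>2 \<le> ip u u * ip v v"
proof (rule quadratic_nonneg_imp_discriminant)
  fix t
  have "0 \<le> ip (add u (scl t v)) (add u (scl t v))"
    using assms by (intro ip_nonneg) auto
  then show "0 \<le> ip u u + 2 * t * ip u v + t\<^sup>2 * ip v v"
    using assms by (simp add: ip_simps ip_commute[of v u] power2_eq_square algebra_simps)
qed (use assms ip_nonneg in auto)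

lemma cauchy_schwarz:
  assumes "u \<in> V" "v \<in> V"
  shows "\<bar>ip u v\<bar> \<le> nrm u * nrm v"
  using real_sqrt_le_mono[OF cauchy_schwarz_sq[OF assms]] by (simp add: nrm_def real_sqrt_mult)

lemma nrm_nonneg [simp]: "u \<in> V \<Longrightarrow> 0 \<le> nrm u"
  by (simp add: nrm_def ip_nonneg)

lemma nrm_sq: "u \<in> V \<Longrightarrow> (nrm u)\<^sup>2 = ip u u"
  by (simp add: nrm_def ip_nonneg)

lemma nrm_scl: "u \<in> V \<Longrightarrow> nrm (scl c u) = \<bar>c\<bar> * nrm u"
  by (simp add: nrm_def ip_simps real_sqrt_mult flip: mult.assoc power2_eq_square)

lemma nrm_add: 
  assumes "u \<in> V" "v \<in> V"
  shows "nrm (add u v) \<le> nrm u + nrm v"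
proof (rule power2_le_imp_le)
  have "(nrm (add u v))\<^sup>2 = (nrm u)\<^sup>2 + 2 * ip u v + (nrm v)\<^sup>2"
    using assms by (simp add: nrm_sq ip_simps ip_commute[of v u])
  also have "\<dots> \<le> (nrm u)\<^sup>2 + 2 * (nrm u * nrm v) + (nrm v)\<^sup>2"
    using cauchy_schwarz[OF assms] by simp
  finally show "(nrm (add u v))\<^sup>2 \<le> (nrm u + nrm v)\<^sup>2"
    by (simp add: power2_sum algebra_simps)
qed (use assms in auto)

end

locale semi_hilbert = semi_inner V add scl ip
  for V :: "'v set" and add scl ip +
  assumes complete: "(\<And>n. f n \<in> V) \<Longrightarrow>
    (\<And>e. e > 0 \<Longrightarrow> \<exists>N. \<forall>m\<ge>N. \<forall>n\<ge>N. ip (dif (f m) (f n)) (dif (f m) (f n)) < e) \<Longrightarrow>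
    \<exists>w\<in>V. (\<lambda>n::nat. ip (dif (f n) w) (dif (f n) w)) \<longlonglongrightarrow> 0"
begin

text \<open>Direct method: \<open>J\<close> is bounded below because \<open>l\<close> is bounded, a
  minimising sequence is Cauchy by the parallelogram law, and its limit satisfies the Euler equation
  of \<open>J\<close>.\<close>

lemma riesz:
  assumes l_add: "\<And>u v. u \<in> V \<Longrightarrow> v \<in> V \<Longrightarrow> l (add u v) = l u + l v"
    and l_scl: "\<And>u c. u \<in> V \<Longrightarrow> l (scl c u) = c * l u"
    and l_bound: "\<And>u. u \<in> V \<Longrightarrow> (l u)\<^sup>2 \<le> C * ip u u"
  shows "\<exists>w\<in>V. \<forall>v\<in>V. ip w v = l v"
proof -
  define J where "J v = ip v v - 2 * l v" for v
  define m where "m = Inf (J ` V)"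
  have J_lower: "- \<bar>C\<bar> \<le> J v" if v: "v \<in> V" for v
  proof -
    have "(2 * l v)\<^sup>2 \<le> 4 * (\<bar>C\<bar> * ip v v)"
      using l_bound[OF v] mult_right_mono[OF abs_ge_self[of C] ip_nonneg[OF v]] by (simp add: power_mult_distrib)
    also have "\<dots> \<le> (\<bar>C\<bar> + ip v v)\<^sup>2"
      using zero_le_power2[of "\<bar>C\<bar> - ip v v"] by (simp add: power2_eq_square algebra_simps)
    finally have "2 * l v \<le> \<bar>C\<bar> + ip v v"
      by (rule power2_le_imp_le) (use ip_nonneg[OF v] in auto)
    then show ?thesis by (simp add: J_def)
  qed
  have bdd: "bdd_below (J ` V)" using J_lower by (auto intro!: bdd_belowI)
  have m_le: "m \<le> J v" if "v \<in> V" for v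
    unfolding m_def using that bdd by (auto intro!: cInf_lower)
  have ex: "\<exists>v\<in>V. J v < m + 1 / real (Suc n)" for n
  proof -
    have "Inf (J ` V) < m + 1 / real (Suc n)" unfolding m_def by simp
    then show ?thesis using cInf_lessD[of "J ` V"] nonempty by auto
  qed
  then obtain f where fV: "\<And>n. f n \<in> V" and fJ: "\<And>n. J (f n) < m + 1 / real (Suc n)" by metis
  \<comment> \<open>Parallelogram law: the midpoint \<open>?h\<close> satisfies
    \<open>m \<le> J ?h\<close>, so two elements whose \<open>J\<close> is close to the infimum are
    close to each other.\<close>
  have cauchy: "ip (dif (f i) (f j)) (dif (f i) (f j)) \<le> 2 / real (Suc i) + 2 / real (Suc j)" for i j
  proof -
    let ?h = "scl (1/2) (add (f i) (f j))"
    have "m \<le> J ?h" using fV by (intro m_le) auto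
    moreover have "ip (dif (f i) (f j)) (dif (f i) (f j)) = 2 * J (f i) + 2 * J (f j) - 4 * J ?h"
      using fV by (simp add: J_def ip_simps l_add l_scl ip_commute[of "f j" "f i"] field_simps)
    moreover have "2 * J (f i) \<le> 2 * m + 2 / real (Suc i)" "2 * J (f j) \<le> 2 * m + 2 / real (Suc j)"
      using fJ[of i] fJ[of j] by (auto simp: field_simps)
    ultimately show ?thesis by linarith
  qed
  have "\<exists>w\<in>V. (\<lambda>n. ip (dif (f n) w) (dif (f n) w)) \<longlonglongrightarrow> 0"
  proof (rule complete)
    fix e :: real assume "e > 0"
    obtain N :: nat where N: "real N > 4 / e" using reals_Archimedean2 by blast
    have *: "2 / real (Suc i) < e / 2" if "i \<ge> N" for i
    proof -
      have "real (Suc i) > 4 / e" using N that by linarith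
      then show ?thesis using \<open>e > 0\<close> by (simp add: field_simps)
    qed
    show "\<exists>N. \<forall>i\<ge>N. \<forall>j\<ge>N. ip (dif (f i) (f j)) (dif (f i) (f j)) < e"
    proof (intro exI allI impI)
      fix i j assume "N \<le> i" "N \<le> j"
      then show "ip (dif (f i) (f j)) (dif (f i) (f j)) < e"
        using cauchy[of i j] *[of i] *[of j] by linarith
    qed
  qed (use fV in auto)
  then obtain w where w: "w \<in> V" and lim: "(\<lambda>n. ip (dif (f n) w) (dif (f n) w)) \<longlonglongrightarrow> 0" by blast
  have "ip w v = l v" if v: "v \<in> V" for v
  proof -
    \<comment> \<open>\<open>f n\<close> minimises \<open>J\<close> only up to
      \<open>1 / real (Suc n)\<close>. Along the line through \<open>f n\<close> in direction
      \<open>v\<close> this makes a quadratic polynomial nonnegative, and its discriminant bounds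
      the defect in the Euler equation. The passage to the limit then concerns
      \<open>ip (f n) v\<close> alone.\<close>
    have var: "(ip (f n) v - l v)\<^sup>2 \<le> (1 / real (Suc n)) * ip v v" for n
    proof (rule quadratic_nonneg_imp_discriminant)
      fix t
      have "m \<le> J (add (f n) (scl t v))" using fV v by (intro m_le) auto
      also have "\<dots> = J (f n) + 2 * t * (ip (f n) v - l v) + t\<^sup>2 * ip v v"
        using fV v by (simp add: J_def ip_simps l_add l_scl ip_commute[of v "f n"] power2_eq_square algebra_simps)
      finally show "0 \<le> 1 / real (Suc n) + 2 * t * (ip (f n) v - l v) + t\<^sup>2 * ip v v"
        using fJ[of n] by linarith
    qed (use v ip_nonneg in auto)
    have "(\<lambda>n. (1 / real (Suc n)) * ip v v) \<longlonglongrightarrow> 0 * ip v v"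
      by (intro tendsto_mult tendsto_const) (use LIMSEQ_inverse_real_of_nat in \<open>simp add: inverse_eq_divide\<close>)
    then have "(\<lambda>n. (ip (f n) v - l v)\<^sup>2) \<longlonglongrightarrow> 0"
      using var by (intro tendsto_sandwich[of "\<lambda>_. 0" "\<lambda>n. (ip (f n) v - l v)\<^sup>2" _ "\<lambda>n. (1 / real (Suc n)) * ip v v"]) auto
    then have 1: "(\<lambda>n. ip (f n) v - l v) \<longlonglongrightarrow> 0"
      by (simp add: tendsto_null_power)
    have "(\<lambda>n. ip (dif (f n) w) (dif (f n) w) * ip v v) \<longlonglongrightarrow> 0 * ip v v"
      by (intro tendsto_mult lim tendsto_const)
    then have "(\<lambda>n. (ip (dif (f n) w) v)\<^sup>2) \<longlonglongrightarrow> 0"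
      using cauchy_schwarz_sq fV w v
      by (intro tendsto_sandwich[of "\<lambda>_. 0" "\<lambda>n. (ip (dif (f n) w) v)\<^sup>2" _ "\<lambda>n. ip (dif (f n) w) (dif (f n) w) * ip v v"]) auto
    then have "(\<lambda>n. ip (dif (f n) w) v) \<longlonglongrightarrow> 0"
      by (simp add: tendsto_null_power)
    then have 2: "(\<lambda>n. ip (f n) v - ip w v) \<longlonglongrightarrow> 0"
      using fV w v by (simp add: ip_simps)
    have "(\<lambda>n. (ip (f n) v - l v) - (ip (f n) v - ip w v)) \<longlonglongrightarrow> 0 - 0"
      by (intro tendsto_diff 1 2)
    then show ?thesis by (simp add: LIMSEQ_const_iff)
  qed
  then show ?thesis using w by blast
qed

text \<open>Serves to pass from a norm whose completeness is known to the energy of a form, and to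
  the inner products built in the two solvability lemmas below.\<close>

lemma equivalent_semi_hilbert:
  assumes ip': "semi_inner V add scl ip'"
    and c: "c > 0" "\<And>u. u \<in> V \<Longrightarrow> c * ip u u \<le> ip' u u"
    and C: "\<And>u. u \<in> V \<Longrightarrow> ip' u u \<le> C * ip u u"
  shows "semi_hilbert V add scl ip'"
proof -
  interpret I: semi_inner V add scl ip' by (rule ip')
  show ?thesis
  proof (intro semi_hilbert.intro ip' semi_hilbert_axioms.intro)
    fix f :: "nat \<Rightarrow> 'v"
    assume fV: "\<And>n. f n \<in> V"
      and cau: "\<And>e. e > 0 \<Longrightarrow> \<exists>N. \<forall>m\<ge>N. \<forall>n\<ge>N. ip' (I.dif (f m) (f n)) (I.dif (f m) (f n)) < e"
    have dif: "I.dif = dif" by (simp add: fun_eq_iff I.dif_def dif_def)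
    have "\<exists>w\<in>V. (\<lambda>n. ip (dif (f n) w) (dif (f n) w)) \<longlonglongrightarrow> 0"
    proof (rule complete[OF fV])
      fix e :: real assume "e > 0"
      then obtain N where "\<forall>m\<ge>N. \<forall>n\<ge>N. ip' (dif (f m) (f n)) (dif (f m) (f n)) < c * e"
        using cau[of "c * e"] c(1) dif by auto
      then have "\<forall>m\<ge>N. \<forall>n\<ge>N. c * ip (dif (f m) (f n)) (dif (f m) (f n)) < c * e"
        using c(2) fV by (meson dif_closed le_less_trans)
      then show "\<exists>N. \<forall>m\<ge>N. \<forall>n\<ge>N. ip (dif (f m) (f n)) (dif (f m) (f n)) < e"
        using c(1) by auto
    qed
    then obtain w where w: "w \<in> V" and lim: "(\<lambda>n. ip (dif (f n) w) (dif (f n) w)) \<longlonglongrightarrow> 0" by blast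
    have "(\<lambda>n. C * ip (dif (f n) w) (dif (f n) w)) \<longlonglongrightarrow> C * 0"
      by (intro tendsto_mult lim tendsto_const)
    then have "(\<lambda>n. ip' (dif (f n) w) (dif (f n) w)) \<longlonglongrightarrow> 0"
      using C fV w I.ip_nonneg
      by (intro tendsto_sandwich[of "\<lambda>_. 0" "\<lambda>n. ip' (dif (f n) w) (dif (f n) w)" _ "\<lambda>n. C * ip (dif (f n) w) (dif (f n) w)"]) auto
    then show "\<exists>w\<in>V. (\<lambda>n. ip' (I.dif (f n) w) (I.dif (f n) w)) \<longlonglongrightarrow> 0"
      using w dif by auto
  qed
qed

text \<open>For a representer \<open>A\<close> of the adjoint of \<open>B\<close>, solve \<open>ip (A g) (A v) = l v\<close> and
  put \<open>w = A g\<close>.\<close>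

lemma lax_milgram:
  assumes B_add_left: "\<And>u v w. u \<in> V \<Longrightarrow> v \<in> V \<Longrightarrow> w \<in> V \<Longrightarrow> B (add u v) w = B u w + B v w"
    and B_scl_left: "\<And>u w c. u \<in> V \<Longrightarrow> w \<in> V \<Longrightarrow> B (scl c u) w = c * B u w"
    and B_add_right: "\<And>u v w. u \<in> V \<Longrightarrow> v \<in> V \<Longrightarrow> w \<in> V \<Longrightarrow> B w (add u v) = B w u + B w v"
    and B_scl_right: "\<And>u w c. u \<in> V \<Longrightarrow> w \<in> V \<Longrightarrow> B w (scl c u) = c * B w u"
    and B_bound: "\<And>u w. u \<in> V \<Longrightarrow> w \<in> V \<Longrightarrow> (B u w)\<^sup>2 \<le> K * ip u u * ip w w"
    and B_coercive: "c > 0" "\<And>u. u \<in> V \<Longrightarrow> c * ip u u \<le> B u u"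
    and l_add: "\<And>u v. u \<in> V \<Longrightarrow> v \<in> V \<Longrightarrow> l (add u v) = l u + l v"
    and l_scl: "\<And>u c. u \<in> V \<Longrightarrow> l (scl c u) = c * l u"
    and l_bound: "\<And>u. u \<in> V \<Longrightarrow> (l u)\<^sup>2 \<le> C * ip u u"
  shows "\<exists>w\<in>V. \<forall>v\<in>V. B w v = l v"
proof -
  have "\<exists>A\<in>V. \<forall>w\<in>V. ip A w = B w v" if v: "v \<in> V" for v
    by (rule riesz[where C = "K * ip v v"]) (use B_add_left B_scl_left B_bound v in \<open>auto simp: mult_ac\<close>)
  then obtain A where A: "\<And>v. v \<in> V \<Longrightarrow> A v \<in> V" "\<And>v w. v \<in> V \<Longrightarrow> w \<in> V \<Longrightarrow> ip (A v) w = B w v"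
    by metis
  have A': "ip w (A v) = B w v" if "v \<in> V" "w \<in> V" for v w
    using A that ip_commute by metis
  define ip' where "ip' u v = ip (A u) (A v)" for u v
  \<comment> \<open>Coercivity gives \<open>c * ip u u \<le> ip (A u) u\<close>, and the right side
    is at most the product of the seminorms of \<open>A u\<close> and \<open>u\<close>.\<close>
  have lower: "c\<^sup>2 * ip u u \<le> ip' u u" if u: "u \<in> V" for u
  proof (cases "ip u u = 0")
    case True
    then show ?thesis using ip_nonneg[OF A(1)[OF u]] by (simp add: ip'_def del: A)
  next
    case False
    then have pos: "ip u u > 0" using ip_nonneg[OF u] by simp
    have "(c * ip u u)\<^sup>2 \<le> (ip (A u) u)\<^sup>2"
      using B_coercive u A pos by (intro power_mono) auto
    also have "\<dots> \<le> ip' u u * ip u u"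
      unfolding ip'_def using A u by (intro cauchy_schwarz_sq) auto
    finally have "(c\<^sup>2 * ip u u) * ip u u \<le> ip' u u * ip u u"
      by (simp add: power2_eq_square algebra_simps)
    then show ?thesis using pos by simp
  qed
  have upper: "ip' u u \<le> K * ip u u" if u: "u \<in> V" for u
  proof (cases "ip' u u = 0")
    case True
    \<comment> \<open>The sign of \<open>K\<close> is unknown, so in the degenerate case the
      inequality has to be extracted from \<open>B_bound\<close>.\<close>
    have "0 \<le> K * ip u u"
    proof (rule ccontr)
      assume n: "\<not> ?thesis"
      then have "ip u u \<noteq> 0" by auto
      then have "ip u u > 0" using ip_nonneg[OF u] by simp
      then have "K * ip u u * ip u u < 0" using n mult_neg_pos[of "K * ip u u" "ip u u"] by linarith
      then show False using B_bound[OF u u] by (smt (verit) zero_le_power2)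
    qed
    then show ?thesis using True by simp
  next
    case False
    then have pos: "ip' u u > 0" using ip_nonneg[OF A(1)[OF u]] by (simp add: ip'_def)
    have "(ip' u u)\<^sup>2 = (B (A u) u)\<^sup>2" using A u by (simp add: ip'_def)
    also have "\<dots> \<le> K * ip' u u * ip u u" unfolding ip'_def using A u by (intro B_bound) auto
    finally have "ip' u u * ip' u u \<le> (K * ip u u) * ip' u u" by (simp add: power2_eq_square algebra_simps)
    then show ?thesis using pos by simp
  qed
  have ip'_B: "ip' u v = B (A u) v" if "u \<in> V" "v \<in> V" for u v
    using A' A that by (simp add: ip'_def)
  have comm: "ip' u v = ip' v u" if "u \<in> V" "v \<in> V" for u v
    using that A ip_commute by (simp add: ip'_def)
  \<comment> \<open>\<open>A\<close> is chosen pointwise and determined only up to elements of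
    seminorm zero, so it need not be additive. Bilinearity of \<open>ip'\<close> comes from
    \<open>ip' u v = B (A u) v\<close> in the second argument and from symmetry in the
    first.\<close>
  have "semi_inner V add scl ip'"
  proof
    fix u v w c assume u: "u \<in> V" and w: "w \<in> V"
    show "ip' (scl c u) w = c * ip' u w"
      using comm u w ip'_B A B_scl_right by (metis scl_closed)
    assume v: "v \<in> V"
    show "ip' (add u v) w = ip' u w + ip' v w"
      using comm u v w ip'_B A B_add_right by (metis add_closed)
  qed (use nonempty comm ip_nonneg[OF A(1)] in \<open>auto simp: ip'_def\<close>)
  then interpret I: semi_hilbert V add scl ip'
    by (rule equivalent_semi_hilbert[of _ "c\<^sup>2" K]) (use B_coercive(1) lower upper in auto)
  have "\<exists>g\<in>V. \<forall>v\<in>V. ip' g v = l v"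
  proof (rule I.riesz[where C = "\<bar>C\<bar> / c\<^sup>2"])
    fix u assume u: "u \<in> V"
    have "(l u)\<^sup>2 \<le> \<bar>C\<bar> * ip u u"
      using l_bound[OF u] mult_right_mono[OF abs_ge_self[of C] ip_nonneg[OF u]] by simp
    also have "\<dots> = \<bar>C\<bar> / c\<^sup>2 * (c\<^sup>2 * ip u u)" using B_coercive(1) by simp
    also have "\<dots> \<le> \<bar>C\<bar> / c\<^sup>2 * ip' u u" using lower[OF u] by (intro mult_left_mono) auto
    finally show "(l u)\<^sup>2 \<le> \<bar>C\<bar> / c\<^sup>2 * ip' u u" .
  qed (use l_add l_scl in auto)
  then obtain g where "g \<in> V" "\<forall>v\<in>V. ip' g v = l v" by blast
  then show ?thesis using A(1) ip'_B by (intro bexI[of _ "A g"]) auto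
qed

text \<open>Normal equations: the form \<open>ip (T u) (T v)\<close> is equivalent to
  \<open>ip\<close>, so the Riesz lemma solves \<open>T (T g) = f\<close> weakly, and
  \<open>z = T g\<close> is the solution. Symmetry turns the bound from below, which by itself gives
  injectivity and closed range, into surjectivity.\<close>

lemma symmetric_bounded_below_solvable:
  assumes T_closed: "\<And>u. u \<in> V \<Longrightarrow> T u \<in> V"
    and T_sym: "\<And>u v. u \<in> V \<Longrightarrow> v \<in> V \<Longrightarrow> ip (T u) v = ip u (T v)"
    and c: "c > 0" "\<And>u. u \<in> V \<Longrightarrow> c * ip u u \<le> ip (T u) (T u)"
    and K: "\<And>u. u \<in> V \<Longrightarrow> ip (T u) (T u) \<le> K * ip u u"
    and f: "f \<in> V"
  shows "\<exists>z\<in>V. \<forall>v\<in>V. ip (T z) v = ip f v"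
proof -
  define ip' where "ip' u v = ip (T u) (T v)" for u v
  have T2: "ip' u v = ip u (T (T v))" if "u \<in> V" "v \<in> V" for u v
    using that by (simp add: ip'_def T_sym T_closed)
  have comm: "ip' u v = ip' v u" if "u \<in> V" "v \<in> V" for u v
    using that T_closed ip_commute by (simp add: ip'_def)
  have "semi_inner V add scl ip'"
  proof
    fix u v w c assume u: "u \<in> V" and w: "w \<in> V"
    show "ip' (scl c u) w = c * ip' u w"
      using u w T_closed by (simp add: T2 ip_scl_left)
    assume v: "v \<in> V"
    show "ip' (add u v) w = ip' u w + ip' v w"
      using u v w T_closed by (simp add: T2 ip_add_left)
  qed (use nonempty comm T_closed ip_nonneg in \<open>auto simp: ip'_def\<close>)
  then interpret I: semi_hilbert V add scl ip'
    by (rule equivalent_semi_hilbert[of _ c K]) (use c K in \<open>auto simp: ip'_def\<close>)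
  have "\<exists>g\<in>V. \<forall>v\<in>V. ip' g v = ip f v"
  proof (rule I.riesz[where C = "ip f f / c"])
    fix u assume u: "u \<in> V"
    have "(ip f u)\<^sup>2 \<le> ip f f * ip u u" by (rule cauchy_schwarz_sq[OF f u])
    also have "\<dots> = ip f f / c * (c * ip u u)" using c(1) by simp
    also have "\<dots> \<le> ip f f / c * ip' u u"
      unfolding ip'_def using c f u ip_nonneg by (intro mult_left_mono) auto
    finally show "(ip f u)\<^sup>2 \<le> ip f f / c * ip' u u" .
  qed (use f in \<open>auto simp: ip_simps\<close>)
  then obtain g where "g \<in> V" "\<forall>v\<in>V. ip' g v = ip f v" by blast
  then show ?thesis
    using T_closed T_sym by (intro bexI[of _ "T g"]) (auto simp: ip'_def)
qed

end

section \<open>Products of semi-Hilbert spaces\<close>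

lemma semi_inner_prod:
  assumes "semi_inner V1 add1 scl1 ip1" "semi_inner V2 add2 scl2 ip2"
  shows "semi_inner (V1 \<times> V2) (\<lambda>u v. (add1 (fst u) (fst v), add2 (snd u) (snd v)))
    (\<lambda>c u. (scl1 c (fst u), scl2 c (snd u))) (\<lambda>u v. ip1 (fst u) (fst v) + ip2 (snd u) (snd v))"
proof -
  interpret A: semi_inner V1 add1 scl1 ip1 by fact
  interpret B: semi_inner V2 add2 scl2 ip2 by fact
  show ?thesis
    by standard (use A.nonempty B.nonempty in \<open>auto simp: A.ip_simps B.ip_simps A.ip_commute
        B.ip_commute A.ip_nonneg B.ip_nonneg algebra_simps\<close>)
qed

lemma semi_hilbert_prod:
  assumes "semi_hilbert V1 add1 scl1 ip1" "semi_hilbert V2 add2 scl2 ip2"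
  shows "semi_hilbert (V1 \<times> V2) (\<lambda>u v. (add1 (fst u) (fst v), add2 (snd u) (snd v)))
    (\<lambda>c u. (scl1 c (fst u), scl2 c (snd u))) (\<lambda>u v. ip1 (fst u) (fst v) + ip2 (snd u) (snd v))"
    (is "semi_hilbert ?V ?add ?scl ?ip")
proof -
  interpret A: semi_hilbert V1 add1 scl1 ip1 by fact
  interpret B: semi_hilbert V2 add2 scl2 ip2 by fact
  interpret P: semi_inner ?V ?add ?scl ?ip
    by (rule semi_inner_prod) unfold_locales
  have dif: "P.dif u v = (A.dif (fst u) (fst v), B.dif (snd u) (snd v))" for u v
    by (simp add: P.dif_def A.dif_def B.dif_def)
  show ?thesis
  proof
    fix f :: "nat \<Rightarrow> 'a \<times> 'b"
    assume f: "\<And>n. f n \<in> ?V"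
      and cau: "\<And>e. e > 0 \<Longrightarrow> \<exists>N. \<forall>m\<ge>N. \<forall>n\<ge>N. ?ip (P.dif (f m) (f n)) (P.dif (f m) (f n)) < e"
    have f1: "fst (f n) \<in> V1" and f2: "snd (f n) \<in> V2" for n using f[of n] by auto
    have nn: "0 \<le> ip1 (A.dif (fst (f m)) (fst (f n))) (A.dif (fst (f m)) (fst (f n)))"
      "0 \<le> ip2 (B.dif (snd (f m)) (snd (f n))) (B.dif (snd (f m)) (snd (f n)))" for m n
      using f1 f2 A.ip_nonneg B.ip_nonneg by auto
    have "\<exists>w\<in>V1. (\<lambda>n. ip1 (A.dif (fst (f n)) w) (A.dif (fst (f n)) w)) \<longlonglongrightarrow> 0"
    proof (rule A.complete[OF f1])
      fix e :: real assume "e > 0"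
      from cau[OF this] nn(2) show "\<exists>N. \<forall>m\<ge>N. \<forall>n\<ge>N. ip1 (A.dif (fst (f m)) (fst (f n))) (A.dif (fst (f m)) (fst (f n))) < e"
        unfolding dif by (metis (no_types, lifting) add_increasing2 fst_conv not_less snd_conv)
    qed
    moreover have "\<exists>w\<in>V2. (\<lambda>n. ip2 (B.dif (snd (f n)) w) (B.dif (snd (f n)) w)) \<longlonglongrightarrow> 0"
    proof (rule B.complete[OF f2])
      fix e :: real assume "e > 0"
      from cau[OF this] nn(1) show "\<exists>N. \<forall>m\<ge>N. \<forall>n\<ge>N. ip2 (B.dif (snd (f m)) (snd (f n))) (B.dif (snd (f m)) (snd (f n))) < e"
        unfolding dif by (metis (no_types, lifting) add_increasing fst_conv not_less snd_conv)
    qed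
    ultimately obtain w1 w2 where w: "w1 \<in> V1" "w2 \<in> V2"
      and l1: "(\<lambda>n. ip1 (A.dif (fst (f n)) w1) (A.dif (fst (f n)) w1)) \<longlonglongrightarrow> 0"
      and l2: "(\<lambda>n. ip2 (B.dif (snd (f n)) w2) (B.dif (snd (f n)) w2)) \<longlonglongrightarrow> 0" by blast
    show "\<exists>w\<in>?V. (\<lambda>n. ?ip (P.dif (f n) w) (P.dif (f n) w)) \<longlonglongrightarrow> 0"
      using w tendsto_add[OF l1 l2] by (intro bexI[of _ "(w1, w2)"]) (auto simp: dif)
  qed
qed

section \<open>Square-integrable functions\<close>

lemma L2_measurable [measurable_dest]: "f \<in> L2 M \<Longrightarrow> f \<in> borel_measurable M"
  by (simp add: L2_def)

lemma L2_sq_integrable: "f \<in> L2 M \<Longrightarrow> integrable M (\<lambda>x. (f x)\<^sup>2)"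
  by (simp add: L2_def)

lemma L2I: "f \<in> borel_measurable M \<Longrightarrow> integrable M (\<lambda>x. (f x)\<^sup>2) \<Longrightarrow> f \<in> L2 M"
  by (simp add: L2_def)

lemma abs_mult_le_sum_squares: "\<bar>x * y\<bar> \<le> x\<^sup>2 + (y::real)\<^sup>2"
  using zero_le_power2[of "\<bar>x\<bar> - \<bar>y\<bar>"] mult_nonneg_nonneg[of "\<bar>x\<bar>" "\<bar>y\<bar>"]
  unfolding power2_diff abs_mult power2_abs by linarith

lemma L2_mult_integrable [intro]:
  assumes "f \<in> L2 M" "g \<in> L2 M"
  shows "integrable M (\<lambda>x. f x * g x)"
proof (rule Bochner_Integration.integrable_bound)
  show "integrable M (\<lambda>x. (f x)\<^sup>2 + (g x)\<^sup>2)" using assms by (auto intro: L2_sq_integrable)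
  show "AE x in M. norm (f x * g x) \<le> norm ((f x)\<^sup>2 + (g x)\<^sup>2)"
  proof (rule AE_I2)
    fix x show "norm (f x * g x) \<le> norm ((f x)\<^sup>2 + (g x)\<^sup>2)"
      using abs_mult_le_sum_squares[of "f x" "g x"] by simp
  qed
qed (use assms[THEN L2_measurable] in simp)

lemma L2_scale [intro]: "f \<in> L2 M \<Longrightarrow> (\<lambda>x. c * f x) \<in> L2 M"
  by (auto simp: L2_def power_mult_distrib)

lemma L2_add [intro]:
  assumes "f \<in> L2 M" "g \<in> L2 M"
  shows "(\<lambda>x. f x + g x) \<in> L2 M"
proof (rule L2I)
  have "integrable M (\<lambda>x. (f x)\<^sup>2 + 2 * (f x * g x) + (g x)\<^sup>2)"
    using assms by (intro Bochner_Integration.integrable_add integrable_mult_right L2_mult_integrable L2_sq_integrable)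
  then show "integrable M (\<lambda>x. (f x + g x)\<^sup>2)" by (simp add: power2_sum algebra_simps)
qed (use assms[THEN L2_measurable] in simp)

lemma L2_uminus [intro]: "f \<in> L2 M \<Longrightarrow> (\<lambda>x. - f x) \<in> L2 M"
  by (auto simp: L2_def)

lemma L2_diff [intro]: "f \<in> L2 M \<Longrightarrow> g \<in> L2 M \<Longrightarrow> (\<lambda>x. f x - g x) \<in> L2 M"
  using L2_add[of f M "\<lambda>x. - g x"] L2_uminus[of g M] by simp

lemma L2_zero [simp, intro]: "(\<lambda>x. 0) \<in> L2 M"
  by (simp add: L2_def)

lemma L2_sum [intro]: "(\<And>i. i \<in> I \<Longrightarrow> f i \<in> L2 M) \<Longrightarrow> (\<lambda>x. \<Sum>i\<in>I. f i x) \<in> L2 M"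
  by (induction I rule: infinite_finite_induct) auto

lemma L2_bound:
  assumes "g \<in> L2 M" "f \<in> borel_measurable M" "AE x in M. \<bar>f x\<bar> \<le> \<bar>g x\<bar>"
  shows "f \<in> L2 M"
proof (rule L2I)
  show "integrable M (\<lambda>x. (f x)\<^sup>2)"
  proof (rule Bochner_Integration.integrable_bound[OF L2_sq_integrable[OF assms(1)]])
    show "AE x in M. norm ((f x)\<^sup>2) \<le> norm ((g x)\<^sup>2)"
      using assms(3) by eventually_elim (simp add: abs_le_square_iff)
  qed (use assms(2) in simp)
qed (use assms in simp)

lemma L2_inner_commute: "L2_inner M f g = L2_inner M g f"
  by (simp add: L2_inner_def mult.commute)

lemma L2_inner_add_left: "f \<in> L2 M \<Longrightarrow> g \<in> L2 M \<Longrightarrow> h \<in> L2 M \<Longrightarrow>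
    L2_inner M (\<lambda>x. f x + g x) h = L2_inner M f h + L2_inner M g h"
  by (simp add: L2_inner_def distrib_right L2_mult_integrable)

lemma L2_inner_diff_left: "f \<in> L2 M \<Longrightarrow> g \<in> L2 M \<Longrightarrow> h \<in> L2 M \<Longrightarrow>
    L2_inner M (\<lambda>x. f x - g x) h = L2_inner M f h - L2_inner M g h"
  by (simp add: L2_inner_def left_diff_distrib L2_mult_integrable)

lemma L2_inner_add_right: "f \<in> L2 M \<Longrightarrow> g \<in> L2 M \<Longrightarrow> h \<in> L2 M \<Longrightarrow>
    L2_inner M h (\<lambda>x. f x + g x) = L2_inner M h f + L2_inner M h g"
  by (simp add: L2_inner_commute[of M h] L2_inner_add_left)

lemma L2_inner_diff_right: "f \<in> L2 M \<Longrightarrow> g \<in> L2 M \<Longrightarrow> h \<in> L2 M \<Longrightarrow>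
    L2_inner M h (\<lambda>x. f x - g x) = L2_inner M h f - L2_inner M h g"
  by (simp add: L2_inner_commute[of M h] L2_inner_diff_left)

lemma L2_inner_scale_left: "L2_inner M (\<lambda>x. c * f x) h = c * L2_inner M f h"
  by (simp add: L2_inner_def mult.assoc)

lemma L2_inner_scale_right: "L2_inner M h (\<lambda>x. c * f x) = c * L2_inner M h f"
  by (simp add: L2_inner_commute[of M h] L2_inner_scale_left)

lemma L2_inner_uminus_left: "L2_inner M (\<lambda>x. - f x) h = - L2_inner M f h"
  by (simp add: L2_inner_def)

lemma L2_inner_uminus_right: "L2_inner M h (\<lambda>x. - f x) = - L2_inner M h f"
  by (simp add: L2_inner_def)

lemmas L2_inner_simps = L2_inner_add_left L2_inner_add_right L2_inner_diff_left L2_inner_diff_right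
  L2_inner_scale_left L2_inner_scale_right L2_inner_uminus_left L2_inner_uminus_right

lemma L2_inner_zero [simp]: "L2_inner M (\<lambda>x. 0) h = 0" "L2_inner M h (\<lambda>x. 0) = 0"
  by (simp_all add: L2_inner_def)

lemma L2_inner_nonneg [simp]: "0 \<le> L2_inner M f f"
  by (simp add: L2_inner_def)

lemma L2_inner_cong_AE:
  assumes "f \<in> L2 M" "f' \<in> L2 M" "g \<in> L2 M" "AE x in M. f x = f' x"
  shows "L2_inner M f g = L2_inner M f' g"
  unfolding L2_inner_def
  by (rule integral_cong_AE) (use assms(1-3)[THEN L2_measurable] assms(4) in auto)

lemma L2_inner_self_eq_0:
  assumes "f \<in> L2 M" "L2_inner M f f = 0"
  shows "AE x in M. f x = 0"
  using integral_nonneg_eq_0_iff_AE[of M "\<lambda>x. f x * f x"] assms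
  by (auto simp: L2_inner_def L2_mult_integrable)

lemma L2_inner_mono:
  assumes "g \<in> L2 M" "f \<in> L2 M" "AE x in M. \<bar>f x\<bar> \<le> \<bar>g x\<bar>"
  shows "L2_inner M f f \<le> L2_inner M g g"
  unfolding L2_inner_def
proof (rule integral_mono_AE)
  show "AE x in M. f x * f x \<le> g x * g x"
    using assms(3) by eventually_elim (metis abs_le_square_iff power2_eq_square)
qed (use assms in auto)

lemma semi_inner_L2:
  assumes "V \<subseteq> L2 M" "V \<noteq> {}" "\<And>f g. f \<in> V \<Longrightarrow> g \<in> V \<Longrightarrow> (\<lambda>x. f x + g x) \<in> V"
    "\<And>c f. f \<in> V \<Longrightarrow> (\<lambda>x. c * f x) \<in> V"
  shows "semi_inner V (\<lambda>f g x. f x + g x) (\<lambda>c f x. c * f x) (L2_inner M)"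
proof
  fix u v w c assume u: "u \<in> V" and w: "w \<in> V"
  show "L2_inner M (\<lambda>x. c * u x) w = c * L2_inner M u w" by (rule L2_inner_scale_left)
  show "L2_inner M u w = L2_inner M w u" by (rule L2_inner_commute)
  assume v: "v \<in> V"
  show "L2_inner M (\<lambda>x. u x + v x) w = L2_inner M u w + L2_inner M v w"
    by (rule L2_inner_add_left) (use assms(1) u v w in auto)
qed (use assms in auto)

lemma semi_inner_L2_UNIV: "semi_inner (L2 M) (\<lambda>f g x. f x + g x) (\<lambda>c f x. c * f x) (L2_inner M)"
  by (rule semi_inner_L2) auto

lemma L2_cauchy_schwarz: "f \<in> L2 M \<Longrightarrow> g \<in> L2 M \<Longrightarrow> (L2_inner M f g)\<^sup>2 \<le> L2_inner M f f * L2_inner M g g"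
  using semi_inner.cauchy_schwarz_sq[OF semi_inner_L2_UNIV] .

lemma L2_inner_sum_sq_le:
  assumes "f \<in> L2 M" "g \<in> L2 M"
  shows "L2_inner M (\<lambda>x. f x + g x) (\<lambda>x. f x + g x) \<le> 2 * L2_inner M f f + 2 * L2_inner M g g"
proof -
  have "0 \<le> L2_inner M (\<lambda>x. f x - g x) (\<lambda>x. f x - g x)" by simp
  then show ?thesis
    using assms by (simp add: L2_inner_simps L2_add L2_diff L2_inner_commute[of M g f])
qed

lemma L2_inner_diff_sq_le:
  assumes "f \<in> L2 M" "g \<in> L2 M"
  shows "L2_inner M (\<lambda>x. f x - g x) (\<lambda>x. f x - g x) \<le> 2 * L2_inner M f f + 2 * L2_inner M g g"
  using L2_inner_sum_sq_le[OF assms(1) L2_uminus[OF assms(2)]] by (simp add: L2_inner_simps)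

lemma term_le_suminf: "f k \<le> (\<Sum>k. f k :: ennreal)"
  using sum_le_suminf[of f "{k}"] by (simp add: summableI)

text \<open>If the squared distances of consecutive terms are at most \<open>8\<^sup>-\<^sup>k\<close>, then
  \<open>\<Sum>k. 2\<^sup>k (f\<^sub>k\<^sub>+\<^sub>1 - f\<^sub>k)\<^sup>2\<close> is integrable, hence finite almost everywhere.\<close>

lemma L2_fast_cauchy_AE_convergent:
  fixes f :: "nat \<Rightarrow> 'x \<Rightarrow> real"
  assumes f: "\<And>n. f n \<in> L2 M"
    and fast: "\<And>k. L2_inner M (\<lambda>x. f (Suc k) x - f k x) (\<lambda>x. f (Suc k) x - f k x) \<le> (1/8) ^ k"
  shows "AE x in M. convergent (\<lambda>k. f k x)"
proof -
  note [measurable] = f[THEN L2_measurable]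
  define d where "d k x = f (Suc k) x - f k x" for k x
  have dL: "d k \<in> L2 M" for k unfolding d_def using f by auto
  have [measurable]: "d k \<in> borel_measurable M" for k using dL L2_measurable by auto
  have int: "(\<integral>\<^sup>+x. ennreal (2 ^ k * (d k x)\<^sup>2) \<partial>M) \<le> ennreal ((1/4) ^ k)" for k
  proof -
    have "(\<integral>\<^sup>+x. ennreal (2 ^ k * (d k x)\<^sup>2) \<partial>M) = ennreal (LINT x|M. 2 ^ k * (d k x)\<^sup>2)"
      using dL by (intro nn_integral_eq_integral) (auto simp: L2_sq_integrable)
    also have "(LINT x|M. 2 ^ k * (d k x)\<^sup>2) = 2 ^ k * L2_inner M (d k) (d k)"
      by (simp add: L2_inner_def power2_eq_square)
    also have "\<dots> \<le> 2 ^ k * (1/8) ^ k" using fast[of k] unfolding d_def by (intro mult_left_mono) auto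
    also have "\<dots> = (2 * (1/8)) ^ k" by (rule power_mult_distrib[symmetric])
    also have "\<dots> = (1/4) ^ k" by simp
    finally show ?thesis by (simp add: ennreal_leI)
  qed
  have "(\<integral>\<^sup>+x. (\<Sum>k. ennreal (2 ^ k * (d k x)\<^sup>2)) \<partial>M) = (\<Sum>k. \<integral>\<^sup>+x. ennreal (2 ^ k * (d k x)\<^sup>2) \<partial>M)"
    by (rule nn_integral_suminf) simp
  also have "\<dots> \<le> (\<Sum>k. ennreal ((1/4) ^ k))"
    by (intro suminf_le int) auto
  also have "\<dots> = ennreal (\<Sum>k. (1/4) ^ k)"
    by (intro suminf_ennreal2) (auto intro!: summable_geometric)
  also have "\<dots> < \<infinity>" by simp
  finally have "AE x in M. (\<Sum>k. ennreal (2 ^ k * (d k x)\<^sup>2)) \<noteq> \<infinity>"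
    by (intro nn_integral_PInf_AE) auto
  then show ?thesis
  proof eventually_elim
    case (elim x)
    define s where "s = enn2real (\<Sum>k. ennreal (2 ^ k * (d k x)\<^sup>2))"
    have s: "(\<Sum>k. ennreal (2 ^ k * (d k x)\<^sup>2)) = ennreal s" "s \<ge> 0"
      unfolding s_def using elim by (simp_all add: less_top)
    \<comment> \<open>Each term of the weighted series is at most its sum \<open>s\<close>, so the
      increments are bounded by a geometric sequence with ratio \<open>1 / sqrt 2\<close>, and the
      telescoping series converges.\<close>
    have "norm (d k x) \<le> sqrt s * (1 / sqrt 2) ^ k" for k
    proof -
      have "ennreal (2 ^ k * (d k x)\<^sup>2) \<le> ennreal s"
        unfolding s(1)[symmetric] by (rule term_le_suminf)
      then have le: "2 ^ k * (d k x)\<^sup>2 \<le> s" using s(2) by (simp add: ennreal_le_iff)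
      have "\<bar>d k x\<bar> \<le> sqrt s * (1 / sqrt 2) ^ k"
      proof (rule power2_le_imp_le)
        have "((1 / sqrt 2) ^ k)\<^sup>2 = ((1 / sqrt 2)\<^sup>2) ^ k"
          by (simp only: power_mult[symmetric] mult.commute)
        then have "(sqrt s * (1 / sqrt 2) ^ k)\<^sup>2 = s * (1 / 2) ^ k"
          using s(2) by (simp add: power_mult_distrib power_divide)
        also have "\<dots> \<ge> (2 ^ k * (d k x)\<^sup>2) * (1 / 2) ^ k"
          using le by (intro mult_right_mono) auto
        also have "(2 ^ k * (d k x)\<^sup>2) * (1 / 2) ^ k = (d k x)\<^sup>2"
          by (simp add: power_divide)
        finally show "\<bar>d k x\<bar>\<^sup>2 \<le> (sqrt s * (1 / sqrt 2) ^ k)\<^sup>2" by simp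
      qed (use s(2) in simp)
      then show ?thesis by simp
    qed
    moreover have "summable (\<lambda>k. sqrt s * (1 / sqrt 2) ^ k)"
      by (intro summable_mult summable_geometric) auto
    ultimately have "summable (\<lambda>k. d k x)"
      using summable_comparison_test'[of "\<lambda>k. sqrt s * (1 / sqrt 2) ^ k" 0 "\<lambda>k. d k x"] by simp
    then have "(\<lambda>n. \<Sum>k<n. d k x) \<longlonglongrightarrow> (\<Sum>k. d k x)" by (rule summable_LIMSEQ)
    moreover have "(\<Sum>k<n. d k x) = f n x - f 0 x" for n
      unfolding d_def by (rule sum_lessThan_telescope)
    ultimately have "(\<lambda>n. (f n x - f 0 x) + f 0 x) \<longlonglongrightarrow> (\<Sum>k. d k x) + f 0 x"
      by (intro tendsto_add tendsto_const) simp
    then show ?case by (auto simp: convergent_def)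
  qed
qed

text \<open>The Riesz-Fischer theorem. A fast subsequence converges almost everywhere, and Fatou's
  lemma along it transfers the Cauchy estimate to the distance between each late term and the
  limit.\<close>

lemma L2_complete:
  fixes f :: "nat \<Rightarrow> 'x \<Rightarrow> real"
  assumes f: "\<And>n. f n \<in> L2 M"
    and cauchy: "\<And>e. e > 0 \<Longrightarrow> \<exists>N. \<forall>m\<ge>N. \<forall>n\<ge>N. L2_inner M (\<lambda>x. f m x - f n x) (\<lambda>x. f m x - f n x) < e"
  shows "\<exists>w\<in>L2 M. (\<lambda>n. L2_inner M (\<lambda>x. f n x - w x) (\<lambda>x. f n x - w x)) \<longlonglongrightarrow> 0"
proof -
  note [measurable] = f[THEN L2_measurable]
  let ?I = "\<lambda>m n. L2_inner M (\<lambda>x. f m x - f n x) (\<lambda>x. f m x - f n x)"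
  have "\<exists>N. \<forall>m\<ge>N. \<forall>n\<ge>N. ?I m n < (1/8) ^ k" for k :: nat by (rule cauchy) simp
  then obtain N where N: "\<And>k m n. m \<ge> N k \<Longrightarrow> n \<ge> N k \<Longrightarrow> ?I m n < (1/8) ^ k" by metis
  \<comment> \<open>Partial sums of the thresholds make \<open>r\<close> monotone and keep
    \<open>r k \<ge> N k\<close>; the summand \<open>k\<close> makes it unbounded.\<close>
  define r where "r k = (\<Sum>i\<le>k. N i) + k" for k
  have rN: "r k \<ge> N k" for k unfolding r_def by (simp add: trans_le_add1 member_le_sum)
  have rSuc: "r (Suc k) \<ge> r k" for k unfolding r_def by simp
  have rk: "r k \<ge> k" for k unfolding r_def by simp
  have conv: "AE x in M. convergent (\<lambda>k. f (r k) x)"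
    by (rule L2_fast_cauchy_AE_convergent) (use f N rN order_trans[OF rN rSuc] in \<open>auto intro: less_imp_le\<close>)
  \<comment> \<open>On the null set where the subsequence diverges \<open>lim\<close> still has some
    value, and \<open>w\<close> is measurable as a whole.\<close>
  define w where "w x = lim (\<lambda>k. f (r k) x)" for x
  have [measurable]: "w \<in> borel_measurable M" unfolding w_def by measurable
  have fatou: "(\<integral>\<^sup>+x. ennreal ((f n x - w x)\<^sup>2) \<partial>M) \<le> ennreal e"
    if e: "\<And>m. m \<ge> K \<Longrightarrow> ?I n m \<le> e" for n e K
  proof -
    have "(\<integral>\<^sup>+x. ennreal ((f n x - w x)\<^sup>2) \<partial>M) = (\<integral>\<^sup>+x. liminf (\<lambda>k. ennreal ((f n x - f (r k) x)\<^sup>2)) \<partial>M)"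
    proof (rule nn_integral_cong_AE)
      show "AE x in M. ennreal ((f n x - w x)\<^sup>2) = liminf (\<lambda>k. ennreal ((f n x - f (r k) x)\<^sup>2))"
        using conv
      proof eventually_elim
        case (elim x)
        then have "(\<lambda>k. f (r k) x) \<longlonglongrightarrow> w x" by (simp add: w_def convergent_LIMSEQ_iff)
        then have "(\<lambda>k. ennreal ((f n x - f (r k) x)\<^sup>2)) \<longlonglongrightarrow> ennreal ((f n x - w x)\<^sup>2)"
          by (intro tendsto_intros)
        then show ?case by (rule lim_imp_Liminf[OF trivial_limit_sequentially, symmetric])
      qed
    qed
    also have "\<dots> \<le> liminf (\<lambda>k. \<integral>\<^sup>+x. ennreal ((f n x - f (r k) x)\<^sup>2) \<partial>M)"
      by (rule nn_integral_liminf) simp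
    also have "\<dots> \<le> limsup (\<lambda>k. \<integral>\<^sup>+x. ennreal ((f n x - f (r k) x)\<^sup>2) \<partial>M)"
      by (rule Liminf_le_Limsup) simp
    also have "\<dots> \<le> ennreal e"
    proof (rule Limsup_bounded)
      show "\<forall>\<^sub>F k in sequentially. (\<integral>\<^sup>+x. ennreal ((f n x - f (r k) x)\<^sup>2) \<partial>M) \<le> ennreal e"
      proof (rule eventually_sequentiallyI[of K])
        fix k assume "K \<le> k"
        have "(\<integral>\<^sup>+x. ennreal ((f n x - f (r k) x)\<^sup>2) \<partial>M) = ennreal (LINT x|M. (f n x - f (r k) x)\<^sup>2)"
          by (intro nn_integral_eq_integral L2_sq_integrable) (use f in auto)
        also have "\<dots> \<le> ennreal e"
          using e[of "r k"] rk[of k] \<open>K \<le> k\<close> by (intro ennreal_leI) (simp add: L2_inner_def power2_eq_square)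
        finally show "(\<integral>\<^sup>+x. ennreal ((f n x - f (r k) x)\<^sup>2) \<partial>M) \<le> ennreal e" .
      qed
    qed
    finally show ?thesis .
  qed
  have in_L2: "(\<lambda>x. f n x - w x) \<in> L2 M" if "\<And>m. m \<ge> K \<Longrightarrow> ?I n m \<le> e" for n e K
    by (rule L2I) (use fatou[of K n e, OF that] in \<open>auto simp: integrable_iff_bounded le_less_trans\<close>)
  obtain K where K: "\<forall>m\<ge>K. \<forall>n\<ge>K. ?I m n < 1" using cauchy[of 1] by auto
  \<comment> \<open>\<open>w\<close> is the difference of the two square-integrable functions
    \<open>f K\<close> and \<open>f K - w\<close>.\<close>
  have "(\<lambda>x. f K x - (f K x - w x)) \<in> L2 M"
    by (intro L2_diff[OF f] in_L2[of K K 1]) (use K in \<open>auto intro: less_imp_le\<close>)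
  then have w: "w \<in> L2 M" by simp
  have "(\<lambda>n. L2_inner M (\<lambda>x. f n x - w x) (\<lambda>x. f n x - w x)) \<longlonglongrightarrow> 0"
  proof (rule LIMSEQ_I)
    fix e :: real assume e: "e > 0"
    obtain K where K: "\<forall>m\<ge>K. \<forall>n\<ge>K. ?I m n < e / 2" using cauchy[of "e / 2"] e by auto
    show "\<exists>no. \<forall>n\<ge>no. norm (L2_inner M (\<lambda>x. f n x - w x) (\<lambda>x. f n x - w x) - 0) < e"
    proof (intro exI[of _ K] allI impI)
      fix n assume n: "K \<le> n"
      have "ennreal (LINT x|M. (f n x - w x)\<^sup>2) = (\<integral>\<^sup>+x. ennreal ((f n x - w x)\<^sup>2) \<partial>M)"
        by (intro nn_integral_eq_integral[symmetric] L2_sq_integrable) (use f w in auto)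
      also have "\<dots> \<le> ennreal (e / 2)" using K n by (intro fatou[of K]) (auto intro: less_imp_le)
      finally have "L2_inner M (\<lambda>x. f n x - w x) (\<lambda>x. f n x - w x) \<le> e / 2"
        using e by (simp add: ennreal_le_iff L2_inner_def power2_eq_square)
      then show "norm (L2_inner M (\<lambda>x. f n x - w x) (\<lambda>x. f n x - w x) - 0) < e"
        using e by simp
    qed
  qed
  with w show ?thesis by blast
qed

text \<open>The hypothesis \<open>proj\<close> takes the place of closedness. A limit in
  \<open>L2 M\<close> is just some function; \<open>proj\<close> replaces it by a representative in
  \<open>V\<close>, for example one that is exactly periodic and vanishes off a given set, at no
  cost in the distance to members of \<open>V\<close>.\<close>

lemma semi_hilbert_L2:
  assumes V: "V \<subseteq> L2 M" "V \<noteq> {}" "\<And>f g. f \<in> V \<Longrightarrow> g \<in> V \<Longrightarrow> (\<lambda>x. f x + g x) \<in> V"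
    "\<And>c f. f \<in> V \<Longrightarrow> (\<lambda>x. c * f x) \<in> V"
    and proj: "\<And>f. f \<in> L2 M \<Longrightarrow> \<exists>f'\<in>V. \<forall>g\<in>V. AE x in M. \<bar>g x - f' x\<bar> \<le> \<bar>g x - f x\<bar>"
  shows "semi_hilbert V (\<lambda>f g x. f x + g x) (\<lambda>c f x. c * f x) (L2_inner M)"
proof -
  interpret semi_inner V "\<lambda>f g x. f x + g x" "\<lambda>c f x. c * f x" "L2_inner M"
    by (rule semi_inner_L2) (use V in auto)
  show ?thesis
  proof
    fix f :: "nat \<Rightarrow> 'a \<Rightarrow> real"
    assume f: "\<And>n. f n \<in> V"
      and cau: "\<And>e. e > 0 \<Longrightarrow> \<exists>N. \<forall>m\<ge>N. \<forall>n\<ge>N. L2_inner M (dif (f m) (f n)) (dif (f m) (f n)) < e"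
    have fL: "f n \<in> L2 M" for n using f V(1) by auto
    have dif': "dif g h = (\<lambda>x. g x - h x)" for g h by (simp add: dif_def)
    obtain w where w: "w \<in> L2 M" "(\<lambda>n. L2_inner M (\<lambda>x. f n x - w x) (\<lambda>x. f n x - w x)) \<longlonglongrightarrow> 0"
      using L2_complete[of f M, OF fL cau[unfolded dif']] by blast
    obtain w' where w': "w' \<in> V" "\<And>g. g \<in> V \<Longrightarrow> AE x in M. \<bar>g x - w' x\<bar> \<le> \<bar>g x - w x\<bar>"
      using proj[OF w(1)] by blast
    have "L2_inner M (\<lambda>x. f n x - w' x) (\<lambda>x. f n x - w' x) \<le> L2_inner M (\<lambda>x. f n x - w x) (\<lambda>x. f n x - w x)" for n
      by (rule L2_inner_mono[OF L2_diff[OF fL w(1)] L2_diff[OF fL subsetD[OF V(1) w'(1)]] w'(2)[OF f]])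
    then have "(\<lambda>n. L2_inner M (\<lambda>x. f n x - w' x) (\<lambda>x. f n x - w' x)) \<longlonglongrightarrow> 0"
      by (intro tendsto_sandwich[OF _ _ tendsto_const w(2)]) auto
    then show "\<exists>w\<in>V. (\<lambda>n. L2_inner M (dif (f n) w) (dif (f n) w)) \<longlonglongrightarrow> 0"
      unfolding dif' by (rule bexI[OF _ w'(1)])
  qed
qed

section \<open>Operators of closed symmetric forms\<close>

lemma L2_norm_complex_eq:
  assumes "(\<lambda>x. Re (f x)) \<in> L2 M" "(\<lambda>x. Im (f x)) \<in> L2 M"
  shows "L2_norm_complex M f = sqrt (L2_inner M (\<lambda>x. Re (f x)) (\<lambda>x. Re (f x)) + L2_inner M (\<lambda>x. Im (f x)) (\<lambda>x. Im (f x)))"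
  using assms by (simp add: L2_norm_complex_def L2_inner_def cmod_power2 L2_sq_integrable flip: power2_eq_square)

locale symmetric_form =
  fixes M :: "'x measure" and H :: "('x \<Rightarrow> real) set" and D :: "'e set"
    and add :: "'e \<Rightarrow> 'e \<Rightarrow> 'e" and scl :: "real \<Rightarrow> 'e \<Rightarrow> 'e" and j :: "'e \<Rightarrow> 'x \<Rightarrow> real"
    and q :: "'e \<Rightarrow> 'e \<Rightarrow> real"
  assumes H_L2: "H \<subseteq> L2 M"
    and H_add: "f \<in> H \<Longrightarrow> g \<in> H \<Longrightarrow> (\<lambda>x. f x + g x) \<in> H"
    and H_scale: "f \<in> H \<Longrightarrow> (\<lambda>x. c * f x) \<in> H"
    and form: "semi_inner D add scl q"
    and j_mem: "e \<in> D \<Longrightarrow> j e \<in> H"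
    and j_add: "e \<in> D \<Longrightarrow> e' \<in> D \<Longrightarrow> j (add e e') = (\<lambda>x. j e x + j e' x)"
    and j_scl: "e \<in> D \<Longrightarrow> j (scl c e) = (\<lambda>x. c * j e x)"
begin

sublocale q: semi_inner D add scl q by (rule form)

abbreviation T where "T \<equiv> form_operator M H D j q"

text \<open>Completeness of \<open>D\<close> in this norm is the closedness of \<open>q\<close>; it
  is the form of the operator shifted by 1.\<close>

definition energy :: "'e \<Rightarrow> 'e \<Rightarrow> real" where "energy e e' = q e e' + L2_inner M (j e) (j e')"

lemma j_L2: "e \<in> D \<Longrightarrow> j e \<in> L2 M" using j_mem H_L2 by auto

lemma semi_inner_energy: "semi_inner D add scl energy"
  by standard (auto simp: energy_def q.nonempty q.ip_simps q.ip_nonneg j_add j_scl j_L2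
      L2_inner_add_left L2_inner_scale_left distrib_left q.ip_commute intro: L2_inner_commute)

lemma operatorE:
  assumes "(F, f) \<in> T"
  obtains e where "F \<in> H" "f \<in> H" "e \<in> D" "AE x in M. F x = j e x"
    "\<And>e'. e' \<in> D \<Longrightarrow> q e e' = L2_inner M f (j e')"
    "\<And>g. g \<in> L2 M \<Longrightarrow> L2_inner M F g = L2_inner M (j e) g"
proof -
  from assms obtain e where e: "F \<in> H" "f \<in> H" "e \<in> D" "AE x in M. F x = j e x"
    "\<forall>e'\<in>D. q e e' = L2_inner M f (j e')" by (auto simp: form_operator_def)
  then show ?thesis
    using L2_inner_cong_AE[of F M "j e"] j_L2 H_L2 by (intro that[of e]) auto
qed

lemma operatorI: "e \<in> D \<Longrightarrow> f \<in> H \<Longrightarrow> (\<And>e'. e' \<in> D \<Longrightarrow> q e e' = L2_inner M f (j e')) \<Longrightarrow> (j e, f) \<in> T"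
  unfolding form_operator_def using j_mem by auto

lemma operator_symmetric:
  assumes "(F, f) \<in> T" "(G, g) \<in> T"
  shows "L2_inner M f G = L2_inner M F g"
proof -
  obtain e where e: "F \<in> H" "f \<in> H" "e \<in> D" "\<And>e'. e' \<in> D \<Longrightarrow> q e e' = L2_inner M f (j e')"
    "\<And>g. g \<in> L2 M \<Longrightarrow> L2_inner M F g = L2_inner M (j e) g"
    using operatorE[OF assms(1)] by metis
  obtain e' where e': "G \<in> H" "g \<in> H" "e' \<in> D" "\<And>e. e \<in> D \<Longrightarrow> q e' e = L2_inner M g (j e)"
    "\<And>g. g \<in> L2 M \<Longrightarrow> L2_inner M G g = L2_inner M (j e') g"
    using operatorE[OF assms(2)] by metis
  have "L2_inner M f G = L2_inner M f (j e')"
    unfolding L2_inner_commute[of M f] by (rule e'(5)) (use e(2) H_L2 in auto)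
  also have "\<dots> = q e e'" using e e' by simp
  also have "\<dots> = q e' e" using e e' q.ip_commute by simp
  also have "\<dots> = L2_inner M F g"
    using e'(4)[OF e(3)] e(5)[of g] e'(2) H_L2 L2_inner_commute[of M g "j e"] by auto
  finally show ?thesis .
qed

text \<open>Kernel and range of a symmetric operator minus a real number are orthogonal, and here
  \<open>F\<close> lies in both.\<close>

lemma real_kernel:
  assumes "(F, \<lambda>x. lam * F x) \<in> T" and "\<exists>G. (G, \<lambda>x. lam * G x + F x) \<in> T"
  shows "AE x in M. F x = 0"
proof -
  obtain G where G: "(G, \<lambda>x. lam * G x + F x) \<in> T" using assms(2) by blast
  have F: "F \<in> L2 M" "G \<in> L2 M" using assms(1) G H_L2 by (auto simp: form_operator_def)
  have "L2_inner M (\<lambda>x. lam * F x) G = L2_inner M F (\<lambda>x. lam * G x + F x)"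
    by (rule operator_symmetric[OF assms(1) G])
  then have "L2_inner M F F = 0" using F by (simp add: L2_inner_simps L2_scale)
  then show ?thesis using F L2_inner_self_eq_0 by blast
qed

text \<open>For real \<open>lam\<close> the equation decouples into real and imaginary parts, so
  real solvability with a bound suffices. Injectivity follows from solvability by
  \<open>real_kernel\<close>.\<close>

lemma real_resolventI:
  assumes ex: "\<And>f. f \<in> H \<Longrightarrow> \<exists>F. (F, \<lambda>x. lam * F x + f x) \<in> T \<and> L2_inner M F F \<le> C * L2_inner M f f"
  shows "complex_of_real lam \<in> resolvent_set M H T"
  unfolding resolvent_set_def
proof (intro CollectI conjI allI impI)
  fix F assume F: "(F, \<lambda>x. complex_of_real lam * F x) \<in> complexify_operator T"
  have *: "AE x in M. G x = 0" if "(G, \<lambda>x. lam * G x) \<in> T" for G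
    by (rule real_kernel[OF that]) (use ex[of G] that in \<open>auto simp: form_operator_def\<close>)
  have "AE x in M. Re (F x) = 0" "AE x in M. Im (F x) = 0"
    by (rule *; use F in \<open>simp add: complexify_operator_def\<close>)+
  then show "AE x in M. F x = 0" by eventually_elim (simp add: complex_eq_iff)
next
  show "\<exists>C. \<forall>f\<in>complexify_space H. \<exists>F. (F, \<lambda>x. complex_of_real lam * F x + f x) \<in> complexify_operator T \<and>
      L2_norm_complex M F \<le> C * L2_norm_complex M f"
  proof (intro exI[of _ "sqrt C"] ballI)
  fix f assume f: "f \<in> complexify_space H"
  then have fH: "(\<lambda>x. Re (f x)) \<in> H" "(\<lambda>x. Im (f x)) \<in> H" by (auto simp: complexify_space_def)
  obtain F1 where F1: "(F1, \<lambda>x. lam * F1 x + Re (f x)) \<in> T"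
    "L2_inner M F1 F1 \<le> C * L2_inner M (\<lambda>x. Re (f x)) (\<lambda>x. Re (f x))" using ex[OF fH(1)] by blast
  obtain F2 where F2: "(F2, \<lambda>x. lam * F2 x + Im (f x)) \<in> T"
    "L2_inner M F2 F2 \<le> C * L2_inner M (\<lambda>x. Im (f x)) (\<lambda>x. Im (f x))" using ex[OF fH(2)] by blast
  have F: "F1 \<in> L2 M" "F2 \<in> L2 M" using F1(1) F2(1) H_L2 by (auto simp: form_operator_def)
  show "\<exists>F. (F, \<lambda>x. complex_of_real lam * F x + f x) \<in> complexify_operator T \<and>
      L2_norm_complex M F \<le> sqrt C * L2_norm_complex M f"
  proof (intro exI[of _ "\<lambda>x. Complex (F1 x) (F2 x)"] conjI)
    show "L2_norm_complex M (\<lambda>x. Complex (F1 x) (F2 x)) \<le> sqrt C * L2_norm_complex M f"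
      using F1(2) F2(2) F fH H_L2
      by (subst (1 2) L2_norm_complex_eq) (auto simp: distrib_left simp flip: real_sqrt_mult)
  qed (use F1 F2 in \<open>simp add: complexify_operator_def\<close>)
  qed
qed

text \<open>The definition of the resolvent set bounds one solution per right-hand side. The last
  conclusion extends the bound to every real solution; in this form it is applied to solutions that
  are constructed explicitly.\<close>

lemma real_resolventD:
  assumes "complex_of_real lam \<in> resolvent_set M H T"
  obtains C where "C \<ge> 0"
    "\<And>f. f \<in> H \<Longrightarrow> \<exists>F. (F, \<lambda>x. lam * F x + f x) \<in> T"
    "\<And>F f. f \<in> H \<Longrightarrow> (F, \<lambda>x. lam * F x + f x) \<in> T \<Longrightarrow> L2_inner M F F \<le> C * L2_inner M f f"
proof -
  from assms obtain C where C: "\<And>f. f \<in> complexify_space H \<Longrightarrow>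
      \<exists>F. (F, \<lambda>x. complex_of_real lam * F x + f x) \<in> complexify_operator T \<and>
        L2_norm_complex M F \<le> C * L2_norm_complex M f"
    by (auto simp: resolvent_set_def)
  have zero: "(\<lambda>x. 0) \<in> H" using H_scale[of _ 0] j_mem q.nonempty by fastforce
  have ex: "\<exists>F. (F, \<lambda>x. lam * F x + f x) \<in> T \<and> L2_inner M F F \<le> C\<^sup>2 * L2_inner M f f" if f: "f \<in> H" for f
  proof -
    have "(\<lambda>x. complex_of_real (f x)) \<in> complexify_space H"
      using f zero by (simp add: complexify_space_def)
    from C[OF this] obtain F where F:
      "(F, \<lambda>x. complex_of_real lam * F x + complex_of_real (f x)) \<in> complexify_operator T"
      "L2_norm_complex M F \<le> C * L2_norm_complex M (\<lambda>x. complex_of_real (f x))" by blast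
    then have T: "((\<lambda>x. Re (F x)), \<lambda>x. lam * Re (F x) + f x) \<in> T" "((\<lambda>x. Im (F x)), \<lambda>x. lam * Im (F x)) \<in> T"
      by (auto simp: complexify_operator_def)
    then have FL: "(\<lambda>x. Re (F x)) \<in> L2 M" "(\<lambda>x. Im (F x)) \<in> L2 M"
      using H_L2 by (auto simp: form_operator_def)
    have fL: "f \<in> L2 M" using f H_L2 by auto
    have "L2_inner M (\<lambda>x. Re (F x)) (\<lambda>x. Re (F x)) + L2_inner M (\<lambda>x. Im (F x)) (\<lambda>x. Im (F x)) = (L2_norm_complex M F)\<^sup>2"
      using FL by (simp add: L2_norm_complex_eq)
    also have "\<dots> \<le> (C * L2_norm_complex M (\<lambda>x. complex_of_real (f x)))\<^sup>2"
      by (rule power_mono[OF F(2)]) (simp add: L2_norm_complex_def)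
    also have "\<dots> = C\<^sup>2 * L2_inner M f f"
      using fL by (subst L2_norm_complex_eq) (auto simp: power_mult_distrib)
    \<comment> \<open>The imaginary part of \<open>F\<close> only adds to the norm and is
      dropped.\<close>
    finally have "L2_inner M (\<lambda>x. Re (F x)) (\<lambda>x. Re (F x)) \<le> C\<^sup>2 * L2_inner M f f"
      using L2_inner_nonneg[of M "\<lambda>x. Im (F x)"] by linarith
    then show ?thesis using T by blast
  qed
  have "L2_inner M F F \<le> C\<^sup>2 * L2_inner M f f" if f: "f \<in> H" and F: "(F, \<lambda>x. lam * F x + f x) \<in> T" for F f
  proof -
    obtain G where G: "(G, \<lambda>x. lam * G x + f x) \<in> T" "L2_inner M G G \<le> C\<^sup>2 * L2_inner M f f"
      using ex[OF f] by blast
    \<comment> \<open>The difference of two solutions lies in the kernel. Solving with right-hand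
      side \<open>K\<close> and using symmetry shows that \<open>K\<close> is orthogonal to
      itself.\<close>
    define K where "K x = F x + (- 1) * G x" for x
    have FG: "F \<in> H" "G \<in> H" using F G by (auto simp: form_operator_def)
    then have K: "K \<in> H" unfolding K_def by (intro H_add H_scale)
    obtain L where L: "(L, \<lambda>x. lam * L x + K x) \<in> T" using ex[OF K] by blast
    have LH: "L \<in> H" using L by (auto simp: form_operator_def)
    note m = FG[THEN subsetD[OF H_L2]] K[THEN subsetD[OF H_L2]] LH[THEN subsetD[OF H_L2]] f[THEN subsetD[OF H_L2]]
    have "L2_inner M F K = L2_inner M f L"
      using operator_symmetric[OF F L] m by (simp add: L2_inner_simps L2_add L2_scale)
    moreover have "L2_inner M G K = L2_inner M f L"
      using operator_symmetric[OF G(1) L] m by (simp add: L2_inner_simps L2_add L2_scale)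
    moreover have "L2_inner M (\<lambda>x. F x + (- 1) * G x) K = L2_inner M F K - L2_inner M G K"
      using L2_inner_add_left[OF m(1) L2_scale[OF m(2), of "- 1"] m(3)] L2_inner_scale_left[of M "- 1" G K] by simp
    then have "L2_inner M K K = L2_inner M F K - L2_inner M G K" by (simp only: K_def[abs_def, symmetric])
    ultimately have "AE x in M. K x = 0" using L2_inner_self_eq_0 m(3) by simp
    then have "AE x in M. \<bar>F x\<bar> \<le> \<bar>G x\<bar>" by eventually_elim (simp add: K_def)
    then have "L2_inner M F F \<le> L2_inner M G G" by (intro L2_inner_mono m)
    then show ?thesis using G(2) by simp
  qed
  moreover have "\<exists>F. (F, \<lambda>x. lam * F x + f x) \<in> T" if "f \<in> H" for f using ex[OF that] by blast
  ultimately show ?thesis using that[OF zero_le_power2[of C]] by meson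
qed

end

locale closed_form = symmetric_form +
  assumes hilbert: "semi_hilbert D add scl energy"
begin

text \<open>Testing the equation \<open>(T - lam) F = f\<close> with \<open>(G\<^sub>1 - s G\<^sub>2, s G\<^sub>1 + G\<^sub>2)\<close> for
  \<open>s = - (Re lam + 1) / Im lam\<close>, a form results whose quadratic part is the energy.\<close>

lemma nonreal_solvable:
  assumes \<beta>: "\<beta> \<noteq> 0" and f1: "f1 \<in> H" and f2: "f2 \<in> H"
  shows "\<exists>e1\<in>D. \<exists>e2\<in>D.
    (j e1, \<lambda>x. \<alpha> * j e1 x - \<beta> * j e2 x + f1 x) \<in> T \<and>
    (j e2, \<lambda>x. \<alpha> * j e2 x + \<beta> * j e1 x + f2 x) \<in> T \<and>
    L2_inner M (j e1) (j e1) + L2_inner M (j e2) (j e2)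
      \<le> 4 * (1 + ((\<alpha> + 1) / \<beta>)\<^sup>2) * (L2_inner M f1 f1 + L2_inner M f2 f2)"
proof -
  define s where "s = - (\<alpha> + 1) / \<beta>"
  \<comment> \<open>In the combination of the first equation with \<open>s\<close> times the second,
    \<open>\<beta> * s = - (\<alpha> + 1)\<close> gives the inner product with \<open>e1\<close> the
    coefficient 1, which completes \<open>q\<close> to \<open>energy\<close>; \<open>t\<close> is
    the coefficient left in front of the inner product with \<open>e2\<close>.\<close>
  define t where "t = \<beta> - \<alpha> * s"
  have s: "\<beta> * s = - (\<alpha> + 1)" using \<beta> by (simp add: s_def)
  note I = j_L2 f1[THEN subsetD[OF H_L2]] f2[THEN subsetD[OF H_L2]]
  define h1 where "h1 x = f1 x + s * f2 x" for x
  define h2 where "h2 x = f2 x - s * f1 x" for x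
  have h: "h1 \<in> L2 M" "h2 \<in> L2 M" unfolding h1_def h2_def using I by auto
  let ?i = "\<lambda>e e'. L2_inner M (j e) (j e')"
  define B where "B F G = energy (fst F) (fst G) + energy (snd F) (snd G)
      + s * (q (snd F) (fst G) - q (fst F) (snd G)) + t * (?i (snd F) (fst G) - ?i (fst F) (snd G))" for F G
  define l where "l G = L2_inner M h1 (j (fst G)) + L2_inner M h2 (j (snd G))" for G
  define N where "N F G = energy (fst F) (fst G) + energy (snd F) (snd G)" for F G
  interpret E: semi_hilbert "D \<times> D" "\<lambda>u v. (add (fst u) (fst v), add (snd u) (snd v))"
      "\<lambda>c u. (scl c (fst u), scl c (snd u))" N
    unfolding N_def by (rule semi_hilbert_prod[OF hilbert hilbert])
  have en: "0 \<le> ?i e e" "0 \<le> q e e" if "e \<in> D" for e using that q.ip_nonneg by auto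
  have qN: "q (fst F) (fst F) \<le> N F F" "q (snd F) (snd F) \<le> N F F"
      "?i (fst F) (fst F) \<le> N F F" "?i (snd F) (snd F) \<le> N F F"
      "?i (fst F) (fst F) + ?i (snd F) (snd F) \<le> N F F" if "F \<in> D \<times> D" for F
    using that en[of "fst F"] en[of "snd F"] unfolding N_def energy_def by auto
  have qb: "\<bar>q e e'\<bar> \<le> sqrt (N F F * N G G)"
    if "e \<in> D" "e' \<in> D" "q e e \<le> N F F" "q e' e' \<le> N G G" for e e' F G
  proof -
    have "(q e e')\<^sup>2 \<le> q e e * q e' e'" by (rule q.cauchy_schwarz_sq[OF that(1,2)])
    also have "\<dots> \<le> N F F * N G G"
      by (rule mult_mono[OF that(3,4) order_trans[OF _ that(3)]]) (use that en in auto)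
    finally show ?thesis by (rule real_le_rsqrt[of "\<bar>_\<bar>", simplified power2_abs])
  qed
  have ib: "\<bar>?i e e'\<bar> \<le> sqrt (N F F * N G G)"
    if "e \<in> D" "e' \<in> D" "?i e e \<le> N F F" "?i e' e' \<le> N G G" for e e' F G
  proof -
    have "(?i e e')\<^sup>2 \<le> ?i e e * ?i e' e'" using that j_L2 by (intro L2_cauchy_schwarz) auto
    also have "\<dots> \<le> N F F * N G G"
      by (rule mult_mono[OF that(3,4) order_trans[OF _ that(3)]]) (use that en in auto)
    finally show ?thesis by (rule real_le_rsqrt[of "\<bar>_\<bar>", simplified power2_abs])
  qed
  have BB: "(B F G)\<^sup>2 \<le> (4 + 2 * \<bar>s\<bar> + 2 * \<bar>t\<bar>)\<^sup>2 * N F F * N G G" if F: "F \<in> D \<times> D" and G: "G \<in> D \<times> D" for F G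
  proof -
    let ?R = "sqrt (N F F * N G G)"
    have m: "fst F \<in> D" "snd F \<in> D" "fst G \<in> D" "snd G \<in> D" using F G by auto
    note b = qb[OF m(1) m(3) qN(1)[OF F] qN(1)[OF G]] qb[OF m(2) m(4) qN(2)[OF F] qN(2)[OF G]]
      qb[OF m(2) m(3) qN(2)[OF F] qN(1)[OF G]] qb[OF m(1) m(4) qN(1)[OF F] qN(2)[OF G]]
      ib[OF m(1) m(3) qN(3)[OF F] qN(3)[OF G]] ib[OF m(2) m(4) qN(4)[OF F] qN(4)[OF G]]
      ib[OF m(2) m(3) qN(4)[OF F] qN(3)[OF G]] ib[OF m(1) m(4) qN(3)[OF F] qN(4)[OF G]]
    have "\<bar>s * (q (snd F) (fst G) - q (fst F) (snd G))\<bar> \<le> \<bar>s\<bar> * (2 * ?R)"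
      using b(3,4) unfolding abs_mult by (intro mult_left_mono) auto
    moreover have "\<bar>t * (?i (snd F) (fst G) - ?i (fst F) (snd G))\<bar> \<le> \<bar>t\<bar> * (2 * ?R)"
      using b(7,8) unfolding abs_mult by (intro mult_left_mono) auto
    moreover have abs_sum_bound: "\<bar>a\<bar> \<le> R \<Longrightarrow> \<bar>b\<bar> \<le> R \<Longrightarrow> \<bar>c\<bar> \<le> R \<Longrightarrow> \<bar>d\<bar> \<le> R \<Longrightarrow>
        \<bar>x\<bar> \<le> X \<Longrightarrow> \<bar>y\<bar> \<le> Y \<Longrightarrow> \<bar>a + b + (c + d) + x + y\<bar> \<le> 4 * R + X + Y" for a b c d x y R X Y :: real
      by linarith
    moreover have "(4 + 2 * \<bar>s\<bar> + 2 * \<bar>t\<bar>) * ?R = 4 * ?R + \<bar>s\<bar> * (2 * ?R) + \<bar>t\<bar> * (2 * ?R)"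
      by (simp add: algebra_simps)
    ultimately have "\<bar>B F G\<bar> \<le> (4 + 2 * \<bar>s\<bar> + 2 * \<bar>t\<bar>) * ?R"
      using abs_sum_bound[OF b(1,5,2,6)] unfolding B_def energy_def by metis
    then have "\<bar>B F G\<bar>\<^sup>2 \<le> ((4 + 2 * \<bar>s\<bar> + 2 * \<bar>t\<bar>) * ?R)\<^sup>2" by (intro power_mono) auto
    then show ?thesis using E.ip_nonneg[OF F] E.ip_nonneg[OF G] by (simp add: power_mult_distrib)
  qed
  have lb: "(l G)\<^sup>2 \<le> 2 * (L2_inner M h1 h1 + L2_inner M h2 h2) * N G G" if G: "G \<in> D \<times> D" for G
  proof -
    have m: "fst G \<in> D" "snd G \<in> D" using G by auto
    have "(L2_inner M h1 (j (fst G)))\<^sup>2 \<le> L2_inner M h1 h1 * ?i (fst G) (fst G)"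
      "(L2_inner M h2 (j (snd G)))\<^sup>2 \<le> L2_inner M h2 h2 * ?i (snd G) (snd G)"
      by (rule L2_cauchy_schwarz[OF h(1) j_L2[OF m(1)]], rule L2_cauchy_schwarz[OF h(2) j_L2[OF m(2)]])
    moreover have "L2_inner M h1 h1 * ?i (fst G) (fst G) \<le> L2_inner M h1 h1 * N G G"
      "L2_inner M h2 h2 * ?i (snd G) (snd G) \<le> L2_inner M h2 h2 * N G G"
      by (intro mult_left_mono qN G; simp)+
    moreover have "(l G)\<^sup>2 \<le> 2 * (L2_inner M h1 (j (fst G)))\<^sup>2 + 2 * (L2_inner M h2 (j (snd G)))\<^sup>2"
      unfolding l_def using zero_le_power2[of "L2_inner M h1 (j (fst G)) - L2_inner M h2 (j (snd G))"]
      by (simp add: power2_sum power2_diff)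
    moreover have "2 * (L2_inner M h1 h1 + L2_inner M h2 h2) * N G G
        = 2 * (L2_inner M h1 h1 * N G G) + 2 * (L2_inner M h2 h2 * N G G)" by (simp add: algebra_simps)
    ultimately show ?thesis by linarith
  qed
  \<comment> \<open>The cross terms are antisymmetric in the two components and cancel on the
    diagonal, so \<open>B\<close> is coercive with constant 1.\<close>
  have sk: "B F F = N F F" if F: "F \<in> D \<times> D" for F
  proof -
    have "q (snd F) (fst F) = q (fst F) (snd F)" by (rule q.ip_commute) (use F in auto)
    then show ?thesis unfolding B_def N_def L2_inner_commute[of M "j (snd F)" "j (fst F)"] by simp
  qed
  interpret en: semi_inner D add scl energy by (rule semi_inner_energy)
  have "\<exists>F\<in>D \<times> D. \<forall>G\<in>D \<times> D. B F G = l G"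
  proof (rule E.lax_milgram[where K = "(4 + 2 * \<bar>s\<bar> + 2 * \<bar>t\<bar>)\<^sup>2" and c = 1
          and C = "2 * (L2_inner M h1 h1 + L2_inner M h2 h2)"])
    show "(B u w)\<^sup>2 \<le> (4 + 2 * \<bar>s\<bar> + 2 * \<bar>t\<bar>)\<^sup>2 * N u u * N w w" if "u \<in> D \<times> D" "w \<in> D \<times> D" for u w
      by (rule BB[OF that])
    show "1 * N u u \<le> B u u" if "u \<in> D \<times> D" for u using sk[OF that] by simp
    show "(l u)\<^sup>2 \<le> 2 * (L2_inner M h1 h1 + L2_inner M h2 h2) * N u u" if "u \<in> D \<times> D" for u by (rule lb[OF that])
  qed (auto simp: B_def l_def en.ip_simps q.ip_simps j_add j_scl L2_inner_simps I h algebra_simps)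
  then obtain e1 e2 where e: "e1 \<in> D" "e2 \<in> D" and eq: "\<And>G. G \<in> D \<times> D \<Longrightarrow> B (e1, e2) G = l G" by auto
  have E1: "q e1 g - \<alpha> * ?i e1 g + \<beta> * ?i e2 g - L2_inner M f1 (j g) = 0"
    and E2: "q e2 g - \<alpha> * ?i e2 g - \<beta> * ?i e1 g - L2_inner M f2 (j g) = 0" if g: "g \<in> D" for g
  proof -
    let ?E1 = "q e1 g - \<alpha> * ?i e1 g + \<beta> * ?i e2 g - L2_inner M f1 (j g)"
    let ?E2 = "q e2 g - \<alpha> * ?i e2 g - \<beta> * ?i e1 g - L2_inner M f2 (j g)"
    have "B (e1, e2) (g, scl 0 g) = l (g, scl 0 g)" "B (e1, e2) (scl 0 g, g) = l (scl 0 g, g)"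
      using eq g by auto
    then have a: "energy e1 g + s * q e2 g + t * ?i e2 g = L2_inner M f1 (j g) + s * L2_inner M f2 (j g)"
      "energy e2 g - s * q e1 g - t * ?i e1 g = L2_inner M f2 (j g) - s * L2_inner M f1 (j g)"
      using e g by (auto simp: B_def l_def en.ip_simps q.ip_simps j_scl h1_def[abs_def] h2_def[abs_def] L2_inner_simps I L2_scale)
    have s': "?i e g + \<alpha> * ?i e g = - (\<beta> * s * ?i e g)" for e
      using arg_cong[OF s, of "\<lambda>u. u * ?i e g"] by (simp add: algebra_simps)
    have 1: "?E1 + s * ?E2 = 0" using a(1) s'[of e1] unfolding t_def energy_def by (simp add: algebra_simps)
    have 2: "?E2 - s * ?E1 = 0" using a(2) s'[of e2] unfolding t_def energy_def by (simp add: algebra_simps)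
    \<comment> \<open>The combined equations are inverted: the matrix with rows
      \<open>(1, s)\<close> and \<open>(- s, 1)\<close> has determinant
      \<open>1 + s\<^sup>2\<close>, which never vanishes.\<close>
    have "(1 + s\<^sup>2) * ?E1 = (?E1 + s * ?E2) - s * (?E2 - s * ?E1)" by (simp add: power2_eq_square algebra_simps)
    then have "(1 + s\<^sup>2) * ?E1 = 0" using 1 2 by simp
    moreover have "1 + s\<^sup>2 > 0" by (smt (verit) zero_le_power2)
    ultimately show "?E1 = 0" by simp
    then show "?E2 = 0" using 2 by simp
  qed
  \<comment> \<open>Testing with the solution itself gives \<open>N = l\<close>, and the bound for
    \<open>l\<close> then bounds \<open>N\<close> by the data. The factor 4 collects the 2 of that
    bound and the 2 from splitting \<open>h1\<close> and \<open>h2\<close>.\<close>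
  have "N (e1, e2) (e1, e2) = l (e1, e2)" using sk[of "(e1, e2)"] eq[of "(e1, e2)"] e by auto
  then have "N (e1, e2) (e1, e2) * N (e1, e2) (e1, e2) \<le> 2 * (L2_inner M h1 h1 + L2_inner M h2 h2) * N (e1, e2) (e1, e2)"
    using lb[of "(e1, e2)"] e by (auto simp: power2_eq_square)
  then have "N (e1, e2) (e1, e2) \<le> 2 * (L2_inner M h1 h1 + L2_inner M h2 h2)"
    using E.ip_nonneg[of "(e1, e2)"] e by (cases "N (e1, e2) (e1, e2) = 0") auto
  also have "L2_inner M h1 h1 \<le> 2 * L2_inner M f1 f1 + 2 * (s * (s * L2_inner M f2 f2))"
    unfolding h1_def using L2_inner_sum_sq_le[OF I(2) L2_scale[OF I(3)], of s] by (simp add: L2_inner_simps)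
  also have "L2_inner M h2 h2 \<le> 2 * L2_inner M f2 f2 + 2 * (s * (s * L2_inner M f1 f1))"
    unfolding h2_def using L2_inner_diff_sq_le[OF I(3) L2_scale[OF I(2)], of s] by (simp add: L2_inner_simps)
  finally have bnd: "?i e1 e1 + ?i e2 e2 \<le> 4 * (1 + s\<^sup>2) * (L2_inner M f1 f1 + L2_inner M f2 f2)"
    using qN(5)[of "(e1, e2)"] e by (simp add: algebra_simps power2_eq_square)
  have H: "(\<lambda>x. \<alpha> * j e1 x - \<beta> * j e2 x + f1 x) \<in> H" "(\<lambda>x. \<alpha> * j e2 x + \<beta> * j e1 x + f2 x) \<in> H"
    using H_add[OF H_add[OF H_scale[of "j e1" \<alpha>] H_scale[of "j e2" "- \<beta>"]] f1]
      H_add[OF H_add[OF H_scale[of "j e2" \<alpha>] H_scale[of "j e1" \<beta>]] f2] j_mem e by auto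
  have "(j e1, \<lambda>x. \<alpha> * j e1 x - \<beta> * j e2 x + f1 x) \<in> T" "(j e2, \<lambda>x. \<alpha> * j e2 x + \<beta> * j e1 x + f2 x) \<in> T"
  proof -
    have L: "(\<lambda>x. \<gamma> * j e x) \<in> L2 M" if "e \<in> D" for e \<gamma> using that I by auto
    have "q e1 g = L2_inner M (\<lambda>x. \<alpha> * j e1 x - \<beta> * j e2 x + f1 x) (j g)" if g: "g \<in> D" for g
      using E1[OF g] L2_inner_add_left[OF L2_diff[OF L[OF e(1)] L[OF e(2)]] I(2) I(1)[OF g], of \<alpha> \<beta>]
        L2_inner_diff_left[OF L[OF e(1)] L[OF e(2)] I(1)[OF g], of \<alpha> \<beta>]
      unfolding L2_inner_scale_left by linarith
    then show "(j e1, \<lambda>x. \<alpha> * j e1 x - \<beta> * j e2 x + f1 x) \<in> T" by (rule operatorI[OF e(1) H(1)])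
    have "q e2 g = L2_inner M (\<lambda>x. \<alpha> * j e2 x + \<beta> * j e1 x + f2 x) (j g)" if g: "g \<in> D" for g
      using E2[OF g] L2_inner_add_left[OF L2_add[OF L[OF e(2)] L[OF e(1)]] I(3) I(1)[OF g], of \<alpha> \<beta>]
        L2_inner_add_left[OF L[OF e(2)] L[OF e(1)] I(1)[OF g], of \<alpha> \<beta>]
      unfolding L2_inner_scale_left by linarith
    then show "(j e2, \<lambda>x. \<alpha> * j e2 x + \<beta> * j e1 x + f2 x) \<in> T" by (rule operatorI[OF e(2) H(2)])
  qed
  moreover have "s\<^sup>2 = ((\<alpha> + 1) / \<beta>)\<^sup>2" unfolding s_def by (simp add: power_divide power2_commute[of "- \<alpha>"] power2_eq_square algebra_simps)
  ultimately show ?thesis using bnd e by auto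
qed

theorem nonreal_in_resolvent_set:
  assumes "Im lam \<noteq> 0"
  shows "lam \<in> resolvent_set M H T"
  unfolding resolvent_set_def
proof (intro CollectI conjI allI impI)
  fix F assume "(F, \<lambda>x. lam * F x) \<in> complexify_operator T"
  then have T: "((\<lambda>x. Re (F x)), (\<lambda>x. Re lam * Re (F x) - Im lam * Im (F x))) \<in> T"
    "((\<lambda>x. Im (F x)), (\<lambda>x. Re lam * Im (F x) + Im lam * Re (F x))) \<in> T"
    by (auto simp: complexify_operator_def)
  then have L: "(\<lambda>x. Re (F x)) \<in> L2 M" "(\<lambda>x. Im (F x)) \<in> L2 M"
    using H_L2 by (auto simp: form_operator_def)
  \<comment> \<open>By symmetry, pairing the two component equations leaves only the imaginary part
    of \<open>lam\<close> times the norm square of \<open>F\<close>.\<close>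
  have "L2_inner M (\<lambda>x. Re lam * Re (F x) - Im lam * Im (F x)) (\<lambda>x. Im (F x))
      = L2_inner M (\<lambda>x. Re (F x)) (\<lambda>x. Re lam * Im (F x) + Im lam * Re (F x))"
    by (rule operator_symmetric[OF T])
  then have "Im lam * (L2_inner M (\<lambda>x. Re (F x)) (\<lambda>x. Re (F x)) + L2_inner M (\<lambda>x. Im (F x)) (\<lambda>x. Im (F x))) = 0"
    using L by (simp add: L2_inner_simps L2_scale L2_add L2_diff algebra_simps)
  then have "L2_inner M (\<lambda>x. Re (F x)) (\<lambda>x. Re (F x)) + L2_inner M (\<lambda>x. Im (F x)) (\<lambda>x. Im (F x)) = 0"
    using assms by simp
  then have "L2_inner M (\<lambda>x. Re (F x)) (\<lambda>x. Re (F x)) = 0" "L2_inner M (\<lambda>x. Im (F x)) (\<lambda>x. Im (F x)) = 0"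
    by (smt (verit) L2_inner_nonneg)+
  then have "AE x in M. Re (F x) = 0" "AE x in M. Im (F x) = 0"
    using L L2_inner_self_eq_0 by auto
  then show "AE x in M. F x = 0" by eventually_elim (simp add: complex_eq_iff)
next
  let ?C = "4 * (1 + ((Re lam + 1) / Im lam)\<^sup>2)"
  show "\<exists>C. \<forall>f\<in>complexify_space H. \<exists>F. (F, \<lambda>x. lam * F x + f x) \<in> complexify_operator T \<and>
      L2_norm_complex M F \<le> C * L2_norm_complex M f"
  proof (intro exI[of _ "sqrt ?C"] ballI)
  fix f assume "f \<in> complexify_space H"
  then have fH: "(\<lambda>x. Re (f x)) \<in> H" "(\<lambda>x. Im (f x)) \<in> H" by (auto simp: complexify_space_def)
  obtain e1 e2 where e: "e1 \<in> D" "e2 \<in> D"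
    "(j e1, \<lambda>x. Re lam * j e1 x - Im lam * j e2 x + Re (f x)) \<in> T"
    "(j e2, \<lambda>x. Re lam * j e2 x + Im lam * j e1 x + Im (f x)) \<in> T"
    "L2_inner M (j e1) (j e1) + L2_inner M (j e2) (j e2)
      \<le> ?C * (L2_inner M (\<lambda>x. Re (f x)) (\<lambda>x. Re (f x)) + L2_inner M (\<lambda>x. Im (f x)) (\<lambda>x. Im (f x)))"
    using nonreal_solvable[OF assms fH] by blast
  show "\<exists>F. (F, \<lambda>x. lam * F x + f x) \<in> complexify_operator T \<and>
      L2_norm_complex M F \<le> sqrt ?C * L2_norm_complex M f"
  proof (intro exI[of _ "\<lambda>x. Complex (j e1 x) (j e2 x)"] conjI)
    show "L2_norm_complex M (\<lambda>x. Complex (j e1 x) (j e2 x)) \<le> sqrt ?C * L2_norm_complex M f"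
      using e(5) j_L2[OF e(1)] j_L2[OF e(2)] fH H_L2
      by (subst (1 2) L2_norm_complex_eq) (auto simp flip: real_sqrt_mult)
  qed (use e in \<open>simp add: complexify_operator_def\<close>)
  qed
qed

end

section \<open>Bump functions and integration by parts\<close>

text \<open>The flat function \<open>exp (- (1 / t))\<close> divided by a power of \<open>t\<close>.
  The family is closed under differentiation up to linear combinations, which its member with
  \<open>n = 0\<close> alone is not.\<close>

definition flat_exp :: "nat \<Rightarrow> real \<Rightarrow> real" where
  "flat_exp n t = (if t \<le> 0 then 0 else exp (- (1 / t)) / t ^ n)"

lemma flat_exp_bounds: "0 \<le> flat_exp 0 t" "flat_exp 0 t \<le> 1" "t > 0 \<Longrightarrow> 0 < flat_exp 0 t" "t \<le> 0 \<Longrightarrow> flat_exp n t = 0"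
  by (auto simp: flat_exp_def)

lemma flat_exp_tendsto_0: "(flat_exp n \<longlongrightarrow> 0) (at 0)"
proof -
  have "((\<lambda>t. (1 / t) ^ n / exp (1 / t)) \<longlongrightarrow> (0::real)) (at_right 0)"
    by (rule filterlim_compose[OF tendsto_power_div_exp_0])
      (use filterlim_inverse_at_top_right in \<open>simp add: inverse_eq_divide\<close>)
  then have "(flat_exp n \<longlongrightarrow> 0) (at_right 0)"
    by (rule Lim_transform_eventually)
      (auto simp: flat_exp_def eventually_at_filter exp_minus field_simps power_one_over)
  moreover have "(flat_exp n \<longlongrightarrow> 0) (at_left 0)"
    by (rule Lim_transform_eventually[OF tendsto_const])
      (auto simp: flat_exp_def eventually_at_filter)
  ultimately show ?thesis by (simp add: filterlim_split_at)
qed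

lemma flat_exp_deriv:
  "(flat_exp n has_real_derivative flat_exp (n + 2) t - real n * flat_exp (n + 1) t) (at t)"
proof -
  consider "t < 0" | "t = 0" | "t > 0" by linarith
  then show ?thesis
  proof cases
    case 1
    have "\<forall>\<^sub>F x in nhds t. flat_exp n x = 0"
      using eventually_nhds_in_open[of "{..<0}" t] 1 by (auto elim!: eventually_mono simp: flat_exp_def)
    then show ?thesis using 1 by (subst DERIV_cong_ev[OF refl _ refl]) (auto simp: flat_exp_def)
  next
    case 2
    \<comment> \<open>The difference quotient at 0 is \<open>flat_exp (Suc n)\<close>, again a
      member of the family.\<close>
    have "((\<lambda>h. flat_exp n h / h) \<longlongrightarrow> 0) (at 0)"
      by (rule Lim_transform_eventually[OF flat_exp_tendsto_0[of "Suc n"]])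
        (auto simp: flat_exp_def eventually_at_filter)
    then show ?thesis using 2 by (simp add: DERIV_def flat_exp_def)
  next
    case 3
    have "((\<lambda>t. exp (- (1 / t)) / t ^ n) has_real_derivative
        exp (- (1 / t)) / t ^ (n + 2) - real n * (exp (- (1 / t)) / t ^ (n + 1))) (at t)"
      using 3 by (auto intro!: derivative_eq_intros simp: field_simps power2_eq_square)
        (cases n; simp add: field_simps power2_eq_square)
    moreover have "\<forall>\<^sub>F x in nhds t. flat_exp n x = exp (- (1 / x)) / x ^ n"
      using eventually_nhds_in_open[of "{0<..}" t] 3 by (auto elim!: eventually_mono simp: flat_exp_def)
    ultimately show ?thesis using 3 by (subst DERIV_cong_ev[OF refl _ refl]) (auto simp: flat_exp_def)
  qed
qed

text \<open>An algebra of explicit functions that is stable under partial derivatives, so that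
  smoothness of all members follows by induction on the order. It contains the bumps and the
  oscillating factors that are needed below.\<close>

inductive_set smooth_alg :: "(real^'d \<Rightarrow> real) set" where
  const: "(\<lambda>x. c) \<in> smooth_alg"
| flat: "(\<lambda>x. flat_exp n (c * x $ i + b)) \<in> smooth_alg"
| sin: "(\<lambda>x. sin (c * x $ i)) \<in> smooth_alg"
| cos: "(\<lambda>x. cos (c * x $ i)) \<in> smooth_alg"
| add: "f \<in> smooth_alg \<Longrightarrow> g \<in> smooth_alg \<Longrightarrow> (\<lambda>x. f x + g x) \<in> smooth_alg"
| mult: "f \<in> smooth_alg \<Longrightarrow> g \<in> smooth_alg \<Longrightarrow> (\<lambda>x. f x * g x) \<in> smooth_alg"

lemma smooth_alg_diff: "f \<in> smooth_alg \<Longrightarrow> g \<in> smooth_alg \<Longrightarrow> (\<lambda>x. f x - g x) \<in> smooth_alg"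
  using smooth_alg.add[OF _ smooth_alg.mult[OF smooth_alg.const[of "- 1"]], of f g] by simp

lemma has_derivative_coord_comp:
  assumes "(h has_real_derivative D) (at (c * x $ i + b))"
  shows "((\<lambda>x::real^'d. h (c * x $ i + b)) has_derivative (\<lambda>v. D * c * v $ i)) (at x)"
proof -
  have "((\<lambda>x::real^'d. c * x $ i + b) has_derivative (\<lambda>v. c * v $ i)) (at x)"
    by (auto intro!: derivative_eq_intros bounded_linear.has_derivative[OF bounded_linear_vec_nth])
  from has_derivative_compose[OF this assms[unfolded has_field_derivative_def]]
  show ?thesis by (simp add: mult.assoc)
qed

lemma smooth_alg_derivative:
  assumes "f \<in> smooth_alg"
  shows "(\<forall>x. f differentiable (at x)) \<and> (\<forall>i. (\<lambda>x. frechet_derivative f (at x) (axis i 1)) \<in> smooth_alg)"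
  using assms
proof induction
  case (const c)
  show ?case by (auto intro: smooth_alg.const)
next
  case (flat n c j b)
  have d: "((\<lambda>x. flat_exp n (c * x $ j + b)) has_derivative
      (\<lambda>v. (flat_exp (n + 2) (c * x $ j + b) - real n * flat_exp (n + 1) (c * x $ j + b)) * c * v $ j)) (at x)" for x
    by (rule has_derivative_coord_comp[OF flat_exp_deriv])
  have e: "(\<lambda>x. frechet_derivative (\<lambda>x. flat_exp n (c * x $ j + b)) (at x) (axis i 1)) =
      (\<lambda>x. c * (axis i 1 $ j) * (flat_exp (n + 2) (c * x $ j + b) + (- real n) * flat_exp (n + 1) (c * x $ j + b)))" for i
    using frechet_derivative_at[OF d] by (simp add: fun_eq_iff algebra_simps flip: frechet_derivative_at[OF d])
  show ?case unfolding e
    using d by (auto simp: differentiable_def intro!: smooth_alg.intros smooth_alg_diff)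
next
  case (sin c j)
  have d: "((\<lambda>x. sin (c * x $ j)) has_derivative (\<lambda>v. cos (c * x $ j) * c * v $ j)) (at x)" for x :: "real^'a"
    using has_derivative_coord_comp[of sin "cos (c * x $ j)" c x j 0] DERIV_sin by simp
  have e: "(\<lambda>x. frechet_derivative (\<lambda>x. sin (c * x $ j)) (at x) (axis i 1)) =
      (\<lambda>x. c * (axis i 1 $ j) * cos (c * x $ j))" for i :: 'a
    by (simp add: fun_eq_iff algebra_simps flip: frechet_derivative_at[OF d])
  show ?case unfolding e
    using d by (auto simp: differentiable_def intro!: smooth_alg.intros)
next
  case (cos c j)
  have d: "((\<lambda>x. cos (c * x $ j)) has_derivative (\<lambda>v. - sin (c * x $ j) * c * v $ j)) (at x)" for x :: "real^'a"
    using has_derivative_coord_comp[of cos "- sin (c * x $ j)" c x j 0] DERIV_cos by simp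
  have e: "(\<lambda>x. frechet_derivative (\<lambda>x. cos (c * x $ j)) (at x) (axis i 1)) =
      (\<lambda>x. - c * (axis i 1 $ j) * sin (c * x $ j))" for i :: 'a
    by (simp add: fun_eq_iff algebra_simps flip: frechet_derivative_at[OF d])
  show ?case unfolding e
    by (intro conjI allI smooth_alg.intros) (use d in \<open>auto simp: differentiable_def\<close>)
next
  case (add f g)
  then have d: "((\<lambda>x. f x + g x) has_derivative (\<lambda>v. frechet_derivative f (at x) v + frechet_derivative g (at x) v)) (at x)" for x
    by (intro has_derivative_add) (auto simp: frechet_derivative_works)
  show ?case using add d unfolding frechet_derivative_at[OF d, symmetric]
    by (auto simp: differentiable_def intro!: smooth_alg.add)
next
  case (mult f g)
  then have d: "((\<lambda>x. f x * g x) has_derivative (\<lambda>v. f x * frechet_derivative g (at x) v + frechet_derivative f (at x) v * g x)) (at x)" for x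
    by (intro has_derivative_mult) (auto simp: frechet_derivative_works)
  show ?case using mult d unfolding frechet_derivative_at[OF d, symmetric]
    by (auto simp: differentiable_def intro!: smooth_alg.add smooth_alg.mult)
qed

lemma smooth_alg_Ck: "f \<in> smooth_alg \<Longrightarrow> Ck n f"
proof (induction n arbitrary: f)
  case 0
  then show ?case using smooth_alg_derivative[OF 0]
    by (auto intro!: continuous_at_imp_continuous_on differentiable_imp_continuous_within)
next
  case (Suc n)
  then show ?case using smooth_alg_derivative[OF Suc.prems] by auto
qed

lemma smooth_alg_prod: "finite I \<Longrightarrow> (\<And>i. i \<in> I \<Longrightarrow> f i \<in> smooth_alg) \<Longrightarrow> (\<lambda>x. \<Prod>i\<in>I. f i x) \<in> smooth_alg"
  by (induction I rule: finite_induct) (auto intro: smooth_alg.const smooth_alg.mult)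

text \<open>For \<open>k > 0\<close> positive exactly on \<open>box a b\<close>. The parameter
  \<open>k\<close> steers the steepness: as it grows, the bumps tend to the indicator of the box.
  The arguments are written in the affine form of \<open>smooth_alg.flat\<close>.\<close>

definition box_bump :: "real \<Rightarrow> real^'d \<Rightarrow> real^'d \<Rightarrow> real^'d \<Rightarrow> real" where
  "box_bump k a b x = (\<Prod>i\<in>UNIV. flat_exp 0 (k * x $ i + - k * a $ i) * flat_exp 0 (- k * x $ i + k * b $ i))"

lemma box_bump_smooth: "box_bump k a b \<in> smooth_alg"
  unfolding box_bump_def[abs_def] by (intro smooth_alg_prod smooth_alg.mult smooth_alg.flat) auto

lemma box_bump_range: "0 \<le> box_bump k a b x" "box_bump k a b x \<le> 1"
proof -
  show "0 \<le> box_bump k a b x" unfolding box_bump_def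
    by (intro prod_nonneg mult_nonneg_nonneg flat_exp_bounds ballI)
  show "box_bump k a b x \<le> 1" unfolding box_bump_def
    by (intro prod_le_1 conjI mult_nonneg_nonneg mult_le_one flat_exp_bounds)
qed

lemma box_bump_pos:
  assumes "k > 0"
  shows "x \<in> box a b \<Longrightarrow> 0 < box_bump k a b x"
    and "x \<notin> box a b \<Longrightarrow> box_bump k a b x = 0"
proof -
  have eq: "k * x $ i + - k * a $ i = k * (x $ i - a $ i)" "- k * x $ i + k * b $ i = k * (b $ i - x $ i)" for i
    by (simp_all add: algebra_simps)
  show "0 < box_bump k a b x" if "x \<in> box a b"
    unfolding box_bump_def eq using that assms
    by (intro prod_pos mult_pos_pos flat_exp_bounds) (auto simp: mem_box_cart)
  show "box_bump k a b x = 0" if x: "x \<notin> box a b"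
  proof -
    obtain i where "x $ i \<le> a $ i \<or> b $ i \<le> x $ i" using x by (auto simp: mem_box_cart not_less)
    then have "flat_exp 0 (k * (x $ i - a $ i)) * flat_exp 0 (k * (b $ i - x $ i)) = 0"
      using assms by (auto simp: flat_exp_def mult_le_0_iff)
    then show ?thesis unfolding box_bump_def eq by (intro prod_zero) auto
  qed
qed

lemma box_bump_tendsto: "(\<lambda>n. box_bump (real (Suc n)) a b x) \<longlonglongrightarrow> indicat_real (box a b) x"
proof (cases "x \<in> box a b")
  case False
  then show ?thesis by (simp add: box_bump_pos(2) del: of_nat_Suc)
next
  case True
  have 1: "(\<lambda>n. flat_exp 0 (real (Suc n) * s)) \<longlonglongrightarrow> 1" if "s > 0" for s
  proof -
    have "(\<lambda>n. exp (- (inverse (real (Suc n)) * (1 / s)))) \<longlonglongrightarrow> exp (- (0 * (1 / s)))"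
      by (intro tendsto_intros LIMSEQ_inverse_real_of_nat)
    moreover have "exp (- (inverse (real (Suc n)) * (1 / s))) = flat_exp 0 (real (Suc n) * s)" for n
    proof -
      have "0 < real (Suc n) * s" using that by simp
      then have "flat_exp 0 (real (Suc n) * s) = exp (- (1 / (real (Suc n) * s)))"
        unfolding flat_exp_def by (simp only: not_le[symmetric] if_False power_0 div_by_1)
      then show ?thesis by (simp only: inverse_eq_divide times_divide_times_eq mult_1)
    qed
    ultimately show ?thesis by simp
  qed
  have eq: "k * x $ i + - k * a $ i = k * (x $ i - a $ i)" "- k * x $ i + k * b $ i = k * (b $ i - x $ i)" for i and k :: real
    by (simp_all add: algebra_simps)
  have "(\<lambda>n. box_bump (real (Suc n)) a b x) \<longlonglongrightarrow> (\<Prod>i\<in>(UNIV::'a set). 1 * 1)"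
    unfolding box_bump_def eq using True by (intro tendsto_prod tendsto_mult 1) (auto simp: mem_box_cart)
  then show ?thesis using True by simp
qed

lemma test_functionI:
  assumes "f \<in> smooth_alg" "cbox a b \<subseteq> S" "\<And>x. x \<notin> box a b \<Longrightarrow> f x = 0"
  shows "f \<in> test_functions S"
proof -
  have "{x. f x \<noteq> 0} \<subseteq> cbox a b" using assms(3) box_subset_cbox by blast
  then have sub: "closure {x. f x \<noteq> 0} \<subseteq> cbox a b" by (intro closure_minimal) auto
  then have "compact (closure {x. f x \<noteq> 0})"
    using compact_cbox compact_eq_bounded_closed bounded_subset by (metis closed_closure)
  then show ?thesis using sub assms smooth_alg_Ck by (auto simp: test_functions_def)
qed

lemma box_bump_test: "k > 0 \<Longrightarrow> cbox a b \<subseteq> S \<Longrightarrow> box_bump k a b \<in> test_functions S"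
  by (rule test_functionI[OF box_bump_smooth]) (use box_bump_pos in auto)

text \<open>Positive and negative part of a Borel representative are densities of two finite
  measures that agree on boxes. Boxes are stable under intersection and generate the Borel sets, so
  the measures and hence the densities coincide.\<close>

lemma AE_zero_if_box_integrals_zero:
  fixes F :: "'a::euclidean_space \<Rightarrow> real"
  assumes F: "integrable lebesgue F" and zero: "\<And>a b. (LINT x|lebesgue. indicat_real (box a b) x * F x) = 0"
  shows "AE x in lebesgue. F x = 0"
proof -
  have "F \<in> borel_measurable lebesgue" using F by auto
  then obtain G where G[measurable]: "G \<in> borel_measurable lborel" and FG: "AE x in lborel. F x = G x"
    using completion_ex_borel_measurable_real[of F lborel] by auto
  have FG': "AE x in lebesgue. F x = G x" using FG by (rule AE_completion)
  have [measurable]: "G \<in> borel_measurable lebesgue" using G by (intro measurable_completion) auto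
  have [measurable]: "F \<in> borel_measurable lebesgue" by fact
  have "integrable lebesgue G" using integrable_cong_AE[of F lebesgue G] F FG' by simp
  then have intG: "integrable lborel G" using integrable_completion[of G lborel] G by simp
  have zeroG: "(LINT x|lborel. indicat_real (box a b) x * G x) = 0" for a b
  proof -
    have "(LINT x|lborel. indicat_real (box a b) x * G x) = (LINT x|lebesgue. indicat_real (box a b) x * G x)"
      by (rule integral_completion[symmetric]) simp
    also have "\<dots> = (LINT x|lebesgue. indicat_real (box a b) x * F x)"
    proof (rule integral_cong_AE)
      show "AE x in lebesgue. indicat_real (box a b) x * G x = indicat_real (box a b) x * F x"
        using FG' by eventually_elim simp
    qed (intro borel_measurable_times borel_measurable_indicator; simp)+
    finally show ?thesis using zero by simp
  qed
  have fin: "(\<integral>\<^sup>+x. ennreal (H x) \<partial>lborel) < \<infinity>" if "integrable lborel H" for H :: "'a \<Rightarrow> real"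
    using that integrableD(2,3)[OF that] by (simp add: less_top)
  \<comment> \<open>A vanishing integral means that positive and negative part have equal integrals;
    both are finite, so equality of the real values is equality in \<open>ennreal\<close>.\<close>
  have eq: "(\<integral>\<^sup>+x. ennreal (indicat_real (box a b) x * G x) \<partial>lborel) = (\<integral>\<^sup>+x. ennreal (- (indicat_real (box a b) x * G x)) \<partial>lborel)" for a b
  proof -
    have i: "integrable lborel (\<lambda>x. indicat_real (box a b) x * G x)"
      using integrable_mult_indicator[OF _ intG, of "box a b"] by simp
    then have "enn2real (\<integral>\<^sup>+x. ennreal (indicat_real (box a b) x * G x) \<partial>lborel) = enn2real (\<integral>\<^sup>+x. ennreal (- (indicat_real (box a b) x * G x)) \<partial>lborel)"
      using zeroG[of a b] by (simp add: real_lebesgue_integral_def)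
    then show ?thesis
      using fin[OF i] fin[OF Bochner_Integration.integrable_minus[OF i]] by (metis ennreal_enn2real infinity_ennreal_def)
  qed
  let ?P = "density lborel (\<lambda>x. ennreal (G x))" and ?N = "density lborel (\<lambda>x. ennreal (- G x))"
  have em: "emeasure ?P (box a b) = emeasure ?N (box a b)" for a b
  proof -
    have "emeasure ?P (box a b) = (\<integral>\<^sup>+x. ennreal (indicat_real (box a b) x * G x) \<partial>lborel)"
      by (subst emeasure_density) (auto intro!: nn_integral_cong simp: indicator_def)
    also note eq
    also have "(\<integral>\<^sup>+x. ennreal (- (indicat_real (box a b) x * G x)) \<partial>lborel) = emeasure ?N (box a b)"
      by (subst emeasure_density) (auto intro!: nn_integral_cong simp: indicator_def)
    finally show ?thesis .
  qed
  have "?P = ?N"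
  proof (rule measure_eqI_generator_eq)
    let ?E = "range (\<lambda>(a, b). box a b :: 'a set)"
    show "Int_stable ?E" by (auto simp: Int_stable_def box_Int_box)
    show "?E \<subseteq> Pow UNIV" by simp
    show "sets ?P = sigma_sets UNIV ?E" "sets ?N = sigma_sets UNIV ?E"
      by (simp_all add: borel_eq_box)
    show "range (\<lambda>n::nat. box (- (real n *\<^sub>R One)) (real n *\<^sub>R One)) \<subseteq> ?E" by auto
    show "(\<Union>n. box (- (real n *\<^sub>R One)) (real n *\<^sub>R One)) = (UNIV :: 'a set)"
      by (rule UN_box_eq_UNIV)
    show "emeasure ?P (box (- (real n *\<^sub>R One)) (real n *\<^sub>R One)) \<noteq> \<infinity>" for n
    proof -
      have "emeasure ?P (box (- (real n *\<^sub>R One)) (real n *\<^sub>R One)) \<le> emeasure ?P UNIV"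
        by (rule emeasure_mono) auto
      also have "\<dots> = (\<integral>\<^sup>+x. ennreal (G x) \<partial>lborel)" by (subst emeasure_density) auto
      also have "\<dots> < \<infinity>" by (rule fin[OF intG])
      finally show ?thesis by simp
    qed
  qed (use em in auto)
  then have "AE x in lborel. ennreal (G x) = ennreal (- G x)"
    using finite_density_unique[of "\<lambda>x. ennreal (G x)" lborel "\<lambda>x. ennreal (- G x)"] fin[OF intG] by auto
  then have "AE x in lborel. G x = 0"
  proof eventually_elim
    case (elim x)
    show ?case
    proof (cases "0 \<le> G x")
      case True
      then have "ennreal (G x) = 0" using elim by (simp add: ennreal_neg)
      then show ?thesis using True by (simp add: ennreal_eq_0_iff)
    next
      case False
      then have "ennreal (- G x) = 0" using elim by (simp add: ennreal_neg)
      then show ?thesis using False by (simp add: ennreal_eq_0_iff)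
    qed
  qed
  with FG have "AE x in lborel. F x = 0" by eventually_elim simp
  then show ?thesis by (rule AE_completion)
qed

section \<open>Lebesgue measure restricted to a set, and the fundamental lemma\<close>

lemma borel_imp_lebesgue_measurable: "f \<in> borel_measurable borel \<Longrightarrow> f \<in> borel_measurable lebesgue"
  by (simp add: measurable_completion)

lemma integral_lebesgue_on:
  fixes f :: "'a::euclidean_space \<Rightarrow> real"
  assumes "S \<in> sets lebesgue"
  shows "(LINT x|lebesgue_on S. f x) = (LINT x|lebesgue. indicat_real S x * f x)"
  using assms by (simp add: integral_restrict_space)

lemma integrable_lebesgue_on:
  fixes f :: "'a::euclidean_space \<Rightarrow> real"
  assumes "S \<in> sets lebesgue"
  shows "integrable (lebesgue_on S) f \<longleftrightarrow> integrable lebesgue (\<lambda>x. indicat_real S x * f x)"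
  using assms by (simp add: integrable_restrict_space)

lemma AE_lebesgue_on:
  fixes S :: "'a::euclidean_space set"
  assumes "S \<in> sets lebesgue"
  shows "(AE x in lebesgue_on S. P x) \<longleftrightarrow> (AE x in lebesgue. x \<in> S \<longrightarrow> P x)"
  using assms by (simp add: AE_restrict_space_iff)

lemma measurable_lebesgue_on:
  fixes f :: "'a::euclidean_space \<Rightarrow> real"
  assumes "S \<in> sets lebesgue"
  shows "f \<in> borel_measurable (lebesgue_on S) \<longleftrightarrow> (\<lambda>x. indicat_real S x * f x) \<in> borel_measurable lebesgue"
  using assms by (simp add: borel_measurable_restrict_space_iff)

lemma integrable_indicator_L2:
  assumes S: "S \<in> sets lebesgue" and g: "g \<in> L2 (lebesgue_on S)" and K: "K \<in> lmeasurable" "K \<subseteq> S"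
  shows "integrable lebesgue (\<lambda>x. indicat_real K x * g x)"
proof (rule Bochner_Integration.integrable_bound)
  have "integrable lebesgue (indicat_real K)" by (rule integrable_real_indicator) (use K(1) in \<open>auto simp: fmeasurable_def simp del: emeasure_completion\<close>)
  then show "integrable lebesgue (\<lambda>x. indicat_real K x + indicat_real S x * (g x)\<^sup>2)"
    using L2_sq_integrable[OF g] S by (intro Bochner_Integration.integrable_add) (auto simp: integrable_lebesgue_on)
  have [measurable]: "(\<lambda>x. indicat_real S x * g x) \<in> borel_measurable lebesgue"
    using L2_measurable[OF g] S by (simp add: measurable_lebesgue_on)
  have [measurable]: "K \<in> sets lebesgue" using K(1) by auto
  have "(\<lambda>x. indicat_real K x * (indicat_real S x * g x)) \<in> borel_measurable lebesgue" by measurable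
  moreover have "indicat_real K x * (indicat_real S x * g x) = indicat_real K x * g x" for x
    using K(2) by (auto simp: indicator_def)
  ultimately show "(\<lambda>x. indicat_real K x * g x) \<in> borel_measurable lebesgue" by simp
  show "AE x in lebesgue. norm (indicat_real K x * g x) \<le> norm (indicat_real K x + indicat_real S x * (g x)\<^sup>2)"
    using K(2) abs_mult_le_sum_squares[of 1 "g _"] by (intro AE_I2) (auto simp: indicator_def)
qed

text \<open>Bump functions tend to indicators of boxes, so the integral of \<open>g\<close> vanishes
  on every \<open>box a b\<close> with \<open>cbox a b \<subseteq> S\<close>. This makes
  \<open>g\<close> vanish on each such closed box, and countably many of them cover
  \<open>S\<close>.\<close>

lemma fundamental_lemma:
  fixes S :: "(real^'d) set"
  assumes S: "open S" and g: "g \<in> L2 (lebesgue_on S)"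
    and zero: "\<And>\<phi>. \<phi> \<in> test_functions S \<Longrightarrow> (LINT x|lebesgue_on S. g x * \<phi> x) = 0"
  shows "AE x in lebesgue_on S. g x = 0"
proof -
  have S': "S \<in> sets lebesgue" using S by simp
  have box0: "(LINT x|lebesgue. indicat_real (box a b) x * g x) = 0" if ab: "cbox a b \<subseteq> S" for a b
  proof -
    have int: "integrable lebesgue (\<lambda>x. indicat_real (box a b) x * g x)"
      using ab box_subset_cbox by (intro integrable_indicator_L2[OF S' g]) auto
    have meas: "(\<lambda>x. box_bump k a b x * (indicat_real (box a b) x * g x)) \<in> borel_measurable lebesgue" for k
      by (rule borel_measurable_times[OF borel_imp_lebesgue_measurable[OF borel_measurable_continuous_onI] borel_measurable_integrable[OF int]])
        (use smooth_alg_Ck[OF box_bump_smooth, of 0 k a b] in simp)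
    have "(\<lambda>n. LINT x|lebesgue. box_bump (real (Suc n)) a b x * (indicat_real (box a b) x * g x))
        \<longlonglongrightarrow> (LINT x|lebesgue. indicat_real (box a b) x * (indicat_real (box a b) x * g x))"
    proof (rule integral_dominated_convergence[where w = "\<lambda>x. \<bar>indicat_real (box a b) x * g x\<bar>"])
      show "AE x in lebesgue. (\<lambda>n. box_bump (real (Suc n)) a b x * (indicat_real (box a b) x * g x))
          \<longlonglongrightarrow> indicat_real (box a b) x * (indicat_real (box a b) x * g x)"
        by (intro AE_I2 tendsto_mult tendsto_const box_bump_tendsto)
      show "AE x in lebesgue. norm (box_bump (real (Suc n)) a b x * (indicat_real (box a b) x * g x))
          \<le> \<bar>indicat_real (box a b) x * g x\<bar>" for n
        using box_bump_range[of "real (Suc n)" a b] by (intro AE_I2) (auto simp: abs_mult intro!: mult_left_le_one_le)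
      show "(\<lambda>x. indicat_real (box a b) x * (indicat_real (box a b) x * g x)) \<in> borel_measurable lebesgue"
        by (rule borel_measurable_times[OF borel_measurable_indicator borel_measurable_integrable[OF int]]) simp
    qed (use int meas in auto)
    moreover have "(LINT x|lebesgue. box_bump (real (Suc n)) a b x * (indicat_real (box a b) x * g x)) = 0" for n
    proof -
      have *: "(\<lambda>x. box_bump (real (Suc n)) a b x * (indicat_real (box a b) x * g x)) = (\<lambda>x. indicat_real S x * (g x * box_bump (real (Suc n)) a b x))"
      proof
        fix x
        show "box_bump (real (Suc n)) a b x * (indicat_real (box a b) x * g x) = indicat_real S x * (g x * box_bump (real (Suc n)) a b x)"
          using ab box_subset_cbox[of a b] by (cases "x \<in> box a b") (auto simp: box_bump_pos(2) simp del: of_nat_Suc)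
      qed
      show ?thesis
        unfolding * integral_lebesgue_on[OF S', symmetric] by (rule zero[OF box_bump_test[OF _ ab]]) simp
    qed
    moreover have "indicat_real (box a b) x * (indicat_real (box a b) x * g x) = indicat_real (box a b) x * g x" for x
      by (simp add: indicator_def)
    ultimately show ?thesis by (simp add: LIMSEQ_const_iff)
  qed
  have cb: "AE x in lebesgue. x \<in> cbox c d \<longrightarrow> g x = 0" if cd: "cbox c d \<subseteq> S" for c d
  proof -
    have "AE x in lebesgue. indicat_real (box c d) x * g x = 0"
    proof (rule AE_zero_if_box_integrals_zero)
      show "integrable lebesgue (\<lambda>x. indicat_real (box c d) x * g x)"
        using cd box_subset_cbox by (intro integrable_indicator_L2[OF S' g]) auto
      fix a b
      \<comment> \<open>A box meets \<open>box c d\<close> in a box again, whose closed version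
        stays inside \<open>S\<close>.\<close>
      let ?a = "\<chi> i. max (a $ i) (c $ i)" and ?b = "\<chi> i. min (b $ i) (d $ i)"
      have eq: "indicat_real (box a b) x * (indicat_real (box c d) x * g x) = indicat_real (box ?a ?b) x * g x" for x
        by (auto simp: indicator_def mem_box_cart)
      have "cbox ?a ?b \<subseteq> S" using cd by (auto simp: mem_box_cart subset_iff)
      then show "(LINT x|lebesgue. indicat_real (box a b) x * (indicat_real (box c d) x * g x)) = 0"
        unfolding eq by (rule box0)
    qed
    moreover have "AE x in lebesgue. x \<notin> cbox c d - box c d"
      using negligible_frontier_interval[of c d] by (intro AE_not_in) (simp add: negligible_iff_null_sets)
    ultimately show ?thesis by eventually_elim (auto simp: indicator_def split: if_splits)
  qed
  obtain \<D> where D: "countable \<D>" "\<D> \<subseteq> Pow S" "\<And>X. X \<in> \<D> \<Longrightarrow> \<exists>a b. X = cbox a b" "\<Union>\<D> = S"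
    using open_countable_Union_open_cbox[OF S] by metis
  have "AE x in lebesgue. \<forall>X\<in>\<D>. x \<in> X \<longrightarrow> g x = 0"
  proof (subst AE_ball_countable[OF D(1)], intro ballI)
    fix X assume X: "X \<in> \<D>"
    then obtain a b where "X = cbox a b" using D(3) by blast
    then show "AE x in lebesgue. x \<in> X \<longrightarrow> g x = 0" using cb X D(2) by blast
  qed
  then show ?thesis unfolding AE_lebesgue_on[OF S'] by eventually_elim (use D(4) in blast)
qed

text \<open>Difference quotients in the coordinate direction integrate to zero by translation
  invariance, and they converge to the partial derivative under a common integrable bound.\<close>

lemma integral_partial_derivative_zero:
  fixes f :: "real^'d \<Rightarrow> real"
  assumes diff: "\<And>x. f differentiable (at x)"
    and cont: "continuous_on UNIV (\<lambda>x. frechet_derivative f (at x) (axis i 1))"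
    and supp: "\<And>x. norm x > R \<Longrightarrow> f x = 0"
  shows "(LINT x|lebesgue. frechet_derivative f (at x) (axis i 1)) = 0"
proof -
  define D where "D x = frechet_derivative f (at x) (axis i 1)" for x
  let ?e = "axis i 1 :: real^'d"
  have line: "((\<lambda>s. f (x + s *\<^sub>R ?e)) has_real_derivative D (x + s *\<^sub>R ?e)) (at s)" for x s
  proof -
    have 1: "((\<lambda>s. x + s *\<^sub>R ?e) has_derivative (\<lambda>h. h *\<^sub>R ?e)) (at s)"
      by (auto intro!: derivative_eq_intros)
    have 2: "(f has_derivative frechet_derivative f (at (x + s *\<^sub>R ?e))) (at (x + s *\<^sub>R ?e))"
      using diff by (simp add: frechet_derivative_works)
    have lin: "linear (frechet_derivative f (at y))" for y
      using diff linear_frechet_derivative by blast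
    show ?thesis
      unfolding has_field_derivative_def D_def
      by (rule has_derivative_eq_rhs[OF has_derivative_compose[OF 1 2]]) (simp add: fun_eq_iff linear_cmul[OF lin])
  qed
  have fcont: "continuous_on UNIV f"
    using diff by (intro continuous_at_imp_continuous_on) (auto intro: differentiable_imp_continuous_within)
  have D0: "D x = 0" if x: "norm x > R" for x
  proof -
    have "open {y. norm y > R}" by (intro open_Collect_less continuous_intros)
    then have "((\<lambda>_. 0) has_derivative (\<lambda>_. 0)) (at x) \<longleftrightarrow> (f has_derivative (\<lambda>_. 0)) (at x)"
      using x supp has_derivative_transform_within_open[of "\<lambda>_. 0" "\<lambda>_. 0" x UNIV "{y. norm y > R}" f] by auto
    then have "(f has_derivative (\<lambda>_. 0)) (at x)" by simp
    then show ?thesis unfolding D_def by (simp flip: frechet_derivative_at)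
  qed
  obtain B where B: "\<And>x. \<bar>D x\<bar> \<le> B" "B \<ge> 0"
  proof -
    have "bounded (D ` cball 0 R)"
      using cont by (intro compact_imp_bounded compact_continuous_image)
        (auto simp: D_def[abs_def] intro: continuous_on_subset)
    then obtain b where "b > 0" "\<And>x. norm x \<le> R \<Longrightarrow> \<bar>D x\<bar> \<le> b"
      by (auto simp: bounded_pos)
    then show ?thesis using D0 by (intro that[of b]) (metis abs_zero less_imp_le not_le, simp)
  qed
  have lip: "\<bar>f (x + t *\<^sub>R ?e) - f x\<bar> \<le> B * t" if "t > 0" for x t
  proof -
    have "\<exists>z>0. z < t \<and> f (x + t *\<^sub>R ?e) - f (x + 0 *\<^sub>R ?e) = (t - 0) * D (x + z *\<^sub>R ?e)"
      using that line by (intro MVT2) auto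
    then obtain z where "f (x + t *\<^sub>R ?e) - f x = t * D (x + z *\<^sub>R ?e)" by auto
    then show ?thesis using B(1)[of "x + z *\<^sub>R ?e"] that by (simp add: abs_mult mult.commute)
  qed
  define t where "t n = inverse (real (Suc n))" for n
  have t: "0 < t n" "t n \<le> 1" "t \<longlonglongrightarrow> 0" for n
    unfolding t_def[abs_def] using LIMSEQ_inverse_real_of_nat by (auto simp: field_simps)
  define q where "q n x = (f (x + t n *\<^sub>R ?e) - f x) / t n" for n x
  have fm: "f \<in> borel_measurable borel" using fcont by (rule borel_measurable_continuous_onI)
  have "bounded (f ` cball 0 R)"
    using fcont by (intro compact_imp_bounded compact_continuous_image) (auto intro: continuous_on_subset)
  then obtain Bf where Bf: "Bf > 0" "\<And>x. norm x \<le> R \<Longrightarrow> \<bar>f x\<bar> \<le> Bf"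
    by (auto simp: bounded_pos)
  have icb: "integrable lborel (\<lambda>x. b * indicat_real (cball 0 r) x)" for b r and z :: "real^'d"
    using emeasure_lborel_cball_finite[of 0 r] by (intro integrable_mult_right) (simp add: integrable_indicator_iff)
  have fint: "integrable lborel f"
  proof (rule Bochner_Integration.integrable_bound[OF icb[of Bf R]])
    show "AE x in lborel. norm (f x) \<le> norm (Bf * indicat_real (cball 0 R) x)"
      using Bf supp by (intro AE_I2) (auto simp: indicator_def not_le)
  qed (use fm in simp)
  have shift: "integrable lborel (\<lambda>x. f (x + c))" "(LINT x|lborel. f (x + c)) = (LINT x|lborel. f x)" for c
  proof -
    have "integrable (distr lborel borel ((+) c)) f" using fint by (simp add: lborel_distr_plus)
    then show "integrable lborel (\<lambda>x. f (x + c))"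
      using fm by (subst (asm) integrable_distr_eq) (auto simp: add.commute)
    have "(LINT x|lborel. f x) = (LINT x|distr lborel borel ((+) c). f x)" by (simp add: lborel_distr_plus)
    also have "\<dots> = (LINT x|lborel. f (x + c))"
      using fm by (subst integral_distr) (auto simp: add.commute)
    finally show "(LINT x|lborel. f (x + c)) = (LINT x|lborel. f x)" ..
  qed
  have "(\<lambda>n. LINT x|lborel. q n x) \<longlonglongrightarrow> (LINT x|lborel. D x)"
  proof (rule integral_dominated_convergence[where w = "\<lambda>x. B * indicat_real (cball 0 (R + 1)) x"])
    show "D \<in> borel_measurable lborel" using cont by (simp add: D_def[abs_def] borel_measurable_continuous_onI)
    show "q n \<in> borel_measurable lborel" for n
      unfolding q_def[abs_def] using fm by measurable
    show "AE x in lborel. (\<lambda>n. q n x) \<longlonglongrightarrow> D x"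
    proof (rule AE_I2)
      fix x
      have "((\<lambda>h. (f (x + h *\<^sub>R ?e) - f x) / h) \<longlongrightarrow> D x) (at 0)"
        using line[of x 0] by (simp add: DERIV_def)
      then show "(\<lambda>n. q n x) \<longlonglongrightarrow> D x"
        unfolding q_def using t by (rule_tac filterlim_compose[of "\<lambda>h. (f (x + h *\<^sub>R ?e) - f x) / h" _ "at 0"])
          (auto simp: filterlim_at less_imp_neq[symmetric])
    qed
    \<comment> \<open>By the mean value theorem the quotients are bounded by \<open>B\<close>;
      shifts by at most 1 enlarge the support to the ball of radius \<open>R + 1\<close>.\<close>
    show "AE x in lborel. norm (q n x) \<le> B * indicat_real (cball 0 (R + 1)) x" for n
    proof (rule AE_I2)
      fix x
      show "norm (q n x) \<le> B * indicat_real (cball 0 (R + 1)) x"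
      proof (cases "norm x \<le> R + 1")
        case True
        then show ?thesis using lip[OF t(1)[of n], of x] t(1)[of n] by (simp add: q_def indicator_def field_simps)
      next
        case False
        have "norm x \<le> norm (x + t n *\<^sub>R ?e) + norm (t n *\<^sub>R ?e)"
          using norm_triangle_sub[of x "x + t n *\<^sub>R ?e"] by simp
        moreover have "norm (t n *\<^sub>R ?e) \<le> 1" using t(1,2)[of n] by (simp add: norm_axis_1)
        ultimately have "norm (x + t n *\<^sub>R ?e) > R" "norm x > R" using False by auto
        then show ?thesis using supp B(2) by (simp add: q_def)
      qed
    qed
  qed (rule icb)
  moreover have "(LINT x|lborel. q n x) = 0" for n
    unfolding q_def using fint shift[of "t n *\<^sub>R ?e"] by simp
  ultimately have "(LINT x|lborel. D x) = 0" by (simp add: LIMSEQ_const_iff)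
  moreover have "D \<in> borel_measurable lborel" using cont by (simp add: D_def[abs_def] borel_measurable_continuous_onI)
  ultimately show ?thesis unfolding D_def[abs_def] by (simp add: integral_completion)
qed

definition partial :: "'d \<Rightarrow> (real^'d \<Rightarrow> real) \<Rightarrow> real^'d \<Rightarrow> real" where
  "partial i f x = frechet_derivative f (at x) (axis i 1)"

lemma grad_nth: "grad f x $ i = partial i f x"
  by (simp add: grad_def partial_def)

lemma test_functions_differentiable: "\<phi> \<in> test_functions S \<Longrightarrow> \<phi> differentiable (at x)"
  unfolding test_functions_def using Ck.simps(2)[of 0 \<phi>] by blast

lemma test_functions_continuous: "\<phi> \<in> test_functions S \<Longrightarrow> continuous_on UNIV \<phi>"
  unfolding test_functions_def using Ck.simps(1)[of \<phi>] by blast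

lemma test_functions_zero_outside: "\<phi> \<in> test_functions S \<Longrightarrow> x \<notin> S \<Longrightarrow> \<phi> x = 0"
  unfolding test_functions_def using closure_subset[of "{x. \<phi> x \<noteq> 0}"] by blast

lemma test_functions_bounded_support:
  assumes "\<phi> \<in> test_functions S"
  obtains R where "\<And>x. norm x > R \<Longrightarrow> \<phi> x = 0"
proof -
  have "bounded (closure {x. \<phi> x \<noteq> 0})"
    using assms by (simp add: compact_imp_bounded test_functions_def)
  then obtain b where b: "\<forall>x\<in>closure {x. \<phi> x \<noteq> 0}. norm x \<le> b" by (auto simp: bounded_iff)
  have "\<phi> x = 0" if "norm x > b" for x
  proof (rule ccontr)
    assume "\<phi> x \<noteq> 0"
    then have "x \<in> closure {x. \<phi> x \<noteq> 0}" by (intro subsetD[OF closure_subset]) simp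
    then show False using b that by fastforce
  qed
  then show ?thesis by (rule that)
qed

lemma compact_closure_subset: "compact C \<Longrightarrow> closure A \<subseteq> C \<Longrightarrow> compact (closure A)"
  for A :: "'a::t2_space set"
  using compact_Int_closed[of C "closure A"] by (simp add: Int_absorb1)

lemma test_functions_partial:
  assumes "\<phi> \<in> test_functions S"
  shows "partial i \<phi> \<in> test_functions S"
proof -
  let ?C = "closure {x. \<phi> x \<noteq> 0}"
  have Ck: "Ck n \<phi>" for n using assms by (simp add: test_functions_def)
  have pz: "partial i \<phi> x = 0" if x: "x \<notin> ?C" for x
  proof -
    have z: "0 = \<phi> y" if "y \<in> - ?C" for y
      using that subsetD[OF closure_subset, of y "{x. \<phi> x \<noteq> 0}"] by auto
    have "(\<phi> has_derivative (\<lambda>_. 0)) (at x)"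
      by (rule has_derivative_transform_within_open[OF has_derivative_const[of 0] open_Compl[OF closed_closure, of "{x. \<phi> x \<noteq> 0}"] _ z])
        (use x in simp)
    then show ?thesis unfolding partial_def by (subst frechet_derivative_at[symmetric]) auto
  qed
  have sub: "closure {x. partial i \<phi> x \<noteq> 0} \<subseteq> ?C"
    by (rule closure_minimal[OF _ closed_closure]) (use pz in blast)
  moreover have "compact ?C" using assms by (simp add: test_functions_def)
  ultimately have "compact (closure {x. partial i \<phi> x \<noteq> 0})"
    using compact_closure_subset by blast
  moreover have "Ck n (partial i \<phi>)" for n using Ck[of "Suc n"] by (simp add: partial_def[abs_def])
  ultimately show ?thesis using sub assms by (auto simp: test_functions_def)
qed

lemma test_functions_combination:
  assumes "\<phi> \<in> test_functions S" "f \<in> smooth_alg" "\<phi> \<in> smooth_alg"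
  shows "(\<lambda>x. \<phi> x * f x) \<in> test_functions S"
proof -
  have "{x. \<phi> x * f x \<noteq> 0} \<subseteq> {x. \<phi> x \<noteq> 0}" by auto
  then have sub: "closure {x. \<phi> x * f x \<noteq> 0} \<subseteq> closure {x. \<phi> x \<noteq> 0}" by (rule closure_mono)
  then have "compact (closure {x. \<phi> x * f x \<noteq> 0})"
    using assms(1) compact_closure_subset[OF _ sub] by (simp add: test_functions_def)
  then show ?thesis using sub assms smooth_alg_Ck[OF smooth_alg.mult[OF assms(3,2)]] by (auto simp: test_functions_def)
qed

lemma test_functions_L2:
  assumes "\<phi> \<in> test_functions S" "S \<in> sets lebesgue"
  shows "\<phi> \<in> L2 (lebesgue_on S)"
proof -
  obtain R where R: "\<And>x. norm x > R \<Longrightarrow> \<phi> x = 0" using test_functions_bounded_support[OF assms(1)] by blast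
  have cont: "continuous_on UNIV \<phi>" by (rule test_functions_continuous[OF assms(1)])
  then have m: "\<phi> \<in> borel_measurable lebesgue" by (intro borel_imp_lebesgue_measurable borel_measurable_continuous_onI)
  have "bounded (\<phi> ` cball 0 R)"
    using cont by (intro compact_imp_bounded compact_continuous_image) (auto intro: continuous_on_subset)
  then obtain B where B: "B > 0" "\<And>x. norm x \<le> R \<Longrightarrow> \<bar>\<phi> x\<bar> \<le> B" by (auto simp: bounded_pos)
  have "integrable lebesgue (\<lambda>x. (\<phi> x)\<^sup>2)"
  proof (rule Bochner_Integration.integrable_bound)
    show "integrable lebesgue (\<lambda>x. B\<^sup>2 * indicat_real (cball 0 R) x)"
      using emeasure_lborel_cball_finite[of 0 R] by (intro integrable_mult_right) (simp add: integrable_indicator_iff)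
    show "AE x in lebesgue. norm ((\<phi> x)\<^sup>2) \<le> norm (B\<^sup>2 * indicat_real (cball 0 R) x)"
      using B R by (intro AE_I2) (auto simp: indicator_def not_le abs_le_square_iff[symmetric])
  qed (use m in simp)
  then have "integrable lebesgue (\<lambda>x. indicat_real S x * (\<phi> x)\<^sup>2)"
    using integrable_mult_indicator[OF assms(2), of "\<lambda>x. (\<phi> x)\<^sup>2"] by simp
  then show ?thesis using m assms(2)
    by (intro L2I) (auto simp: integrable_lebesgue_on measurable_restrict_space1)
qed

lemma partial_mult:
  assumes "f differentiable (at x)" "g differentiable (at x)"
  shows "partial i (\<lambda>x. f x * g x) x = f x * partial i g x + partial i f x * g x"
proof -
  have "((\<lambda>x. f x * g x) has_derivative (\<lambda>v. f x * frechet_derivative g (at x) v + frechet_derivative f (at x) v * g x)) (at x)"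
    using assms by (intro has_derivative_mult) (auto simp: frechet_derivative_works)
  then show ?thesis by (simp add: partial_def flip: frechet_derivative_at)
qed

lemma integration_by_parts:
  fixes S :: "(real^'d) set"
  assumes u: "u \<in> test_functions S" and v: "v \<in> test_functions S" and S: "S \<in> sets lebesgue"
  shows "L2_inner (lebesgue_on S) u (partial i v) = - L2_inner (lebesgue_on S) (partial i u) v"
proof -
  have d: "u differentiable (at x)" "v differentiable (at x)" for x
    using u v test_functions_differentiable by auto
  have eq: "partial i (\<lambda>x. u x * v x) x = u x * partial i v x + partial i u x * v x" for x
    by (rule partial_mult[OF d])
  obtain R where R: "\<And>x. norm x > R \<Longrightarrow> u x = 0" using test_functions_bounded_support[OF u] by blast
  have "(LINT x|lebesgue. partial i (\<lambda>x. u x * v x) x) = 0"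
    unfolding partial_def
  proof (rule integral_partial_derivative_zero[where R = R])
    show "(\<lambda>x. u x * v x) differentiable (at x)" for x using d by (auto intro: differentiable_mult)
    have "continuous_on UNIV (\<lambda>x. u x * partial i v x + partial i u x * v x)"
      using u v by (intro continuous_intros test_functions_continuous[of _ S] test_functions_partial)
    then show "continuous_on UNIV (\<lambda>x. frechet_derivative (\<lambda>x. u x * v x) (at x) (axis i 1))"
      unfolding eq[symmetric] by (simp add: partial_def)
  qed (use R in auto)
  \<comment> \<open>Outside \<open>S\<close> both factors vanish, so the integral over the whole
    space is the one over \<open>S\<close>.\<close>
  moreover have ind: "(\<lambda>x. indicat_real S x * partial i (\<lambda>x. u x * v x) x) = partial i (\<lambda>x. u x * v x)"
    using test_functions_zero_outside[OF u] test_functions_zero_outside[OF v]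
    by (auto simp: eq indicator_def fun_eq_iff)
  ultimately have "(LINT x|lebesgue_on S. partial i (\<lambda>x. u x * v x) x) = 0"
    using integral_lebesgue_on[OF S, of "partial i (\<lambda>x. u x * v x)"] unfolding ind by simp
  then have "(LINT x|lebesgue_on S. u x * partial i v x + partial i u x * v x) = 0"
    unfolding eq .
  moreover have "u \<in> L2 (lebesgue_on S)" "v \<in> L2 (lebesgue_on S)" "partial i u \<in> L2 (lebesgue_on S)" "partial i v \<in> L2 (lebesgue_on S)"
    by (intro test_functions_L2[OF _ S] test_functions_partial u v)+
  ultimately show ?thesis by (simp add: L2_inner_def L2_mult_integrable)
qed

section \<open>Sobolev spaces\<close>

lemma L2_inner_tendsto:
  assumes f: "\<And>n. f n \<in> L2 M" "w \<in> L2 M" and h: "h \<in> L2 M"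
    and lim: "(\<lambda>n. L2_inner M (\<lambda>x. f n x - w x) (\<lambda>x. f n x - w x)) \<longlonglongrightarrow> 0"
  shows "(\<lambda>n::nat. L2_inner M (f n) h) \<longlonglongrightarrow> L2_inner M w h"
proof -
  have "(\<lambda>n. L2_inner M (\<lambda>x. f n x - w x) (\<lambda>x. f n x - w x) * L2_inner M h h) \<longlonglongrightarrow> 0 * L2_inner M h h"
    by (intro tendsto_mult lim tendsto_const)
  moreover have "(L2_inner M (\<lambda>x. f n x - w x) h)\<^sup>2 \<le> L2_inner M (\<lambda>x. f n x - w x) (\<lambda>x. f n x - w x) * L2_inner M h h" for n
    by (intro L2_cauchy_schwarz L2_diff f h)
  ultimately have "(\<lambda>n. (L2_inner M (\<lambda>x. f n x - w x) h)\<^sup>2) \<longlonglongrightarrow> 0"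
    by (intro tendsto_sandwich[of "\<lambda>_. 0" "\<lambda>n. (L2_inner M (\<lambda>x. f n x - w x) h)\<^sup>2" sequentially
        "\<lambda>n. L2_inner M (\<lambda>x. f n x - w x) (\<lambda>x. f n x - w x) * L2_inner M h h"]) auto
  then have "(\<lambda>n. L2_inner M (\<lambda>x. f n x - w x) h) \<longlonglongrightarrow> 0"
    by (simp add: tendsto_null_power)
  then have "(\<lambda>n. L2_inner M (f n) h - L2_inner M w h) \<longlonglongrightarrow> 0"
    by (simp add: L2_inner_diff_left[OF f h])
  then show ?thesis by (rule LIM_zero_cancel)
qed

lemma (in semi_inner) nrm_dif_triangle:
  assumes "u \<in> V" "v \<in> V" "w \<in> V"
  shows "nrm (dif u w) \<le> nrm (dif u v) + nrm (dif v w)"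
proof -
  \<comment> \<open>\<open>dif u w\<close> and the sum of the other two differences need not be the
    same element; the axioms only yield that their \<open>ip\<close> squares agree.\<close>
  have "(nrm (dif u w))\<^sup>2 = (nrm (add (dif u v) (dif v w)))\<^sup>2"
    using assms by (simp add: nrm_sq ip_simps)
  then have "nrm (dif u w) = nrm (add (dif u v) (dif v w))"
    using assms by (simp add: power2_eq_iff_nonneg)
  then show ?thesis using nrm_add[of "dif u v" "dif v w"] assms by simp
qed

text \<open>Applied to the test functions inside \<open>H1 S\<close>, whose closure is
  \<open>H1_0 S\<close> when \<open>S\<close> is not the whole space.\<close>

lemma (in semi_hilbert) closure_semi_hilbert:
  assumes W: "W \<subseteq> V" "W \<noteq> {}" "\<And>u v. u \<in> W \<Longrightarrow> v \<in> W \<Longrightarrow> add u v \<in> W" "\<And>u c. u \<in> W \<Longrightarrow> scl c u \<in> W"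
  shows "semi_hilbert {u \<in> V. \<forall>e>0. \<exists>v\<in>W. ip (dif u v) (dif u v) < e} add scl ip"
proof -
  let ?C = "{u \<in> V. \<forall>e>0. \<exists>v\<in>W. ip (dif u v) (dif u v) < e}"
  have small: "\<exists>v\<in>W. nrm (dif u v) < e" if u: "u \<in> ?C" and "e > 0" for u e
  proof -
    from \<open>e > 0\<close> have "e\<^sup>2 > 0" by simp
    with u obtain v where v: "v \<in> W" "ip (dif u v) (dif u v) < e\<^sup>2" by blast
    then show ?thesis using \<open>e > 0\<close> real_sqrt_less_mono[OF v(2)] by (auto simp: nrm_def)
  qed
  have small': "u \<in> ?C" if u: "u \<in> V" and ex: "\<And>e. e > 0 \<Longrightarrow> \<exists>v\<in>W. nrm (dif u v) < e" for u
  proof -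
    have "\<exists>v\<in>W. ip (dif u v) (dif u v) < e" if "e > 0" for e
    proof -
      obtain v where v: "v \<in> W" "nrm (dif u v) < sqrt e" using ex[of "sqrt e"] \<open>e > 0\<close> by auto
      then have "(nrm (dif u v))\<^sup>2 < (sqrt e)\<^sup>2" using u W(1) by (intro power_strict_mono) auto
      then show ?thesis using v u W(1) \<open>e > 0\<close> by (auto simp: nrm_sq subset_iff intro!: bexI[of _ v])
    qed
    then show ?thesis using u by simp
  qed
  have WC: "W \<subseteq> ?C"
  proof
    fix w assume "w \<in> W"
    then show "w \<in> ?C" using W(1) by (auto simp: ip_simps subset_iff intro!: bexI[of _ w])
  qed
  have addC: "add u v \<in> ?C" if u: "u \<in> ?C" and v: "v \<in> ?C" for u v
  proof (rule small')
    fix e :: real assume "e > 0"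
    then obtain u' v' where w: "u' \<in> W" "v' \<in> W" "nrm (dif u u') < e / 2" "nrm (dif v v') < e / 2"
      using small[OF u, of "e/2"] small[OF v, of "e/2"] by auto
    have mem: "u \<in> V" "v \<in> V" "u' \<in> V" "v' \<in> V" using u v w W(1) by auto
    have "(nrm (dif (add u v) (add u' v')))\<^sup>2 = (nrm (add (dif u u') (dif v v')))\<^sup>2"
      using mem by (simp add: nrm_sq ip_simps)
    then have "nrm (dif (add u v) (add u' v')) = nrm (add (dif u u') (dif v v'))"
      using mem by (simp add: power2_eq_iff_nonneg)
    then have "nrm (dif (add u v) (add u' v')) < e"
      using nrm_add[of "dif u u'" "dif v v'"] mem w by simp
    then show "\<exists>w\<in>W. nrm (dif (add u v) w) < e" using W(3) w by blast
  qed (use u v in auto)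
  have sclC: "scl c u \<in> ?C" if u: "u \<in> ?C" for u c
  proof (rule small')
    fix e :: real assume "e > 0"
    then obtain u' where w: "u' \<in> W" "nrm (dif u u') < e / (\<bar>c\<bar> + 1)"
      using small[OF u, of "e / (\<bar>c\<bar> + 1)"] by auto
    have mem: "u \<in> V" "u' \<in> V" using u w W(1) by auto
    have "(nrm (dif (scl c u) (scl c u')))\<^sup>2 = (nrm (scl c (dif u u')))\<^sup>2"
      using mem by (simp add: nrm_sq ip_simps right_diff_distrib)
    then have "nrm (dif (scl c u) (scl c u')) = nrm (scl c (dif u u'))"
      using mem by (simp add: power2_eq_iff_nonneg)
    also have "\<dots> \<le> (\<bar>c\<bar> + 1) * nrm (dif u u')" using mem by (simp add: nrm_scl mult_right_mono)
    also have "\<dots> < e" using w(2) by (simp add: field_simps)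
    finally show "\<exists>w\<in>W. nrm (dif (scl c u) w) < e" using W(4) w by blast
  qed (use u in auto)
  interpret C: semi_inner ?C add scl ip
  proof
    show "?C \<noteq> {}" using WC W(2) by blast
    fix u v w c assume u: "u \<in> ?C"
    show "scl c u \<in> ?C" by (rule sclC[OF u])
    show "0 \<le> ip u u" using u ip_nonneg by blast
    assume w: "w \<in> ?C"
    show "ip (scl c u) w = c * ip u w" using u w ip_scl_left by blast
    show "ip u w = ip w u" using u w ip_commute by blast
    show "add u w \<in> ?C" by (rule addC[OF u w])
    assume v: "v \<in> ?C"
    show "ip (add u v) w = ip u w + ip v w" using u v w ip_add_left by blast
  qed
  show ?thesis
  proof
    fix f :: "nat \<Rightarrow> 'v"
    assume f: "\<And>n. f n \<in> ?C"
      and cau: "\<And>e. e > 0 \<Longrightarrow> \<exists>N. \<forall>m\<ge>N. \<forall>n\<ge>N. ip (C.dif (f m) (f n)) (C.dif (f m) (f n)) < e"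
    have fV: "f n \<in> V" for n using f by auto
    obtain w where w: "w \<in> V" "(\<lambda>n. ip (dif (f n) w) (dif (f n) w)) \<longlonglongrightarrow> 0"
      using complete[of f, OF fV cau] by blast
    have lim: "(\<lambda>n. nrm (dif (f n) w)) \<longlonglongrightarrow> 0"
      using tendsto_real_sqrt[OF w(2)] by (simp add: nrm_def)
    have "w \<in> ?C"
    proof (rule small'[OF w(1)])
      fix e :: real assume "e > 0"
      then have "\<forall>\<^sub>F n in sequentially. nrm (dif (f n) w) < e / 2"
        using order_tendstoD(2)[OF lim, of "e / 2"] by simp
      then obtain n where n: "nrm (dif (f n) w) < e / 2" by (auto simp: eventually_sequentially)
      obtain v where v: "v \<in> W" "nrm (dif (f n) v) < e / 2" using small[OF f, of "e / 2" n] \<open>e > 0\<close> by auto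
      have mem: "v \<in> V" using v W(1) by auto
      have "nrm (dif w (f n)) = nrm (dif (f n) w)"
        using w(1) fV[of n] by (simp add: nrm_def ip_simps ip_commute[of w "f n"])
      then have "nrm (dif w v) < e" using nrm_dif_triangle[OF w(1) fV[of n] mem] n v(2) by simp
      then show "\<exists>v\<in>W. nrm (dif w v) < e" using v by blast
    qed
    then show "\<exists>w\<in>?C. (\<lambda>n. ip (C.dif (f n) w) (C.dif (f n) w)) \<longlonglongrightarrow> 0"
      using w(2) by (rule bexI[rotated])
  qed
qed

section \<open>Linear operations on test functions\<close>

lemma frechet_add:
  assumes "f differentiable (at x)" "g differentiable (at x)"
  shows "frechet_derivative (\<lambda>x. f x + g x) (at x) v = frechet_derivative f (at x) v + frechet_derivative g (at x) v"
proof -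
  have "((\<lambda>x. f x + g x) has_derivative (\<lambda>v. frechet_derivative f (at x) v + frechet_derivative g (at x) v)) (at x)"
    using assms by (intro has_derivative_add) (auto simp: frechet_derivative_works)
  then show ?thesis by (simp flip: frechet_derivative_at)
qed

lemma frechet_cmult:
  fixes f :: "'a::real_normed_vector \<Rightarrow> real"
  assumes "f differentiable (at x)"
  shows "frechet_derivative (\<lambda>x. c * f x) (at x) v = c * frechet_derivative f (at x) v"
proof -
  have "((\<lambda>x. c * f x) has_derivative (\<lambda>v. c * frechet_derivative f (at x) v)) (at x)"
    using assms by (intro has_derivative_mult_right) (auto simp: frechet_derivative_works)
  then show ?thesis by (simp flip: frechet_derivative_at)
qed

lemma Ck_add: "Ck n f \<Longrightarrow> Ck n g \<Longrightarrow> Ck n (\<lambda>x. f x + g x)"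
  by (induction n arbitrary: f g) (auto intro: continuous_on_add differentiable_add simp: frechet_add)

lemma Ck_cmult: "Ck n f \<Longrightarrow> Ck n (\<lambda>x. c * f x)"
  by (induction n arbitrary: f) (auto intro: continuous_on_mult_left differentiable_mult[OF differentiable_const] simp: frechet_cmult)

lemma test_functions_add:
  assumes "f \<in> test_functions S" "g \<in> test_functions S"
  shows "(\<lambda>x. f x + g x) \<in> test_functions S"
proof -
  let ?C = "closure {x. f x \<noteq> 0} \<union> closure {x. g x \<noteq> 0}"
  have "{x. f x + g x \<noteq> 0} \<subseteq> {x. f x \<noteq> 0} \<union> {x. g x \<noteq> 0}" by auto
  then have sub: "closure {x. f x + g x \<noteq> 0} \<subseteq> ?C" by (simp only: closure_Un[symmetric] closure_mono)
  have C: "compact ?C" "?C \<subseteq> S" "\<And>n. Ck n f" "\<And>n. Ck n g" using assms by (auto simp: test_functions_def)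
  show ?thesis unfolding test_functions_def
    using compact_closure_subset[OF C(1) sub] order_trans[OF sub C(2)] Ck_add[OF C(3,4)] by blast
qed

lemma test_functions_cmult:
  assumes "f \<in> test_functions S"
  shows "(\<lambda>x. c * f x) \<in> test_functions S"
proof -
  let ?C = "closure {x. f x \<noteq> 0}"
  have sub: "closure {x. c * f x \<noteq> 0} \<subseteq> ?C" by (intro closure_mono) auto
  have C: "compact ?C" "?C \<subseteq> S" "\<And>n. Ck n f" using assms by (simp_all add: test_functions_def)
  show ?thesis unfolding test_functions_def
    using compact_closure_subset[OF C(1) sub] order_trans[OF sub C(2)] Ck_cmult[OF C(3)] by blast
qed

lemma zero_test_function: "(\<lambda>x. 0) \<in> test_functions S"
  using smooth_alg_Ck[OF smooth_alg.const[of 0]] by (auto simp: test_functions_def)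

lemma grad_sin: "partial i (\<lambda>x. sin (c * x $ i)) x = c * cos (c * x $ i)"
  and grad_cos: "partial i (\<lambda>x. cos (c * x $ i)) x = - c * sin (c * x $ i)"
proof -
  have "((\<lambda>x. sin (c * x $ i)) has_derivative (\<lambda>v. cos (c * x $ i) * c * v $ i)) (at x)"
    "((\<lambda>x. cos (c * x $ i)) has_derivative (\<lambda>v. - sin (c * x $ i) * c * v $ i)) (at x)"
    using has_derivative_coord_comp[of sin "cos (c * x $ i)" c x i 0] DERIV_sin
      has_derivative_coord_comp[of cos "- sin (c * x $ i)" c x i 0] DERIV_cos by simp_all
  then show "partial i (\<lambda>x. sin (c * x $ i)) x = c * cos (c * x $ i)"
    "partial i (\<lambda>x. cos (c * x $ i)) x = - c * sin (c * x $ i)"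
    by (simp_all add: partial_def flip: frechet_derivative_at)
qed

definition wpartial :: "(real^'d) set \<Rightarrow> 'd \<Rightarrow> (real^'d \<Rightarrow> real) \<Rightarrow> real^'d \<Rightarrow> real" where
  "wpartial S i u x = wgrad S u x $ i"

definition H1_inner :: "(real^'d) set \<Rightarrow> (real^'d \<Rightarrow> real) \<Rightarrow> (real^'d \<Rightarrow> real) \<Rightarrow> real" where
  "H1_inner S u v = L2_inner (lebesgue_on S) u v
     + (\<Sum>i\<in>UNIV. L2_inner (lebesgue_on S) (wpartial S i u) (wpartial S i v))"

context
  fixes S :: "(real^'d) set"
  assumes S: "open S"
begin

abbreviation "leb \<equiv> lebesgue_on S"

lemma S_lebesgue: "S \<in> sets lebesgue" using S by simp

lemmas test_L2 = test_functions_L2[OF _ S_lebesgue]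

lemma weak_gradient_iff: "weak_gradient S u g \<longleftrightarrow> (\<forall>i. (\<lambda>x. g x $ i) \<in> L2 leb \<and>
    (\<forall>\<phi>\<in>test_functions S. L2_inner leb u (partial i \<phi>) = - L2_inner leb (\<lambda>x. g x $ i) \<phi>))"
  by (simp add: weak_gradient_def L2_inner_def grad_nth)

lemma weak_gradient_unique:
  assumes "weak_gradient S u g" "weak_gradient S u h"
  shows "AE x in leb. g x = h x"
proof -
  have "AE x in leb. g x $ i - h x $ i = 0" for i
  proof (rule fundamental_lemma[OF S])
    have L: "(\<lambda>x. g x $ i) \<in> L2 leb" "(\<lambda>x. h x $ i) \<in> L2 leb" using assms by (auto simp: weak_gradient_iff)
    then show "(\<lambda>x. g x $ i - h x $ i) \<in> L2 leb" by (rule L2_diff)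
    fix \<phi> assume \<phi>: "\<phi> \<in> test_functions S"
    have "L2_inner leb (\<lambda>x. g x $ i) \<phi> = L2_inner leb (\<lambda>x. h x $ i) \<phi>"
      using assms \<phi> by (simp add: weak_gradient_iff)
    then have "L2_inner leb (\<lambda>x. g x $ i - h x $ i) \<phi> = 0"
      using L2_inner_diff_left[OF L test_L2[OF \<phi>]] by simp
    then show "(LINT x|leb. (g x $ i - h x $ i) * \<phi> x) = 0" by (simp add: L2_inner_def)
  qed
  then have "AE x in leb. \<forall>i. g x $ i - h x $ i = 0" by (simp add: AE_all_countable)
  then show ?thesis by eventually_elim (simp add: vec_eq_iff)
qed

lemma weak_gradient_add:
  assumes "u \<in> L2 leb" "v \<in> L2 leb" "weak_gradient S u g" "weak_gradient S v h"
  shows "weak_gradient S (\<lambda>x. u x + v x) (\<lambda>x. g x + h x)"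
  unfolding weak_gradient_iff
proof (intro allI conjI ballI)
  fix i
  have L: "(\<lambda>x. g x $ i) \<in> L2 leb" "(\<lambda>x. h x $ i) \<in> L2 leb" using assms by (auto simp: weak_gradient_iff)
  then show "(\<lambda>x. (g x + h x) $ i) \<in> L2 leb" by (simp add: L2_add)
  fix \<phi> assume \<phi>: "\<phi> \<in> test_functions S"
  show "L2_inner leb (\<lambda>x. u x + v x) (partial i \<phi>) = - L2_inner leb (\<lambda>x. (g x + h x) $ i) \<phi>"
    using assms(3,4) \<phi> L2_inner_add_left[OF L test_L2[OF \<phi>]]
      L2_inner_add_left[OF assms(1,2) test_L2[OF test_functions_partial[OF \<phi>]]]
    by (simp add: weak_gradient_iff)
qed

lemma weak_gradient_cmult:
  assumes "weak_gradient S u g"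
  shows "weak_gradient S (\<lambda>x. c * u x) (\<lambda>x. c *\<^sub>R g x)"
  using assms by (auto simp: weak_gradient_iff L2_inner_scale_left)

lemma weak_gradient_test:
  assumes \<phi>: "\<phi> \<in> test_functions S"
  shows "weak_gradient S \<phi> (grad \<phi>)"
  unfolding weak_gradient_iff grad_nth
  using integration_by_parts[OF \<phi> _ S_lebesgue] test_L2[OF test_functions_partial[OF \<phi>]] by blast

lemma H1_L2: "u \<in> H1 S \<Longrightarrow> u \<in> L2 leb"
  by (simp add: H1_def)

lemma wgrad:
  assumes "u \<in> H1 S"
  shows "weak_gradient S u (wgrad S u)"
proof -
  have "\<exists>g. weak_gradient S u g" using assms by (simp add: H1_def)
  then show ?thesis unfolding wgrad_def by (rule someI_ex)
qed

lemma H1I: "u \<in> L2 leb \<Longrightarrow> weak_gradient S u g \<Longrightarrow> u \<in> H1 S"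
  by (auto simp: H1_def)

lemma H1_add: "u \<in> H1 S \<Longrightarrow> v \<in> H1 S \<Longrightarrow> (\<lambda>x. u x + v x) \<in> H1 S"
  by (rule H1I[OF L2_add weak_gradient_add]) (auto intro: H1_L2 wgrad)

lemma H1_cmult: "u \<in> H1 S \<Longrightarrow> (\<lambda>x. c * u x) \<in> H1 S"
  by (rule H1I[OF L2_scale weak_gradient_cmult]) (auto intro: H1_L2 wgrad)

lemma test_H1: "\<phi> \<in> test_functions S \<Longrightarrow> \<phi> \<in> H1 S"
  using H1I test_L2 weak_gradient_test by blast

lemma wpartial_L2: "u \<in> H1 S \<Longrightarrow> wpartial S i u \<in> L2 leb"
  using wgrad[of u] by (simp add: wpartial_def[abs_def] weak_gradient_iff)

lemma wpartial_AE: 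
  assumes "u \<in> L2 leb" "weak_gradient S u g"
  shows "AE x in leb. wpartial S i u x = g x $ i"
  using weak_gradient_unique[OF wgrad[OF H1I[OF assms]] assms(2)]
  by eventually_elim (simp add: wpartial_def)

lemma wpartial_inner:
  assumes u: "u \<in> L2 leb" "weak_gradient S u g" and h: "h \<in> L2 leb"
  shows "L2_inner leb (wpartial S i u) h = L2_inner leb (\<lambda>x. g x $ i) h"
  by (rule L2_inner_cong_AE[OF wpartial_L2[OF H1I[OF u]] _ h wpartial_AE[OF u]])
    (use u(2) in \<open>simp add: weak_gradient_iff\<close>)

text \<open>\<open>wgrad\<close> is an arbitrary choice of a weak gradient, hence additive only
  almost everywhere. Additivity is therefore stated after pairing with a function in L2, here and in
  the next lemma.\<close>

lemma wpartial_add: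
  assumes "u \<in> H1 S" "v \<in> H1 S" "h \<in> L2 leb"
  shows "L2_inner leb (wpartial S i (\<lambda>x. u x + v x)) h = L2_inner leb (wpartial S i u) h + L2_inner leb (wpartial S i v) h"
proof -
  have "L2_inner leb (wpartial S i (\<lambda>x. u x + v x)) h = L2_inner leb (\<lambda>x. (wgrad S u x + wgrad S v x) $ i) h"
    by (rule wpartial_inner[OF L2_add weak_gradient_add assms(3)]) (auto intro: H1_L2 wgrad assms)
  also have "\<dots> = L2_inner leb (\<lambda>x. wpartial S i u x + wpartial S i v x) h" by (simp add: wpartial_def)
  also have "\<dots> = L2_inner leb (wpartial S i u) h + L2_inner leb (wpartial S i v) h"
    by (rule L2_inner_add_left[OF wpartial_L2 wpartial_L2]) fact+
  finally show ?thesis .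
qed

lemma wpartial_cmult:
  assumes "u \<in> H1 S" "h \<in> L2 leb"
  shows "L2_inner leb (wpartial S i (\<lambda>x. c * u x)) h = c * L2_inner leb (wpartial S i u) h"
proof -
  have "L2_inner leb (wpartial S i (\<lambda>x. c * u x)) h = L2_inner leb (\<lambda>x. (c *\<^sub>R wgrad S u x) $ i) h"
    by (rule wpartial_inner[OF L2_scale weak_gradient_cmult assms(2)]) (auto intro: H1_L2 wgrad assms)
  then show ?thesis by (simp add: wpartial_def[abs_def] L2_inner_scale_left)
qed

lemma wpartial_test:
  assumes "\<phi> \<in> test_functions S" "h \<in> L2 leb"
  shows "L2_inner leb (wpartial S i \<phi>) h = L2_inner leb (partial i \<phi>) h"
  using wpartial_inner[OF test_L2[OF assms(1)] weak_gradient_test[OF assms(1)] assms(2)]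
  by (simp add: grad_nth)

lemma semi_inner_H1: "semi_inner (H1 S) (\<lambda>f g x. f x + g x) (\<lambda>c f x. c * f x) (H1_inner S)"
proof
  fix u v w c assume u: "u \<in> H1 S" and w: "w \<in> H1 S"
  show "H1_inner S (\<lambda>x. c * u x) w = c * H1_inner S u w"
    using u w by (simp add: H1_inner_def L2_inner_scale_left wpartial_cmult wpartial_L2 sum_distrib_left distrib_left)
  show "H1_inner S u w = H1_inner S w u"
    unfolding H1_inner_def L2_inner_commute[of leb u w] L2_inner_commute[of leb "wpartial S _ u" "wpartial S _ w"] ..
  assume v: "v \<in> H1 S"
  show "H1_inner S (\<lambda>x. u x + v x) w = H1_inner S u w + H1_inner S v w"
    using u v w by (simp add: H1_inner_def L2_inner_add_left wpartial_add wpartial_L2 H1_L2 sum.distrib)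
qed (use test_H1 zero_test_function in \<open>auto simp: H1_inner_def sum_nonneg H1_add H1_cmult\<close>)

lemma H1_inner_dif:
  assumes u: "u \<in> H1 S" and v: "v \<in> H1 S"
  shows "H1_inner S (\<lambda>x. u x + - 1 * v x) (\<lambda>x. u x + - 1 * v x) =
    L2_inner leb (\<lambda>x. u x - v x) (\<lambda>x. u x - v x)
     + (\<Sum>i\<in>UNIV. L2_inner leb (\<lambda>x. wpartial S i u x - wpartial S i v x) (\<lambda>x. wpartial S i u x - wpartial S i v x))"
proof -
  let ?d = "\<lambda>x. u x + - 1 * v x"
  have d: "?d \<in> H1 S" by (intro H1_add H1_cmult u v)
  have "L2_inner leb (wpartial S i ?d) (wpartial S i ?d)
      = L2_inner leb (\<lambda>x. wpartial S i u x - wpartial S i v x) (\<lambda>x. wpartial S i u x - wpartial S i v x)" for i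
  proof -
    have *: "L2_inner leb (wpartial S i ?d) h = L2_inner leb (\<lambda>x. wpartial S i u x - wpartial S i v x) h" if "h \<in> L2 leb" for h
      using wpartial_add[OF u H1_cmult[OF v, of "- 1"] that, of i] wpartial_cmult[OF v that, of i "- 1"]
        L2_inner_diff_left[OF wpartial_L2[OF u] wpartial_L2[OF v] that, of i i] by simp
    have l: "wpartial S i ?d \<in> L2 leb" "(\<lambda>x. wpartial S i u x - wpartial S i v x) \<in> L2 leb"
      by (intro wpartial_L2 d L2_diff u v)+
    show ?thesis
      using *[OF l(1)] *[OF l(2)] L2_inner_commute[of leb "wpartial S i ?d" "\<lambda>x. wpartial S i u x - wpartial S i v x"] by simp
  qed
  then show ?thesis by (simp add: H1_inner_def)
qed

text \<open>The functions and each of their weak partial derivatives converge separately in L2. The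
  identity that defines a weak gradient is an equality of two inner products with fixed functions,
  so it survives the limit.\<close>

lemma semi_hilbert_H1: "semi_hilbert (H1 S) (\<lambda>f g x. f x + g x) (\<lambda>c f x. c * f x) (H1_inner S)"
proof -
  interpret semi_inner "H1 S" "\<lambda>f g x. f x + g x" "\<lambda>c f x. c * f x" "H1_inner S" by (rule semi_inner_H1)
  show ?thesis
  proof
    fix f :: "nat \<Rightarrow> real^'d \<Rightarrow> real"
    assume f: "\<And>n. f n \<in> H1 S"
      and cau: "\<And>e. e > 0 \<Longrightarrow> \<exists>N. \<forall>m\<ge>N. \<forall>n\<ge>N. H1_inner S (dif (f m) (f n)) (dif (f m) (f n)) < e"
    let ?w = "\<lambda>i n. wpartial S i (f n)"
    have dif2: "H1_inner S (dif u v) (dif u v) = L2_inner leb (\<lambda>x. u x - v x) (\<lambda>x. u x - v x)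
        + (\<Sum>i\<in>UNIV. L2_inner leb (\<lambda>x. wpartial S i u x - wpartial S i v x) (\<lambda>x. wpartial S i u x - wpartial S i v x))"
      if "u \<in> H1 S" "v \<in> H1 S" for u v using H1_inner_dif[OF that] by (simp add: dif_def)
    have le0: "L2_inner leb (\<lambda>x. f m x - f n x) (\<lambda>x. f m x - f n x) \<le> H1_inner S (dif (f m) (f n)) (dif (f m) (f n))" for m n
      unfolding dif2[OF f f] by (simp add: sum_nonneg)
    have le1: "L2_inner leb (\<lambda>x. ?w i m x - ?w i n x) (\<lambda>x. ?w i m x - ?w i n x) \<le> H1_inner S (dif (f m) (f n)) (dif (f m) (f n))" for i m n
      unfolding dif2[OF f f] by (intro add_increasing member_le_sum) auto
    have "\<exists>w\<in>L2 leb. (\<lambda>n. L2_inner leb (\<lambda>x. f n x - w x) (\<lambda>x. f n x - w x)) \<longlonglongrightarrow> 0"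
    proof (rule L2_complete[OF H1_L2[OF f]])
      fix e :: real assume "e > 0"
      from cau[OF this] obtain N where N: "\<forall>m\<ge>N. \<forall>n\<ge>N. H1_inner S (dif (f m) (f n)) (dif (f m) (f n)) < e" by blast
      show "\<exists>N. \<forall>m\<ge>N. \<forall>n\<ge>N. L2_inner leb (\<lambda>x. f m x - f n x) (\<lambda>x. f m x - f n x) < e"
      proof (intro exI allI impI)
        fix m n assume "N \<le> m" "N \<le> n"
        with N have "H1_inner S (dif (f m) (f n)) (dif (f m) (f n)) < e" by blast
        with le0[of m n] show "L2_inner leb (\<lambda>x. f m x - f n x) (\<lambda>x. f m x - f n x) < e" by (rule le_less_trans)
      qed
    qed
    then obtain w where w: "w \<in> L2 leb" "(\<lambda>n. L2_inner leb (\<lambda>x. f n x - w x) (\<lambda>x. f n x - w x)) \<longlonglongrightarrow> 0" by blast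
    have "\<forall>i. \<exists>g. g \<in> L2 leb \<and> (\<lambda>n. L2_inner leb (\<lambda>x. ?w i n x - g x) (\<lambda>x. ?w i n x - g x)) \<longlonglongrightarrow> 0"
    proof
    fix i
    have "\<exists>g\<in>L2 leb. (\<lambda>n. L2_inner leb (\<lambda>x. ?w i n x - g x) (\<lambda>x. ?w i n x - g x)) \<longlonglongrightarrow> 0"
    proof (rule L2_complete[OF wpartial_L2[OF f]])
      fix e :: real assume "e > 0"
      from cau[OF this] obtain N where N: "\<forall>m\<ge>N. \<forall>n\<ge>N. H1_inner S (dif (f m) (f n)) (dif (f m) (f n)) < e" by blast
      show "\<exists>N. \<forall>m\<ge>N. \<forall>n\<ge>N. L2_inner leb (\<lambda>x. ?w i m x - ?w i n x) (\<lambda>x. ?w i m x - ?w i n x) < e"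
      proof (intro exI allI impI)
        fix m n assume "N \<le> m" "N \<le> n"
        with N have "H1_inner S (dif (f m) (f n)) (dif (f m) (f n)) < e" by blast
        with le1[of i m n] show "L2_inner leb (\<lambda>x. ?w i m x - ?w i n x) (\<lambda>x. ?w i m x - ?w i n x) < e" by (rule le_less_trans)
      qed
    qed
    then show "\<exists>g. g \<in> L2 leb \<and> (\<lambda>n. L2_inner leb (\<lambda>x. ?w i n x - g x) (\<lambda>x. ?w i n x - g x)) \<longlonglongrightarrow> 0"
      by blast
    qed
    from choice[OF this] obtain g where "\<forall>i. g i \<in> L2 leb \<and> (\<lambda>n. L2_inner leb (\<lambda>x. ?w i n x - g i x) (\<lambda>x. ?w i n x - g i x)) \<longlonglongrightarrow> 0"
      by blast
    then have g: "\<And>i. g i \<in> L2 leb" "\<And>i. (\<lambda>n. L2_inner leb (\<lambda>x. ?w i n x - g i x) (\<lambda>x. ?w i n x - g i x)) \<longlonglongrightarrow> 0"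
      by blast+
    have wg: "weak_gradient S w (\<lambda>x. \<chi> i. g i x)"
      unfolding weak_gradient_iff
    proof (intro allI conjI ballI)
      fix i show "(\<lambda>x. (\<chi> i. g i x) $ i) \<in> L2 leb" using g by simp
      fix \<phi> assume \<phi>: "\<phi> \<in> test_functions S"
      have 1: "(\<lambda>n. L2_inner leb (f n) (partial i \<phi>)) \<longlonglongrightarrow> L2_inner leb w (partial i \<phi>)"
        by (rule L2_inner_tendsto[OF H1_L2[OF f] w(1) test_L2[OF test_functions_partial[OF \<phi>]] w(2)])
      moreover have "(\<lambda>n. - L2_inner leb (?w i n) \<phi>) \<longlonglongrightarrow> - L2_inner leb (g i) \<phi>"
        by (intro tendsto_minus L2_inner_tendsto[OF wpartial_L2[OF f] g(1) test_L2[OF \<phi>] g(2)])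
      moreover have "L2_inner leb (f n) (partial i \<phi>) = - L2_inner leb (?w i n) \<phi>" for n
        using wgrad[OF f[of n]] \<phi> by (simp add: weak_gradient_iff wpartial_def[abs_def])
      ultimately have "(\<lambda>n. L2_inner leb (f n) (partial i \<phi>)) \<longlonglongrightarrow> - L2_inner leb (g i) \<phi>"
        by presburger
      from LIMSEQ_unique[OF 1 this]
      show "L2_inner leb w (partial i \<phi>) = - L2_inner leb (\<lambda>x. (\<chi> i. g i x) $ i) \<phi>" by simp
    qed
    have wH: "w \<in> H1 S" by (rule H1I[OF w(1) wg])
    \<comment> \<open>The chosen partial derivative of the limit equals \<open>g i\<close> only
      almost everywhere; the distances agree nevertheless.\<close>
    have wp: "L2_inner leb (\<lambda>x. ?w i n x - wpartial S i w x) (\<lambda>x. ?w i n x - wpartial S i w x)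
        = L2_inner leb (\<lambda>x. ?w i n x - g i x) (\<lambda>x. ?w i n x - g i x)" for i n
    proof (rule antisym)
      have ae: "AE x in leb. wpartial S i w x = g i x" using wpartial_AE[OF w(1) wg, of i] by simp
      have l: "(\<lambda>x. ?w i n x - wpartial S i w x) \<in> L2 leb" "(\<lambda>x. ?w i n x - g i x) \<in> L2 leb"
        by (intro L2_diff wpartial_L2 f wH g)+
      show "L2_inner leb (\<lambda>x. ?w i n x - wpartial S i w x) (\<lambda>x. ?w i n x - wpartial S i w x)
        \<le> L2_inner leb (\<lambda>x. ?w i n x - g i x) (\<lambda>x. ?w i n x - g i x)"
        by (rule L2_inner_mono[OF l(2,1)]) (use ae in eventually_elim, simp)
      show "L2_inner leb (\<lambda>x. ?w i n x - g i x) (\<lambda>x. ?w i n x - g i x)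
        \<le> L2_inner leb (\<lambda>x. ?w i n x - wpartial S i w x) (\<lambda>x. ?w i n x - wpartial S i w x)"
        by (rule L2_inner_mono[OF l(1,2)]) (use ae in eventually_elim, simp)
    qed
    have "(\<lambda>n. H1_inner S (dif (f n) w) (dif (f n) w)) \<longlonglongrightarrow> 0 + (\<Sum>i\<in>(UNIV :: 'd set). 0)"
      unfolding dif2[OF f wH] wp by (intro tendsto_add w(2) tendsto_sum g(2))
    then show "\<exists>w\<in>H1 S. (\<lambda>n. H1_inner S (dif (f n) w) (dif (f n) w)) \<longlonglongrightarrow> 0"
      using wH by (intro bexI[of _ w]) auto
  qed
qed

text \<open>For a test function the chosen weak gradient coincides almost everywhere with
  \<open>grad\<close>, so the definition of \<open>H1_0\<close> describes the closure in the norm of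
  \<open>H1_inner\<close>.\<close>

lemma H1_0_eq: "S \<noteq> UNIV \<Longrightarrow> H1_0 S = {u \<in> H1 S. \<forall>e>0. \<exists>v\<in>test_functions S.
    H1_inner S (\<lambda>x. u x + - 1 * v x) (\<lambda>x. u x + - 1 * v x) < e}"
proof -
  assume "S \<noteq> UNIV"
  have "(LINT x|leb. (u x - \<phi> x)\<^sup>2) + (LINT x|leb. (norm (wgrad S u x - grad \<phi> x))\<^sup>2)
      = H1_inner S (\<lambda>x. u x + - 1 * \<phi> x) (\<lambda>x. u x + - 1 * \<phi> x)" if u: "u \<in> H1 S" and \<phi>: "\<phi> \<in> test_functions S" for u \<phi>
  proof -
    have l: "(\<lambda>x. wpartial S i u x - partial i \<phi> x) \<in> L2 leb" "(\<lambda>x. wpartial S i u x - wpartial S i \<phi> x) \<in> L2 leb" for i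
      by (intro L2_diff wpartial_L2 u test_H1 \<phi> test_L2 test_functions_partial)+
    have ae: "AE x in leb. wpartial S i \<phi> x = partial i \<phi> x" for i
      using wpartial_AE[OF test_L2[OF \<phi>] weak_gradient_test[OF \<phi>], of i] by (simp add: grad_nth)
    have eq: "L2_inner leb (\<lambda>x. wpartial S i u x - partial i \<phi> x) (\<lambda>x. wpartial S i u x - partial i \<phi> x)
        = L2_inner leb (\<lambda>x. wpartial S i u x - wpartial S i \<phi> x) (\<lambda>x. wpartial S i u x - wpartial S i \<phi> x)" for i
      by (intro antisym L2_inner_mono l; use ae[of i] in eventually_elim, simp)
    have "(LINT x|leb. (norm (wgrad S u x - grad \<phi> x))\<^sup>2)
        = (LINT x|leb. (\<Sum>i\<in>UNIV. (wpartial S i u x - partial i \<phi> x) * (wpartial S i u x - partial i \<phi> x)))"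
      by (simp add: norm_vec_def L2_set_def sum_nonneg wpartial_def grad_nth power2_eq_square)
    also have "\<dots> = (\<Sum>i\<in>UNIV. L2_inner leb (\<lambda>x. wpartial S i u x - partial i \<phi> x) (\<lambda>x. wpartial S i u x - partial i \<phi> x))"
      unfolding L2_inner_def by (rule Bochner_Integration.integral_sum) (rule L2_mult_integrable[OF l(1) l(1)])
    finally show ?thesis unfolding H1_inner_dif[OF u test_H1[OF \<phi>]] eq by (simp add: L2_inner_def power2_eq_square)
  qed
  then show ?thesis using \<open>S \<noteq> UNIV\<close> unfolding H1_0_def by auto
qed

lemma semi_hilbert_H1_0: "semi_hilbert (H1_0 S) (\<lambda>f g x. f x + g x) (\<lambda>c f x. c * f x) (H1_inner S)"
proof (cases "S = UNIV")
  case True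
  then show ?thesis using semi_hilbert_H1 by (simp add: H1_0_def)
next
  case False
  interpret semi_hilbert "H1 S" "\<lambda>f g x. f x + g x" "\<lambda>c f x. c * f x" "H1_inner S" by (rule semi_hilbert_H1)
  show ?thesis
    using closure_semi_hilbert[of "test_functions S"] test_H1 zero_test_function[of S] test_functions_add test_functions_cmult
    unfolding H1_0_eq[OF False] dif_def by blast
qed

lemma H1_0_H1: "u \<in> H1_0 S \<Longrightarrow> u \<in> H1 S"
  by (auto simp: H1_0_def split: if_splits)

lemma test_H1_0: 
  assumes \<phi>: "\<phi> \<in> test_functions S"
  shows "\<phi> \<in> H1_0 S"
proof (cases "S = UNIV")
  case True
  then show ?thesis using test_H1[OF \<phi>] by (simp add: H1_0_def)
next
  case False
  interpret semi_hilbert "H1 S" "\<lambda>f g x. f x + g x" "\<lambda>c f x. c * f x" "H1_inner S" by (rule semi_hilbert_H1)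
  have "H1_inner S (\<lambda>x. \<phi> x + - 1 * \<phi> x) (\<lambda>x. \<phi> x + - 1 * \<phi> x) = 0"
    using ip_simps(5)[of \<phi> \<phi> "dif \<phi> \<phi>"] test_H1[OF \<phi>] test_H1[OF zero_test_function] by (simp add: dif_def)
  then show ?thesis using test_H1[OF \<phi>] unfolding H1_0_eq[OF False] by (auto intro!: bexI[OF _ \<phi>])
qed

end

section \<open>The homogenized form\<close>

definition coercive_matrix :: "real^'d^'d \<Rightarrow> real \<Rightarrow> bool" where
  "coercive_matrix A c \<longleftrightarrow> c > 0 \<and> (\<forall>i j. A $ i $ j = A $ j $ i) \<and>
     (\<forall>\<xi> :: 'd \<Rightarrow> real. c * (\<Sum>i\<in>UNIV. (\<xi> i)\<^sup>2) \<le> (\<Sum>i\<in>UNIV. \<Sum>j\<in>UNIV. A $ i $ j * \<xi> j * \<xi> i))"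

text \<open>The operator \<open>- div (A grad f)\<close> with constant coefficients; by
  \<open>hom_form_test\<close> it represents \<open>hom_form\<close> on test functions.\<close>

definition neg_lap :: "real^'d^'d \<Rightarrow> (real^'d \<Rightarrow> real) \<Rightarrow> real^'d \<Rightarrow> real" where
  "neg_lap A f x = - (\<Sum>i\<in>UNIV. \<Sum>j\<in>UNIV. A $ i $ j * partial i (partial j f) x)"

context
  fixes S :: "(real^'d) set"
  assumes S: "open S"
begin

lemma hom_form_eq:
  assumes u: "u \<in> H1 S" and v: "v \<in> H1 S"
  shows "hom_form S A u v = (\<Sum>i\<in>UNIV. \<Sum>j\<in>UNIV. A $ i $ j * L2_inner (lebesgue_on S) (wpartial S j u) (wpartial S i v))"
proof -
  have int: "integrable (lebesgue_on S) (\<lambda>x. wpartial S j u x * wpartial S i v x)" for i j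
    using wpartial_L2[OF S u] wpartial_L2[OF S v] by (rule L2_mult_integrable)
  have "hom_form S A u v = (LINT x|(lebesgue_on S). (\<Sum>i\<in>UNIV. \<Sum>j\<in>UNIV. A $ i $ j * (wpartial S j u x * wpartial S i v x)))"
    by (simp add: hom_form_def inner_vec_def matrix_vector_mult_def wpartial_def sum_distrib_right mult.assoc)
  also have "\<dots> = (\<Sum>i\<in>UNIV. \<Sum>j\<in>UNIV. A $ i $ j * (LINT x|(lebesgue_on S). wpartial S j u x * wpartial S i v x))"
    using int by (simp add: Bochner_Integration.integral_sum)
  finally show ?thesis by (simp add: L2_inner_def)
qed

lemma hom_form_coercive:
  assumes A: "coercive_matrix A c" and u: "u \<in> H1 S"
  shows "c * (\<Sum>i\<in>UNIV. L2_inner (lebesgue_on S) (wpartial S i u) (wpartial S i u)) \<le> hom_form S A u u"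
proof -
  have int: "integrable (lebesgue_on S) (\<lambda>x. wpartial S j u x * wpartial S i u x)" for i j
    using wpartial_L2[OF S u] wpartial_L2[OF S u] by (rule L2_mult_integrable)
  have "c * (\<Sum>i\<in>UNIV. L2_inner (lebesgue_on S) (wpartial S i u) (wpartial S i u))
      = (LINT x|(lebesgue_on S). c * (\<Sum>i\<in>UNIV. (wpartial S i u x)\<^sup>2))"
    using int by (simp add: L2_inner_def power2_eq_square Bochner_Integration.integral_sum)
  also have "\<dots> \<le> (LINT x|(lebesgue_on S). (\<Sum>i\<in>UNIV. \<Sum>j\<in>UNIV. A $ i $ j * (wpartial S j u x * wpartial S i u x)))"
  proof (rule integral_mono)
    fix x
    have "c * (\<Sum>i\<in>UNIV. (wpartial S i u x)\<^sup>2) \<le> (\<Sum>i\<in>UNIV. \<Sum>j\<in>UNIV. A $ i $ j * wpartial S j u x * wpartial S i u x)"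
      using A unfolding coercive_matrix_def by (elim conjE allE[of _ "\<lambda>i. wpartial S i u x"])
    then show "c * (\<Sum>i\<in>UNIV. (wpartial S i u x)\<^sup>2) \<le> (\<Sum>i\<in>UNIV. \<Sum>j\<in>UNIV. A $ i $ j * (wpartial S j u x * wpartial S i u x))"
      by (simp add: mult.assoc)
  qed (intro integrable_mult_right Bochner_Integration.integrable_sum int; simp add: power2_eq_square int)+
  also have "\<dots> = hom_form S A u u"
    using int by (simp add: hom_form_eq[OF u u] L2_inner_def Bochner_Integration.integral_sum)
  finally show ?thesis .
qed

lemma hom_form_upper:
  assumes u: "u \<in> H1 S"
  shows "hom_form S A u u \<le> (\<Sum>i\<in>UNIV. \<Sum>j\<in>UNIV. \<bar>A $ i $ j\<bar>) * (\<Sum>i\<in>UNIV. L2_inner (lebesgue_on S) (wpartial S i u) (wpartial S i u))"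
proof -
  let ?N = "\<Sum>i\<in>UNIV. L2_inner (lebesgue_on S) (wpartial S i u) (wpartial S i u)"
  have N: "L2_inner (lebesgue_on S) (wpartial S i u) (wpartial S i u) \<le> ?N" for i by (rule member_le_sum) auto
  have N0: "0 \<le> ?N" by (simp add: sum_nonneg)
  have le: "\<bar>L2_inner (lebesgue_on S) (wpartial S j u) (wpartial S i u)\<bar> \<le> ?N" for i j
  proof -
    have "(L2_inner (lebesgue_on S) (wpartial S j u) (wpartial S i u))\<^sup>2 \<le> L2_inner (lebesgue_on S) (wpartial S j u) (wpartial S j u) * L2_inner (lebesgue_on S) (wpartial S i u) (wpartial S i u)"
      by (intro L2_cauchy_schwarz wpartial_L2[OF S u])
    also have "\<dots> \<le> ?N * ?N" by (intro mult_mono N N0) auto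
    finally have "(L2_inner (lebesgue_on S) (wpartial S j u) (wpartial S i u))\<^sup>2 \<le> ?N\<^sup>2" by (simp only: power2_eq_square)
    then have "\<bar>L2_inner (lebesgue_on S) (wpartial S j u) (wpartial S i u)\<bar> \<le> \<bar>?N\<bar>" by (simp only: abs_le_square_iff)
    then show ?thesis using N0 by simp
  qed
  have "hom_form S A u u \<le> (\<Sum>i\<in>UNIV. \<Sum>j\<in>UNIV. \<bar>A $ i $ j\<bar> * ?N)"
    unfolding hom_form_eq[OF u u]
  proof (intro sum_mono)
    fix i j
    have "A $ i $ j * L2_inner (lebesgue_on S) (wpartial S j u) (wpartial S i u) \<le> \<bar>A $ i $ j\<bar> * \<bar>L2_inner (lebesgue_on S) (wpartial S j u) (wpartial S i u)\<bar>"
      using abs_ge_self[of "A $ i $ j * L2_inner (lebesgue_on S) (wpartial S j u) (wpartial S i u)"] by (simp only: abs_mult)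
    also have "\<dots> \<le> \<bar>A $ i $ j\<bar> * ?N" by (intro mult_left_mono le) simp
    finally show "A $ i $ j * L2_inner (lebesgue_on S) (wpartial S j u) (wpartial S i u) \<le> \<bar>A $ i $ j\<bar> * ?N" .
  qed
  then show ?thesis by (simp only: sum_distrib_right)
qed

lemma hom_form_linear:
  assumes "u \<in> H1 S" "v \<in> H1 S" "w \<in> H1 S"
  shows "hom_form S A (\<lambda>x. u x + v x) w = hom_form S A u w + hom_form S A v w"
    and "hom_form S A (\<lambda>x. c * u x) w = c * hom_form S A u w"
  using assms
  by (simp_all add: hom_form_eq H1_add[OF S] H1_cmult[OF S] wpartial_add[OF S] wpartial_cmult[OF S]
      wpartial_L2[OF S] distrib_left sum.distrib sum_distrib_left mult.left_commute)

lemma hom_form_commute: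
  assumes A: "coercive_matrix A c" and u: "u \<in> H1 S" and v: "v \<in> H1 S"
  shows "hom_form S A u v = hom_form S A v u"
proof -
  have sym: "A $ i $ j = A $ j $ i" for i j using A by (simp add: coercive_matrix_def)
  have "hom_form S A u v = (\<Sum>j\<in>UNIV. \<Sum>i\<in>UNIV. A $ i $ j * L2_inner (lebesgue_on S) (wpartial S j u) (wpartial S i v))"
    unfolding hom_form_eq[OF u v] by (rule sum.swap)
  also have "\<dots> = hom_form S A v u"
    unfolding hom_form_eq[OF v u]
    by (intro sum.cong refl arg_cong2[where f = "(*)"] sym L2_inner_commute)
  finally show ?thesis .
qed

lemma semi_inner_hom_form:
  assumes A: "coercive_matrix A c"
  shows "semi_inner (H1_0 S) (\<lambda>f g x. f x + g x) (\<lambda>c f x. c * f x) (hom_form S A)"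
proof -
  interpret semi_hilbert "H1_0 S" "\<lambda>f g x. f x + g x" "\<lambda>c f x. c * f x" "H1_inner S" by (rule semi_hilbert_H1_0[OF S])
  show ?thesis
  proof
    show "H1_0 S \<noteq> {}" by (rule nonempty)
    fix u v w c' assume u: "u \<in> H1_0 S"
    note h = H1_0_H1[OF S]
    show "(\<lambda>x. c' * u x) \<in> H1_0 S" using scl_closed[OF u] .
    have "0 \<le> (\<Sum>i\<in>UNIV. L2_inner (lebesgue_on S) (wpartial S i u) (wpartial S i u))" by (simp add: sum_nonneg)
    then show "0 \<le> hom_form S A u u" using hom_form_coercive[OF A h[OF u]] A
      by (smt (verit) coercive_matrix_def zero_le_mult_iff)
    assume w: "w \<in> H1_0 S"
    show "hom_form S A (\<lambda>x. c' * u x) w = c' * hom_form S A u w" by (rule hom_form_linear(2)[OF h[OF u] h[OF u] h[OF w]])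
    show "hom_form S A u w = hom_form S A w u" by (rule hom_form_commute[OF A h[OF u] h[OF w]])
    show "(\<lambda>x. u x + w x) \<in> H1_0 S" using add_closed[OF u w] .
    assume v: "v \<in> H1_0 S"
    show "hom_form S A (\<lambda>x. u x + v x) w = hom_form S A u w + hom_form S A v w"
      by (rule hom_form_linear(1)[OF h[OF u] h[OF v] h[OF w]])
  qed
qed

lemma neg_lap_L2:
  assumes \<phi>: "\<phi> \<in> test_functions S"
  shows "neg_lap A \<phi> \<in> L2 (lebesgue_on S)"
  unfolding neg_lap_def[abs_def]
  by (intro L2_uminus L2_sum L2_scale test_L2[OF S] test_functions_partial \<phi>)

lemma hom_form_test:
  assumes \<phi>: "\<phi> \<in> test_functions S" and v: "v \<in> H1 S"
  shows "hom_form S A \<phi> v = L2_inner (lebesgue_on S) (neg_lap A \<phi>) v"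
proof -
  have t: "partial j \<phi> \<in> test_functions S" "partial i (partial j \<phi>) \<in> test_functions S" for i j
    by (intro test_functions_partial \<phi>)+
  have "L2_inner (lebesgue_on S) (wpartial S j \<phi>) (wpartial S i v) = - L2_inner (lebesgue_on S) (partial i (partial j \<phi>)) v" for i j
  proof -
    have "L2_inner (lebesgue_on S) (wpartial S j \<phi>) (wpartial S i v) = L2_inner (lebesgue_on S) (partial j \<phi>) (wpartial S i v)"
      by (rule wpartial_test[OF S \<phi> wpartial_L2[OF S v]])
    also have "\<dots> = L2_inner (lebesgue_on S) (wpartial S i v) (partial j \<phi>)" by (rule L2_inner_commute)
    also have "\<dots> = - L2_inner (lebesgue_on S) v (partial i (partial j \<phi>))"
      using wgrad[OF S v] t by (simp add: weak_gradient_iff[OF S] wpartial_def[abs_def])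
    finally show ?thesis unfolding L2_inner_commute[of "lebesgue_on S" v] .
  qed
  then have "hom_form S A \<phi> v = (\<Sum>i\<in>UNIV. \<Sum>j\<in>UNIV. A $ i $ j * - L2_inner (lebesgue_on S) (partial i (partial j \<phi>)) v)"
    using hom_form_eq[OF test_H1[OF S \<phi>] v, of A] by simp
  also have "\<dots> = L2_inner (lebesgue_on S) (neg_lap A \<phi>) v"
    using L2_mult_integrable[OF test_L2[OF S t(2)] H1_L2[OF S v]]
    by (simp add: L2_inner_def neg_lap_def sum_distrib_right mult.assoc Bochner_Integration.integral_sum sum_negf)
  finally show ?thesis .
qed

text \<open>For \<open>u\<^sub>1 = \<phi> sin (k x\<^sub>i)\<close> and \<open>u\<^sub>2 = \<phi> cos (k x\<^sub>i)\<close> one has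
  \<open>u\<^sub>1\<^sup>2 + u\<^sub>2\<^sup>2 = \<phi>\<^sup>2\<close> and \<open>(\<partial>\<^sub>i u\<^sub>1)\<^sup>2 + (\<partial>\<^sub>i u\<^sub>2)\<^sup>2 = (\<partial>\<^sub>i \<phi>)\<^sup>2 + k\<^sup>2 \<phi>\<^sup>2\<close>.\<close>

lemma neg_lap_unbounded:
  assumes A: "coercive_matrix A c" and ne: "S \<noteq> {}"
  shows "\<exists>u\<in>test_functions S. L2_inner (lebesgue_on S) (neg_lap A u) (neg_lap A u) > N * L2_inner (lebesgue_on S) u u"
proof (rule ccontr)
  assume "\<not> ?thesis"
  then have bnd: "L2_inner (lebesgue_on S) (neg_lap A u) (neg_lap A u) \<le> N * L2_inner (lebesgue_on S) u u" if "u \<in> test_functions S" for u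
    using that by (auto simp: not_less)
  obtain i :: 'd where True by simp
  have c: "c > 0" using A by (simp add: coercive_matrix_def)
  \<comment> \<open>If \<open>neg_lap\<close> were bounded by \<open>sqrt \<bar>N\<bar>\<close> on
    test functions, coercivity and the Cauchy-Schwarz inequality would bound the partial derivative
    in direction \<open>i\<close>. \<open>K\<close> is the constant in that bound for norm
    squares.\<close>
  define K where "K = sqrt \<bar>N\<bar> / c"
  have grad: "L2_inner (lebesgue_on S) (partial i u) (partial i u) \<le> K * L2_inner (lebesgue_on S) u u" if u: "u \<in> test_functions S" for u
  proof -
    have uH: "u \<in> H1 S" by (rule test_H1[OF S u])
    have "L2_inner (lebesgue_on S) (partial i u) (partial i u) = L2_inner (lebesgue_on S) (wpartial S i u) (partial i u)"
      by (rule wpartial_test[OF S u test_L2[OF S test_functions_partial[OF u]], symmetric])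
    also have "\<dots> = L2_inner (lebesgue_on S) (partial i u) (wpartial S i u)" by (rule L2_inner_commute)
    also have "\<dots> = L2_inner (lebesgue_on S) (wpartial S i u) (wpartial S i u)"
      by (rule wpartial_test[OF S u wpartial_L2[OF S uH], symmetric])
    also have "\<dots> \<le> (\<Sum>i\<in>UNIV. L2_inner (lebesgue_on S) (wpartial S i u) (wpartial S i u))" by (rule member_le_sum) auto
    finally have "c * L2_inner (lebesgue_on S) (partial i u) (partial i u) \<le> hom_form S A u u"
      using hom_form_coercive[OF A uH] c by (meson mult_left_mono less_imp_le order_trans)
    also have "\<dots> = L2_inner (lebesgue_on S) (neg_lap A u) u" by (rule hom_form_test[OF u uH])
    also have "\<dots> \<le> sqrt \<bar>N\<bar> * L2_inner (lebesgue_on S) u u"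
    proof (rule power2_le_imp_le)
      have "(L2_inner (lebesgue_on S) (neg_lap A u) u)\<^sup>2 \<le> L2_inner (lebesgue_on S) (neg_lap A u) (neg_lap A u) * L2_inner (lebesgue_on S) u u"
        by (rule L2_cauchy_schwarz[OF neg_lap_L2[OF u] test_L2[OF S u]])
      also have "\<dots> \<le> (\<bar>N\<bar> * L2_inner (lebesgue_on S) u u) * L2_inner (lebesgue_on S) u u"
        using bnd[OF u] mult_right_mono[OF abs_ge_self[of N] L2_inner_nonneg[of "lebesgue_on S" u]] by (intro mult_right_mono) auto
      also have "\<dots> = (sqrt \<bar>N\<bar> * L2_inner (lebesgue_on S) u u)\<^sup>2" by (simp add: power_mult_distrib) (simp add: power2_eq_square)
      finally show "(L2_inner (lebesgue_on S) (neg_lap A u) u)\<^sup>2 \<le> (sqrt \<bar>N\<bar> * L2_inner (lebesgue_on S) u u)\<^sup>2" .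
    qed simp
    finally show ?thesis using c by (simp add: K_def field_simps)
  qed
  obtain a b where ab: "cbox a b \<subseteq> S" "box a b \<noteq> {}"
  proof -
    obtain x where x: "x \<in> S" using ne by auto
    obtain a b where "cbox a b \<subseteq> S" "x \<in> box a b" using open_contains_cbox[of S] S x
      by (metis)
    then show ?thesis using that by auto
  qed
  define \<phi> where "\<phi> = box_bump 1 a b"
  have \<phi>: "\<phi> \<in> test_functions S" "\<phi> \<in> smooth_alg"
    unfolding \<phi>_def using box_bump_test[of 1 a b S] box_bump_smooth ab(1) by auto
  have pos: "L2_inner (lebesgue_on S) \<phi> \<phi> > 0"
  proof (rule ccontr)
    assume "\<not> ?thesis"
    then have "L2_inner (lebesgue_on S) \<phi> \<phi> = 0" using L2_inner_nonneg[of "lebesgue_on S" \<phi>] by linarith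
    then have "AE x in (lebesgue_on S). \<phi> x = 0" by (rule L2_inner_self_eq_0[OF test_L2[OF S \<phi>(1)]])
    then have "AE x in lebesgue. x \<notin> box a b"
      unfolding AE_lebesgue_on[OF S_lebesgue[OF S]]
    proof eventually_elim
      case (elim x)
      then show ?case using box_bump_pos(1)[of 1 x a b] ab(1) box_subset_cbox[of a b] unfolding \<phi>_def by auto
    qed
    then have "box a b \<in> null_sets lebesgue" by (simp add: AE_iff_null)
    then have "negligible (box a b)" by (simp add: negligible_iff_null_sets)
    then show False using open_not_negligible[OF open_box] ab(2) by blast
  qed
  \<comment> \<open>The frequency is chosen so that \<open>k\<^sup>2\<close> exceeds
    \<open>K\<close>; the derivative bounds for the sine and the cosine version, added up, then
    contradict \<open>0 < L2_inner (lebesgue_on S) \<phi> \<phi>\<close>.\<close>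
  define k where "k = sqrt (\<bar>K\<bar> + 1)"
  have k2: "k\<^sup>2 = \<bar>K\<bar> + 1" by (simp add: k_def)
  define u1 where "u1 x = \<phi> x * sin (k * x $ i)" for x
  define u2 where "u2 x = \<phi> x * cos (k * x $ i)" for x
  have u: "u1 \<in> test_functions S" "u2 \<in> test_functions S"
    unfolding u1_def[abs_def] u2_def[abs_def]
    by (intro test_functions_combination \<phi> smooth_alg.sin smooth_alg.cos)+
  have ds: "(\<lambda>x. sin (k * x $ i)) differentiable (at x)" "(\<lambda>x. cos (k * x $ i)) differentiable (at x)" for x :: "real^'d"
    using smooth_alg_derivative[OF smooth_alg.sin[of k i]] smooth_alg_derivative[OF smooth_alg.cos[of k i]] by auto
  have p: "partial i u1 x = \<phi> x * (k * cos (k * x $ i)) + partial i \<phi> x * sin (k * x $ i)"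
    "partial i u2 x = \<phi> x * (- k * sin (k * x $ i)) + partial i \<phi> x * cos (k * x $ i)" for x
    unfolding u1_def[abs_def] u2_def[abs_def]
    using partial_mult[OF test_functions_differentiable[OF \<phi>(1)] ds(1), of i x]
      partial_mult[OF test_functions_differentiable[OF \<phi>(1)] ds(2), of i x] by (simp_all add: grad_sin grad_cos)
  have L: "u1 \<in> L2 (lebesgue_on S)" "u2 \<in> L2 (lebesgue_on S)" "partial i u1 \<in> L2 (lebesgue_on S)" "partial i u2 \<in> L2 (lebesgue_on S)" "\<phi> \<in> L2 (lebesgue_on S)" "partial i \<phi> \<in> L2 (lebesgue_on S)"
    by (intro test_L2[OF S] test_functions_partial u \<phi>)+
  have sc: "(sin t)\<^sup>2 * z + (cos t)\<^sup>2 * z = z" for t z :: real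
    by (simp flip: distrib_right)
  have e1: "L2_inner (lebesgue_on S) u1 u1 + L2_inner (lebesgue_on S) u2 u2 = L2_inner (lebesgue_on S) \<phi> \<phi>"
  proof -
    have "L2_inner (lebesgue_on S) u1 u1 + L2_inner (lebesgue_on S) u2 u2 = (LINT x|(lebesgue_on S). u1 x * u1 x + u2 x * u2 x)"
      unfolding L2_inner_def by (rule Bochner_Integration.integral_add[symmetric]; intro L2_mult_integrable L)
    also have "(\<lambda>x. u1 x * u1 x + u2 x * u2 x) = (\<lambda>x. \<phi> x * \<phi> x)"
      using sc[of "k * _ $ i" "(\<phi> _)\<^sup>2"] by (auto simp: fun_eq_iff u1_def u2_def power2_eq_square algebra_simps)
    finally show ?thesis by (simp add: L2_inner_def)
  qed
  have e2: "L2_inner (lebesgue_on S) (partial i u1) (partial i u1) + L2_inner (lebesgue_on S) (partial i u2) (partial i u2)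
      = L2_inner (lebesgue_on S) (partial i \<phi>) (partial i \<phi>) + k\<^sup>2 * L2_inner (lebesgue_on S) \<phi> \<phi>"
  proof -
    have "L2_inner (lebesgue_on S) (partial i u1) (partial i u1) + L2_inner (lebesgue_on S) (partial i u2) (partial i u2)
        = (LINT x|(lebesgue_on S). partial i u1 x * partial i u1 x + partial i u2 x * partial i u2 x)"
      unfolding L2_inner_def by (rule Bochner_Integration.integral_add[symmetric]; intro L2_mult_integrable L)
    also have "(\<lambda>x. partial i u1 x * partial i u1 x + partial i u2 x * partial i u2 x)
        = (\<lambda>x. partial i \<phi> x * partial i \<phi> x + k\<^sup>2 * (\<phi> x * \<phi> x))"
    proof
      fix x
      have "partial i u1 x * partial i u1 x + partial i u2 x * partial i u2 x =
        ((sin (k * x $ i))\<^sup>2 * ((partial i \<phi> x)\<^sup>2) + (cos (k * x $ i))\<^sup>2 * (partial i \<phi> x)\<^sup>2)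
        + ((sin (k * x $ i))\<^sup>2 * (k\<^sup>2 * (\<phi> x)\<^sup>2) + (cos (k * x $ i))\<^sup>2 * (k\<^sup>2 * (\<phi> x)\<^sup>2))"
        unfolding p by (simp add: power2_eq_square algebra_simps)
      then show "partial i u1 x * partial i u1 x + partial i u2 x * partial i u2 x = partial i \<phi> x * partial i \<phi> x + k\<^sup>2 * (\<phi> x * \<phi> x)"
        unfolding sc by (simp add: power2_eq_square)
    qed
    also have "(LINT x|(lebesgue_on S). partial i \<phi> x * partial i \<phi> x + k\<^sup>2 * (\<phi> x * \<phi> x))
        = L2_inner (lebesgue_on S) (partial i \<phi>) (partial i \<phi>) + k\<^sup>2 * L2_inner (lebesgue_on S) \<phi> \<phi>"
      using L2_mult_integrable[OF L(6,6)] L2_mult_integrable[OF L(5,5)] by (simp add: L2_inner_def)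
    finally show ?thesis .
  qed
  have "k\<^sup>2 * L2_inner (lebesgue_on S) \<phi> \<phi> \<le> K * (L2_inner (lebesgue_on S) u1 u1 + L2_inner (lebesgue_on S) u2 u2)"
    unfolding distrib_left
    using grad[OF u(1)] grad[OF u(2)] e2 L2_inner_nonneg[of "lebesgue_on S" "partial i \<phi>"] by linarith
  then have "(\<bar>K\<bar> + 1) * L2_inner (lebesgue_on S) \<phi> \<phi> \<le> K * L2_inner (lebesgue_on S) \<phi> \<phi>" unfolding e1 k2 .
  then show False using pos by (simp add: mult_le_cancel_right)
qed

end

section \<open>Lebesgue measure on products\<close>

text \<open>A function measurable for the completed Borel sets can be composed with a Borel map only
  if preimages of null sets are null. These are the maps along which Lebesgue measurability and
  statements almost everywhere can be pulled back.\<close>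

definition null_pres :: "('a::euclidean_space \<Rightarrow> 'b::euclidean_space) \<Rightarrow> bool" where
  "null_pres T \<longleftrightarrow> T \<in> borel_measurable borel \<and> (\<forall>N\<in>null_sets lborel. T -` N \<in> null_sets lborel)"

lemma lebesgue_measurable_AE_cong:
  fixes f g :: "'a::euclidean_space \<Rightarrow> real"
  assumes g: "g \<in> borel_measurable lebesgue" and ae: "AE x in lebesgue. f x = g x"
  shows "f \<in> borel_measurable lebesgue"
proof (rule measurableI)
  obtain N where N: "N \<in> null_sets lborel" "{x. f x \<noteq> g x} \<subseteq> N"
    using ae unfolding AE_completion_iff by (auto simp: eventually_ae_filter)
  fix A :: "real set" assume A: "A \<in> sets borel"
  have NL: "N \<in> sets lebesgue" using N(1) by auto
  have "f -` A \<inter> N \<in> sets lebesgue"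
    using N(1) by (auto intro: null_sets_completion_subset[of _ N lborel, THEN null_setsD2] null_sets_completionI)
  moreover have "g -` A \<inter> space lebesgue - N \<in> sets lebesgue"
    using measurable_sets[OF g A] NL by (rule sets.Diff)
  moreover have "f -` A \<inter> space lebesgue = (g -` A \<inter> space lebesgue - N) \<union> (f -` A \<inter> N)"
    using N(2) by auto
  ultimately show "f -` A \<inter> space lebesgue \<in> sets lebesgue" by (metis sets.Un)
qed simp

lemma lebesgue_borel_rep:
  fixes f :: "'a::euclidean_space \<Rightarrow> real"
  assumes "f \<in> borel_measurable lebesgue"
  obtains g where "g \<in> borel_measurable borel" "AE x in lborel. f x = g x"
  using completion_ex_borel_measurable_real[OF assms] by auto

lemma null_pres_AE:
  assumes "null_pres T" "AE x in lebesgue. P x"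
  shows "AE x in lebesgue. P (T x)"
proof -
  obtain N where N: "N \<in> null_sets lborel" "{x. \<not> P x} \<subseteq> N"
    using assms(2) unfolding AE_completion_iff by (auto simp: eventually_ae_filter)
  have "T -` N \<in> null_sets lborel" using assms(1) N(1) by (auto simp: null_pres_def)
  then have "AE x in lborel. P (T x)" by (rule AE_I') (use N(2) in auto)
  then show ?thesis by (rule AE_completion)
qed

lemma null_pres_measurable:
  fixes f :: "'b::euclidean_space \<Rightarrow> real"
  assumes T: "null_pres T" and f: "f \<in> borel_measurable lebesgue"
  shows "(\<lambda>x. f (T x)) \<in> borel_measurable lebesgue"
proof -
  obtain g where g: "g \<in> borel_measurable borel" "AE x in lborel. f x = g x" using lebesgue_borel_rep[OF f] .
  have Tm: "T \<in> borel_measurable borel" using T by (simp add: null_pres_def)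
  have "(\<lambda>x. g (T x)) \<in> borel_measurable lebesgue"
    by (rule borel_imp_lebesgue_measurable[OF measurable_compose[OF Tm g(1)]])
  moreover have "AE x in lebesgue. f (T x) = g (T x)"
    by (rule null_pres_AE[OF T AE_completion[OF g(2)]])
  ultimately show ?thesis by (rule lebesgue_measurable_AE_cong)
qed

lemma null_pres_comp: "null_pres T \<Longrightarrow> null_pres U \<Longrightarrow> null_pres (\<lambda>x. U (T x))"
  unfolding null_pres_def vimage_comp[of T U, unfolded comp_def, symmetric]
  by (blast intro: measurable_compose)

lemma null_pres_id: "null_pres (\<lambda>x. x)"
  by (simp add: null_pres_def)

lemma null_pres_shift: "null_pres (\<lambda>x. c + x)"
proof -
  have "(\<lambda>x. c + x) -` N \<in> null_sets lborel" if N: "N \<in> null_sets lborel" for N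
  proof -
    have "N \<in> null_sets (distr lborel borel ((+) c))" using N by (simp add: lborel_distr_plus)
    then show ?thesis by (subst (asm) null_sets_distr_iff) auto
  qed
  then show ?thesis by (simp add: null_pres_def)
qed

lemma null_pres_shift': "null_pres (\<lambda>x. x + c)"
  using null_pres_shift[of c] by (simp add: add.commute)

lemma null_sets_prod_iff:
  fixes N :: "('a::euclidean_space \<times> 'b::euclidean_space) set"
  assumes "N \<in> sets borel"
  shows "N \<in> null_sets lborel \<longleftrightarrow> (AE x in lborel. {y. (x, y) \<in> N} \<in> null_sets lborel)"
    and "N \<in> null_sets lborel \<longleftrightarrow> (AE y in lborel. {x. (x, y) \<in> N} \<in> null_sets lborel)"
proof -
  have N: "N \<in> sets (lborel \<Otimes>\<^sub>M lborel)" unfolding lborel_prod using assms by simp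
  have v: "Pair x -` N = {y. (x, y) \<in> N}" "(\<lambda>x. (x, y)) -` N = {x. (x, y) \<in> N}" for x y by auto
  have m: "{y. (x, y) \<in> N} \<in> sets lborel" "{x. (x, y) \<in> N} \<in> sets lborel" for x y
    using sets_Pair1[OF N, of x] sets_Pair2[OF N, of y] unfolding v by auto
  have "N \<in> null_sets lborel \<longleftrightarrow> emeasure (lborel \<Otimes>\<^sub>M lborel) N = 0"
    using assms by (simp add: null_sets_def lborel_prod)
  also have "\<dots> \<longleftrightarrow> (AE x in lborel. emeasure lborel (Pair x -` N) = 0)"
    unfolding lborel.emeasure_pair_measure_alt[OF N]
    by (rule nn_integral_0_iff_AE) (rule lborel.measurable_emeasure_Pair[OF N])
  finally show "N \<in> null_sets lborel \<longleftrightarrow> (AE x in lborel. {y. (x, y) \<in> N} \<in> null_sets lborel)"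
    unfolding v null_sets_def using m by simp
  have "N \<in> null_sets lborel \<longleftrightarrow> emeasure (lborel \<Otimes>\<^sub>M lborel) N = 0"
    using assms by (simp add: null_sets_def lborel_prod)
  also have "\<dots> \<longleftrightarrow> (AE y in lborel. emeasure lborel ((\<lambda>x. (x, y)) -` N) = 0)"
    unfolding lborel_pair.emeasure_pair_measure_alt2[OF N]
    by (rule nn_integral_0_iff_AE) (rule lborel_pair.measurable_emeasure_Pair2[OF N])
  finally show "N \<in> null_sets lborel \<longleftrightarrow> (AE y in lborel. {x. (x, y) \<in> N} \<in> null_sets lborel)"
    unfolding v null_sets_def using m by simp
qed

text \<open>By Tonelli's theorem a Borel set is null once its sections are, so only maps of one
  variable have to be checked.\<close>

lemma null_pres_sect_fst:
  fixes T :: "('a::euclidean_space \<times> 'b::euclidean_space) \<Rightarrow> 'c::euclidean_space"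
  assumes T: "T \<in> borel_measurable borel" and s: "\<And>y. null_pres (\<lambda>x. T (x, y))"
  shows "null_pres T"
  unfolding null_pres_def
proof (intro conjI T ballI)
  fix N :: "'c set" assume N: "N \<in> null_sets lborel"
  then have "T -` N \<in> sets borel" using T measurable_sets[of T borel borel N] by auto
  moreover have "{x. (x, y) \<in> T -` N} \<in> null_sets lborel" for y
    using s[of y] N by (auto simp: null_pres_def vimage_def)
  ultimately show "T -` N \<in> null_sets lborel" using null_sets_prod_iff(2) by blast
qed

lemma null_pres_sect_snd:
  fixes T :: "('a::euclidean_space \<times> 'b::euclidean_space) \<Rightarrow> 'c::euclidean_space"
  assumes T: "T \<in> borel_measurable borel" and s: "\<And>x. null_pres (\<lambda>y. T (x, y))"
  shows "null_pres T"
  unfolding null_pres_def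
proof (intro conjI T ballI)
  fix N :: "'c set" assume N: "N \<in> null_sets lborel"
  then have "T -` N \<in> sets borel" using T measurable_sets[of T borel borel N] by auto
  moreover have "{y. (x, y) \<in> T -` N} \<in> null_sets lborel" for x
    using s[of x] N by (auto simp: null_pres_def vimage_def)
  ultimately show "T -` N \<in> null_sets lborel" using null_sets_prod_iff(1) by blast
qed

lemma null_pres_fst: "null_pres (fst :: ('a::euclidean_space \<times> 'b::euclidean_space) \<Rightarrow> 'a)"
  by (rule null_pres_sect_fst) (auto simp: null_pres_id borel_prod[symmetric])

lemma null_pres_snd: "null_pres (snd :: ('a::euclidean_space \<times> 'b::euclidean_space) \<Rightarrow> 'b)"
  by (rule null_pres_sect_snd) (auto simp: null_pres_id borel_prod[symmetric])

text \<open>Covers maps that keep the first variable and move the second one depending on it, such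
  as \<open>(y, \<xi>)\<close> to \<open>(y, y + \<xi>)\<close>, by which kernels are rewritten in
  terms of the jump.\<close>

lemma null_pres_fibre:
  fixes g :: "'a::euclidean_space \<Rightarrow> 'b::euclidean_space \<Rightarrow> 'c::euclidean_space"
  assumes g: "(\<lambda>w. g (fst w) (snd w)) \<in> borel_measurable borel" and s: "\<And>x. null_pres (g x)"
  shows "null_pres (\<lambda>w. (fst w, g (fst w) (snd w)))"
  unfolding null_pres_def
proof (intro conjI ballI)
  show T: "(\<lambda>w. (fst w, g (fst w) (snd w))) \<in> borel_measurable borel"
    using g by (intro borel_measurable_Pair) (auto simp: borel_prod[symmetric])
  fix N :: "('a \<times> 'c) set" assume N: "N \<in> null_sets lborel"
  then have "(\<lambda>w. (fst w, g (fst w) (snd w))) -` N \<in> sets borel"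
    using T measurable_sets[of _ borel borel N] by fastforce
  moreover have "AE x in lborel. {y. (x, y) \<in> (\<lambda>w. (fst w, g (fst w) (snd w))) -` N} \<in> null_sets lborel"
  proof -
    have "AE x in lborel. {y. (x, y) \<in> N} \<in> null_sets lborel"
      using null_sets_prod_iff(1)[of N] N by auto
    then show ?thesis
    proof eventually_elim
      case (elim x)
      then have "g x -` {y. (x, y) \<in> N} \<in> null_sets lborel" using s[of x] by (auto simp: null_pres_def)
      then show ?case by (simp add: vimage_def)
    qed
  qed
  ultimately show "(\<lambda>w. (fst w, g (fst w) (snd w))) -` N \<in> null_sets lborel"
    using null_sets_prod_iff(1) by blast
qed

lemma null_pres_swap: "null_pres (prod.swap :: ('a::euclidean_space \<times> 'b::euclidean_space) \<Rightarrow> 'b \<times> 'a)"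
  unfolding null_pres_def
proof (intro conjI ballI)
  show T: "(prod.swap :: ('a \<times> 'b) \<Rightarrow> 'b \<times> 'a) \<in> borel_measurable borel"
    unfolding prod.swap_def[abs_def] by (intro borel_measurable_Pair) (auto simp: borel_prod[symmetric])
  fix N :: "('b \<times> 'a) set" assume N: "N \<in> null_sets lborel"
  then have m: "prod.swap -` N \<in> sets borel"
    using T measurable_sets[of _ borel borel N] by fastforce
  have "AE x in lborel. {y. (x, y) \<in> prod.swap -` N} \<in> null_sets lborel"
    using null_sets_prod_iff(2)[of N] N by auto
  then show "prod.swap -` N \<in> null_sets lborel" using null_sets_prod_iff(1)[OF m] by blast
qed

lemma null_pres_fibre':
  fixes g :: "'b::euclidean_space \<Rightarrow> 'a::euclidean_space \<Rightarrow> 'c::euclidean_space"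
  assumes g: "(\<lambda>w. g (fst w) (snd w)) \<in> borel_measurable borel" and s: "\<And>x. null_pres (g x)"
  shows "null_pres (\<lambda>w. (g (snd w) (fst w), snd w))"
  using null_pres_comp[OF null_pres_comp[OF null_pres_swap null_pres_fibre[OF g s]] null_pres_swap] by simp

section \<open>Tonelli and Fubini theorems for the completed measure\<close>

lemma AE_lebesgue_prod:
  fixes P :: "('a::euclidean_space \<times> 'b::euclidean_space) \<Rightarrow> bool"
  assumes "AE w in lebesgue. P w"
  shows "AE x in lebesgue. AE y in lebesgue. P (x, y)" and "AE y in lebesgue. AE x in lebesgue. P (x, y)"
proof -
  have *: "AE x in lebesgue. AE y in lebesgue. Q (x, y)" if "AE w in lebesgue. Q w" for Q :: "('c::euclidean_space \<times> 'd::euclidean_space) \<Rightarrow> bool"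
  proof -
    have "AE w in lborel. Q w" using that by (simp add: AE_completion_iff)
    then have "AE w in lborel \<Otimes>\<^sub>M lborel. Q w" by (simp only: lborel_prod)
    from lborel_pair.AE_pair[OF this] show ?thesis by (simp add: AE_completion_iff)
  qed
  show "AE x in lebesgue. AE y in lebesgue. P (x, y)" by (rule *[OF assms])
  show "AE y in lebesgue. AE x in lebesgue. P (x, y)"
    using *[OF null_pres_AE[OF null_pres_swap assms]] by simp
qed

lemma nn_integral_lebesgue_borel:
  fixes g :: "'a::euclidean_space \<Rightarrow> ennreal"
  shows "g \<in> borel_measurable borel \<Longrightarrow> (\<integral>\<^sup>+x. g x \<partial>lebesgue) = (\<integral>\<^sup>+x. g x \<partial>lborel)"
  by (rule nn_integral_completion)

context
  fixes f :: "('a::euclidean_space \<times> 'b::euclidean_space) \<Rightarrow> real"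
  assumes f: "f \<in> borel_measurable lebesgue"
begin

text \<open>Lebesgue measure on a product is not the product of the completed measures, and sections
  of a measurable function are measurable only almost everywhere. A Borel representative of
  \<open>f\<close> settles both points, since it agrees with \<open>f\<close> on almost every
  section; the next lemmas rest on the same exchange.\<close>

lemma lebesgue_section:
  "AE x in lebesgue. (\<lambda>y. f (x, y)) \<in> borel_measurable lebesgue"
  "AE y in lebesgue. (\<lambda>x. f (x, y)) \<in> borel_measurable lebesgue"
proof -
  obtain g where g: "g \<in> borel_measurable borel" "AE w in lborel. f w = g w" using lebesgue_borel_rep[OF f] .
  have gs: "(\<lambda>y. g (x, y)) \<in> borel_measurable lebesgue" "(\<lambda>x. g (x, y)) \<in> borel_measurable lebesgue" for x y
    using g(1) by (auto intro!: borel_imp_lebesgue_measurable measurable_compose[OF _ g(1)] simp: borel_prod[symmetric])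
  note ae = AE_lebesgue_prod[OF AE_completion[OF g(2)]]
  show "AE x in lebesgue. (\<lambda>y. f (x, y)) \<in> borel_measurable lebesgue"
    using ae(1) by eventually_elim (rule lebesgue_measurable_AE_cong[OF gs(1)])
  show "AE y in lebesgue. (\<lambda>x. f (x, y)) \<in> borel_measurable lebesgue"
    using ae(2) by eventually_elim (rule lebesgue_measurable_AE_cong[OF gs(2)])
qed

lemma lebesgue_param_integral:
  "(\<lambda>x. LINT y|lebesgue. f (x, y)) \<in> borel_measurable lebesgue"
  "(\<lambda>y. LINT x|lebesgue. f (x, y)) \<in> borel_measurable lebesgue"
proof -
  obtain g where g: "g \<in> borel_measurable borel" "AE w in lborel. f w = g w" using lebesgue_borel_rep[OF f] .
  have gp: "g \<in> borel_measurable (lborel \<Otimes>\<^sub>M lborel)" using g(1) by (simp add: lborel_prod)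
  have gs: "(\<lambda>y. g (x, y)) \<in> borel_measurable borel" "(\<lambda>x. g (x, y)) \<in> borel_measurable borel" for x y
    using g(1) by (auto intro!: measurable_compose[OF _ g(1)] simp: borel_prod[symmetric])
  note ae = AE_lebesgue_prod[OF AE_completion[OF g(2)]] and sec = lebesgue_section
  show "(\<lambda>x. LINT y|lebesgue. f (x, y)) \<in> borel_measurable lebesgue"
  proof (rule lebesgue_measurable_AE_cong)
    show "(\<lambda>x. LINT y|lborel. g (x, y)) \<in> borel_measurable lebesgue"
      using lborel.borel_measurable_lebesgue_integral[of "\<lambda>x y. g (x, y)" lborel] gp
      by (auto intro!: borel_imp_lebesgue_measurable)
    show "AE x in lebesgue. (LINT y|lebesgue. f (x, y)) = (LINT y|lborel. g (x, y))"
      using ae(1) sec(1)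
    proof eventually_elim
      case (elim x)
      then have "(LINT y|lebesgue. f (x, y)) = (LINT y|lebesgue. g (x, y))"
        by (intro integral_cong_AE[OF _ borel_imp_lebesgue_measurable[OF gs(1)]])
      then show ?case using gs(1)[of x] by (simp add: integral_completion)
    qed
  qed
  show "(\<lambda>y. LINT x|lebesgue. f (x, y)) \<in> borel_measurable lebesgue"
  proof (rule lebesgue_measurable_AE_cong)
    show "(\<lambda>y. LINT x|lborel. g (x, y)) \<in> borel_measurable lebesgue"
      using lborel.borel_measurable_lebesgue_integral[of "\<lambda>y x. g (x, y)" lborel] measurable_pair_swap[OF gp]
      by (auto intro!: borel_imp_lebesgue_measurable)
    show "AE y in lebesgue. (LINT x|lebesgue. f (x, y)) = (LINT x|lborel. g (x, y))"
      using ae(2) sec(2)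
    proof eventually_elim
      case (elim y)
      then have "(LINT x|lebesgue. f (x, y)) = (LINT x|lebesgue. g (x, y))"
        by (intro integral_cong_AE[OF _ borel_imp_lebesgue_measurable[OF gs(2)]])
      then show ?case using gs(2)[of y] by (simp add: integral_completion)
    qed
  qed
qed

lemma lebesgue_tonelli:
  "(\<integral>\<^sup>+w. ennreal (f w) \<partial>lebesgue) = (\<integral>\<^sup>+x. \<integral>\<^sup>+y. ennreal (f (x, y)) \<partial>lebesgue \<partial>lebesgue)"
  "(\<integral>\<^sup>+w. ennreal (f w) \<partial>lebesgue) = (\<integral>\<^sup>+y. \<integral>\<^sup>+x. ennreal (f (x, y)) \<partial>lebesgue \<partial>lebesgue)"
proof -
  obtain g where g: "g \<in> borel_measurable borel" "AE w in lborel. f w = g w" using lebesgue_borel_rep[OF f] .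
  have gp: "(\<lambda>w. ennreal (g w)) \<in> borel_measurable (lborel \<Otimes>\<^sub>M lborel)" using g(1) by (simp add: lborel_prod)
  have gs: "(\<lambda>y. ennreal (g (x, y))) \<in> borel_measurable borel" "(\<lambda>x. ennreal (g (x, y))) \<in> borel_measurable borel" for x y
    using g(1) by (auto intro!: measurable_compose[OF _ g(1)] simp: borel_prod[symmetric])
  note ae = AE_lebesgue_prod[OF AE_completion[OF g(2)]]
  have "(\<integral>\<^sup>+w. ennreal (f w) \<partial>lebesgue) = (\<integral>\<^sup>+w. ennreal (g w) \<partial>lebesgue)"
    by (rule nn_integral_cong_AE) (use AE_completion[OF g(2)] in eventually_elim, simp)
  also have "\<dots> = (\<integral>\<^sup>+w. ennreal (g w) \<partial>(lborel \<Otimes>\<^sub>M lborel))"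
    unfolding lborel_prod by (rule nn_integral_lebesgue_borel) (use g(1) in simp)
  finally have fg: "(\<integral>\<^sup>+w. ennreal (f w) \<partial>lebesgue) = (\<integral>\<^sup>+w. ennreal (g w) \<partial>(lborel \<Otimes>\<^sub>M lborel))" .
  also have "\<dots> = (\<integral>\<^sup>+x. \<integral>\<^sup>+y. ennreal (g (x, y)) \<partial>lborel \<partial>lborel)"
    by (rule lborel.nn_integral_fst[OF gp, symmetric])
  also have "\<dots> = (\<integral>\<^sup>+x. \<integral>\<^sup>+y. ennreal (g (x, y)) \<partial>lborel \<partial>lebesgue)"
    using lborel.borel_measurable_nn_integral_fst[OF gp] by (intro nn_integral_lebesgue_borel[symmetric]) simp
  also have "\<dots> = (\<integral>\<^sup>+x. \<integral>\<^sup>+y. ennreal (f (x, y)) \<partial>lebesgue \<partial>lebesgue)"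
  proof (rule nn_integral_cong_AE)
    show "AE x in lebesgue. (\<integral>\<^sup>+y. ennreal (g (x, y)) \<partial>lborel) = (\<integral>\<^sup>+y. ennreal (f (x, y)) \<partial>lebesgue)"
      using ae(1)
    proof eventually_elim
      case (elim x)
      have "(\<integral>\<^sup>+y. ennreal (g (x, y)) \<partial>lborel) = (\<integral>\<^sup>+y. ennreal (g (x, y)) \<partial>lebesgue)"
        by (rule nn_integral_lebesgue_borel[OF gs(1), symmetric])
      also have "\<dots> = (\<integral>\<^sup>+y. ennreal (f (x, y)) \<partial>lebesgue)"
        by (rule nn_integral_cong_AE) (use elim in eventually_elim, simp)
      finally show ?case .
    qed
  qed
  finally show "(\<integral>\<^sup>+w. ennreal (f w) \<partial>lebesgue) = (\<integral>\<^sup>+x. \<integral>\<^sup>+y. ennreal (f (x, y)) \<partial>lebesgue \<partial>lebesgue)" .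
  note fg
  also have "(\<integral>\<^sup>+w. ennreal (g w) \<partial>(lborel \<Otimes>\<^sub>M lborel)) = (\<integral>\<^sup>+y. \<integral>\<^sup>+x. ennreal (g (x, y)) \<partial>lborel \<partial>lborel)"
    by (rule lborel_pair.nn_integral_snd[OF gp, symmetric])
  also have "\<dots> = (\<integral>\<^sup>+y. \<integral>\<^sup>+x. ennreal (g (x, y)) \<partial>lborel \<partial>lebesgue)"
    using lborel.borel_measurable_nn_integral_fst[OF measurable_pair_swap[OF gp]]
    by (intro nn_integral_lebesgue_borel[symmetric]) simp
  also have "\<dots> = (\<integral>\<^sup>+y. \<integral>\<^sup>+x. ennreal (f (x, y)) \<partial>lebesgue \<partial>lebesgue)"
  proof (rule nn_integral_cong_AE)
    show "AE y in lebesgue. (\<integral>\<^sup>+x. ennreal (g (x, y)) \<partial>lborel) = (\<integral>\<^sup>+x. ennreal (f (x, y)) \<partial>lebesgue)"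
      using ae(2)
    proof eventually_elim
      case (elim y)
      have "(\<integral>\<^sup>+x. ennreal (g (x, y)) \<partial>lborel) = (\<integral>\<^sup>+x. ennreal (g (x, y)) \<partial>lebesgue)"
        by (rule nn_integral_lebesgue_borel[OF gs(2), symmetric])
      also have "\<dots> = (\<integral>\<^sup>+x. ennreal (f (x, y)) \<partial>lebesgue)"
        by (rule nn_integral_cong_AE) (use elim in eventually_elim, simp)
      finally show ?case .
    qed
  qed
  finally show "(\<integral>\<^sup>+w. ennreal (f w) \<partial>lebesgue) = (\<integral>\<^sup>+y. \<integral>\<^sup>+x. ennreal (f (x, y)) \<partial>lebesgue \<partial>lebesgue)" .
qed

end

lemma lebesgue_fubini:
  fixes f :: "('a::euclidean_space \<times> 'b::euclidean_space) \<Rightarrow> real"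
  assumes f: "integrable lebesgue f"
  shows "AE x in lebesgue. integrable lebesgue (\<lambda>y. f (x, y))"
    and "integrable lebesgue (\<lambda>x. LINT y|lebesgue. f (x, y))"
    and "(LINT x|lebesgue. (LINT y|lebesgue. f (x, y))) = (LINT w|lebesgue. f w)"
proof -
  have fm: "f \<in> borel_measurable lebesgue" using f by auto
  obtain g where g: "g \<in> borel_measurable borel" "AE w in lborel. f w = g w" using lebesgue_borel_rep[OF fm] .
  have gs: "(\<lambda>y. g (x, y)) \<in> borel_measurable borel" for x
    using g(1) by (auto intro!: measurable_compose[OF _ g(1)] simp: borel_prod[symmetric])
  note ae = AE_lebesgue_prod(1)[OF AE_completion[OF g(2)]] and sec = lebesgue_section(1)[OF fm]
  have gL: "g \<in> borel_measurable lebesgue" by (rule borel_imp_lebesgue_measurable[OF g(1)])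
  have "integrable lebesgue g"
    using integrable_cong_AE[OF fm gL AE_completion[OF g(2)]] f by simp
  then have gi: "integrable (lborel \<Otimes>\<^sub>M lborel) g"
    using g(1) integrable_completion[of g lborel] by (simp add: lborel_prod)
  have eq: "AE x in lebesgue. (LINT y|lebesgue. f (x, y)) = (LINT y|lborel. g (x, y)) \<and> (integrable lborel (\<lambda>y. g (x, y)) \<longrightarrow> integrable lebesgue (\<lambda>y. f (x, y)))"
    using ae sec
  proof eventually_elim
    case (elim x)
    have gx: "(\<lambda>y. g (x, y)) \<in> borel_measurable lebesgue" by (rule borel_imp_lebesgue_measurable[OF gs])
    have "(LINT y|lebesgue. f (x, y)) = (LINT y|lebesgue. g (x, y))"
      using elim by (intro integral_cong_AE gx)
    moreover have "integrable lebesgue (\<lambda>y. f (x, y)) \<longleftrightarrow> integrable lebesgue (\<lambda>y. g (x, y))"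
      using elim by (intro integrable_cong_AE gx)
    ultimately show ?case using gs[of x] by (simp add: integral_completion integrable_completion)
  qed
  have "AE x in lebesgue. integrable lborel (\<lambda>y. g (x, y))"
    by (rule AE_completion[OF lborel_pair.AE_integrable_fst'[OF gi]])
  with eq show "AE x in lebesgue. integrable lebesgue (\<lambda>y. f (x, y))"
    by eventually_elim simp
  have m1: "(\<lambda>x. LINT y|lebesgue. f (x, y)) \<in> borel_measurable lebesgue" by (rule lebesgue_param_integral(1)[OF fm])
  have gi2: "integrable lborel (\<lambda>x. LINT y|lborel. g (x, y))" by (rule lborel_pair.integrable_fst'[OF gi])
  then have m2': "(\<lambda>x. LINT y|lborel. g (x, y)) \<in> borel_measurable lborel" by auto
  then have m2: "(\<lambda>x. LINT y|lborel. g (x, y)) \<in> borel_measurable lebesgue" by (simp add: measurable_completion)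
  have eq1: "AE x in lebesgue. (LINT y|lebesgue. f (x, y)) = (LINT y|lborel. g (x, y))" using eq by eventually_elim simp
  show "integrable lebesgue (\<lambda>x. LINT y|lebesgue. f (x, y))"
    using integrable_cong_AE[OF m1 m2 eq1] gi2 integrable_completion[OF m2'] by simp
  have "(LINT x|lebesgue. (LINT y|lebesgue. f (x, y))) = (LINT x|lebesgue. (LINT y|lborel. g (x, y)))"
    by (rule integral_cong_AE[OF m1 m2 eq1])
  also have "\<dots> = (LINT x|lborel. (LINT y|lborel. g (x, y)))" by (rule integral_completion[OF m2'])
  also have "\<dots> = (LINT w|lborel. g w)" using lborel_pair.integral_fst'[OF gi] by (simp add: lborel_prod)
  also have "\<dots> = (LINT w|lebesgue. g w)" using g(1) by (simp add: integral_completion)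
  also have "\<dots> = (LINT w|lebesgue. f w)"
    by (rule integral_cong_AE[OF gL fm]) (use AE_completion[OF g(2)] in eventually_elim, simp)
  finally show "(LINT x|lebesgue. (LINT y|lebesgue. f (x, y))) = (LINT w|lebesgue. f w)" .
qed

lemma lebesgue_swap:
  fixes f :: "('a::euclidean_space \<times> 'b::euclidean_space) \<Rightarrow> real"
  assumes f: "integrable lebesgue f"
  shows "integrable lebesgue (\<lambda>w. f (prod.swap w))" and "(LINT w|lebesgue. f (prod.swap w)) = (LINT w|lebesgue. f w)"
proof -
  have fm: "f \<in> borel_measurable lebesgue" using f by auto
  have sm: "(\<lambda>w. f (prod.swap w)) \<in> borel_measurable lebesgue" by (rule null_pres_measurable[OF null_pres_swap fm])
  have nn: "(\<integral>\<^sup>+w. ennreal (h (prod.swap w)) \<partial>lebesgue) = (\<integral>\<^sup>+w. ennreal (h w) \<partial>lebesgue)"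
    if "h \<in> borel_measurable lebesgue" for h :: "('a \<times> 'b) \<Rightarrow> real"
    using lebesgue_tonelli(1)[OF null_pres_measurable[OF null_pres_swap that]] lebesgue_tonelli(2)[OF that] by simp
  show i: "integrable lebesgue (\<lambda>w. f (prod.swap w))"
    using f sm nn[of "\<lambda>w. norm (f w)"] fm by (simp add: integrable_iff_bounded)
  show "(LINT w|lebesgue. f (prod.swap w)) = (LINT w|lebesgue. f w)"
    using nn[OF fm] nn[of "\<lambda>w. - f w"] fm by (simp add: real_lebesgue_integral_def[OF f] real_lebesgue_integral_def[OF i])
qed

section \<open>Iterated integrals over rectangles\<close>

lemma nn_integral_lebesgue_on:
  fixes f :: "'c::euclidean_space \<Rightarrow> real"
  assumes "C \<in> sets lebesgue"
  shows "(\<integral>\<^sup>+x. ennreal (f x) \<partial>lebesgue_on C) = (\<integral>\<^sup>+x. ennreal (indicat_real C x * f x) \<partial>lebesgue)"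
  using assms by (auto simp: nn_integral_restrict_space indicator_def intro!: nn_integral_cong)

context
  fixes A :: "'a::euclidean_space set" and B :: "'b::euclidean_space set" and f :: "'a \<times> 'b \<Rightarrow> real"
  assumes A: "A \<in> sets borel" and B: "B \<in> sets borel"
begin

lemma leb_sets: "A \<in> sets lebesgue" "B \<in> sets lebesgue" "A \<times> B \<in> sets lebesgue"
  using A B by (auto intro!: sets_completionI_sets borel_Times)

lemma AE_prod_on:
  assumes "AE w in lebesgue_on (A \<times> B). P w"
  shows "AE x in lebesgue_on A. AE y in lebesgue_on B. P (x, y)"
  using AE_lebesgue_prod(1)[OF assms[unfolded AE_lebesgue_on[OF leb_sets(3)]]]
  unfolding AE_lebesgue_on[OF leb_sets(1)] AE_lebesgue_on[OF leb_sets(2)]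
  by eventually_elim (auto elim!: eventually_mono)

lemma ext_measurable:
  assumes "f \<in> borel_measurable (lebesgue_on (A \<times> B))"
  shows "(\<lambda>w. indicat_real (A \<times> B) w * f w) \<in> borel_measurable lebesgue"
  using assms by (simp add: measurable_lebesgue_on[OF leb_sets(3)])

lemma section_on:
  assumes f: "f \<in> borel_measurable (lebesgue_on (A \<times> B))"
  shows "AE x in lebesgue_on A. (\<lambda>y. f (x, y)) \<in> borel_measurable (lebesgue_on B)"
  using lebesgue_section(1)[OF ext_measurable[OF f]]
  unfolding AE_lebesgue_on[OF leb_sets(1)] measurable_lebesgue_on[OF leb_sets(2)]
  by eventually_elim (auto simp: indicator_times)

lemma param_integral_on:
  assumes f: "f \<in> borel_measurable (lebesgue_on (A \<times> B))"
  shows "(\<lambda>x. LINT y|lebesgue_on B. f (x, y)) \<in> borel_measurable (lebesgue_on A)"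
  using lebesgue_param_integral(1)[OF ext_measurable[OF f]]
  unfolding measurable_lebesgue_on[OF leb_sets(1)] integral_lebesgue_on[OF leb_sets(2)]
  by (simp add: indicator_times mult.assoc)

lemma tonelli_on:
  assumes f: "f \<in> borel_measurable (lebesgue_on (A \<times> B))"
  shows "(\<integral>\<^sup>+w. ennreal (f w) \<partial>lebesgue_on (A \<times> B)) = (\<integral>\<^sup>+x. \<integral>\<^sup>+y. ennreal (f (x, y)) \<partial>lebesgue_on B \<partial>lebesgue_on A)"
    and "(\<integral>\<^sup>+w. ennreal (f w) \<partial>lebesgue_on (A \<times> B)) = (\<integral>\<^sup>+y. \<integral>\<^sup>+x. ennreal (f (x, y)) \<partial>lebesgue_on A \<partial>lebesgue_on B)"
proof -
  have 0: "(\<integral>\<^sup>+w. ennreal (f w) \<partial>lebesgue_on (A \<times> B)) = (\<integral>\<^sup>+w. ennreal (indicat_real (A \<times> B) w * f w) \<partial>lebesgue)"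
    by (rule nn_integral_lebesgue_on[OF leb_sets(3)])
  show "(\<integral>\<^sup>+w. ennreal (f w) \<partial>lebesgue_on (A \<times> B)) = (\<integral>\<^sup>+x. \<integral>\<^sup>+y. ennreal (f (x, y)) \<partial>lebesgue_on B \<partial>lebesgue_on A)"
    unfolding 0 lebesgue_tonelli(1)[OF ext_measurable[OF f]] nn_integral_lebesgue_on[OF leb_sets(2)]
    using leb_sets(1) by (auto simp: nn_integral_restrict_space indicator_def intro!: nn_integral_cong)
  show "(\<integral>\<^sup>+w. ennreal (f w) \<partial>lebesgue_on (A \<times> B)) = (\<integral>\<^sup>+y. \<integral>\<^sup>+x. ennreal (f (x, y)) \<partial>lebesgue_on A \<partial>lebesgue_on B)"
    unfolding 0 lebesgue_tonelli(2)[OF ext_measurable[OF f]] nn_integral_lebesgue_on[OF leb_sets(1)]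
    using leb_sets(2) by (auto simp: nn_integral_restrict_space indicator_def intro!: nn_integral_cong)
qed

lemma fubini_on:
  assumes f: "integrable (lebesgue_on (A \<times> B)) f"
  shows "AE x in lebesgue_on A. integrable (lebesgue_on B) (\<lambda>y. f (x, y))"
    and "integrable (lebesgue_on A) (\<lambda>x. LINT y|lebesgue_on B. f (x, y))"
    and "(LINT x|lebesgue_on A. (LINT y|lebesgue_on B. f (x, y))) = (LINT w|lebesgue_on (A \<times> B). f w)"
proof -
  have F: "integrable lebesgue (\<lambda>w. indicat_real (A \<times> B) w * f w)"
    using f by (simp add: integrable_lebesgue_on[OF leb_sets(3)])
  have eq: "indicat_real (A \<times> B) (x, y) * f (x, y) = indicat_real A x * (indicat_real B y * f (x, y))" for x y
    by (simp add: indicator_times)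
  note L = lebesgue_fubini[OF F, unfolded eq]
  show "AE x in lebesgue_on A. integrable (lebesgue_on B) (\<lambda>y. f (x, y))"
    using L(1) unfolding AE_lebesgue_on[OF leb_sets(1)] integrable_lebesgue_on[OF leb_sets(2)]
    by eventually_elim auto
  show "integrable (lebesgue_on A) (\<lambda>x. LINT y|lebesgue_on B. f (x, y))"
    using L(2) unfolding integrable_lebesgue_on[OF leb_sets(1)] integral_lebesgue_on[OF leb_sets(2)] by simp
  show "(LINT x|lebesgue_on A. (LINT y|lebesgue_on B. f (x, y))) = (LINT w|lebesgue_on (A \<times> B). f w)"
    using L(3) unfolding integral_lebesgue_on[OF leb_sets(1)] integral_lebesgue_on[OF leb_sets(2)] integral_lebesgue_on[OF leb_sets(3)] by simp
qed

end

lemma swap_on: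
  fixes A :: "'a::euclidean_space set" and B :: "'b::euclidean_space set" and f :: "'a \<times> 'b \<Rightarrow> real"
  assumes A: "A \<in> sets borel" and B: "B \<in> sets borel" and f: "integrable (lebesgue_on (A \<times> B)) f"
  shows "integrable (lebesgue_on (B \<times> A)) (\<lambda>w. f (prod.swap w))"
    and "(LINT w|lebesgue_on (B \<times> A). f (prod.swap w)) = (LINT w|lebesgue_on (A \<times> B). f w)"
proof -
  have F: "integrable lebesgue (\<lambda>w. indicat_real (A \<times> B) w * f w)"
    using f by (simp add: integrable_lebesgue_on[OF leb_sets(3)[OF A B]])
  have eq: "indicat_real (A \<times> B) (prod.swap w) = indicat_real (B \<times> A) w" for w
    by (cases w) (auto simp: indicator_def)
  show "integrable (lebesgue_on (B \<times> A)) (\<lambda>w. f (prod.swap w))"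
    using lebesgue_swap(1)[OF F] unfolding eq integrable_lebesgue_on[OF leb_sets(3)[OF B A]] .
  show "(LINT w|lebesgue_on (B \<times> A). f (prod.swap w)) = (LINT w|lebesgue_on (A \<times> B). f w)"
    using lebesgue_swap(2)[OF F] unfolding eq integral_lebesgue_on[OF leb_sets(3)[OF B A]] integral_lebesgue_on[OF leb_sets(3)[OF A B]] .
qed

lemma fubini_on':
  fixes A :: "'a::euclidean_space set" and B :: "'b::euclidean_space set" and f :: "'a \<times> 'b \<Rightarrow> real"
  assumes A: "A \<in> sets borel" and B: "B \<in> sets borel" and f: "integrable (lebesgue_on (A \<times> B)) f"
  shows "(LINT y|lebesgue_on B. (LINT x|lebesgue_on A. f (x, y))) = (LINT w|lebesgue_on (A \<times> B). f w)"
  using fubini_on(3)[OF B A swap_on(1)[OF A B f]] swap_on(2)[OF A B f] by simp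

lemma integrable_iff_nn:
  fixes f :: "'a \<Rightarrow> real"
  shows "integrable M f \<longleftrightarrow> f \<in> borel_measurable M \<and> (\<integral>\<^sup>+x. ennreal \<bar>f x\<bar> \<partial>M) < \<infinity>"
  by (simp add: integrable_iff_bounded)

section \<open>Periodic functions\<close>

definition frac_vec :: "real^'d \<Rightarrow> real^'d" where
  "frac_vec y = (\<chi> i. y $ i - of_int \<lfloor>y $ i\<rfloor>)"

lemma frac_vec_eq: "frac_vec y = y + lattice_vec (\<chi> i. - \<lfloor>y $ i\<rfloor>)"
  by (simp add: frac_vec_def lattice_vec_def vec_eq_iff)

lemma frac_vec_cell: "frac_vec y \<in> cell"
  by (auto simp: frac_vec_def cell_def) linarith+

lemma frac_vec_id: "y \<in> cell \<Longrightarrow> frac_vec y = y"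
proof -
  assume "y \<in> cell"
  then have "\<lfloor>y $ i\<rfloor> = 0" for i by (simp add: cell_def floor_eq_iff)
  then show ?thesis by (simp add: frac_vec_def vec_eq_iff)
qed

lemma lattice_vec_uminus: "lattice_vec (- m) = - lattice_vec m"
  by (simp add: lattice_vec_def vec_eq_iff)

lemma cell_lattice_unique:
  assumes "y + lattice_vec m \<in> cell" "y + lattice_vec n \<in> cell"
  shows "m = n"
proof -
  have "m $ i = n $ i" for i
  proof -
    have "0 \<le> y $ i + of_int (m $ i)" "y $ i + of_int (m $ i) < 1" "0 \<le> y $ i + of_int (n $ i)" "y $ i + of_int (n $ i) < 1"
      using assms by (auto simp: cell_def lattice_vec_def)
    then have "real_of_int (m $ i) - of_int (n $ i) < 1" "real_of_int (n $ i) - of_int (m $ i) < 1" by linarith+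
    then show ?thesis by linarith
  qed
  then show ?thesis by (simp add: vec_eq_iff)
qed

lemma periodicD: "periodic f \<Longrightarrow> f (x + lattice_vec m) = f x"
  by (simp add: periodic_def)

lemma periodic_frac: "periodic f \<Longrightarrow> f (frac_vec y) = f y"
  by (simp add: frac_vec_eq periodicD)

lemma vec_borel_measurable:
  fixes f :: "'a \<Rightarrow> real^'d"
  assumes "\<And>i. (\<lambda>x. f x $ i) \<in> borel_measurable M"
  shows "f \<in> borel_measurable M"
  using assms by (subst borel_measurable_euclidean_space) (auto simp: Basis_vec_def inner_axis)

lemma frac_vec_measurable: "frac_vec \<in> borel_measurable borel"
proof (rule vec_borel_measurable)
  fix i
  have "(\<lambda>y::real^'a. y $ i) \<in> borel_measurable borel"
    by (intro borel_measurable_continuous_onI continuous_intros)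
  then show "(\<lambda>y. frac_vec y $ i) \<in> borel_measurable borel"
    unfolding frac_vec_def by simp
qed

lemma cell_borel [simp]: "cell \<in> sets borel"
proof -
  have "(\<lambda>y::real^'a. y $ i) \<in> borel_measurable borel" for i
    by (intro borel_measurable_continuous_onI continuous_intros)
  note [measurable] = this
  have "cell = (\<Inter>i. {y \<in> space borel. 0 \<le> (y::real^'a) $ i \<and> y $ i < 1})" by (auto simp: cell_def)
  also have "\<dots> \<in> sets borel" by (intro sets.finite_INT) auto
  finally show ?thesis .
qed

lemma cell_lebesgue [simp]: "cell \<in> sets lebesgue"
  using cell_borel by (intro sets_completionI_sets) simp

lemma emeasure_cell: "emeasure lebesgue (cell :: (real^'d) set) = 1"
proof -
  have b: "(1 :: real^'d) \<bullet> b = 1" if "b \<in> Basis" for b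
    using that by (auto simp: Basis_vec_def inner_axis)
  have 1: "emeasure lborel (box 0 (1 :: real^'d)) = 1" "emeasure lborel (cbox 0 (1 :: real^'d)) = 1"
    by (simp_all add: emeasure_lborel_box_eq emeasure_lborel_cbox_eq b)
  have "emeasure lborel (box 0 (1 :: real^'d)) \<le> emeasure lborel (cell :: (real^'d) set)"
    by (rule emeasure_mono) (auto simp: mem_box_cart cell_def less_imp_le)
  moreover have "emeasure lborel (cell :: (real^'d) set) \<le> emeasure lborel (cbox 0 (1 :: real^'d))"
    by (rule emeasure_mono) (auto simp: mem_box_cart cell_def less_imp_le)
  ultimately have "emeasure lborel (cell :: (real^'d) set) = 1" using 1 by auto
  then show ?thesis by (simp add: emeasure_completion)
qed

text \<open>At each point \<open>frac_vec\<close> acts as one of countably many lattice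
  translations, so a preimage lies in a countable union of translates.\<close>

lemma null_pres_frac: "null_pres (frac_vec :: real^'d \<Rightarrow> real^'d)"
  unfolding null_pres_def
proof (intro conjI frac_vec_measurable ballI)
  fix N :: "(real^'d) set" assume N: "N \<in> null_sets lborel"
  have m: "frac_vec -` N \<in> sets lborel"
    using measurable_sets[OF frac_vec_measurable, of N] N by auto
  have "(\<Union>m. (\<lambda>y. y + lattice_vec m) -` N) \<in> null_sets lborel"
  proof (rule null_sets_UN')
    fix m show "(\<lambda>y. y + lattice_vec m) -` N \<in> null_sets lborel"
      using null_pres_shift'[of "lattice_vec m"] N by (auto simp: null_pres_def)
  qed simp
  moreover have "frac_vec -` N \<subseteq> (\<Union>m. (\<lambda>y. y + lattice_vec m) -` N)"
    by (auto simp: frac_vec_eq)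
  ultimately show "frac_vec -` N \<in> null_sets lborel" using m by (meson null_sets_subset)
qed

text \<open>A periodic function is its restriction to the cell composed with
  \<open>frac_vec\<close>, so \<open>null_pres_frac\<close> carries measurability from the cell to
  the whole space.\<close>

lemma periodic_measurable:
  fixes f :: "real^'d \<Rightarrow> real"
  assumes "periodic f" "f \<in> borel_measurable (lebesgue_on cell)"
  shows "f \<in> borel_measurable lebesgue"
proof -
  have "(\<lambda>y. indicat_real cell (frac_vec y) * f (frac_vec y)) \<in> borel_measurable lebesgue"
    using assms(2) by (intro null_pres_measurable[OF null_pres_frac, of "\<lambda>y. indicat_real cell y * f y"]) (simp add: measurable_lebesgue_on)
  then show ?thesis by (simp add: frac_vec_cell periodic_frac[OF assms(1)])
qed

lemma periodic_AE:
  assumes "periodic P" "AE y in lebesgue_on cell. P y"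
  shows "AE y in lebesgue. P y"
  using null_pres_AE[OF null_pres_frac, of "\<lambda>y. y \<in> cell \<longrightarrow> P y"] assms
  by (simp add: AE_lebesgue_on frac_vec_cell periodic_frac)

lemma nn_integral_lebesgue_shift:
  fixes f :: "'a::euclidean_space \<Rightarrow> real"
  assumes f: "f \<in> borel_measurable lebesgue"
  shows "(\<integral>\<^sup>+x. ennreal (f (x + c)) \<partial>lebesgue) = (\<integral>\<^sup>+x. ennreal (f x) \<partial>lebesgue)"
proof -
  obtain g where g: "g \<in> borel_measurable borel" "AE w in lborel. f w = g w" using lebesgue_borel_rep[OF f] .
  have ae: "AE w in lebesgue. f w = g w" by (rule AE_completion[OF g(2)])
  have gc: "(\<lambda>x. g (x + c)) \<in> borel_measurable borel" using g(1) by measurable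
  have "(\<integral>\<^sup>+x. ennreal (f (x + c)) \<partial>lebesgue) = (\<integral>\<^sup>+x. ennreal (g (x + c)) \<partial>lebesgue)"
    by (rule nn_integral_cong_AE) (use null_pres_AE[OF null_pres_shift' ae, of c] in eventually_elim, simp)
  also have "\<dots> = (\<integral>\<^sup>+x. ennreal (g (x + c)) \<partial>lborel)" using gc by (intro nn_integral_lebesgue_borel) simp
  also have "\<dots> = (\<integral>\<^sup>+x. ennreal (g x) \<partial>distr lborel borel ((+) c))"
    using g(1) by (subst nn_integral_distr) (auto simp: add.commute)
  also have "\<dots> = (\<integral>\<^sup>+x. ennreal (g x) \<partial>lborel)" by (simp add: lborel_distr_plus)
  also have "\<dots> = (\<integral>\<^sup>+x. ennreal (g x) \<partial>lebesgue)" using g(1) by (intro nn_integral_lebesgue_borel[symmetric]) simp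
  also have "\<dots> = (\<integral>\<^sup>+x. ennreal (f x) \<partial>lebesgue)"
    by (rule nn_integral_cong_AE) (use ae in eventually_elim, simp)
  finally show ?thesis .
qed

text \<open>The shifted cell and the cell itself are cut into countably many pieces that match up
  under lattice translations, and these preserve the measure with the periodic density
  \<open>g\<close>.\<close>

lemma nn_integral_cell_shift:
  fixes g :: "real^'d \<Rightarrow> real"
  assumes g: "g \<in> borel_measurable lebesgue" and per: "periodic g"
  shows "(\<integral>\<^sup>+y. ennreal (g (y + c)) \<partial>lebesgue_on cell) = (\<integral>\<^sup>+y. ennreal (g y) \<partial>lebesgue_on cell)"
proof -
  let ?M = "density lebesgue (\<lambda>y. ennreal (g y))"
  have sh: "{y. y + b \<in> X} \<in> sets lebesgue" if X: "X \<in> sets borel" for X and b :: "real^'d"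
  proof -
    have "(\<lambda>y. y + b) -` X \<inter> space borel \<in> sets borel" by (rule measurable_sets[OF _ X]) simp
    then have "{y. y + b \<in> X} \<in> sets borel" by (simp add: vimage_def)
    then show ?thesis by (simp add: sets_completionI_sets)
  qed
  have em: "emeasure ?M X = (\<integral>\<^sup>+y. ennreal (indicat_real X y * g y) \<partial>lebesgue)" if "X \<in> sets lebesgue" for X
    using that g by (subst emeasure_density) (auto intro!: nn_integral_cong simp: indicator_def)
  have inv: "emeasure ?M {y. y + lattice_vec m \<in> X} = emeasure ?M X" if X: "X \<in> sets lebesgue" "{y. y + lattice_vec m \<in> X} \<in> sets lebesgue" for X m
  proof -
    have Xm: "(\<lambda>y. indicat_real X y * g y) \<in> borel_measurable lebesgue" using X g by (intro borel_measurable_times) auto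
    have "emeasure ?M X = (\<integral>\<^sup>+y. ennreal (indicat_real X (y + lattice_vec m) * g (y + lattice_vec m)) \<partial>lebesgue)"
      unfolding em[OF X(1)] by (rule nn_integral_lebesgue_shift[OF Xm, symmetric])
    also have "\<dots> = emeasure ?M {y. y + lattice_vec m \<in> X}"
      unfolding em[OF X(2)] using periodicD[OF per] by (intro nn_integral_cong) (simp add: indicator_def)
    finally show ?thesis ..
  qed
  let ?C = "{y. y + (- c) \<in> cell}"
  \<comment> \<open>\<open>?X m\<close> is the part of the shifted cell that the lattice vector of
    \<open>m\<close> moves into the cell, and \<open>?Y m\<close> is its image there.\<close>
  let ?X = "\<lambda>m. {y. y + (- c) \<in> cell \<and> y + lattice_vec m \<in> cell}"
  let ?Y = "\<lambda>m. {y. y - lattice_vec m + (- c) \<in> cell \<and> y \<in> cell}"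
  have Xs: "?X m \<in> sets lebesgue" for m
    using sets.Int[OF sh[OF cell_borel, of "- c"] sh[OF cell_borel, of "lattice_vec m"]] by (simp add: Collect_conj_eq)
  have Ys: "?Y m \<in> sets lebesgue" for m
    using sets.Int[OF sh[OF cell_borel, of "- lattice_vec m - c"] cell_lebesgue] by (simp add: Collect_conj_eq algebra_simps)
  have "\<exists>m. y + lattice_vec m \<in> cell" for y :: "real^'d"
    using frac_vec_cell[of y] unfolding frac_vec_eq by blast
  then have "(\<Union>m. ?X m) = ?C" by blast
  moreover have "disjoint_family ?X"
    unfolding disjoint_family_on_def using cell_lattice_unique by blast
  ultimately have 1: "emeasure ?M ?C = (\<integral>\<^sup>+m. emeasure ?M (?X m) \<partial>count_space UNIV)"
    using emeasure_UN_countable[of UNIV ?X ?M] Xs by simp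
  have "(\<Union>m. ?Y m) = cell"
  proof -
    have "\<exists>m. y - lattice_vec m + (- c) \<in> cell" for y
      using frac_vec_cell[of "y - c"] unfolding frac_vec_eq
      by (intro exI[of _ "- (\<chi> i. - \<lfloor>(y - c) $ i\<rfloor>)"]) (simp only: lattice_vec_uminus, simp add: algebra_simps)
    then show ?thesis by blast
  qed
  moreover have "disjoint_family ?Y"
  proof -
    have "m = n" if "y - lattice_vec m + (- c) \<in> cell" "y - lattice_vec n + (- c) \<in> cell" for y m n
      using cell_lattice_unique[of "y - c" "- m" "- n"] that by (simp add: lattice_vec_uminus algebra_simps)
    then show ?thesis unfolding disjoint_family_on_def by blast
  qed
  ultimately have 2: "emeasure ?M cell = (\<integral>\<^sup>+m. emeasure ?M (?Y m) \<partial>count_space UNIV)"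
    using emeasure_UN_countable[of UNIV ?Y ?M] Ys by simp
  have "emeasure ?M (?X m) = emeasure ?M (?Y m)" for m
  proof -
    have "{y. y + lattice_vec m \<in> ?Y m} = ?X m" by auto
    then show ?thesis using inv[OF Ys, of m m] Xs[of m] by simp
  qed
  then have 3: "emeasure ?M ?C = emeasure ?M cell" unfolding 1 2 by simp
  have Cs: "?C \<in> sets lebesgue" by (rule sh[OF cell_borel])
  have gm: "(\<lambda>y. indicat_real ?C y * g y) \<in> borel_measurable lebesgue" using Cs g by (intro borel_measurable_times) auto
  have "(\<integral>\<^sup>+y. ennreal (g (y + c)) \<partial>lebesgue_on cell) = (\<integral>\<^sup>+y. ennreal (indicat_real cell y * g (y + c)) \<partial>lebesgue)"
    by (rule nn_integral_lebesgue_on) simp_all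
  also have "\<dots> = (\<integral>\<^sup>+y. ennreal (indicat_real ?C (y + c) * g (y + c)) \<partial>lebesgue)"
    by (simp add: indicator_def)
  also have "\<dots> = emeasure ?M ?C" unfolding em[OF Cs] by (rule nn_integral_lebesgue_shift[OF gm])
  also have "\<dots> = (\<integral>\<^sup>+y. ennreal (g y) \<partial>lebesgue_on cell)"
    unfolding 3 em[OF cell_lebesgue] by (rule nn_integral_lebesgue_on[symmetric]) simp_all
  finally show ?thesis .
qed

lemma cell_shift:
  fixes g :: "real^'d \<Rightarrow> real"
  assumes g: "g \<in> borel_measurable lebesgue" and per: "periodic g"
  shows "integrable (lebesgue_on cell) (\<lambda>y. g (y + c)) \<longleftrightarrow> integrable (lebesgue_on cell) g"
    and "(LINT y|lebesgue_on cell. g (y + c)) = (LINT y|lebesgue_on cell. g y)"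
proof -
  have gc: "(\<lambda>y. g (y + c)) \<in> borel_measurable lebesgue" by (rule null_pres_measurable[OF null_pres_shift' g])
  have nn: "(\<integral>\<^sup>+y. ennreal (h (g (y + c))) \<partial>lebesgue_on cell) = (\<integral>\<^sup>+y. ennreal (h (g y)) \<partial>lebesgue_on cell)"
    if h: "h \<in> borel_measurable borel" for h :: "real \<Rightarrow> real"
    by (rule nn_integral_cell_shift[of "\<lambda>y. h (g y)"]) (use per in \<open>auto simp: periodic_def intro: measurable_compose[OF g h]\<close>)
  show i: "integrable (lebesgue_on cell) (\<lambda>y. g (y + c)) \<longleftrightarrow> integrable (lebesgue_on cell) g"
    using nn[of abs] g gc by (simp add: integrable_iff_nn measurable_restrict_space1)
  show "(LINT y|lebesgue_on cell. g (y + c)) = (LINT y|lebesgue_on cell. g y)"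
  proof (cases "integrable (lebesgue_on cell) g")
    case True
    then show ?thesis using i nn[of "\<lambda>x. x"] nn[of uminus] by (simp add: real_lebesgue_integral_def)
  next
    case False
    then show ?thesis using i by (simp add: not_integrable_integral_eq)
  qed
qed

lemma integral_lebesgue_reflect:
  fixes f :: "'a::euclidean_space \<Rightarrow> real"
  assumes f: "f \<in> borel_measurable lebesgue"
  shows "(LINT x|lebesgue. f (- x)) = (LINT x|lebesgue. f x)"
proof -
  have d: "distr lborel borel (uminus :: 'a \<Rightarrow> 'a) = lborel"
    by (subst (2) lborel_affine[of "-1" 0]) (auto simp: density_1 one_ennreal_def[symmetric])
  obtain g where g: "g \<in> borel_measurable borel" "AE w in lborel. f w = g w" using lebesgue_borel_rep[OF f] .
  have gm: "(\<lambda>x. g (- x)) \<in> borel_measurable borel" using g(1) by measurable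
  have ae: "AE w in lebesgue. f w = g w" by (rule AE_completion[OF g(2)])
  have np: "null_pres (uminus :: 'a \<Rightarrow> 'a)"
  proof -
    have "uminus -` N \<in> null_sets lborel" if N: "N \<in> null_sets lborel" for N :: "'a set"
    proof -
      have "N \<in> null_sets (distr lborel borel (uminus :: 'a \<Rightarrow> 'a))" using N d by simp
      then show ?thesis by (subst (asm) null_sets_distr_iff) auto
    qed
    then show ?thesis by (simp add: null_pres_def)
  qed
  have "(LINT x|lebesgue. f (- x)) = (LINT x|lebesgue. g (- x))"
    by (rule integral_cong_AE[OF null_pres_measurable[OF np f] borel_imp_lebesgue_measurable[OF gm] null_pres_AE[OF np ae]])
  also have "\<dots> = (LINT x|lborel. g (- x))" using gm by (simp add: integral_completion)
  also have "\<dots> = (LINT x|distr lborel borel uminus. g x)" using g(1) by (subst integral_distr) auto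
  also have "\<dots> = (LINT x|lebesgue. g x)" using g(1) unfolding d by (simp add: integral_completion)
  also have "\<dots> = (LINT x|lebesgue. f x)"
    by (rule integral_cong_AE[OF borel_imp_lebesgue_measurable[OF g(1)] f]) (use ae in eventually_elim, simp)
  finally show ?thesis .
qed

section \<open>The soft operator\<close>

lemma L2_per_mono: "L2_per U \<subseteq> L2_per UNIV"
  by (auto simp: L2_per_def)

lemma L2_perD:
  assumes "f \<in> L2_per U"
  shows "f \<in> L2 (lebesgue_on cell)" "periodic f" "AE y in lebesgue_on cell. y \<notin> U \<longrightarrow> f y = 0" "f \<in> borel_measurable lebesgue"
  using assms periodic_measurable[of f] L2_measurable[of f] by (auto simp: L2_per_def)

lemma L2_per_add: "f \<in> L2_per U \<Longrightarrow> g \<in> L2_per U \<Longrightarrow> (\<lambda>x. f x + g x) \<in> L2_per U"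
  by (auto simp: L2_per_def periodic_def elim!: AE_mp)

lemma L2_per_scale: "f \<in> L2_per U \<Longrightarrow> (\<lambda>x. c * f x) \<in> L2_per U"
  by (auto simp: L2_per_def periodic_def elim!: AE_mp)

lemma L2_per_diff: "f \<in> L2_per U \<Longrightarrow> g \<in> L2_per U \<Longrightarrow> (\<lambda>x. f x - g x) \<in> L2_per U"
  using L2_per_add[of f U "\<lambda>x. - 1 * g x"] L2_per_scale[of g U "- 1"] by simp

lemma L2_per_zero: "(\<lambda>x. 0) \<in> L2_per U"
  by (auto simp: L2_per_def periodic_def)

lemma finite_measure_cell: "finite_measure (lebesgue_on (cell :: (real^'d) set))"
proof
  have "emeasure lebesgue (cell :: (real^'d) set) \<noteq> \<infinity>" unfolding emeasure_cell by simp
  then show "emeasure (lebesgue_on cell) (space (lebesgue_on (cell :: (real^'d) set))) \<noteq> \<infinity>"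
    by (simp add: emeasure_restrict_space del: emeasure_completion)
qed

lemma semi_hilbert_L2_per:
  fixes U :: "(real^'d) set"
  assumes U: "open U" "periodic_set U"
  shows "semi_hilbert (L2_per U) (\<lambda>f g x. f x + g x) (\<lambda>c f x. c * f x) (L2_inner (lebesgue_on cell))"
proof (rule semi_hilbert_L2)
  show "L2_per U \<noteq> {}" using L2_per_zero by blast
  fix f :: "real^'d \<Rightarrow> real" assume f: "f \<in> L2 (lebesgue_on cell)"
  \<comment> \<open>Cut-off by \<open>U\<close> and periodic extension from the cell: the
    representative that \<open>semi_hilbert_L2\<close> asks for.\<close>
  let ?g = "\<lambda>y. indicat_real U y * f (frac_vec y)"
  have Um: "indicat_real U \<in> borel_measurable (lebesgue_on cell)"
    using U(1) by (intro measurable_restrict_space1 borel_measurable_indicator) simp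
  have "(\<lambda>y. indicat_real U y * f y) \<in> borel_measurable (lebesgue_on cell)"
    using L2_measurable[OF f] Um by simp
  then have gm: "?g \<in> borel_measurable (lebesgue_on cell)"
    by (subst measurable_cong[where g = "\<lambda>y. indicat_real U y * f y"]) (auto simp: frac_vec_id)
  have "?g \<in> L2 (lebesgue_on cell)"
    by (rule L2_bound[OF f gm AE_I2]) (auto simp: frac_vec_id indicator_def)
  moreover have "periodic ?g"
  proof -
    have "frac_vec (y + lattice_vec m) = frac_vec y" for y :: "real^'d" and m
      by (simp add: frac_vec_def lattice_vec_def vec_eq_iff)
    moreover have "indicat_real U (y + lattice_vec m) = indicat_real U y" for y m
      using U(2) by (simp add: periodic_def periodic_set_def indicator_def)
    ultimately show ?thesis by (simp add: periodic_def)
  qed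
  moreover have "AE y in lebesgue_on cell. y \<notin> U \<longrightarrow> ?g y = 0" by simp
  ultimately have "?g \<in> L2_per U" unfolding L2_per_def by blast
  moreover have "AE x in lebesgue_on cell. \<bar>h x - ?g x\<bar> \<le> \<bar>h x - f x\<bar>" if h: "h \<in> L2_per U" for h
    using L2_perD(3)[OF h] AE_space
  proof eventually_elim
    case (elim x)
    then have "frac_vec x = x" by (intro frac_vec_id) simp
    then show ?case using elim by (cases "x \<in> U") simp_all
  qed
  ultimately show "\<exists>f'\<in>L2_per U. \<forall>h\<in>L2_per U. AE x in lebesgue_on cell. \<bar>h x - f' x\<bar> \<le> \<bar>h x - f x\<bar>"
    by (intro bexI[of _ ?g] ballI)
qed (auto simp: L2_perD(1) L2_per_add L2_per_scale)

declare lebesgue_on_UNIV_eq [simp]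

text \<open>The bounded operator that represents the form. The factor 2 arises because the two terms
  of \<open>b (y + \<xi>) - b y\<close> contribute equally, and the indicator projects onto
  functions vanishing off \<open>U\<close>.\<close>

definition soft_op :: "(real^'d) set \<Rightarrow> (real^'d \<Rightarrow> real) \<Rightarrow> (real^'d \<Rightarrow> real^'d \<Rightarrow> real)
    \<Rightarrow> (real^'d \<Rightarrow> real) \<Rightarrow> real^'d \<Rightarrow> real" where
  "soft_op U a p z y = 2 * indicat_real U y * (LINT \<xi>|lebesgue. a \<xi> * p y (y + \<xi>) * (z y - z (y + \<xi>)))"

text \<open>Shared by \<open>p\<close>, where it yields the soft operator, and by
  \<open>Lam\<close>, where it yields the integrability behind the homogenized matrix. Both kernels
  vanish for some pairs of phases, so the range includes 0.\<close>

locale convolution_form =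
  fixes a :: "real^'d \<Rightarrow> real" and p :: "real^'d \<Rightarrow> real^'d \<Rightarrow> real" and P :: real
  assumes a_nonneg: "0 \<le> a \<xi>" and a_even: "a (- \<xi>) = a \<xi>" and a_int: "integrable lebesgue a"
    and p_coeff: "periodic_coefficient p" and p_range: "0 \<le> p x y" "p x y \<le> P"
begin

lemma P_nonneg: "0 \<le> P" using p_range[of 0 0] by linarith

definition a1 where "a1 = (LINT \<xi>|lebesgue. a \<xi>)"

lemma a1_nonneg: "0 \<le> a1" unfolding a1_def using a_nonneg by simp

abbreviation "MC \<equiv> lebesgue_on (cell :: (real^'d) set)"
abbreviation "MCR \<equiv> lebesgue_on ((cell :: (real^'d) set) \<times> (UNIV :: (real^'d) set))"

lemma p_sym: "p x y = p y x" using p_coeff by (simp add: periodic_coefficient_def)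

lemma p_shift_measurable: "(\<lambda>w. p (fst w) (fst w + snd w)) \<in> borel_measurable lebesgue"
  "(\<lambda>w. p (fst w + snd w) (fst w)) \<in> borel_measurable lebesgue"
proof -
  have g: "(\<lambda>w::(real^'d) \<times> (real^'d). fst w + snd w) \<in> borel_measurable borel"
    by (auto simp: borel_prod[symmetric])
  have "null_pres (\<lambda>w::(real^'d) \<times> (real^'d). (fst w, fst w + snd w))"
    by (rule null_pres_fibre[OF g null_pres_shift])
  from null_pres_measurable[OF this, of "\<lambda>(x, y). p x y"] p_coeff
  show "(\<lambda>w. p (fst w) (fst w + snd w)) \<in> borel_measurable lebesgue" by (simp add: periodic_coefficient_def)
  moreover have "(\<lambda>w. p (fst w + snd w) (fst w)) = (\<lambda>w. p (fst w) (fst w + snd w))"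
    by (rule ext) (rule p_sym)
  ultimately show "(\<lambda>w. p (fst w + snd w) (fst w)) \<in> borel_measurable lebesgue" by simp
qed

lemma p_periodic: "p (x + lattice_vec m) (y + lattice_vec m) = p x y"
  using p_coeff by (simp add: periodic_coefficient_def periodic_def)

lemma a_measurable: "a \<in> borel_measurable lebesgue" using a_int by auto

lemma sum_null_pres: "null_pres (\<lambda>w::(real^'d) \<times> (real^'d). fst w + snd w)"
  by (rule null_pres_sect_snd) (auto simp: null_pres_shift borel_prod[symmetric])

lemma comps_measurable:
  fixes f :: "real^'d \<Rightarrow> real"
  assumes "f \<in> borel_measurable lebesgue"
  shows "(\<lambda>w::(real^'d) \<times> (real^'d). f (fst w)) \<in> borel_measurable lebesgue"
    "(\<lambda>w::(real^'d) \<times> (real^'d). f (snd w)) \<in> borel_measurable lebesgue"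
    "(\<lambda>w::(real^'d) \<times> (real^'d). f (fst w + snd w)) \<in> borel_measurable lebesgue"
  by (rule null_pres_measurable[OF null_pres_fst assms] null_pres_measurable[OF null_pres_snd assms]
      null_pres_measurable[OF sum_null_pres assms])+

text \<open>Integration over \<open>y\<close> comes first. There the shift by \<open>\<xi>\<close>
  is invisible by periodicity, which leaves the integral of \<open>a\<close> times the norm square
  of \<open>z\<close>.\<close>

lemma kernel_square_integrable:
  assumes z: "z \<in> L2_per UNIV"
  shows "integrable MCR (\<lambda>w. a (snd w) * (z (fst w + snd w))\<^sup>2)"
    and "(LINT w|MCR. a (snd w) * (z (fst w + snd w))\<^sup>2) = a1 * L2_inner MC z z"
    and "integrable MCR (\<lambda>w. a (snd w) * (z (fst w))\<^sup>2)"
proof -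
  let ?N = "L2_inner MC z z"
  have zm: "z \<in> borel_measurable lebesgue" by (rule L2_perD(4)[OF z])
  have z2: "(\<lambda>y. (z y)\<^sup>2) \<in> borel_measurable lebesgue" using zm by simp
  have per: "periodic (\<lambda>y. (z y)\<^sup>2)" using L2_perD(2)[OF z] by (simp add: periodic_def)
  have N: "(\<integral>\<^sup>+y. ennreal ((z y)\<^sup>2) \<partial>MC) = ennreal ?N"
    using L2_sq_integrable[OF L2_perD(1)[OF z]] by (subst nn_integral_eq_integral) (auto simp: L2_inner_def power2_eq_square)
  have "(\<lambda>w. a (snd w) * (z (fst w + snd w))\<^sup>2) \<in> borel_measurable lebesgue"
    "(\<lambda>w. a (snd w) * (z (fst w))\<^sup>2) \<in> borel_measurable lebesgue"
    by (intro borel_measurable_times comps_measurable a_measurable z2)+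
  then have m: "(\<lambda>w. a (snd w) * (z (fst w + snd w))\<^sup>2) \<in> borel_measurable MCR"
    "(\<lambda>w. a (snd w) * (z (fst w))\<^sup>2) \<in> borel_measurable MCR"
    by (auto intro: measurable_restrict_space1)
  have aN: "(\<integral>\<^sup>+\<xi>. ennreal (a \<xi>) * ennreal ?N \<partial>lebesgue) = ennreal (a1 * ?N)"
    using a_int a_nonneg a_measurable by (simp add: nn_integral_multc nn_integral_eq_integral a1_def ennreal_mult)
  have in1: "(\<integral>\<^sup>+y. ennreal (a \<xi> * (z (y + \<xi>))\<^sup>2) \<partial>MC) = ennreal (a \<xi>) * ennreal ?N" for \<xi>
  proof -
    have zs: "(\<lambda>y. (z (y + \<xi>))\<^sup>2) \<in> borel_measurable MC"
      by (intro measurable_restrict_space1 null_pres_measurable[OF null_pres_shift' z2])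
    have "(\<integral>\<^sup>+y. ennreal (a \<xi> * (z (y + \<xi>))\<^sup>2) \<partial>MC) = ennreal (a \<xi>) * (\<integral>\<^sup>+y. ennreal ((z (y + \<xi>))\<^sup>2) \<partial>MC)"
      using zs a_nonneg by (subst nn_integral_cmult[symmetric]) (auto simp: ennreal_mult)
    also have "(\<integral>\<^sup>+y. ennreal ((z (y + \<xi>))\<^sup>2) \<partial>MC) = ennreal ?N"
      unfolding N[symmetric] by (rule nn_integral_cell_shift[OF z2 per])
    finally show ?thesis .
  qed
  have nn1: "(\<integral>\<^sup>+w. ennreal (a (snd w) * (z (fst w + snd w))\<^sup>2) \<partial>MCR) = ennreal (a1 * ?N)"
    using tonelli_on(2)[OF cell_borel _ m(1)] in1 aN by simp
  show i1: "integrable MCR (\<lambda>w. a (snd w) * (z (fst w + snd w))\<^sup>2)"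
    using m(1) nn1 a_nonneg by (simp add: integrable_iff_nn abs_mult)
  show "(LINT w|MCR. a (snd w) * (z (fst w + snd w))\<^sup>2) = a1 * ?N"
    using nn1 nn_integral_eq_integral[OF i1] a_nonneg a1_nonneg L2_inner_nonneg[of MC z]
    by (simp add: integral_nonneg_AE)
  have in2: "(\<integral>\<^sup>+y. ennreal (a \<xi> * (z y)\<^sup>2) \<partial>MC) = ennreal (a \<xi>) * ennreal ?N" for \<xi>
    using a_nonneg z2 unfolding N[symmetric]
    by (subst nn_integral_cmult[symmetric]) (auto simp: ennreal_mult measurable_restrict_space1)
  have nn2: "(\<integral>\<^sup>+w. ennreal (a (snd w) * (z (fst w))\<^sup>2) \<partial>MCR) = ennreal (a1 * ?N)"
    using tonelli_on(2)[OF cell_borel _ m(2)] in2 aN by simp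
  show "integrable MCR (\<lambda>w. a (snd w) * (z (fst w))\<^sup>2)"
    using m(2) nn2 a_nonneg by (simp add: integrable_iff_nn abs_mult)
qed

lemma kernel_integrable:
  assumes z: "z \<in> L2_per UNIV" and b: "b \<in> L2_per UNIV"
  shows "integrable MCR (\<lambda>w. a (snd w) * p (fst w) (fst w + snd w) * (z (fst w + snd w) - z (fst w)) * b (fst w))" (is ?T1)
    and "integrable MCR (\<lambda>w. a (snd w) * p (fst w) (fst w + snd w) * (z (fst w + snd w) - z (fst w)) * b (fst w + snd w))" (is ?T2)
proof -
  have zm: "z \<in> borel_measurable lebesgue" "b \<in> borel_measurable lebesgue" using L2_perD(4) z b by auto
  let ?D = "\<lambda>w. P * (2 * (a (snd w) * (z (fst w + snd w))\<^sup>2) + 2 * (a (snd w) * (z (fst w))\<^sup>2)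
      + a (snd w) * (b (fst w + snd w))\<^sup>2 + a (snd w) * (b (fst w))\<^sup>2)"
  have D: "integrable MCR ?D"
    by (intro integrable_mult_right Bochner_Integration.integrable_add kernel_square_integrable z b)
  have bound: "\<bar>a \<xi> * p x y * (z1 - z2) * t\<bar> \<le> P * (2 * (a \<xi> * z1\<^sup>2) + 2 * (a \<xi> * z2\<^sup>2) + a \<xi> * t1\<^sup>2 + a \<xi> * t2\<^sup>2)"
    if "t = t1 \<or> t = t2" for \<xi> x y z1 z2 t t1 t2
  proof -
    have "\<bar>(z1 - z2) * t\<bar> \<le> (z1 - z2)\<^sup>2 + t\<^sup>2" by (rule abs_mult_le_sum_squares)
    also have "(z1 - z2)\<^sup>2 \<le> 2 * z1\<^sup>2 + 2 * z2\<^sup>2"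
      using zero_le_power2[of "z1 + z2"] by (simp add: power2_sum power2_diff)
    also have "t\<^sup>2 \<le> t1\<^sup>2 + t2\<^sup>2" using that by auto
    finally have 1: "\<bar>(z1 - z2) * t\<bar> \<le> 2 * z1\<^sup>2 + 2 * z2\<^sup>2 + t1\<^sup>2 + t2\<^sup>2" by (simp add: algebra_simps)
    have "\<bar>a \<xi> * p x y * (z1 - z2) * t\<bar> = p x y * (a \<xi> * \<bar>(z1 - z2) * t\<bar>)"
      using a_nonneg[of \<xi>] p_range[of x y] by (simp add: abs_mult)
    also have "\<dots> \<le> P * (a \<xi> * (2 * z1\<^sup>2 + 2 * z2\<^sup>2 + t1\<^sup>2 + t2\<^sup>2))"
      using 1 a_nonneg p_range P_nonneg by (intro mult_mono mult_left_mono mult_nonneg_nonneg) auto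
    finally show ?thesis by (simp add: algebra_simps)
  qed
  have m: "(\<lambda>w. a (snd w) * p (fst w) (fst w + snd w) * (z (fst w + snd w) - z (fst w)) * b (fst w)) \<in> borel_measurable MCR"
    "(\<lambda>w. a (snd w) * p (fst w) (fst w + snd w) * (z (fst w + snd w) - z (fst w)) * b (fst w + snd w)) \<in> borel_measurable MCR"
    by (intro measurable_restrict_space1 borel_measurable_times borel_measurable_diff comps_measurable p_shift_measurable a_measurable zm)+
  show ?T1 by (rule Bochner_Integration.integrable_bound[OF D m(1) AE_I2]) (use bound in \<open>auto intro: order_trans[OF _ abs_ge_self]\<close>)
  show ?T2 by (rule Bochner_Integration.integrable_bound[OF D m(2) AE_I2]) (use bound in \<open>auto intro: order_trans[OF _ abs_ge_self]\<close>)
qed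

text \<open>The substitution \<open>(y, \<xi>) \<mapsto> (y + \<xi>, - \<xi>)\<close> interchanges the two terms of \<open>b (y + \<xi>) - b y\<close>.\<close>

lemma soft_form_eq:
  assumes z: "z \<in> L2_per UNIV" and b: "b \<in> L2_per UNIV"
  shows "soft_form a p z b = - 2 * (LINT w|MCR. a (snd w) * p (fst w) (fst w + snd w) * (z (fst w + snd w) - z (fst w)) * b (fst w))"
proof -
  let ?H = "\<lambda>w. a (snd w) * p (fst w) (fst w + snd w) * (z (fst w + snd w) - z (fst w)) * b (fst w)"
  let ?H' = "\<lambda>w. a (snd w) * p (fst w) (fst w + snd w) * (z (fst w + snd w) - z (fst w)) * b (fst w + snd w)"
  note H = kernel_integrable[OF z b]
  have zm: "z \<in> borel_measurable lebesgue" "b \<in> borel_measurable lebesgue" using L2_perD(4) z b by auto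
  have U: "(UNIV :: (real^'d) set) \<in> sets borel" by simp
  \<comment> \<open>\<open>soft_form\<close> has the outer integral over \<open>\<xi>\<close>,
    whereas \<open>MCR\<close> lists \<open>y\<close> first; hence Fubini's theorem is used after a
    swap. The inner integrals over \<open>y\<close> are controlled only for almost every
    \<open>\<xi>\<close>.\<close>
  define h where "h \<xi> = (LINT y|MC. ?H (y, \<xi>))" for \<xi>
  define h' where "h' \<xi> = (LINT y|MC. ?H' (y, \<xi>))" for \<xi>
  have hint: "integrable lebesgue h" "integrable lebesgue h'"
    using fubini_on(2)[OF U cell_borel swap_on(1)[OF cell_borel U H(1)]] fubini_on(2)[OF U cell_borel swap_on(1)[OF cell_borel U H(2)]]
    unfolding h_def[abs_def] h'_def[abs_def] by simp_all
  have ae: "AE \<xi> in lebesgue. integrable MC (\<lambda>y. ?H (y, \<xi>))" "AE \<xi> in lebesgue. integrable MC (\<lambda>y. ?H' (y, \<xi>))"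
    using fubini_on(1)[OF U cell_borel swap_on(1)[OF cell_borel U H(1)]] fubini_on(1)[OF U cell_borel swap_on(1)[OF cell_borel U H(2)]]
    unfolding lebesgue_on_UNIV_eq by simp_all
  have "soft_form a p z b = (LINT \<xi>|lebesgue. h' \<xi> - h \<xi>)"
    unfolding soft_form_def
  proof (rule integral_cong_AE)
    have eq: "a \<xi> * p y (y + \<xi>) * (z (y + \<xi>) - z y) * (b (y + \<xi>) - b y) = ?H' (y, \<xi>) - ?H (y, \<xi>)" for y \<xi>
      by (simp add: algebra_simps)
    show "AE \<xi> in lebesgue. (LINT y|MC. a \<xi> * p y (y + \<xi>) * (z (y + \<xi>) - z y) * (b (y + \<xi>) - b y)) = h' \<xi> - h \<xi>"
      using ae unfolding eq h_def h'_def by eventually_elim (rule Bochner_Integration.integral_diff)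
    have "integrable MCR (\<lambda>w. ?H' w - ?H w)" by (intro Bochner_Integration.integrable_diff H)
    from fubini_on(2)[OF U cell_borel swap_on(1)[OF cell_borel U this]]
    show "(\<lambda>\<xi>. LINT y|MC. a \<xi> * p y (y + \<xi>) * (z (y + \<xi>) - z y) * (b (y + \<xi>) - b y)) \<in> borel_measurable lebesgue"
      unfolding eq by auto
  qed (use hint in auto)
  also have "\<dots> = (LINT \<xi>|lebesgue. h' \<xi>) - (LINT \<xi>|lebesgue. h \<xi>)" using hint by simp
  also have "(LINT \<xi>|lebesgue. h' \<xi>) = (LINT \<xi>|lebesgue. - h (- \<xi>))"
  proof (rule integral_cong_AE)
    have "AE \<xi> in lebesgue. (\<lambda>y. p (y + \<xi>) y) \<in> borel_measurable lebesgue"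
      using lebesgue_section(2)[OF p_shift_measurable(2)] by simp
    then have "AE \<xi> in lebesgue. (\<lambda>y. p (y + - \<xi>) y) \<in> borel_measurable lebesgue"
    proof -
      have "null_pres (uminus :: real^'d \<Rightarrow> real^'d)"
      proof -
        have d: "distr lborel borel (uminus :: real^'d \<Rightarrow> real^'d) = lborel"
          by (subst (2) lborel_affine[of "-1" 0]) (auto simp: density_1 one_ennreal_def[symmetric])
        have "uminus -` N \<in> null_sets lborel" if N: "N \<in> null_sets lborel" for N :: "(real^'d) set"
        proof -
          have "N \<in> null_sets (distr lborel borel (uminus :: real^'d \<Rightarrow> real^'d))" using N d by simp
          then show ?thesis by (subst (asm) null_sets_distr_iff) auto
        qed
        then show ?thesis by (simp add: null_pres_def)
      qed
      from null_pres_AE[OF this \<open>AE \<xi> in lebesgue. (\<lambda>y. p (y + \<xi>) y) \<in> borel_measurable lebesgue\<close>] show ?thesis .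
    qed
    then show "AE \<xi> in lebesgue. h' \<xi> = - h (- \<xi>)"
    proof eventually_elim
      case (elim \<xi>)
      let ?g = "\<lambda>y. a \<xi> * p (y + - \<xi>) y * (z y - z (y + - \<xi>)) * b y"
      have gm: "?g \<in> borel_measurable lebesgue"
        by (rule borel_measurable_times[OF borel_measurable_times[OF borel_measurable_times[OF borel_measurable_const elim]
          borel_measurable_diff[OF zm(1) null_pres_measurable[OF null_pres_shift' zm(1)]]] zm(2)])
      have per: "periodic ?g"
        unfolding periodic_def
      proof (intro allI)
        fix m x
        have "z (x + lattice_vec m + - \<xi>) = z (x + - \<xi>)"
          using periodicD[OF L2_perD(2)[OF z], of "x + - \<xi>" m] by (simp add: algebra_simps)
        moreover have "p (x + lattice_vec m + - \<xi>) (x + lattice_vec m) = p (x + - \<xi>) x"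
          using p_periodic[of "x + - \<xi>" m x] by (simp add: algebra_simps)
        ultimately show "?g (x + lattice_vec m) = ?g x"
          using periodicD[OF L2_perD(2)[OF z], of x m] periodicD[OF L2_perD(2)[OF b], of x m] by simp
      qed
      have "(\<lambda>y. ?H' (y, \<xi>)) = (\<lambda>y. ?g (y + \<xi>))" by (rule ext) simp
      then have "h' \<xi> = (LINT y|MC. ?g (y + \<xi>))" by (simp only: h'_def)
      also have "\<dots> = (LINT y|MC. ?g y)" by (rule cell_shift(2)[OF gm per])
      also have "\<dots> = (LINT y|MC. - (?H (y, - \<xi>)))"
      proof (intro Bochner_Integration.integral_cong refl)
        fix y
        show "?g y = - (?H (y, - \<xi>))"
          unfolding p_sym[of "y + - \<xi>" y] a_even fst_conv snd_conv minus_mult_left[symmetric] minus_mult_right[symmetric]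
            minus_diff_eq[of "z (y + - \<xi>)" "z y", symmetric] by simp
      qed
      finally show ?case by (simp add: h_def)
    qed
    have "(\<lambda>\<xi>. h (- \<xi>)) \<in> borel_measurable lebesgue"
    proof -
      have d: "distr lborel borel (uminus :: real^'d \<Rightarrow> real^'d) = lborel"
        by (subst (2) lborel_affine[of "-1" 0]) (auto simp: density_1 one_ennreal_def[symmetric])
      have "uminus -` N \<in> null_sets lborel" if N: "N \<in> null_sets lborel" for N :: "(real^'d) set"
      proof -
        have "N \<in> null_sets (distr lborel borel (uminus :: real^'d \<Rightarrow> real^'d))" using N d by simp
        then show ?thesis by (subst (asm) null_sets_distr_iff) auto
      qed
      then have "null_pres (uminus :: real^'d \<Rightarrow> real^'d)" by (simp add: null_pres_def)
      then show ?thesis using hint(1) by (intro null_pres_measurable[of uminus h]) auto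
    qed
    then show "(\<lambda>\<xi>. - h (- \<xi>)) \<in> borel_measurable lebesgue" by simp
  qed (use hint in auto)
  also have "\<dots> = - (LINT \<xi>|lebesgue. h \<xi>)"
    using integral_lebesgue_reflect[of h] hint(1) by simp
  also have "(LINT \<xi>|lebesgue. h \<xi>) = (LINT w|MCR. ?H w)"
    using fubini_on'[OF cell_borel U H(1)] by (simp add: h_def)
  finally show ?thesis by simp
qed

lemma section_integrable:
  assumes z: "z \<in> L2_per UNIV"
  shows "AE y in MC. integrable lebesgue (\<lambda>\<xi>. a \<xi> * (z (y + \<xi>))\<^sup>2) \<and> (\<lambda>\<xi>. a \<xi> * p y (y + \<xi>) * (z y - z (y + \<xi>))) \<in> borel_measurable lebesgue"
proof -
  have zm: "z \<in> borel_measurable lebesgue" using L2_perD(4) z by auto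
  have U: "(UNIV :: (real^'d) set) \<in> sets borel" by simp
  have "AE y in lebesgue. (\<lambda>\<xi>. a \<xi> * p y (y + \<xi>) * (z y - z (y + \<xi>))) \<in> borel_measurable lebesgue"
  proof -
    have "(\<lambda>w. a (snd w) * p (fst w) (fst w + snd w) * (z (fst w) - z (fst w + snd w))) \<in> borel_measurable lebesgue"
      by (intro borel_measurable_times borel_measurable_diff comps_measurable p_shift_measurable a_measurable zm)
    from lebesgue_section(1)[OF this] show ?thesis by simp
  qed
  then have "AE y in MC. (\<lambda>\<xi>. a \<xi> * p y (y + \<xi>) * (z y - z (y + \<xi>))) \<in> borel_measurable lebesgue"
    unfolding AE_lebesgue_on[OF cell_lebesgue] by eventually_elim simp
  with fubini_on(1)[OF cell_borel U kernel_square_integrable(1)[OF z]] show ?thesis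
    unfolding lebesgue_on_UNIV_eq by eventually_elim simp
qed

text \<open>Cauchy-Schwarz inequality with the weight \<open>a\<close> split into two square roots,
  followed by \<open>(s - t)\<^sup>2 \<le> 2 * s\<^sup>2 + 2 * t\<^sup>2\<close>. The constant 8 is
  the square of the factor 2 in \<open>soft_op\<close> times this 2.\<close>

lemma soft_op_pointwise:
  assumes z: "z \<in> L2_per UNIV"
  shows "AE y in MC. (soft_op V a p z y)\<^sup>2 \<le> 8 * P\<^sup>2 * a1 * (a1 * (z y)\<^sup>2 + (LINT \<xi>|lebesgue. a \<xi> * (z (y + \<xi>))\<^sup>2))"
  using section_integrable[OF z]
proof eventually_elim
  case (elim y)
  have zm: "z \<in> borel_measurable lebesgue" using L2_perD(4) z by auto
  have zs: "(\<lambda>\<xi>. z (y + \<xi>)) \<in> borel_measurable lebesgue" by (rule null_pres_measurable[OF null_pres_shift zm])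
  let ?I = "LINT \<xi>|lebesgue. a \<xi> * (z (y + \<xi>))\<^sup>2"
  let ?f = "\<lambda>\<xi>. sqrt (a \<xi>)" and ?g = "\<lambda>\<xi>. sqrt (a \<xi>) * \<bar>z y - z (y + \<xi>)\<bar>"
  have sm: "?f \<in> borel_measurable lebesgue" using a_measurable by simp
  have fL: "?f \<in> L2 lebesgue" using sm a_int a_nonneg by (intro L2I) auto
  have g2: "(?g \<xi>)\<^sup>2 = a \<xi> * (z y - z (y + \<xi>))\<^sup>2" for \<xi> using a_nonneg by (simp add: power_mult_distrib)
  have dom: "a \<xi> * (z y - z (y + \<xi>))\<^sup>2 \<le> 2 * (z y)\<^sup>2 * a \<xi> + 2 * (a \<xi> * (z (y + \<xi>))\<^sup>2)" for \<xi>
  proof -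
    have "(z y - z (y + \<xi>))\<^sup>2 \<le> 2 * (z y)\<^sup>2 + 2 * (z (y + \<xi>))\<^sup>2"
      using zero_le_power2[of "z y + z (y + \<xi>)"] by (simp add: power2_sum power2_diff)
    from mult_left_mono[OF this a_nonneg[of \<xi>]] show ?thesis by (simp add: algebra_simps)
  qed
  have di: "integrable lebesgue (\<lambda>\<xi>. 2 * (z y)\<^sup>2 * a \<xi> + 2 * (a \<xi> * (z (y + \<xi>))\<^sup>2))"
    using elim a_int by simp
  have gi: "integrable lebesgue (\<lambda>\<xi>. a \<xi> * (z y - z (y + \<xi>))\<^sup>2)"
  proof (rule Bochner_Integration.integrable_bound[OF di _ AE_I2])
    fix \<xi>
    have "0 \<le> a \<xi> * (z y - z (y + \<xi>))\<^sup>2" using a_nonneg by simp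
    with dom[of \<xi>] show "norm (a \<xi> * (z y - z (y + \<xi>))\<^sup>2) \<le> norm (2 * (z y)\<^sup>2 * a \<xi> + 2 * (a \<xi> * (z (y + \<xi>))\<^sup>2))"
      unfolding real_norm_def by linarith
  qed (use a_measurable zs in simp)
  have gL: "?g \<in> L2 lebesgue" using sm zs gi g2 by (intro L2I) auto
  have fg: "(\<lambda>\<xi>. ?f \<xi> * ?g \<xi>) = (\<lambda>\<xi>. a \<xi> * \<bar>z y - z (y + \<xi>)\<bar>)"
    using a_nonneg by (auto simp: fun_eq_iff simp flip: mult.assoc)
  have fgi: "integrable lebesgue (\<lambda>\<xi>. a \<xi> * \<bar>z y - z (y + \<xi>)\<bar>)"
    using L2_mult_integrable[OF fL gL] unfolding fg .
  have cs: "(LINT \<xi>|lebesgue. a \<xi> * \<bar>z y - z (y + \<xi>)\<bar>)\<^sup>2 \<le> a1 * (LINT \<xi>|lebesgue. a \<xi> * (z y - z (y + \<xi>))\<^sup>2)"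
    using L2_cauchy_schwarz[OF fL gL] unfolding L2_inner_def fg g2[unfolded power2_eq_square[of "?g _"]]
    using a_nonneg by (simp add: a1_def)
  have "(LINT \<xi>|lebesgue. a \<xi> * (z y - z (y + \<xi>))\<^sup>2) \<le> (LINT \<xi>|lebesgue. 2 * (z y)\<^sup>2 * a \<xi> + 2 * (a \<xi> * (z (y + \<xi>))\<^sup>2))"
    by (rule integral_mono[OF gi di dom])
  also have "\<dots> = 2 * (a1 * (z y)\<^sup>2 + ?I)" using elim a_int by (simp add: a1_def)
  finally have up: "(LINT \<xi>|lebesgue. a \<xi> * (z y - z (y + \<xi>))\<^sup>2) \<le> 2 * (a1 * (z y)\<^sup>2 + ?I)" .
  let ?J = "LINT \<xi>|lebesgue. a \<xi> * p y (y + \<xi>) * (z y - z (y + \<xi>))"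
  have "\<bar>?J\<bar> \<le> (LINT \<xi>|lebesgue. P * (a \<xi> * \<bar>z y - z (y + \<xi>)\<bar>))"
  proof (rule integral_abs_bound_integral)
    have b: "\<bar>a \<xi> * p y (y + \<xi>) * (z y - z (y + \<xi>))\<bar> \<le> P * (a \<xi> * \<bar>z y - z (y + \<xi>)\<bar>)" for \<xi>
    proof -
      have "\<bar>a \<xi> * p y (y + \<xi>) * (z y - z (y + \<xi>))\<bar> = p y (y + \<xi>) * (a \<xi> * \<bar>z y - z (y + \<xi>)\<bar>)"
        using a_nonneg[of \<xi>] p_range[of y "y + \<xi>"] by (simp add: abs_mult)
      also have "\<dots> \<le> P * (a \<xi> * \<bar>z y - z (y + \<xi>)\<bar>)" using a_nonneg p_range by (intro mult_right_mono) auto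
      finally show ?thesis .
    qed
    then show "\<bar>a \<xi> * p y (y + \<xi>) * (z y - z (y + \<xi>))\<bar> \<le> P * (a \<xi> * \<bar>z y - z (y + \<xi>)\<bar>)" for \<xi> .
    show i: "integrable lebesgue (\<lambda>\<xi>. P * (a \<xi> * \<bar>z y - z (y + \<xi>)\<bar>))" using fgi by simp
    show "integrable lebesgue (\<lambda>\<xi>. a \<xi> * p y (y + \<xi>) * (z y - z (y + \<xi>)))"
    proof (rule Bochner_Integration.integrable_bound[OF i _ AE_I2])
      show "norm (a \<xi> * p y (y + \<xi>) * (z y - z (y + \<xi>))) \<le> norm (P * (a \<xi> * \<bar>z y - z (y + \<xi>)\<bar>))" for \<xi>
        unfolding real_norm_def by (rule order_trans[OF b abs_ge_self])
    qed (use elim in simp)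
  qed
  then have "\<bar>?J\<bar> \<le> P * (LINT \<xi>|lebesgue. a \<xi> * \<bar>z y - z (y + \<xi>)\<bar>)" by simp
  then have "?J\<^sup>2 \<le> (P * (LINT \<xi>|lebesgue. a \<xi> * \<bar>z y - z (y + \<xi>)\<bar>))\<^sup>2"
    using power_mono[OF _ abs_ge_zero, of ?J _ 2] by simp
  also have "\<dots> = P\<^sup>2 * (LINT \<xi>|lebesgue. a \<xi> * \<bar>z y - z (y + \<xi>)\<bar>)\<^sup>2" by (rule power_mult_distrib)
  also have "\<dots> \<le> P\<^sup>2 * (a1 * (2 * (a1 * (z y)\<^sup>2 + ?I)))"
    by (intro mult_left_mono order_trans[OF cs] up a1_nonneg zero_le_power2)
  finally have J: "?J\<^sup>2 \<le> P\<^sup>2 * (a1 * (2 * (a1 * (z y)\<^sup>2 + ?I)))" .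
  have "(soft_op V a p z y)\<^sup>2 \<le> 4 * ?J\<^sup>2" by (simp add: soft_op_def power_mult_distrib indicator_def)
  also have "\<dots> \<le> 4 * (P\<^sup>2 * (a1 * (2 * (a1 * (z y)\<^sup>2 + ?I))))" using J by simp
  finally show ?case by (simp add: algebra_simps)
qed

text \<open>Bounds the square of the operator norm. It comes from integrating
  \<open>soft_op_pointwise\<close>, each of whose two terms contributes
  \<open>8 * P\<^sup>2 * a1\<^sup>2\<close>.\<close>

definition opbound where "opbound = 16 * P\<^sup>2 * a1\<^sup>2"

lemma opbound_nonneg: "0 \<le> opbound" by (simp add: opbound_def)

lemma soft_op_periodic:
  assumes z: "periodic z" and V: "periodic_set V"
  shows "periodic (soft_op V a p z)"
  unfolding periodic_def
proof (intro allI)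
  fix m x
  have "z (x + lattice_vec m + \<xi>) = z (x + \<xi>)" "p (x + lattice_vec m) (x + lattice_vec m + \<xi>) = p x (x + \<xi>)" for \<xi>
    using periodicD[OF z, of "x + \<xi>" m] p_periodic[of x m "x + \<xi>"] by (simp_all add: algebra_simps)
  moreover have "indicat_real V (x + lattice_vec m) = indicat_real V x"
    using V by (simp add: periodic_set_def periodic_def indicator_def)
  ultimately show "soft_op V a p z (x + lattice_vec m) = soft_op V a p z x"
    using periodicD[OF z, of x m] by (simp add: soft_op_def)
qed

lemma soft_op_L2:
  assumes z: "z \<in> L2_per UNIV" and V: "V \<in> sets lebesgue" "periodic_set V"
  shows "soft_op V a p z \<in> L2_per V"
    and "L2_inner MC (soft_op V a p z) (soft_op V a p z) \<le> opbound * L2_inner MC z z"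
proof -
  have zm: "z \<in> borel_measurable lebesgue" using L2_perD(4) z by auto
  have U: "(UNIV :: (real^'d) set) \<in> sets borel" by simp
  let ?L = "soft_op V a p z"
  have "(\<lambda>w. a (snd w) * p (fst w) (fst w + snd w) * (z (fst w) - z (fst w + snd w))) \<in> borel_measurable lebesgue"
    by (intro borel_measurable_times borel_measurable_diff comps_measurable p_shift_measurable a_measurable zm)
  from lebesgue_param_integral(1)[OF this] have Lm: "?L \<in> borel_measurable lebesgue"
    unfolding soft_op_def[abs_def] using V(1) by simp
  then have LmC: "?L \<in> borel_measurable MC" by (rule measurable_restrict_space1)
  let ?B = "\<lambda>y. 8 * P\<^sup>2 * a1 * (a1 * (z y)\<^sup>2 + (LINT \<xi>|lebesgue. a \<xi> * (z (y + \<xi>))\<^sup>2))"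
  have K: "integrable MC (\<lambda>y. LINT \<xi>|lebesgue. a \<xi> * (z (y + \<xi>))\<^sup>2)"
    "(LINT y|MC. (LINT \<xi>|lebesgue. a \<xi> * (z (y + \<xi>))\<^sup>2)) = a1 * L2_inner MC z z"
    using fubini_on(2,3)[OF cell_borel U kernel_square_integrable(1)[OF z]] kernel_square_integrable(2)[OF z] by simp_all
  have z2: "integrable MC (\<lambda>y. (z y)\<^sup>2)" by (rule L2_sq_integrable[OF L2_perD(1)[OF z]])
  have B: "integrable MC ?B" using K(1) z2 by simp
  have Bval: "(LINT y|MC. ?B y) = opbound * L2_inner MC z z"
  proof -
    have "(LINT y|MC. ?B y) = 8 * P\<^sup>2 * a1 * (a1 * (LINT y|MC. (z y)\<^sup>2) + a1 * L2_inner MC z z)"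
      using K z2 by simp
    then show ?thesis by (simp add: opbound_def L2_inner_def power2_eq_square)
  qed
  have L2: "integrable MC (\<lambda>y. (?L y)\<^sup>2)"
  proof (rule Bochner_Integration.integrable_bound[OF B])
    show "AE y in MC. norm ((?L y)\<^sup>2) \<le> norm (?B y)"
      using soft_op_pointwise[OF z, of V] by eventually_elim simp
  qed (use LmC in simp)
  then have LL: "?L \<in> L2 MC" using LmC by (rule L2I[rotated])
  then show "?L \<in> L2_per V"
    using soft_op_periodic[OF L2_perD(2)[OF z] V(2)] by (auto simp: L2_per_def soft_op_def)
  have "L2_inner MC ?L ?L = (LINT y|MC. (?L y)\<^sup>2)" by (simp add: L2_inner_def power2_eq_square)
  also have "\<dots> \<le> (LINT y|MC. ?B y)" by (rule integral_mono_AE[OF L2 B soft_op_pointwise[OF z]])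
  finally show "L2_inner MC ?L ?L \<le> opbound * L2_inner MC z z" unfolding Bval .
qed

lemma soft_form_op:
  assumes z: "z \<in> L2_per UNIV" and b: "b \<in> L2_per V" and V: "V \<in> sets lebesgue" "periodic_set V"
  shows "soft_form a p z b = L2_inner MC (soft_op V a p z) b"
proof -
  have b': "b \<in> L2_per UNIV" using b L2_per_mono by blast
  have U: "(UNIV :: (real^'d) set) \<in> sets borel" by simp
  note L = soft_op_L2(1)[OF z V]
  have "L2_inner MC (soft_op V a p z) b = (LINT y|MC. - 2 * (LINT \<xi>|lebesgue. a \<xi> * p y (y + \<xi>) * (z (y + \<xi>) - z y) * b y))"
    unfolding L2_inner_def
  proof (rule integral_cong_AE)
    show "(\<lambda>y. soft_op V a p z y * b y) \<in> borel_measurable MC"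
      using L2_mult_integrable[OF L2_perD(1)[OF L] L2_perD(1)[OF b]] by auto
    show "(\<lambda>y. - 2 * (LINT \<xi>|lebesgue. a \<xi> * p y (y + \<xi>) * (z (y + \<xi>) - z y) * b y)) \<in> borel_measurable MC"
      using fubini_on(2)[OF cell_borel U kernel_integrable(1)[OF z b']] by simp
    show "AE y in MC. soft_op V a p z y * b y = - 2 * (LINT \<xi>|lebesgue. a \<xi> * p y (y + \<xi>) * (z (y + \<xi>) - z y) * b y)"
      using L2_perD(3)[OF b]
    proof eventually_elim
      case (elim y)
      have "(LINT \<xi>|lebesgue. a \<xi> * p y (y + \<xi>) * (z y - z (y + \<xi>))) = - (LINT \<xi>|lebesgue. a \<xi> * p y (y + \<xi>) * (z (y + \<xi>) - z y))"
        by (subst Bochner_Integration.integral_minus[symmetric]) (simp add: algebra_simps)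
      then show ?case using elim by (cases "y \<in> V") (simp_all add: soft_op_def)
    qed
  qed
  also have "\<dots> = - 2 * (LINT w|MCR. a (snd w) * p (fst w) (fst w + snd w) * (z (fst w + snd w) - z (fst w)) * b (fst w))"
    using fubini_on(3)[OF cell_borel U kernel_integrable(1)[OF z b']] by simp
  also have "\<dots> = soft_form a p z b" by (rule soft_form_eq[OF z b', symmetric])
  finally show ?thesis ..
qed

lemma soft_form_commute: "soft_form a p z b = soft_form a p b z"
  by (simp add: soft_form_def mult.assoc mult.commute[of "b _ - b _"])

lemma soft_form_nonneg: "0 \<le> soft_form a p z z"
proof -
  have "0 \<le> a \<xi> * p y (y + \<xi>) * (z (y + \<xi>) - z y) * (z (y + \<xi>) - z y)" for y \<xi>
    unfolding mult.assoc[of _ "z (y + \<xi>) - z y"] using a_nonneg p_range by simp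
  then show ?thesis unfolding soft_form_def by (intro Bochner_Integration.integral_nonneg)
qed

end

lemma lebesgue_on_AE_cong:
  fixes f g :: "'a::euclidean_space \<Rightarrow> real"
  assumes S: "S \<in> sets lebesgue" and g: "g \<in> borel_measurable (lebesgue_on S)" and ae: "AE x in lebesgue_on S. f x = g x"
  shows "f \<in> borel_measurable (lebesgue_on S)" and "(LINT x|lebesgue_on S. f x) = (LINT x|lebesgue_on S. g x)"
proof -
  show m: "f \<in> borel_measurable (lebesgue_on S)"
    unfolding measurable_lebesgue_on[OF S]
    by (rule lebesgue_measurable_AE_cong[OF g[unfolded measurable_lebesgue_on[OF S]]])
      (use ae[unfolded AE_lebesgue_on[OF S]] in eventually_elim, auto simp: indicator_def)
  show "(LINT x|lebesgue_on S. f x) = (LINT x|lebesgue_on S. g x)"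
    by (rule integral_cong_AE[OF m g ae])
qed

section \<open>Functions of a slow and a fast variable\<close>

locale two_scale = convolution_form a p P
  for a :: "real^'d \<Rightarrow> real" and p :: "real^'d \<Rightarrow> real^'d \<Rightarrow> real" and P :: real +
  fixes U S :: "(real^'d) set"
  assumes U_open: "open U" and U_per: "periodic_set U" and S_open: "open S"
begin

abbreviation "L \<equiv> soft_op U a p"
abbreviation "MX \<equiv> lebesgue_on S"
abbreviation "MSC \<equiv> lebesgue_on (S \<times> (cell :: (real^'d) set))"

lemma S_sets: "S \<in> sets borel" "S \<in> sets lebesgue" using S_open by auto
lemma U_sets: "U \<in> sets lebesgue" using U_open by auto
lemmas L_L2 = soft_op_L2[OF _ U_sets U_per]
lemmas SC = leb_sets[OF S_sets(1) cell_borel]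

lemma soft_form_L: "z \<in> L2_per U \<Longrightarrow> b \<in> L2_per U \<Longrightarrow> soft_form a p z b = L2_inner MC (L z) b"
  using soft_form_op[OF _ _ U_sets U_per] L2_per_mono by blast

lemma L_mem: "z \<in> L2_per U \<Longrightarrow> L z \<in> L2_per U"
  using L_L2(1) L2_per_mono by blast

lemma L_bound: "z \<in> L2_per U \<Longrightarrow> L2_inner MC (L z) (L z) \<le> opbound * L2_inner MC z z"
  using L_L2(2) L2_per_mono by blast

lemma L_symmetric: "z \<in> L2_per U \<Longrightarrow> b \<in> L2_per U \<Longrightarrow> L2_inner MC (L z) b = L2_inner MC z (L b)"
  using soft_form_L soft_form_commute by (metis L2_inner_commute)

definition Lt :: "((real^'d) \<times> (real^'d) \<Rightarrow> real) \<Rightarrow> (real^'d) \<times> (real^'d) \<Rightarrow> real" where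
  "Lt z w = L (\<lambda>y. z (fst w, y)) (snd w)"

lemma L2_S_perD:
  assumes "z \<in> L2_S_per S U"
  shows "z \<in> L2 MSC" "x \<in> S \<Longrightarrow> periodic (\<lambda>y. z (x, y))" "AE w in MSC. snd w \<notin> U \<longrightarrow> z w = 0"
  using assms by (auto simp: L2_S_per_def split_beta')

lemma L2_S_perI:
  assumes "z \<in> L2 MSC" "\<And>x. x \<in> S \<Longrightarrow> periodic (\<lambda>y. z (x, y))" "AE w in MSC. snd w \<notin> U \<longrightarrow> z w = 0"
  shows "z \<in> L2_S_per S U"
  using assms by (auto simp: L2_S_per_def split_beta')

lemma L2_S_per_add:
  assumes z: "z \<in> L2_S_per S U" and b: "b \<in> L2_S_per S U"
  shows "(\<lambda>w. z w + b w) \<in> L2_S_per S U"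
proof (rule L2_S_perI)
  show "(\<lambda>w. z w + b w) \<in> L2 MSC" by (rule L2_add[OF L2_S_perD(1)[OF z] L2_S_perD(1)[OF b]])
  show "periodic (\<lambda>y. z (x, y) + b (x, y))" if "x \<in> S" for x
    using L2_S_perD(2)[OF z that] L2_S_perD(2)[OF b that] by (simp add: periodic_def)
  show "AE w in MSC. snd w \<notin> U \<longrightarrow> z w + b w = 0"
    using L2_S_perD(3)[OF z] L2_S_perD(3)[OF b] by eventually_elim simp
qed

lemma L2_S_per_scale:
  assumes z: "z \<in> L2_S_per S U"
  shows "(\<lambda>w. c * z w) \<in> L2_S_per S U"
proof (rule L2_S_perI)
  show "(\<lambda>w. c * z w) \<in> L2 MSC" by (rule L2_scale[OF L2_S_perD(1)[OF z]])
  show "periodic (\<lambda>y. c * z (x, y))" if "x \<in> S" for x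
    using L2_S_perD(2)[OF z that] by (simp add: periodic_def)
  show "AE w in MSC. snd w \<notin> U \<longrightarrow> c * z w = 0"
    using L2_S_perD(3)[OF z] by eventually_elim simp
qed

lemma L2_S_per_zero: "(\<lambda>w. 0) \<in> L2_S_per S U"
  by (rule L2_S_perI) (auto simp: periodic_def)

lemma L2_S_per_diff:
  assumes z: "z \<in> L2_S_per S U" and b: "b \<in> L2_S_per S U"
  shows "(\<lambda>w. z w - b w) \<in> L2_S_per S U"
  using L2_S_per_add[OF z L2_S_per_scale[OF b, of "- 1"]] by simp

lemma frac_fibre: "null_pres (\<lambda>w::(real^'d) \<times> (real^'d). (fst w, frac_vec (snd w)))"
proof (rule null_pres_fibre)
  show "(\<lambda>w::(real^'d) \<times> (real^'d). frac_vec (snd w)) \<in> borel_measurable borel"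
    by (rule measurable_compose[OF _ frac_vec_measurable]) (simp add: borel_prod[symmetric])
qed (rule null_pres_frac)

text \<open>The representative of the \<open>L\<^sup>2\<close> class of \<open>f\<close>, cut off outside \<open>U\<close>, that is periodic
  in the second variable.\<close>

definition cut_U :: "((real^'d) \<times> (real^'d) \<Rightarrow> real) \<Rightarrow> (real^'d) \<times> (real^'d) \<Rightarrow> real" where
  "cut_U f w = indicat_real U (snd w) * f (fst w, frac_vec (snd w))"

lemma cut_U_cell: "w \<in> S \<times> cell \<Longrightarrow> cut_U f w = indicat_real U (snd w) * f w"
  by (cases w) (auto simp: cut_U_def frac_vec_id)

lemma U_snd_measurable: "(\<lambda>w::(real^'d) \<times> (real^'d). indicat_real U (snd w)) \<in> borel_measurable lebesgue"
  using comps_measurable(2)[of "indicat_real U"] U_sets by simp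

lemma cut_U_mem:
  assumes f: "f \<in> L2 MSC"
  shows "cut_U f \<in> L2_S_per S U"
proof (rule L2_S_perI)
  have "(\<lambda>w. indicat_real U (snd w) * f w) \<in> borel_measurable MSC"
    by (rule borel_measurable_times[OF measurable_restrict_space1[OF U_snd_measurable] L2_measurable[OF f]])
  then have m: "cut_U f \<in> borel_measurable MSC"
    by (subst measurable_cong[where g = "\<lambda>w. indicat_real U (snd w) * f w"]) (auto simp: cut_U_cell)
  show "cut_U f \<in> L2 MSC"
    by (rule L2_bound[OF f m AE_I2]) (auto simp: cut_U_cell indicator_def)
  have fr: "frac_vec (y + lattice_vec m) = frac_vec y" for y :: "real^'d" and m
    by (simp add: frac_vec_def lattice_vec_def vec_eq_iff)
  have "indicat_real U (y + lattice_vec m) = indicat_real U y" for y m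
    using U_per by (simp add: periodic_def periodic_set_def indicator_def)
  then show "periodic (\<lambda>y. cut_U f (x, y))" for x by (simp add: periodic_def cut_U_def fr)
qed (simp add: cut_U_def)

lemma semi_hilbert_L2_S_per:
  "semi_hilbert (L2_S_per S U) (\<lambda>f g x. f x + g x) (\<lambda>c f x. c * f x) (L2_inner MSC)"
proof (rule semi_hilbert_L2)
  show "L2_S_per S U \<noteq> {}" using L2_S_per_zero by blast
  fix f assume f: "f \<in> L2 MSC"
  have "AE w in MSC. \<bar>h w - cut_U f w\<bar> \<le> \<bar>h w - f w\<bar>" if h: "h \<in> L2_S_per S U" for h
    using L2_S_perD(3)[OF h] AE_space
  proof eventually_elim
    case (elim w)
    then have "cut_U f w = indicat_real U (snd w) * f w" by (intro cut_U_cell) simp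
    then show ?case using elim(1) by (cases "snd w \<in> U") simp_all
  qed
  then show "\<exists>f'\<in>L2_S_per S U. \<forall>h\<in>L2_S_per S U. AE w in MSC. \<bar>h w - f' w\<bar> \<le> \<bar>h w - f w\<bar>"
    by (intro bexI[OF _ cut_U_mem[OF f]] ballI)
qed (auto simp: L2_S_perD(1) L2_S_per_add L2_S_per_scale)

lemma L2_inner_MSC:
  assumes f: "f \<in> L2 MSC" and g: "g \<in> L2 MSC"
  shows "integrable MX (\<lambda>x. L2_inner MC (\<lambda>y. f (x, y)) (\<lambda>y. g (x, y)))"
    and "L2_inner MSC f g = (LINT x|MX. L2_inner MC (\<lambda>y. f (x, y)) (\<lambda>y. g (x, y)))"
  using fubini_on(2,3)[OF S_sets(1) cell_borel L2_mult_integrable[OF f g]] by (simp_all add: L2_inner_def)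

lemma section_L2:
  assumes f: "f \<in> L2 MSC"
  shows "AE x in MX. (\<lambda>y. f (x, y)) \<in> L2 MC"
  using section_on[OF S_sets(1) cell_borel L2_measurable[OF f]] fubini_on(1)[OF S_sets(1) cell_borel L2_sq_integrable[OF f]]
  by eventually_elim (rule L2I)

lemma section_L2_per:
  assumes z: "z \<in> L2_S_per S U"
  shows "AE x in MX. (\<lambda>y. z (x, y)) \<in> L2_per U"
  using section_L2[OF L2_S_perD(1)[OF z]] AE_prod_on[OF S_sets(1) cell_borel L2_S_perD(3)[OF z]] AE_space
proof eventually_elim
  case (elim x)
  then show ?case using L2_S_perD(2)[OF z, of x] by (simp add: L2_per_def)
qed

text \<open>\<open>z\<close> is known to be measurable on \<open>S \<times> cell\<close> only, while
  \<open>L\<close> evaluates it at \<open>y + \<xi>\<close>. The extension \<open>zz\<close> by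
  \<open>frac_vec\<close> agrees with \<open>z\<close> over \<open>S\<close> by periodicity and
  makes the integrand measurable in the three variables \<open>x\<close>, \<open>y\<close>,
  \<open>\<xi>\<close>.\<close>

lemma Lt_measurable:
  assumes z: "z \<in> L2_S_per S U"
  shows "Lt z \<in> borel_measurable MSC"
proof -
  let ?h = "\<lambda>w. indicat_real (S \<times> cell) w * z w"
  define zz where "zz w = ?h (fst w, frac_vec (snd w))" for w
  have hm: "?h \<in> borel_measurable lebesgue" by (rule ext_measurable[OF S_sets(1) cell_borel L2_measurable[OF L2_S_perD(1)[OF z]]])
  have zzm: "zz \<in> borel_measurable lebesgue"
    unfolding zz_def[abs_def] by (rule null_pres_measurable[OF frac_fibre hm])
  have zz: "zz (x, y) = z (x, y)" if "x \<in> S" for x y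
    using that frac_vec_cell[of y] periodic_frac[OF L2_S_perD(2)[OF z that], of y] by (simp add: zz_def indicator_def)
  have b1: "(\<lambda>w::((real^'d) \<times> (real^'d)) \<times> (real^'d). fst (fst w)) \<in> borel_measurable borel" "(\<lambda>w::((real^'d) \<times> (real^'d)) \<times> (real^'d). snd (fst w)) \<in> borel_measurable borel" "(\<lambda>w::((real^'d) \<times> (real^'d)) \<times> (real^'d). snd w) \<in> borel_measurable borel"
    by (auto simp: borel_prod[symmetric])
  \<comment> \<open>For fixed \<open>\<xi>\<close> this is a shift of the second variable, which
    preserves null sets; the sections in \<open>\<xi>\<close> then give the map of three
    variables.\<close>
  have n1: "null_pres (\<lambda>w::((real^'d) \<times> (real^'d)) \<times> (real^'d). (fst (fst w), snd (fst w) + snd w))"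
  proof (rule null_pres_sect_fst)
    show "(\<lambda>w::((real^'d) \<times> (real^'d)) \<times> (real^'d). (fst (fst w), snd (fst w) + snd w)) \<in> borel_measurable borel"
      using b1 by (intro borel_measurable_Pair borel_measurable_add)
    fix \<xi> :: "real^'d"
    have g: "(\<lambda>w::(real^'d) \<times> (real^'d). snd w + \<xi>) \<in> borel_measurable borel"
      by (intro borel_measurable_add) (auto simp: borel_prod[symmetric])
    have "null_pres (\<lambda>w::(real^'d) \<times> (real^'d). (fst w, snd w + \<xi>))"
      by (rule null_pres_fibre[OF g null_pres_shift'])
    then show "null_pres (\<lambda>x::(real^'d) \<times> (real^'d). (fst (fst (x, \<xi>)), snd (fst (x, \<xi>)) + snd (x, \<xi>)))" by simp
  qed
  have n2: "null_pres (\<lambda>w::((real^'d) \<times> (real^'d)) \<times> (real^'d). (snd (fst w), snd w))"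
    by (rule null_pres_fibre'[of "\<lambda>_. snd"]) (auto simp: null_pres_snd borel_prod[symmetric])
  have pm: "(\<lambda>w::((real^'d) \<times> (real^'d)) \<times> (real^'d). p (snd (fst w)) (snd (fst w) + snd w)) \<in> borel_measurable lebesgue"
    using null_pres_measurable[OF n2 p_shift_measurable(1)] by simp
  have am: "(\<lambda>w::((real^'d) \<times> (real^'d)) \<times> (real^'d). a (snd w)) \<in> borel_measurable lebesgue" by (rule null_pres_measurable[OF null_pres_snd a_measurable])
  have z1: "(\<lambda>w::((real^'d) \<times> (real^'d)) \<times> (real^'d). zz (fst w)) \<in> borel_measurable lebesgue" by (rule null_pres_measurable[OF null_pres_fst zzm])
  have z2: "(\<lambda>w::((real^'d) \<times> (real^'d)) \<times> (real^'d). zz (fst (fst w), snd (fst w) + snd w)) \<in> borel_measurable lebesgue" by (rule null_pres_measurable[OF n1 zzm])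
  have "(\<lambda>w::((real^'d) \<times> (real^'d)) \<times> (real^'d). a (snd w) * p (snd (fst w)) (snd (fst w) + snd w) * (zz (fst w) - zz (fst (fst w), snd (fst w) + snd w))) \<in> borel_measurable lebesgue"
    by (intro borel_measurable_times borel_measurable_diff pm am z1 z2)
  from lebesgue_param_integral(1)[OF this]
  have "(\<lambda>w. 2 * indicat_real U (snd w) * (LINT \<xi>|lebesgue. a \<xi> * p (snd w) (snd w + \<xi>) * (zz w - zz (fst w, snd w + \<xi>)))) \<in> borel_measurable lebesgue"
    using U_snd_measurable by simp
  then have "(\<lambda>w. 2 * indicat_real U (snd w) * (LINT \<xi>|lebesgue. a \<xi> * p (snd w) (snd w + \<xi>) * (zz w - zz (fst w, snd w + \<xi>)))) \<in> borel_measurable MSC"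
    by (rule measurable_restrict_space1)
  then show ?thesis
    by (subst measurable_cong[where g = "\<lambda>w. 2 * indicat_real U (snd w) * (LINT \<xi>|lebesgue. a \<xi> * p (snd w) (snd w + \<xi>) * (zz w - zz (fst w, snd w + \<xi>)))"])
      (auto simp: Lt_def soft_op_def zz)
qed

lemma Lt_L2:
  assumes z: "z \<in> L2_S_per S U"
  shows "Lt z \<in> L2_S_per S U" and "L2_inner MSC (Lt z) (Lt z) \<le> opbound * L2_inner MSC z z"
proof -
  have m: "Lt z \<in> borel_measurable MSC" by (rule Lt_measurable[OF z])
  note zL = L2_S_perD(1)[OF z]
  have "(\<integral>\<^sup>+w. ennreal ((Lt z w)\<^sup>2) \<partial>MSC) = (\<integral>\<^sup>+x. \<integral>\<^sup>+y. ennreal ((Lt z (x, y))\<^sup>2) \<partial>MC \<partial>MX)"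
    by (rule tonelli_on(1)[OF S_sets(1) cell_borel]) (use m in simp)
  also have "\<dots> \<le> (\<integral>\<^sup>+x. ennreal (opbound * L2_inner MC (\<lambda>y. z (x, y)) (\<lambda>y. z (x, y))) \<partial>MX)"
  proof (rule nn_integral_mono_AE)
    show "AE x in MX. (\<integral>\<^sup>+y. ennreal ((Lt z (x, y))\<^sup>2) \<partial>MC) \<le> ennreal (opbound * L2_inner MC (\<lambda>y. z (x, y)) (\<lambda>y. z (x, y)))"
      using section_L2_per[OF z]
    proof eventually_elim
      case (elim x)
      let ?Lz = "L (\<lambda>y. z (x, y))"
      have "(\<integral>\<^sup>+y. ennreal ((Lt z (x, y))\<^sup>2) \<partial>MC) = ennreal (L2_inner MC ?Lz ?Lz)"
        using nn_integral_eq_integral[OF L2_sq_integrable[OF L2_perD(1)[OF L_mem[OF elim]]]]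
        by (simp add: Lt_def L2_inner_def power2_eq_square)
      also have "\<dots> \<le> ennreal (opbound * L2_inner MC (\<lambda>y. z (x, y)) (\<lambda>y. z (x, y)))"
        by (rule ennreal_leI[OF L_bound[OF elim]])
      finally show ?case .
    qed
  qed
  also have "\<dots> = ennreal (opbound * L2_inner MSC z z)"
    using L2_inner_MSC(1)[OF zL zL] opbound_nonneg unfolding L2_inner_MSC(2)[OF zL zL]
    by (subst nn_integral_eq_integral) auto
  finally have nn: "(\<integral>\<^sup>+w. ennreal ((Lt z w)\<^sup>2) \<partial>MSC) \<le> ennreal (opbound * L2_inner MSC z z)" .
  have i: "integrable MSC (\<lambda>w. (Lt z w)\<^sup>2)"
    using m le_less_trans[OF nn] by (simp add: integrable_iff_nn)
  then have LL: "Lt z \<in> L2 MSC" using m by (rule L2I[rotated])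
  show "Lt z \<in> L2_S_per S U"
  proof (rule L2_S_perI[OF LL])
    fix x assume "x \<in> S"
    then show "periodic (\<lambda>y. Lt z (x, y))"
      using soft_op_periodic[OF L2_S_perD(2)[OF z] U_per] by (simp add: Lt_def)
  qed (simp add: Lt_def soft_op_def)
  have "ennreal (L2_inner MSC (Lt z) (Lt z)) \<le> ennreal (opbound * L2_inner MSC z z)"
    using nn nn_integral_eq_integral[OF i] by (simp add: L2_inner_def power2_eq_square)
  then show "L2_inner MSC (Lt z) (Lt z) \<le> opbound * L2_inner MSC z z"
    using opbound_nonneg by (subst (asm) ennreal_le_iff) auto
qed

lemma integral_soft_form:
  assumes z: "z \<in> L2_S_per S U" and b: "b \<in> L2_S_per S U"
  shows "(LINT x|MX. soft_form a p (\<lambda>y. z (x, y)) (\<lambda>y. b (x, y))) = L2_inner MSC (Lt z) b"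
  unfolding L2_inner_MSC(2)[OF L2_S_perD(1)[OF Lt_L2(1)[OF z]] L2_S_perD(1)[OF b]]
proof (rule lebesgue_on_AE_cong(2)[OF S_sets(2)])
  show "(\<lambda>x. L2_inner MC (\<lambda>y. Lt z (x, y)) (\<lambda>y. b (x, y))) \<in> borel_measurable MX"
    using L2_inner_MSC(1)[OF L2_S_perD(1)[OF Lt_L2(1)[OF z]] L2_S_perD(1)[OF b]] by auto
  show "AE x in MX. soft_form a p (\<lambda>y. z (x, y)) (\<lambda>y. b (x, y)) = L2_inner MC (\<lambda>y. Lt z (x, y)) (\<lambda>y. b (x, y))"
    using section_L2_per[OF z] section_L2_per[OF b]
    by eventually_elim (simp add: soft_form_L Lt_def)
qed

lemma Lt_symmetric:
  assumes z: "z \<in> L2_S_per S U" and b: "b \<in> L2_S_per S U"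
  shows "L2_inner MSC (Lt z) b = L2_inner MSC z (Lt b)"
  unfolding integral_soft_form[OF z b, symmetric] L2_inner_commute[of MSC z] integral_soft_form[OF b z, symmetric]
  by (subst soft_form_commute) (rule refl)

lemma Lt_nonneg: "z \<in> L2_S_per S U \<Longrightarrow> 0 \<le> L2_inner MSC (Lt z) z"
  unfolding integral_soft_form[symmetric] by (intro Bochner_Integration.integral_nonneg soft_form_nonneg)

text \<open>The microscopic estimate applies to almost every section in \<open>x\<close> with one
  and the same constant and is integrated over \<open>S\<close>.\<close>

lemma Lt_bounded_below:
  assumes c: "c > 0" "\<And>z. z \<in> L2_per U \<Longrightarrow> c * L2_inner MC z z \<le> L2_inner MC (\<lambda>y. L z y - lam * z y) (\<lambda>y. L z y - lam * z y)"
    and z: "z \<in> L2_S_per S U"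
  shows "c * L2_inner MSC z z \<le> L2_inner MSC (\<lambda>w. Lt z w - lam * z w) (\<lambda>w. Lt z w - lam * z w)"
proof -
  have L1: "(\<lambda>w. Lt z w - lam * z w) \<in> L2 MSC"
    by (intro L2_diff L2_scale L2_S_perD(1)[OF z] L2_S_perD(1)[OF Lt_L2(1)[OF z]])
  note zL = L2_S_perD(1)[OF z]
  have "c * L2_inner MSC z z = (LINT x|MX. c * L2_inner MC (\<lambda>y. z (x, y)) (\<lambda>y. z (x, y)))"
    unfolding L2_inner_MSC(2)[OF zL zL] by simp
  also have "\<dots> \<le> (LINT x|MX. L2_inner MC (\<lambda>y. Lt z (x, y) - lam * z (x, y)) (\<lambda>y. Lt z (x, y) - lam * z (x, y)))"
  proof (rule integral_mono_AE)
    show "AE x in MX. c * L2_inner MC (\<lambda>y. z (x, y)) (\<lambda>y. z (x, y)) \<le> L2_inner MC (\<lambda>y. Lt z (x, y) - lam * z (x, y)) (\<lambda>y. Lt z (x, y) - lam * z (x, y))"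
      using section_L2_per[OF z]
    proof eventually_elim
      case (elim x)
      from c(2)[OF elim] show ?case by (simp add: Lt_def)
    qed
  qed (use L2_inner_MSC(1)[OF zL zL] L2_inner_MSC(1)[OF L1 L1] in auto)
  finally show ?thesis unfolding L2_inner_MSC(2)[OF L1 L1] .
qed

section \<open>Functions of one variable, cell averages and products\<close>

definition lift :: "(real^'d \<Rightarrow> real) \<Rightarrow> (real^'d) \<times> (real^'d) \<Rightarrow> real" where "lift v w = v (fst w)"
definition avg :: "((real^'d) \<times> (real^'d) \<Rightarrow> real) \<Rightarrow> real^'d \<Rightarrow> real" where "avg f x = (LINT y|MC. f (x, y))"

lemma emeasure_MC: "emeasure MC (cell :: (real^'d) set) = 1"
  unfolding emeasure_cell[where 'd = 'd, symmetric] by (rule emeasure_restrict_space) simp_all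

lemma one_L2: "(\<lambda>y. 1) \<in> L2 MC"
  using finite_measure.integrable_const[OF finite_measure_cell] by (intro L2I) auto

lemma lift_L2:
  assumes v: "v \<in> L2 MX"
  shows "lift v \<in> L2 MSC"
proof (rule L2I)
  have "(\<lambda>x. indicat_real S x * v x) \<in> borel_measurable lebesgue"
    using L2_measurable[OF v] by (simp add: measurable_lebesgue_on[OF S_sets(2)])
  from comps_measurable(1)[OF this] have "(\<lambda>w. indicat_real S (fst w) * v (fst w)) \<in> borel_measurable MSC"
    by (rule measurable_restrict_space1)
  then show m: "lift v \<in> borel_measurable MSC"
    by (subst measurable_cong[where g = "\<lambda>w. indicat_real S (fst w) * v (fst w)"]) (auto simp: lift_def)
  have "(\<integral>\<^sup>+w. ennreal ((lift v w)\<^sup>2) \<partial>MSC) = (\<integral>\<^sup>+x. \<integral>\<^sup>+y. ennreal ((lift v (x, y))\<^sup>2) \<partial>MC \<partial>MX)"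
    by (rule tonelli_on(1)[OF S_sets(1) cell_borel]) (use m in simp)
  also have "\<dots> = (\<integral>\<^sup>+x. ennreal ((v x)\<^sup>2) \<partial>MX)"
    by (simp add: lift_def emeasure_MC)
  also have "\<dots> < \<infinity>" using L2_sq_integrable[OF v] by (simp add: integrable_iff_nn)
  finally show "integrable MSC (\<lambda>w. (lift v w)\<^sup>2)" using m by (simp add: integrable_iff_nn)
qed

text \<open>\<open>avg\<close> is the adjoint of \<open>lift\<close>; in this way the fast variable
  is integrated out of the macroscopic equation.\<close>

lemma inner_lift:
  assumes f: "f \<in> L2 MSC" and v: "v \<in> L2 MX"
  shows "L2_inner MSC f (lift v) = L2_inner MX (avg f) v"
  unfolding L2_inner_MSC(2)[OF f lift_L2[OF v]] by (simp add: L2_inner_def avg_def lift_def)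

text \<open>Cauchy-Schwarz inequality against the constant 1 on the cell, which has measure
  1.\<close>

lemma avg_L2:
  assumes f: "f \<in> L2 MSC"
  shows "avg f \<in> L2 MX" and "L2_inner MX (avg f) (avg f) \<le> L2_inner MSC f f"
proof -
  have m: "avg f \<in> borel_measurable MX"
    unfolding avg_def[abs_def] by (rule param_integral_on[OF S_sets(1) cell_borel L2_measurable[OF f]])
  have le: "AE x in MX. (avg f x)\<^sup>2 \<le> L2_inner MC (\<lambda>y. f (x, y)) (\<lambda>y. f (x, y))"
    using section_L2[OF f]
  proof eventually_elim
    case (elim x)
    from L2_cauchy_schwarz[OF elim one_L2] show ?case by (simp add: L2_inner_def avg_def measure_def emeasure_MC)
  qed
  have i: "integrable MX (\<lambda>x. (avg f x)\<^sup>2)"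
  proof (rule Bochner_Integration.integrable_bound[OF L2_inner_MSC(1)[OF f f]])
    show "AE x in MX. norm ((avg f x)\<^sup>2) \<le> norm (L2_inner MC (\<lambda>y. f (x, y)) (\<lambda>y. f (x, y)))"
      using le by eventually_elim simp
  qed (use m in simp)
  show "avg f \<in> L2 MX" by (rule L2I[OF m i])
  show "L2_inner MX (avg f) (avg f) \<le> L2_inner MSC f f"
    using integral_mono_AE[OF i L2_inner_MSC(1)[OF f f] le] unfolding L2_inner_MSC(2)[OF f f]
    by (simp add: L2_inner_def power2_eq_square)
qed

lemma avg_lift: "avg (lift v) = v"
  by (simp add: avg_def lift_def measure_def emeasure_MC fun_eq_iff)

lemma inner_lift_lift:
  assumes "u \<in> L2 MX" "v \<in> L2 MX"
  shows "L2_inner MSC (lift u) (lift v) = L2_inner MX u v"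
  using inner_lift[OF lift_L2[OF assms(1)] assms(2)] by (simp add: avg_lift)

definition tensor :: "(real^'d \<Rightarrow> real) \<Rightarrow> (real^'d \<Rightarrow> real) \<Rightarrow> (real^'d) \<times> (real^'d) \<Rightarrow> real" where
  "tensor \<psi> z w = \<psi> (fst w) * z (snd w)"

lemma tensor_L2:
  assumes \<psi>: "\<psi> \<in> L2 MX" and z: "z \<in> L2 MC"
  shows "tensor \<psi> z \<in> L2 MSC"
proof (rule L2I)
  have "(\<lambda>x. indicat_real S x * \<psi> x) \<in> borel_measurable lebesgue" "(\<lambda>x. indicat_real cell x * z x) \<in> borel_measurable lebesgue"
    using L2_measurable[OF \<psi>] L2_measurable[OF z] by (simp_all add: measurable_lebesgue_on[OF S_sets(2)] measurable_lebesgue_on[OF cell_lebesgue])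
  from borel_measurable_times[OF comps_measurable(1)[OF this(1)] comps_measurable(2)[OF this(2)]]
  have "(\<lambda>w. (indicat_real S (fst w) * \<psi> (fst w)) * (indicat_real cell (snd w) * z (snd w))) \<in> borel_measurable MSC"
    by (rule measurable_restrict_space1)
  then show m: "tensor \<psi> z \<in> borel_measurable MSC"
    by (subst measurable_cong[where g = "\<lambda>w. (indicat_real S (fst w) * \<psi> (fst w)) * (indicat_real cell (snd w) * z (snd w))"]) (auto simp: tensor_def)
  have zn: "(\<integral>\<^sup>+y. ennreal ((z y)\<^sup>2) \<partial>MC) = ennreal (L2_inner MC z z)"
    using nn_integral_eq_integral[OF L2_sq_integrable[OF z]] by (simp add: L2_inner_def power2_eq_square)
  have "(\<integral>\<^sup>+w. ennreal ((tensor \<psi> z w)\<^sup>2) \<partial>MSC) = (\<integral>\<^sup>+x. \<integral>\<^sup>+y. ennreal ((tensor \<psi> z (x, y))\<^sup>2) \<partial>MC \<partial>MX)"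
    by (rule tonelli_on(1)[OF S_sets(1) cell_borel]) (use m in simp)
  also have "\<dots> = (\<integral>\<^sup>+x. ennreal (L2_inner MC z z * (\<psi> x)\<^sup>2) \<partial>MX)"
  proof (rule nn_integral_cong)
    fix x
    have "(\<integral>\<^sup>+y. ennreal ((tensor \<psi> z (x, y))\<^sup>2) \<partial>MC) = ennreal ((\<psi> x)\<^sup>2) * (\<integral>\<^sup>+y. ennreal ((z y)\<^sup>2) \<partial>MC)"
      using L2_measurable[OF z] by (subst nn_integral_cmult[symmetric]) (auto simp: tensor_def power_mult_distrib ennreal_mult)
    then show "(\<integral>\<^sup>+y. ennreal ((tensor \<psi> z (x, y))\<^sup>2) \<partial>MC) = ennreal (L2_inner MC z z * (\<psi> x)\<^sup>2)"
      unfolding zn by (simp add: ennreal_mult mult.commute)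
  qed
  also have "\<dots> < \<infinity>"
  proof -
    have "integrable MX (\<lambda>x. L2_inner MC z z * (\<psi> x)\<^sup>2)" using L2_sq_integrable[OF \<psi>] by simp
    from nn_integral_eq_integral[OF this] show ?thesis by simp
  qed
  finally show "integrable MSC (\<lambda>w. (tensor \<psi> z w)\<^sup>2)" using m by (simp add: integrable_iff_nn)
qed

lemma tensor_inner:
  assumes "\<psi> \<in> L2 MX" "z \<in> L2 MC" "\<phi> \<in> L2 MX" "b \<in> L2 MC"
  shows "L2_inner MSC (tensor \<psi> z) (tensor \<phi> b) = L2_inner MX \<psi> \<phi> * L2_inner MC z b"
proof -
  have "L2_inner MC (\<lambda>y. \<psi> x * z y) (\<lambda>y. \<phi> x * b y) = \<psi> x * \<phi> x * L2_inner MC z b" for x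
    by (simp add: L2_inner_scale_left L2_inner_scale_right)
  then show ?thesis
    unfolding L2_inner_MSC(2)[OF tensor_L2[OF assms(1,2)] tensor_L2[OF assms(3,4)]]
    by (simp add: tensor_def L2_inner_def[of MX])
qed

lemma tensor_mem:
  assumes \<psi>: "\<psi> \<in> L2 MX" and z: "z \<in> L2_per U"
  shows "tensor \<psi> z \<in> L2_S_per S U"
proof (rule L2_S_perI)
  show "tensor \<psi> z \<in> L2 MSC" by (rule tensor_L2[OF \<psi> L2_perD(1)[OF z]])
  show "periodic (\<lambda>y. tensor \<psi> z (x, y))" for x
    using L2_perD(2)[OF z] by (simp add: periodic_def tensor_def)
  have N: "AE y in lebesgue. y \<in> cell \<longrightarrow> y \<notin> U \<longrightarrow> z y = 0"
    using L2_perD(3)[OF z] unfolding AE_lebesgue_on[OF cell_lebesgue] .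
  show "AE w in MSC. snd w \<notin> U \<longrightarrow> tensor \<psi> z w = 0"
  proof -
    have "null_pres (snd :: (real^'d) \<times> (real^'d) \<Rightarrow> real^'d)" by (rule null_pres_snd)
    from null_pres_AE[OF this N] show ?thesis unfolding AE_lebesgue_on[OF SC(3)]
      by eventually_elim (auto simp: tensor_def)
  qed
qed

lemma soft_op_scale: "soft_op U a p (\<lambda>y. c * z y) y = c * soft_op U a p z y"
proof -
  have "(LINT \<xi>|lebesgue. a \<xi> * p y (y + \<xi>) * (c * z y - c * z (y + \<xi>))) = (LINT \<xi>|lebesgue. c * (a \<xi> * p y (y + \<xi>) * (z y - z (y + \<xi>))))"
    by (rule Bochner_Integration.integral_cong) (simp_all add: algebra_simps)
  then show ?thesis by (simp add: soft_op_def)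
qed

lemma Lt_tensor: "Lt (tensor \<psi> z) = tensor \<psi> (L z)"
  by (simp add: fun_eq_iff Lt_def tensor_def soft_op_scale)

end

section \<open>Coercivity of the homogenized matrix\<close>

lemma convolution_kernel_integrable:
  fixes a :: "real^'d \<Rightarrow> real"
  assumes "convolution_kernel a r c"
  shows "integrable lebesgue a" "integrable lebesgue (\<lambda>x. a x * (x $ i)\<^sup>2)"
proof -
  have int: "integrable lebesgue (\<lambda>x. a x * (1 + (norm x)\<^sup>2))" and nn: "0 \<le> a x" for x
    using assms by (auto simp: convolution_kernel_def)
  have nm: "(\<lambda>x::real^'d. 1 / (1 + (norm x)\<^sup>2)) \<in> borel_measurable lebesgue"
    by (intro borel_imp_lebesgue_measurable) measurable
  have im: "(\<lambda>x::real^'d. (x $ i)\<^sup>2) \<in> borel_measurable lebesgue"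
    by (intro borel_imp_lebesgue_measurable borel_measurable_continuous_onI continuous_intros)
  have pos: "1 + (norm x)\<^sup>2 \<noteq> 0" for x :: "real^'d" by (smt (verit) zero_le_power2)
  \<comment> \<open>The assumption gives measurability of \<open>a\<close> times the weight;
    dividing by the positive weight recovers \<open>a\<close>.\<close>
  have "(\<lambda>x. a x * (1 + (norm x)\<^sup>2) * (1 / (1 + (norm x)\<^sup>2))) \<in> borel_measurable lebesgue"
    by (rule borel_measurable_times[OF borel_measurable_integrable[OF int] nm])
  then have am: "a \<in> borel_measurable lebesgue" using pos by simp
  show "integrable lebesgue a"
  proof (rule Bochner_Integration.integrable_bound[OF int am AE_I2])
    fix x have "a x * 1 \<le> a x * (1 + (norm x)\<^sup>2)" by (intro mult_left_mono nn) simp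
    then show "norm (a x) \<le> norm (a x * (1 + (norm x)\<^sup>2))" using nn[of x] by simp
  qed
  show "integrable lebesgue (\<lambda>x. a x * (x $ i)\<^sup>2)"
  proof (rule Bochner_Integration.integrable_bound[OF int borel_measurable_times[OF am im] AE_I2])
    fix x :: "real^'d"
    have "\<bar>x $ i\<bar> \<le> norm x" by (rule component_le_norm_cart)
    then have "(x $ i)\<^sup>2 \<le> (norm x)\<^sup>2" by (simp add: abs_le_square_iff[symmetric])
    then have "a x * (x $ i)\<^sup>2 \<le> a x * (1 + (norm x)\<^sup>2)" by (intro mult_left_mono nn) simp
    then show "norm (a x * (x $ i)\<^sup>2) \<le> norm (a x * (1 + (norm x)\<^sup>2))" using nn[of x] by simp
  qed
qed

lemma open_Int_AE_ex:
  fixes E :: "'a::euclidean_space set"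
  assumes "open E" "E \<noteq> {}" "AE y in lebesgue. P y"
  shows "\<exists>y\<in>E. P y"
proof (rule ccontr)
  assume "\<not> ?thesis"
  then have "AE y in lebesgue. y \<notin> E" using assms(3) by (auto elim!: eventually_mono)
  then have "E \<in> null_sets lebesgue" using assms(1) by (subst (asm) AE_iff_null) auto
  then show False using open_not_negligible[OF assms(1,2)] by (simp add: negligible_iff_null_sets)
qed

lemma periodic_set_shift: "periodic_set V \<Longrightarrow> x + lattice_vec m \<in> V \<longleftrightarrow> x \<in> V"
  by (simp add: periodic_set_def periodic_def)

lemma axis_lattice: "\<exists>m. lattice_vec m = - axis i (1::real)"
  by (rule exI[of _ "\<chi> j. if j = i then - 1 else 0"]) (simp add: lattice_vec_def axis_def vec_eq_iff)

text \<open>A function \<open>v\<close> on a connected stiff phase that does not change under jumps shorter than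
  \<open>r_a\<close> is constant along the chain from \<open>\<eta>\<close> to \<open>\<eta> - e\<^sub>i\<close>.\<close>

lemma stiff_rigidity:
  fixes Ys :: "(real^'d) set" and v :: "real^'d \<Rightarrow> real"
  assumes Ys: "open Ys" "periodic_set Ys" "Ys \<noteq> {}" and conn: "stiff_connected Ys ra"
    and v: "AE y in lebesgue. AE y' in lebesgue. norm (y' - y) < ra \<and> y \<in> Ys \<and> y' \<in> Ys \<longrightarrow> v y' = v y"
    and shift: "\<And>y. v (y - axis i 1) = v y - t"
  shows "t = 0"
proof -
  obtain r0 r1 k Nbar where r: "r0 > 0" "ra \<ge> 2 * r0 + r1" "r1 > 0"
    and chain: "\<forall>\<eta>'\<in>Ys \<inter> cube 1. \<forall>\<eta>''\<in>Ys \<inter> cube 1. \<exists>N\<le>(Nbar::nat). \<exists>\<eta> :: nat \<Rightarrow> real^'d.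
             \<eta> 0 = \<eta>' \<and> \<eta> (N + 1) = \<eta>'' \<and> (\<forall>j\<le>N + 1. \<eta> j \<in> Ys \<inter> cube k) \<and> (\<forall>j\<le>N. norm (\<eta> (j + 1) - \<eta> j) \<le> r1)"
    using conn unfolding stiff_connected_def by blast
  \<comment> \<open>\<open>v\<close> is known almost everywhere only, so its values at the chain
    points mean nothing. They are replaced by the stiff parts of balls around these points, which
    are open and nonempty and hence not null.\<close>
  define E where "E \<eta> = Ys \<inter> ball \<eta> r0" for \<eta>
  have E: "open (E \<eta>)" "\<eta> \<in> Ys \<Longrightarrow> E \<eta> \<noteq> {}" for \<eta> using Ys(1) r(1) by (auto simp: E_def)
  define const where "const \<eta> c \<longleftrightarrow> (AE y in lebesgue. y \<in> E \<eta> \<longrightarrow> v y = c)" for \<eta> c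
  \<comment> \<open>Points of \<open>E \<eta>\<close> and \<open>E \<eta>'\<close> are less than
    \<open>2 * r0 + r1\<close> apart, hence within the range in which \<open>v\<close> does not
    change.\<close>
  have near: "const \<eta>' (v y)" if good: "AE y' in lebesgue. norm (y' - y) < ra \<and> y \<in> Ys \<and> y' \<in> Ys \<longrightarrow> v y' = v y"
    and y: "y \<in> E \<eta>" and \<eta>: "norm (\<eta>' - \<eta>) \<le> r1" for \<eta> \<eta>' y
    unfolding const_def using good
  proof eventually_elim
    case (elim y')
    show ?case
    proof
      assume y': "y' \<in> E \<eta>'"
      have "norm (y' - y) \<le> norm (y' - \<eta>') + (norm (\<eta>' - \<eta>) + norm (\<eta> - y))"
        using norm_triangle_ineq[of "y' - \<eta>'" "(\<eta>' - \<eta>) + (\<eta> - y)"] norm_triangle_ineq[of "\<eta>' - \<eta>" "\<eta> - y"] by simp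
      moreover have "norm (y' - \<eta>') < r0" "norm (\<eta> - y) < r0"
        using y y' by (auto simp: E_def dist_norm norm_minus_commute)
      ultimately have "norm (y' - y) < ra" using r \<eta> by linarith
      then show "v y' = v y" using elim y y' by (auto simp: E_def)
    qed
  qed
  \<comment> \<open>One point of \<open>E \<eta>\<close> outside the exceptional null set determines
    \<open>v\<close> almost everywhere on \<open>E \<eta>\<close>.\<close>
  have init: "\<exists>c. const \<eta> c" if \<eta>: "\<eta> \<in> Ys" for \<eta>
  proof -
    obtain y where "y \<in> E \<eta>" "AE y' in lebesgue. norm (y' - y) < ra \<and> y \<in> Ys \<and> y' \<in> Ys \<longrightarrow> v y' = v y"
      using open_Int_AE_ex[OF E(1) E(2)[OF \<eta>] v] by blast
    then show ?thesis using near[of y \<eta> \<eta>] r(3) by auto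
  qed
  have step: "const \<eta>' c" if c: "const \<eta> c" and \<eta>: "\<eta> \<in> Ys" "norm (\<eta>' - \<eta>) \<le> r1" for \<eta> \<eta>' c
  proof -
    have "AE y in lebesgue. (AE y' in lebesgue. norm (y' - y) < ra \<and> y \<in> Ys \<and> y' \<in> Ys \<longrightarrow> v y' = v y) \<and> (y \<in> E \<eta> \<longrightarrow> v y = c)"
      using v c unfolding const_def by eventually_elim simp
    from open_Int_AE_ex[OF E(1) E(2)[OF \<eta>(1)] this] obtain y where "y \<in> E \<eta>" "v y = c"
      "AE y' in lebesgue. norm (y' - y) < ra \<and> y \<in> Ys \<and> y' \<in> Ys \<longrightarrow> v y' = v y" by blast
    then show ?thesis using near[of y \<eta> \<eta>'] \<eta>(2) by simp
  qed
  obtain x where x: "x \<in> Ys" using Ys(3) by auto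
  \<comment> \<open>Moving the point into the cell puts it and its translate by
    \<open>- axis i 1\<close> into \<open>cube 1\<close>, where the chain condition applies.\<close>
  define \<eta> where "\<eta> = frac_vec x"
  have \<eta>: "\<eta> \<in> Ys" "\<eta> \<in> cell"
    using x frac_vec_cell unfolding \<eta>_def frac_vec_eq periodic_set_shift[OF Ys(2)] by (auto simp flip: frac_vec_eq)
  let ?\<eta> = "\<eta> - axis i 1"
  obtain m where m: "lattice_vec m = - axis i (1::real)" using axis_lattice by blast
  have sh: "y - axis i 1 \<in> Ys \<longleftrightarrow> y \<in> Ys" for y using periodic_set_shift[OF Ys(2), of y m] by (simp add: m)
  have b: "- 1 \<le> \<eta> $ j" "\<eta> $ j \<le> 1" "0 \<le> \<eta> $ j" "\<eta> $ j \<le> 2" for j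
    using \<eta>(2) unfolding cell_def by (smt (verit) mem_Collect_eq)+
  have cubes: "\<eta> \<in> Ys \<inter> cube 1" "?\<eta> \<in> Ys \<inter> cube 1"
  proof -
    show "\<eta> \<in> Ys \<inter> cube 1" using \<eta>(1) b by (simp add: cube_def)
    have "- 1 \<le> \<eta> $ j - axis i 1 $ j" "\<eta> $ j - axis i 1 $ j \<le> 1" for j
      using b[of j] by (cases "j = i"; simp add: axis_def)+
    then show "?\<eta> \<in> Ys \<inter> cube 1" using \<eta>(1) sh[of \<eta>] by (simp add: cube_def)
  qed
  from bspec[OF bspec[OF chain cubes(1)] cubes(2)] obtain N and h :: "nat \<Rightarrow> real^'d"
    where h: "h 0 = \<eta>" "h (N + 1) = ?\<eta>" and h': "\<forall>j\<le>N + 1. h j \<in> Ys \<inter> cube k" "\<forall>j\<le>N. norm (h (j + 1) - h j) \<le> r1"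
    by (elim exE conjE)
  obtain c where c: "const \<eta> c" using init[OF \<eta>(1)] by blast
  have "j \<le> N + 1 \<Longrightarrow> const (h j) c" for j
  proof (induction j)
    case (Suc j)
    then show ?case using step[of "h j" c "h (Suc j)"] h' by simp
  qed (use c h(1) in simp)
  from this[of "N + 1"] have "const ?\<eta> c" using h(2) by simp
  \<comment> \<open>The constant value near \<open>\<eta> - axis i 1\<close> is pulled back to
    \<open>E \<eta>\<close>, where \<open>shift\<close> turns it into \<open>v y - t = c\<close>;
    together with \<open>v y = c\<close> this gives \<open>t = 0\<close>.\<close>
  then have "AE y in lebesgue. y + - axis i 1 \<in> E ?\<eta> \<longrightarrow> v (y + - axis i 1) = c"
    unfolding const_def by (rule null_pres_AE[OF null_pres_shift'])
  then have "AE y in lebesgue. y \<in> E \<eta> \<longrightarrow> v y - t = c"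
  proof eventually_elim
    case (elim y)
    have "y \<in> E \<eta> \<Longrightarrow> y - axis i 1 \<in> E ?\<eta>" using sh by (auto simp: E_def dist_norm)
    then show ?case using elim shift[of y] by simp
  qed
  with c[unfolded const_def] have "AE y in lebesgue. y \<in> E \<eta> \<longrightarrow> t = 0" by eventually_elim auto
  from open_Int_AE_ex[OF E(1) E(2)[OF \<eta>(1)] this] show ?thesis by blast
qed

text \<open>Compactness of the unit sphere gives a positive minimum, and homogeneity of degree 2
  extends the estimate to all vectors.\<close>

lemma quadratic_form_coercive:
  fixes A :: "real^'d^'d"
  assumes sym: "\<And>i j. A $ i $ j = A $ j $ i"
    and nonneg: "\<And>e. 0 \<le> (\<Sum>i\<in>UNIV. \<Sum>j\<in>UNIV. A $ i $ j * e j * e i)"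
    and def: "\<And>e. (\<Sum>i\<in>UNIV. \<Sum>j\<in>UNIV. A $ i $ j * e j * e i) = 0 \<Longrightarrow> e = (\<lambda>i. 0)"
  shows "\<exists>c. coercive_matrix A c"
proof -
  let ?q = "\<lambda>x::real^'d. \<Sum>i\<in>UNIV. \<Sum>j\<in>UNIV. A $ i $ j * x $ j * x $ i"
  have cont: "continuous_on (sphere 0 1) ?q" by (intro continuous_intros)
  obtain x0 where x0: "x0 \<in> sphere 0 1" "\<And>x. x \<in> sphere 0 1 \<Longrightarrow> ?q x0 \<le> ?q x"
  proof -
    have "axis (undefined :: 'd) (1::real) \<in> sphere 0 1" by (simp add: norm_axis_1)
    then have "sphere (0::real^'d) 1 \<noteq> {}" by blast
    then show ?thesis using continuous_attains_inf[OF compact_sphere _ cont] that by blast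
  qed
  let ?m = "?q x0"
  have "?m \<noteq> 0"
  proof
    assume "?m = 0"
    then have "(\<lambda>i. x0 $ i) = (\<lambda>i. 0)" by (rule def)
    then have "x0 = 0" by (simp add: vec_eq_iff fun_eq_iff)
    then show False using x0(1) by simp
  qed
  then have m: "?m > 0" using nonneg[of "\<lambda>i. x0 $ i"] by simp
  have "?m * (\<Sum>i\<in>UNIV. (e i)\<^sup>2) \<le> (\<Sum>i\<in>UNIV. \<Sum>j\<in>UNIV. A $ i $ j * e j * e i)" for e :: "'d \<Rightarrow> real"
  proof (cases "e = (\<lambda>i. 0)")
    case False
    define x where "x = (\<chi> i. e i)"
    have xi: "x $ i = e i" for i by (simp add: x_def)
    have "x \<noteq> 0" using False by (auto simp: vec_eq_iff xi fun_eq_iff)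
    then have n: "norm x > 0" by simp
    have nx: "(norm x)\<^sup>2 = (\<Sum>i\<in>UNIV. (e i)\<^sup>2)" by (simp add: norm_vec_def L2_set_def sum_nonneg xi)
    have "?m \<le> ?q ((1 / norm x) *\<^sub>R x)" using n by (intro x0(2)) simp
    also have "\<dots> = (1 / norm x)\<^sup>2 * ?q x"
      by (simp add: sum_distrib_left power2_eq_square mult_ac)
    finally have "?m * (norm x)\<^sup>2 \<le> ?q x" using n by (simp add: field_simps power2_eq_square)
    then show ?thesis unfolding nx xi .
  qed simp
  then show ?thesis using m sym unfolding coercive_matrix_def by blast
qed

text \<open>In \<open>A_hom\<close> the corrector enters one factor only. Testing the corrector
  equation with \<open>X j\<close> completes the other factor, so the matrix is the Gram matrix of
  the fields \<open>\<xi> $ i + X i (y + \<xi>) - X i y\<close> with the nonnegative weight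
  \<open>a \<xi> * Lam y (y + \<xi>)\<close>. It remains to exclude null vectors.\<close>

lemma A_hom_coercive:
  fixes Ystiff Ysoft :: "(real^'d) set" and X :: "'d \<Rightarrow> real^'d \<Rightarrow> real"
  assumes geo: "geometry Ystiff Ysoft" and ker: "convolution_kernel a r_a c_a"
    and coeff: "coefficients Ystiff Lam p" and conn: "stiff_connected Ystiff r_a"
    and corr: "\<forall>i. corrector Ystiff a Lam i (X i)"
  shows "\<exists>c. coercive_matrix (A_hom a Lam X) c"
proof -
  obtain \<alpha>1 \<alpha>2 where al: "0 < \<alpha>1" "\<alpha>1 < \<alpha>2" "\<And>x y. x \<in> Ystiff \<Longrightarrow> y \<in> Ystiff \<Longrightarrow> \<alpha>1 < Lam x y \<and> Lam x y < \<alpha>2"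
    and L0: "\<And>x y. (x, y) \<notin> Ystiff \<times> Ystiff \<Longrightarrow> Lam x y = 0" and LC: "periodic_coefficient Lam"
    using coeff unfolding coefficients_def by blast
  have Lr: "0 \<le> Lam x y" "Lam x y \<le> \<alpha>2" for x y
    using al L0[of x y] by (cases "(x, y) \<in> Ystiff \<times> Ystiff"; force)+
  have an: "0 \<le> a \<xi>" and ae: "a (- \<xi>) = a \<xi>" and apos: "norm \<xi> < r_a \<Longrightarrow> 0 < a \<xi>" for \<xi>
    using ker unfolding convolution_kernel_def by (auto intro: less_le_trans)
  note ai = convolution_kernel_integrable[OF ker]
  interpret convolution_form a Lam \<alpha>2
    by unfold_locales (use an ae ai(1) LC Lr in auto)
  have Ys: "open Ystiff" "periodic_set Ystiff" "Ystiff \<noteq> {}" using geo by (auto simp: geometry_def)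
  have XL: "X i \<in> L2_per UNIV" for i using corr L2_per_mono by (auto simp: corrector_def)
  have Xm: "X i \<in> borel_measurable lebesgue" for i by (rule L2_perD(4)[OF XL])
  have U: "(UNIV :: (real^'d) set) \<in> sets borel" by simp
  have nm: "(\<lambda>x::real^'d. x $ i) \<in> borel_measurable lebesgue" for i
    by (intro borel_imp_lebesgue_measurable borel_measurable_continuous_onI continuous_intros)
  have sm: "(\<lambda>w::(real^'d) \<times> (real^'d). sqrt (a (snd w))) \<in> borel_measurable lebesgue"
    using comps_measurable(2)[OF a_measurable] by simp
  have Lm: "(\<lambda>w. Lam (fst w) (fst w + snd w)) \<in> borel_measurable lebesgue" by (rule p_shift_measurable(1))
  \<comment> \<open>Square integrability with weight \<open>a\<close>. The field
    \<open>\<xi> $ i\<close> has it by the second moment of \<open>a\<close>, the differences of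
    \<open>X\<close> by \<open>kernel_square_integrable\<close>; products of two such fields with
    \<open>Lam\<close> are then integrable.\<close>
  define W where "W F \<longleftrightarrow> F \<in> borel_measurable lebesgue \<and> (\<lambda>w. sqrt (a (snd w)) * F w) \<in> L2 MCR" for F
  have WI: "W F" if "F \<in> borel_measurable lebesgue" "integrable MCR (\<lambda>w. a (snd w) * (F w)\<^sup>2)" for F
    using that sm an unfolding W_def
    by (intro conjI L2I measurable_restrict_space1 borel_measurable_times) (auto simp: power_mult_distrib)
  have Wadd: "W (\<lambda>w. F w + G w)" and Wdiff: "W (\<lambda>w. F w - G w)" if "W F" "W G" for F G
    using that L2_add[of "\<lambda>w. sqrt (a (snd w)) * F w" MCR "\<lambda>w. sqrt (a (snd w)) * G w"]
      L2_diff[of "\<lambda>w. sqrt (a (snd w)) * F w" MCR "\<lambda>w. sqrt (a (snd w)) * G w"]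
    unfolding W_def by (auto simp: algebra_simps)
  have Wint: "integrable MCR (\<lambda>w. a (snd w) * Lam (fst w) (fst w + snd w) * F w * G w)" if F: "W F" and G: "W G" for F G
  proof (rule Bochner_Integration.integrable_bound)
    let ?p = "\<lambda>w. (sqrt (a (snd w)) * F w) * (sqrt (a (snd w)) * G w)"
    show "integrable MCR (\<lambda>w. \<alpha>2 * ?p w)"
      using F G unfolding W_def by (intro integrable_mult_right L2_mult_integrable) auto
    have eq: "a (snd w) * Lam (fst w) (fst w + snd w) * F w * G w = Lam (fst w) (fst w + snd w) * ?p w" for w
    proof -
      have "?p w = (sqrt (a (snd w)) * sqrt (a (snd w))) * (F w * G w)" by (simp only: mult_ac)
      also have "sqrt (a (snd w)) * sqrt (a (snd w)) = a (snd w)" using an by simp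
      finally show ?thesis by (simp only: mult_ac)
    qed
    show "AE w in MCR. norm (a (snd w) * Lam (fst w) (fst w + snd w) * F w * G w) \<le> norm (\<alpha>2 * ?p w)"
    proof (rule AE_I2)
      fix w
      have "norm (Lam (fst w) (fst w + snd w)) \<le> norm \<alpha>2" using Lr[of "fst w" "fst w + snd w"] by simp
      then show "norm (a (snd w) * Lam (fst w) (fst w + snd w) * F w * G w) \<le> norm (\<alpha>2 * ?p w)"
        unfolding eq norm_mult by (rule mult_right_mono) simp
    qed
    have "F \<in> borel_measurable lebesgue" "G \<in> borel_measurable lebesgue" using F G by (auto simp: W_def)
    then show "(\<lambda>w. a (snd w) * Lam (fst w) (fst w + snd w) * F w * G w) \<in> borel_measurable MCR"
      by (intro measurable_restrict_space1 borel_measurable_times Lm comps_measurable(2)[OF a_measurable])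
  qed
  define xi where "xi i w = snd w $ i" for i and w :: "(real^'d) \<times> (real^'d)"
  define dX where "dX i w = X i (fst w + snd w) - X i (fst w)" for i w
  define E where "E i w = xi i w + dX i w" for i w
  have Wxi: "W (xi i)" for i
  proof (rule WI)
    show m: "xi i \<in> borel_measurable lebesgue" unfolding xi_def[abs_def] by (rule comps_measurable(2)[OF nm])
    have mm: "(\<lambda>w. a (snd w) * (xi i w)\<^sup>2) \<in> borel_measurable MCR"
      using m by (intro measurable_restrict_space1 borel_measurable_times comps_measurable(2)[OF a_measurable] borel_measurable_power)
    have "(\<integral>\<^sup>+w. ennreal (a (snd w) * (xi i w)\<^sup>2) \<partial>MCR) = (\<integral>\<^sup>+y. \<integral>\<^sup>+\<xi>. ennreal (a \<xi> * (\<xi> $ i)\<^sup>2) \<partial>lebesgue \<partial>MC)"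
      using tonelli_on(1)[OF cell_borel U mm] by (simp add: xi_def)
    also have "\<dots> = (\<integral>\<^sup>+y. ennreal (LINT \<xi>|lebesgue. a \<xi> * (\<xi> $ i)\<^sup>2) \<partial>MC)"
      using nn_integral_eq_integral[OF ai(2)[of i]] an by simp
    also have "\<dots> < \<infinity>"
      using finite_measure.finite_emeasure_space[OF finite_measure_cell[where 'd = 'd]]
      by (simp add: ennreal_mult_less_top less_top)
    finally show "integrable MCR (\<lambda>w. a (snd w) * (xi i w)\<^sup>2)" using mm an by (simp add: integrable_iff_nn abs_mult)
  qed
  have WdX: "W (dX i)" for i
    unfolding dX_def[abs_def] by (intro Wdiff WI comps_measurable Xm kernel_square_integrable XL)
  have WE: "W (E i)" for i unfolding E_def[abs_def] by (rule Wadd[OF Wxi WdX])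
  define g where "g F G = (LINT w|MCR. a (snd w) * Lam (fst w) (fst w + snd w) * F w * G w)" for F G
  have A: "A_hom a Lam X $ i $ j = g (E i) (xi j)" for i j
    using fubini_on(3)[OF cell_borel U Wint[OF WE Wxi], of i j]
    by (simp add: A_hom_def g_def E_def xi_def dX_def add_diff_eq)
  have c0: "g (E i) (dX j) = 0" for i j
  proof -
    have "(LINT y|lebesgue_on cell. (LINT \<xi>|lebesgue.
           a \<xi> * Lam y (y + \<xi>) * (\<xi> $ i + X i (y + \<xi>) - X i y) * (X j (y + \<xi>) - X j y))) = 0"
      using corr XL[of j] by (auto simp: corrector_def)
    then show ?thesis
      using fubini_on(3)[OF cell_borel U Wint[OF WE WdX], of i j]
      by (simp add: g_def E_def xi_def dX_def add_diff_eq)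
  qed
  have gE: "g (E i) (E j) = A_hom a Lam X $ i $ j" for i j
  proof -
    have "g (E i) (E j) = (LINT w|MCR. a (snd w) * Lam (fst w) (fst w + snd w) * E i w * xi j w + a (snd w) * Lam (fst w) (fst w + snd w) * E i w * dX j w)"
      unfolding g_def E_def[of j] by (simp add: distrib_left)
    also have "\<dots> = g (E i) (xi j) + g (E i) (dX j)"
      unfolding g_def by (rule Bochner_Integration.integral_add[OF Wint[OF WE Wxi] Wint[OF WE WdX]])
    finally show ?thesis unfolding c0 A by simp
  qed
  define V where "V e w = (\<Sum>i\<in>UNIV. e i * E i w)" for e w
  have quad: "(\<Sum>i\<in>UNIV. \<Sum>j\<in>UNIV. A_hom a Lam X $ i $ j * e j * e i)
      = (LINT w|MCR. a (snd w) * Lam (fst w) (fst w + snd w) * (V e w)\<^sup>2)"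
    and Vint: "integrable MCR (\<lambda>w. a (snd w) * Lam (fst w) (fst w + snd w) * (V e w)\<^sup>2)" for e
  proof -
    have eq: "a (snd w) * Lam (fst w) (fst w + snd w) * (V e w)\<^sup>2 = (\<Sum>i\<in>UNIV. \<Sum>j\<in>UNIV. (e j * e i) * (a (snd w) * Lam (fst w) (fst w + snd w) * E i w * E j w))" for w
      unfolding V_def power2_eq_square sum_product by (simp add: sum_distrib_left mult_ac)
    show "integrable MCR (\<lambda>w. a (snd w) * Lam (fst w) (fst w + snd w) * (V e w)\<^sup>2)"
      unfolding eq by (intro Bochner_Integration.integrable_sum integrable_mult_right Wint WE)
    have "(LINT w|MCR. a (snd w) * Lam (fst w) (fst w + snd w) * (V e w)\<^sup>2) = (\<Sum>i\<in>UNIV. \<Sum>j\<in>UNIV. (e j * e i) * g (E i) (E j))"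
      unfolding eq g_def using Wint[OF WE WE] by (simp add: Bochner_Integration.integral_sum)
    then show "(\<Sum>i\<in>UNIV. \<Sum>j\<in>UNIV. A_hom a Lam X $ i $ j * e j * e i)
      = (LINT w|MCR. a (snd w) * Lam (fst w) (fst w + snd w) * (V e w)\<^sup>2)"
      unfolding gE by (simp add: mult_ac)
  qed
  have Vnn: "0 \<le> a (snd w) * Lam (fst w) (fst w + snd w) * (V e w)\<^sup>2" for e w using an Lr by simp
  show ?thesis
  proof (rule quadratic_form_coercive)
    show "A_hom a Lam X $ i $ j = A_hom a Lam X $ j $ i" for i j
      unfolding gE[symmetric] g_def by (simp add: mult_ac)
    show "0 \<le> (\<Sum>i\<in>UNIV. \<Sum>j\<in>UNIV. A_hom a Lam X $ i $ j * e j * e i)" for e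
      unfolding quad by (rule Bochner_Integration.integral_nonneg[OF Vnn])
    fix e assume "(\<Sum>i\<in>UNIV. \<Sum>j\<in>UNIV. A_hom a Lam X $ i $ j * e j * e i) = 0"
    then have "AE w in MCR. a (snd w) * Lam (fst w) (fst w + snd w) * (V e w)\<^sup>2 = 0"
      unfolding quad using integral_nonneg_eq_0_iff_AE[OF Vint AE_I2[OF Vnn]] by simp
    from AE_prod_on[OF cell_borel U this]
    have aeC: "AE y in MC. AE \<xi> in lebesgue. norm \<xi> < r_a \<and> y \<in> Ystiff \<and> y + \<xi> \<in> Ystiff \<longrightarrow> V e (y, \<xi>) = 0"
      unfolding lebesgue_on_UNIV_eq
    proof eventually_elim
      case (elim y)
      then show ?case
      proof eventually_elim
        case (elim \<xi>)
        show ?case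
        proof
          assume *: "norm \<xi> < r_a \<and> y \<in> Ystiff \<and> y + \<xi> \<in> Ystiff"
          then have "a \<xi> \<noteq> 0" "Lam y (y + \<xi>) \<noteq> 0" using apos[of \<xi>] al(1) al(3)[of y "y + \<xi>"] by force+
          then show "V e (y, \<xi>) = 0" using elim by simp
        qed
      qed
    qed
    \<comment> \<open>The condition on \<open>y\<close> is periodic, so it passes from the cell to
      the whole space, through which the chains run.\<close>
    have "AE y in lebesgue. AE \<xi> in lebesgue. norm \<xi> < r_a \<and> y \<in> Ystiff \<and> y + \<xi> \<in> Ystiff \<longrightarrow> V e (y, \<xi>) = 0"
    proof (rule periodic_AE[OF _ aeC])
      have per: "X i (x + lattice_vec m) = X i x" for i x m by (rule periodicD[OF L2_perD(2)[OF XL]])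
      have "V e (x + lattice_vec m, \<xi>) = V e (x, \<xi>)" for x m \<xi>
        using per[of _ x m] per[of _ "x + \<xi>" m] by (simp add: V_def E_def xi_def dX_def add.commute add.left_commute)
      moreover have "x + lattice_vec m + \<xi> \<in> Ystiff \<longleftrightarrow> x + \<xi> \<in> Ystiff" for x m \<xi>
        using periodic_set_shift[OF Ys(2), of "x + \<xi>" m] by (simp add: algebra_simps)
      ultimately show "periodic (\<lambda>y. AE \<xi> in lebesgue. norm \<xi> < r_a \<and> y \<in> Ystiff \<and> y + \<xi> \<in> Ystiff \<longrightarrow> V e (y, \<xi>) = 0)"
        by (simp add: periodic_def periodic_set_shift[OF Ys(2)])
    qed
    then have ae2: "AE y in lebesgue. AE y' in lebesgue. norm (y' - y) < r_a \<and> y \<in> Ystiff \<and> y' \<in> Ystiff \<longrightarrow>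
        (\<Sum>i\<in>UNIV. e i * (y' $ i + X i y')) = (\<Sum>i\<in>UNIV. e i * (y $ i + X i y))"
    proof eventually_elim
      case (elim y)
      from null_pres_AE[OF null_pres_shift' elim, of "- y"] show ?case
      proof eventually_elim
        case (elim y')
        have "V e (y, y' + - y) = (\<Sum>i\<in>UNIV. e i * (y' $ i + X i y')) - (\<Sum>i\<in>UNIV. e i * (y $ i + X i y))"
          unfolding V_def E_def xi_def dX_def sum_subtractf[symmetric] by (simp add: algebra_simps)
        then show ?case using elim by simp
      qed
    qed
    show "e = (\<lambda>i. 0)"
    proof
      fix i :: 'd
      obtain m where m: "lattice_vec m = - (axis i 1 :: real^'d)" using axis_lattice by blast
      have per: "X j (y - axis i 1) = X j y" for j and y :: "real^'d" using periodicD[OF L2_perD(2)[OF XL], of j y m] by (simp add: m)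
      \<comment> \<open>Rigidity is applied to the sum of all \<open>e j * (y $ j + X j y)\<close>.
        Since \<open>X\<close> is periodic, this function drops by exactly \<open>e i\<close> under
        the shift, so \<open>t = e i\<close>.\<close>
      show "e i = 0"
      proof (rule stiff_rigidity[OF Ys conn ae2])
        fix y :: "real^'d"
        have "(\<Sum>j\<in>UNIV. e j * ((y - axis i 1) $ j + X j (y - axis i 1))) = (\<Sum>j\<in>UNIV. e j * (y $ j + X j y) - (if j = i then e j else 0))"
          unfolding per by (intro sum.cong refl) (auto simp: axis_def algebra_simps)
        then show "(\<Sum>j\<in>UNIV. e j * ((y - axis i 1) $ j + X j (y - axis i 1))) = (\<Sum>j\<in>UNIV. e j * (y $ j + X j y)) - e i"
          by (simp add: sum_subtractf)
      qed
    qed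
  qed
qed

section \<open>The two-scale operator\<close>

lemma semi_inner_cong:
  assumes "semi_inner V add scl ip" and eq: "\<And>u v. u \<in> V \<Longrightarrow> v \<in> V \<Longrightarrow> ip' u v = ip u v"
  shows "semi_inner V add scl ip'"
proof -
  interpret I: semi_inner V add scl ip by fact
  show ?thesis
  proof
    fix u v w c assume u: "u \<in> V" and w: "w \<in> V"
    show "ip' (scl c u) w = c * ip' u w" using u w I.ip_scl_left by (simp add: eq)
    show "ip' u w = ip' w u" using u w I.ip_commute by (simp add: eq)
    show "0 \<le> ip' u u" using u I.ip_nonneg by (simp add: eq)
    assume v: "v \<in> V"
    show "ip' (add u v) w = ip' u w + ip' v w" using u v w I.ip_add_left by (simp add: eq)
  qed (use I.nonempty in auto)
qed

text \<open>The stiff phase is present only through the coercive matrix and through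
  \<open>nonsoft\<close>. The complement of \<open>U\<close> includes the interface, which may have
  positive measure and on which members of \<open>L2_per U\<close> vanish as well.\<close>

locale two_scale_problem = two_scale a p P U S
  for a :: "real^'d \<Rightarrow> real" and p :: "real^'d \<Rightarrow> real^'d \<Rightarrow> real" and P :: real and U S :: "(real^'d) set" +
  fixes A :: "real^'d^'d" and cA :: real
  assumes A: "coercive_matrix A cA" and S_ne: "S \<noteq> {}"
    and nonsoft: "\<not> (AE y in lebesgue_on cell. y \<in> U)"
begin

abbreviation "D \<equiv> H1_0 S \<times> L2_S_per S U"
abbreviation "H \<equiv> two_scale_space S U"
text \<open>\<open>n\<close> is orthogonal to \<open>L2_per U\<close>, so that pairing \<open>u + z\<close> with \<open>u \<otimes> n\<close> recovers the norm of \<open>u\<close>.\<close>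

abbreviation "n \<equiv> (\<lambda>y. 1 - indicat_real U y)"
abbreviation "\<theta> \<equiv> L2_inner MC n n"

lemma indicator_L2_per: "indicat_real U \<in> L2_per U"
proof -
  have m: "indicat_real U \<in> borel_measurable MC" using U_sets by (intro measurable_restrict_space1 borel_measurable_indicator)
  have "indicat_real U \<in> L2 MC" by (rule L2_bound[OF one_L2 m AE_I2]) (simp add: indicator_def)
  then show ?thesis using U_per by (auto simp: L2_per_def periodic_def periodic_set_def indicator_def)
qed

lemma n_L2: "n \<in> L2 MC"
  by (intro L2_diff one_L2 L2_perD(1)[OF indicator_L2_per])

lemma theta_pos: "0 < \<theta>"
proof (rule ccontr)
  assume "\<not> 0 < \<theta>"
  then have "\<theta> = 0" using L2_inner_nonneg[of MC n] by linarith
  from L2_inner_self_eq_0[OF n_L2 this] have "AE y in MC. y \<in> U"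
    by eventually_elim (auto simp: indicator_def split: if_splits)
  then show False using nonsoft by simp
qed

lemma one_n: "L2_inner MC (\<lambda>y. 1) n = \<theta>"
  unfolding L2_inner_def by (rule Bochner_Integration.integral_cong) (auto simp: indicator_def)

lemma lift_tensor: "lift u = tensor u (\<lambda>y. 1)"
  by (simp add: fun_eq_iff lift_def tensor_def)

lemma tensor_n: "tensor k n = (\<lambda>w. lift k w - tensor k (indicat_real U) w)"
  by (simp add: fun_eq_iff lift_def tensor_def algebra_simps)

lemma MSC_mult_zero:
  assumes "AE w in MSC. f w * g w = 0" "f \<in> L2 MSC" "g \<in> L2 MSC"
  shows "L2_inner MSC f g = 0"
  unfolding L2_inner_def
  by (rule trans[OF integral_cong_AE[of _ _ "\<lambda>_. 0"]]) (use assms L2_measurable in auto)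

lemma inner_tensor_n:
  assumes k: "k \<in> L2 MX" and b: "b \<in> L2_S_per S U"
  shows "L2_inner MSC (tensor k n) b = 0"
proof (rule MSC_mult_zero[OF _ tensor_L2[OF k n_L2] L2_S_perD(1)[OF b]])
  show "AE w in MSC. tensor k n w * b w = 0"
    using L2_S_perD(3)[OF b] by eventually_elim (auto simp: tensor_def indicator_def)
qed

lemma inner_tensor_U:
  assumes k: "k \<in> L2 MX" and b: "b \<in> L2_S_per S U"
  shows "L2_inner MSC (tensor k (indicat_real U)) b = L2_inner MSC (lift k) b"
  using inner_tensor_n[OF k b] L2_inner_diff_left[OF lift_L2[OF k] tensor_L2[OF k L2_perD(1)[OF indicator_L2_per]] L2_S_perD(1)[OF b]]
  unfolding tensor_n by simp

lemma avg_tensor: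
  assumes z: "z \<in> L2 MC" and k: "k \<in> L2 MX" and v: "v \<in> L2 MX"
  shows "L2_inner MSC (tensor k z) (lift v) = (LINT y|MC. z y) * L2_inner MX k v"
  unfolding lift_tensor tensor_inner[OF k z v one_L2] by (simp add: L2_inner_def mult.commute)

lemma integral_n: "(LINT y|MC. n y) = \<theta>"
  using one_n by (simp add: L2_inner_def)

lemma mean_sq_le: "z \<in> L2 MC \<Longrightarrow> (LINT y|MC. z y)\<^sup>2 \<le> L2_inner MC z z"
  using L2_cauchy_schwarz[of z MC "\<lambda>y. 1"] one_L2 by (simp add: L2_inner_def measure_def emeasure_MC)

definition ksum where "ksum = 2 + 3 / \<theta>"

lemma ksum_pos: "0 < ksum" using theta_pos by (simp add: ksum_def add_pos_pos)

text \<open>Pairing the sum with \<open>tensor u n\<close> shows that \<open>\<theta>\<close> times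
  the norm square of \<open>u\<close> is at most that of the sum. As \<open>z\<close> is the sum
  minus \<open>u\<close>, its norm square is at most twice that of the sum plus twice that of
  \<open>u\<close>. Altogether this is 2 times the sum and 3 times \<open>u\<close>, whence
  \<open>ksum\<close>.\<close>

lemma direct_sum_bound:
  assumes u: "u \<in> L2 MX" and z: "z \<in> L2_S_per S U"
  shows "L2_inner MX u u + L2_inner MSC z z \<le> ksum * L2_inner MSC (\<lambda>w. lift u w + z w) (\<lambda>w. lift u w + z w)"
proof -
  let ?F = "\<lambda>w. lift u w + z w" and ?u = "L2_inner MX u u"
  note zL = L2_S_perD(1)[OF z] and uL = lift_L2[OF u]
  have FL: "?F \<in> L2 MSC" by (rule L2_add[OF uL zL])
  have tL: "tensor u n \<in> L2 MSC" by (rule tensor_L2[OF u n_L2])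
  have "L2_inner MSC ?F (tensor u n) = L2_inner MSC (lift u) (tensor u n) + L2_inner MSC z (tensor u n)"
    by (rule L2_inner_add_left[OF uL zL tL])
  also have "L2_inner MSC (lift u) (tensor u n) = ?u * \<theta>"
    unfolding lift_tensor tensor_inner[OF u one_L2 u n_L2] one_n ..
  also have "L2_inner MSC z (tensor u n) = 0"
    using inner_tensor_n[OF u z] by (simp add: L2_inner_commute)
  finally have "(?u * \<theta>)\<^sup>2 = (L2_inner MSC ?F (tensor u n))\<^sup>2" by simp
  also have "\<dots> \<le> L2_inner MSC ?F ?F * (?u * \<theta>)"
    using L2_cauchy_schwarz[OF FL tL] unfolding tensor_inner[OF u n_L2 u n_L2] .
  finally have "(?u * \<theta>) * (?u * \<theta>) \<le> L2_inner MSC ?F ?F * (?u * \<theta>)" by (simp only: power2_eq_square)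
  moreover have "x \<le> y" if "x * x \<le> y * x" "0 \<le> x" "0 \<le> y" for x y :: real
    using that by (cases "x = 0") (auto simp: mult_le_cancel_right)
  moreover have "0 \<le> ?u * \<theta>" by (intro mult_nonneg_nonneg L2_inner_nonneg)
  ultimately have 1: "?u * \<theta> \<le> L2_inner MSC ?F ?F" using L2_inner_nonneg by blast
  have 2: "L2_inner MSC z z \<le> 2 * L2_inner MSC ?F ?F + 2 * ?u"
    using L2_inner_diff_sq_le[OF FL uL] inner_lift_lift[OF u u] by simp
  have "?u \<le> L2_inner MSC ?F ?F / \<theta>" using 1 theta_pos by (simp add: field_simps)
  with 2 show ?thesis unfolding ksum_def by (simp add: algebra_simps)
qed

lemma j_eq: "two_scale_fun e = (\<lambda>w. lift (fst e) w + snd e w)"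
  by (simp add: fun_eq_iff two_scale_fun_def lift_def)

lemma form_eq: "e \<in> D \<Longrightarrow> e' \<in> D \<Longrightarrow> two_scale_form S A a p e e' = hom_form S A (fst e) (fst e') + L2_inner MSC (Lt (snd e)) (snd e')"
  using integral_soft_form[of "snd e" "snd e'"] by (auto simp: two_scale_form_def)

lemma H1_0_L2: "u \<in> H1_0 S \<Longrightarrow> u \<in> L2 MX"
  using H1_0_H1[OF S_open] H1_L2[OF S_open] by blast

lemma H_I: "u \<in> L2 MX \<Longrightarrow> z \<in> L2_S_per S U \<Longrightarrow> (\<lambda>w. lift u w + z w) \<in> H"
  using L2_add[OF lift_L2 L2_S_perD(1)] unfolding two_scale_space_def
  by (auto simp: j_eq intro!: bexI[of _ "(u, z)"])

lemma H_E:
  assumes "f \<in> H"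
  obtains u z where "f \<in> L2 MSC" "u \<in> L2 MX" "z \<in> L2_S_per S U" "AE w in MSC. f w = lift u w + z w"
  using assms unfolding two_scale_space_def by (auto simp: j_eq)

lemma H_add:
  assumes f: "f \<in> H" and g: "g \<in> H"
  shows "(\<lambda>x. f x + g x) \<in> H"
proof -
  obtain u z where 1: "f \<in> L2 MSC" "u \<in> L2 MX" "z \<in> L2_S_per S U" "AE w in MSC. f w = lift u w + z w" using H_E[OF f] .
  obtain v b where 2: "g \<in> L2 MSC" "v \<in> L2 MX" "b \<in> L2_S_per S U" "AE w in MSC. g w = lift v w + b w" using H_E[OF g] .
  have "AE w in MSC. f w + g w = two_scale_fun ((\<lambda>x. u x + v x), (\<lambda>w. z w + b w)) w"
    using 1(4) 2(4) by eventually_elim (simp add: j_eq lift_def)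
  then show ?thesis unfolding two_scale_space_def
    using L2_add[OF 1(1) 2(1)] L2_add[OF 1(2) 2(2)] L2_S_per_add[OF 1(3) 2(3)] by blast
qed

lemma H_scale:
  assumes f: "f \<in> H"
  shows "(\<lambda>x. c * f x) \<in> H"
proof -
  obtain u z where 1: "f \<in> L2 MSC" "u \<in> L2 MX" "z \<in> L2_S_per S U" "AE w in MSC. f w = lift u w + z w" using H_E[OF f] .
  have "AE w in MSC. c * f w = two_scale_fun ((\<lambda>x. c * u x), (\<lambda>w. c * z w)) w"
    using 1(4) by eventually_elim (simp add: j_eq lift_def algebra_simps)
  then show ?thesis unfolding two_scale_space_def
    using L2_scale[OF 1(1)] L2_scale[OF 1(2)] L2_S_per_scale[OF 1(3)] by blast
qed

lemma H_lift: "u \<in> L2 MX \<Longrightarrow> lift u \<in> H"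
  using H_I[OF _ L2_S_per_zero] by simp

lemma H_per: "z \<in> L2_S_per S U \<Longrightarrow> z \<in> H"
  using H_I[OF L2_zero, of z] by (simp add: lift_def)

lemma H_tensor_n: "k \<in> L2 MX \<Longrightarrow> tensor k n \<in> H"
  using H_add[OF H_lift H_scale[OF H_per[OF tensor_mem[OF _ indicator_L2_per]], of k "- 1"], of k] by (simp add: tensor_n)

lemma H_L2: "f \<in> H \<Longrightarrow> f \<in> L2 MSC" by (simp add: two_scale_space_def)

sublocale hom: symmetric_form MX "L2 MX" "H1_0 S" "\<lambda>f g x. f x + g x" "\<lambda>c f x. c * f x" "\<lambda>u. u" "hom_form S A"
  by (intro symmetric_form.intro semi_inner_hom_form[OF S_open A]) (use H1_0_L2 in auto)

lemma semi_inner_soft_form: "semi_inner (L2_per U) (\<lambda>f g x. f x + g x) (\<lambda>c f x. c * f x) (soft_form a p)"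
proof
  fix u v w c assume u: "u \<in> L2_per U" and w: "w \<in> L2_per U"
  note m = u[THEN L2_perD(1)] w[THEN L2_perD(1)] L_mem[OF u, THEN L2_perD(1)] L_mem[OF w, THEN L2_perD(1)]
  \<comment> \<open>Linearity in the first argument is read off after \<open>L\<close> has been
    moved to the second one, where only inner products are involved; a direct argument would have to
    split the integral in \<open>soft_op\<close>.\<close>
  have sw: "soft_form a p u' w = L2_inner MC u' (L w)" if "u' \<in> L2_per U" for u'
    using soft_form_L[OF that w] L_symmetric[OF that w] by simp
  show "soft_form a p (\<lambda>x. c * u x) w = c * soft_form a p u w"
    using sw[OF u] sw[OF L2_per_scale[OF u]] by (simp add: L2_inner_scale_left)
  show "soft_form a p u w = soft_form a p w u" by (rule soft_form_commute)
  show "0 \<le> soft_form a p u u" by (rule soft_form_nonneg)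
  assume v: "v \<in> L2_per U"
  show "soft_form a p (\<lambda>x. u x + v x) w = soft_form a p u w + soft_form a p v w"
    using sw[OF u] sw[OF v] sw[OF L2_per_add[OF u v]] L2_inner_add_left[OF m(1) v[THEN L2_perD(1)] m(4)] by simp
next
  show "L2_per U \<noteq> {}" using L2_per_zero by blast
qed (use L2_per_add L2_per_scale in auto)

sublocale soft: symmetric_form MC "L2_per U" "L2_per U" "\<lambda>f g x. f x + g x" "\<lambda>c f x. c * f x" "\<lambda>z. z" "soft_form a p"
  by (intro symmetric_form.intro semi_inner_soft_form) (use L2_perD(1) L2_per_add L2_per_scale in auto)

lemma inner_le_sum:
  assumes "f \<in> L2 M" "g \<in> L2 M"
  shows "L2_inner M f g \<le> L2_inner M f f + L2_inner M g g"
proof -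
  have "0 \<le> L2_inner M (\<lambda>x. f x - g x) (\<lambda>x. f x - g x)" by simp
  also have "\<dots> = L2_inner M f f - 2 * L2_inner M f g + L2_inner M g g"
    using assms by (simp add: L2_inner_simps L2_diff L2_inner_commute[of M g f])
  finally show ?thesis using L2_inner_nonneg[of M f] L2_inner_nonneg[of M g] by linarith
qed

sublocale soft: closed_form MC "L2_per U" "L2_per U" "\<lambda>f g x. f x + g x" "\<lambda>c f x. c * f x" "\<lambda>z. z" "soft_form a p"
proof (intro closed_form.intro closed_form_axioms.intro soft.symmetric_form_axioms)
  interpret V: semi_hilbert "L2_per U" "\<lambda>f g x. f x + g x" "\<lambda>c f x. c * f x" "L2_inner MC"
    by (rule semi_hilbert_L2_per[OF U_open U_per])
  have e: "soft.energy z z = L2_inner MC (L z) z + L2_inner MC z z" if "z \<in> L2_per U" for z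
    using soft_form_L[OF that that] by (simp add: soft.energy_def)
  show "semi_hilbert (L2_per U) (\<lambda>f g x. f x + g x) (\<lambda>c f x. c * f x) soft.energy"
  proof (rule V.equivalent_semi_hilbert[OF soft.semi_inner_energy, of 1 "opbound + 2"])
    fix z assume z: "z \<in> L2_per U"
    show "1 * L2_inner MC z z \<le> soft.energy z z"
      using soft_form_nonneg[of z] soft_form_L[OF z z] e[OF z] by simp
    show "soft.energy z z \<le> (opbound + 2) * L2_inner MC z z"
      using e[OF z] inner_le_sum[OF L2_perD(1)[OF L_mem[OF z]] L2_perD(1)[OF z]] L_bound[OF z]
      by (simp add: algebra_simps)
  qed simp
qed

abbreviation "addD \<equiv> \<lambda>u v :: (real^'d \<Rightarrow> real) \<times> ((real^'d) \<times> (real^'d) \<Rightarrow> real). ((\<lambda>x. fst u x + fst v x), (\<lambda>w. snd u w + snd v w))"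
abbreviation "sclD \<equiv> \<lambda>c (u :: (real^'d \<Rightarrow> real) \<times> ((real^'d) \<times> (real^'d) \<Rightarrow> real)). ((\<lambda>x. c * fst u x), (\<lambda>w. c * snd u w))"

lemma semi_inner_Lt: "semi_inner (L2_S_per S U) (\<lambda>f g x. f x + g x) (\<lambda>c f x. c * f x) (\<lambda>z b. L2_inner MSC (Lt z) b)"
proof
  fix u v w c assume u: "u \<in> L2_S_per S U" and w: "w \<in> L2_S_per S U"
  note wL = L2_S_perD(1)[OF Lt_L2(1)[OF w]]
  show "L2_inner MSC (Lt (\<lambda>x. c * u x)) w = c * L2_inner MSC (Lt u) w"
    using Lt_symmetric[OF u w] Lt_symmetric[OF L2_S_per_scale[OF u] w] by (simp add: L2_inner_scale_left)
  show "L2_inner MSC (Lt u) w = L2_inner MSC (Lt w) u"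
    using Lt_symmetric[OF u w] by (simp add: L2_inner_commute)
  show "0 \<le> L2_inner MSC (Lt u) u" by (rule Lt_nonneg[OF u])
  assume v: "v \<in> L2_S_per S U"
  show "L2_inner MSC (Lt (\<lambda>x. u x + v x)) w = L2_inner MSC (Lt u) w + L2_inner MSC (Lt v) w"
    using Lt_symmetric[OF u w] Lt_symmetric[OF v w] Lt_symmetric[OF L2_S_per_add[OF u v] w]
      L2_inner_add_left[OF L2_S_perD(1)[OF u] L2_S_perD(1)[OF v] wL] by simp
next
  show "L2_S_per S U \<noteq> {}" using L2_S_per_zero by blast
qed (use L2_S_per_add L2_S_per_scale in auto)

lemma semi_inner_two_scale_form: "semi_inner D addD sclD (two_scale_form S A a p)"
  by (rule semi_inner_cong[OF semi_inner_prod[OF semi_inner_hom_form[OF S_open A] semi_inner_Lt] form_eq])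

sublocale ts: symmetric_form MSC H D addD sclD two_scale_fun "two_scale_form S A a p"
proof (intro symmetric_form.intro semi_inner_two_scale_form)
  show "H \<subseteq> L2 MSC" using H_L2 by blast
  fix e assume "e \<in> D"
  then have "fst e \<in> L2 MX" "snd e \<in> L2_S_per S U" by (auto simp: mem_Times_iff intro: H1_0_L2)
  then show "two_scale_fun e \<in> H" unfolding j_eq by (rule H_I)
qed (auto simp: H_add H_scale j_eq lift_def fun_eq_iff algebra_simps)

sublocale ts: closed_form MSC H D addD sclD two_scale_fun "two_scale_form S A a p"
proof -
  interpret V: semi_hilbert D addD sclD "\<lambda>e e'. H1_inner S (fst e) (fst e') + L2_inner MSC (snd e) (snd e')"
    by (rule semi_hilbert_prod[OF semi_hilbert_H1_0[OF S_open] semi_hilbert_L2_S_per])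
  let ?CA = "\<Sum>i\<in>UNIV. \<Sum>j\<in>UNIV. \<bar>A $ i $ j\<bar>"
  have cA: "cA > 0" using A by (simp add: coercive_matrix_def)
  have "semi_hilbert D addD sclD ts.energy"
  \<comment> \<open>From below, \<open>cA\<close> controls the gradient by coercivity, and
    \<open>1 / ksum\<close> controls \<open>u\<close> and \<open>z\<close> by their sum. From above,
    each of the three parts of the energy is bounded, and 5 leaves room for the constants in the
    bounds of \<open>Lt\<close> and of the sum.\<close>
  proof (rule V.equivalent_semi_hilbert[OF ts.semi_inner_energy, of "min cA (1 / ksum)" "?CA + opbound + 5"])
    show "min cA (1 / ksum) > 0" using cA ksum_pos by simp
    fix e assume e: "e \<in> D"
    obtain u z where uz: "e = (u, z)" "u \<in> H1_0 S" "z \<in> L2_S_per S U" using e by auto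
    let ?G = "\<Sum>i\<in>UNIV. L2_inner MX (wpartial S i u) (wpartial S i u)"
    let ?F = "\<lambda>w. lift u w + z w"
    have uL: "u \<in> L2 MX" by (rule H1_0_L2[OF uz(2)])
    have uH: "u \<in> H1 S" by (rule H1_0_H1[OF S_open uz(2)])
    have en: "ts.energy e e = hom_form S A u u + L2_inner MSC (Lt z) z + L2_inner MSC ?F ?F"
      using form_eq[OF e e] by (simp add: ts.energy_def uz(1) j_eq)
    have G0: "0 \<le> ?G" by (simp add: sum_nonneg)
    have "min cA (1 / ksum) * ?G \<le> cA * ?G" using G0 by (intro mult_right_mono) auto
    also have "\<dots> \<le> hom_form S A u u" by (rule hom_form_coercive[OF S_open A uH])
    finally have 1: "min cA (1 / ksum) * ?G \<le> hom_form S A u u" .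
    have "min cA (1 / ksum) * (L2_inner MX u u + L2_inner MSC z z) \<le> 1 / ksum * (L2_inner MX u u + L2_inner MSC z z)"
      by (intro mult_right_mono) auto
    also have "\<dots> \<le> L2_inner MSC ?F ?F"
      using direct_sum_bound[OF uL uz(3)] ksum_pos by (simp add: field_simps)
    finally have 2: "min cA (1 / ksum) * (L2_inner MX u u + L2_inner MSC z z) \<le> L2_inner MSC ?F ?F" .
    show "min cA (1 / ksum) * (H1_inner S (fst e) (fst e) + L2_inner MSC (snd e) (snd e)) \<le> ts.energy e e"
      using 1 2 Lt_nonneg[OF uz(3)] unfolding en by (simp add: uz(1) H1_inner_def distrib_left)
    have 3: "hom_form S A u u \<le> ?CA * ?G" by (rule hom_form_upper[OF S_open uH])
    have 4: "L2_inner MSC (Lt z) z \<le> opbound * L2_inner MSC z z + L2_inner MSC z z"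
      using inner_le_sum[OF L2_S_perD(1)[OF Lt_L2(1)[OF uz(3)]] L2_S_perD(1)[OF uz(3)]] Lt_L2(2)[OF uz(3)] by simp
    have 5: "L2_inner MSC ?F ?F \<le> 2 * L2_inner MX u u + 2 * L2_inner MSC z z"
      using L2_inner_sum_sq_le[OF lift_L2[OF uL] L2_S_perD(1)[OF uz(3)]] inner_lift_lift[OF uL uL] by simp
    have CA0: "0 \<le> ?CA" by (simp add: sum_nonneg)
    have arith: "h + l + f \<le> (k + b + 5) * (p + g + q)"
      if "h \<le> k * g" "l \<le> b * q + q" "f \<le> 2 * p + 2 * q" "0 \<le> k" "0 \<le> b" "0 \<le> g" "0 \<le> p" "0 \<le> q"
      for h l f k b g p q :: real
    proof -
      have "0 \<le> k * p" "0 \<le> k * q" "0 \<le> b * p" "0 \<le> b * g" using that by simp_all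
      moreover have "(k + b + 5) * (p + g + q) = k * p + k * g + k * q + b * p + b * g + b * q + 5 * p + 5 * g + 5 * q"
        by (simp add: algebra_simps)
      ultimately show ?thesis using that by linarith
    qed
    show "ts.energy e e \<le> (?CA + opbound + 5) * (H1_inner S (fst e) (fst e) + L2_inner MSC (snd e) (snd e))"
      using arith[OF 3 4 5 CA0 opbound_nonneg G0 L2_inner_nonneg L2_inner_nonneg] unfolding en by (simp add: uz(1) H1_inner_def)
  qed
  then show "closed_form MSC H D addD sclD two_scale_fun (two_scale_form S A a p)"
    by (intro closed_form.intro closed_form_axioms.intro ts.symmetric_form_axioms)
qed

section \<open>The operator equation as a macroscopic and a microscopic equation\<close>

lemma operator_eqs:
  "two_scale_operator S U A a p = ts.T" "soft_operator U a p = soft.T" "hom_operator S A = hom.T"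
  by (simp_all add: two_scale_operator_def soft_operator_def hom_operator_def)

lemma ts_operatorI:
  assumes u: "u \<in> H1_0 S" and z: "z \<in> L2_S_per S U" and f: "f \<in> H"
    and macro: "\<And>v. v \<in> H1_0 S \<Longrightarrow> hom_form S A u v = L2_inner MSC f (lift v)"
    and micro: "\<And>b. b \<in> L2_S_per S U \<Longrightarrow> L2_inner MSC (Lt z) b = L2_inner MSC f b"
  shows "((\<lambda>w. lift u w + z w), f) \<in> ts.T"
proof -
  have "(two_scale_fun (u, z), f) \<in> ts.T"
  proof (rule ts.operatorI[OF _ f])
    fix e assume e: "e \<in> D"
    obtain v b where vb: "e = (v, b)" "v \<in> H1_0 S" "b \<in> L2_S_per S U" using e by auto
    show "two_scale_form S A a p (u, z) e = L2_inner MSC f (two_scale_fun e)"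
      using macro[OF vb(2)] micro[OF vb(3)] form_eq[of "(u, z)" e] u z e
        L2_inner_add_right[OF lift_L2[OF H1_0_L2[OF vb(2)]] L2_S_perD(1)[OF vb(3)] H_L2[OF f]]
      by (simp add: vb(1) j_eq)
  qed (use u z in auto)
  then show ?thesis by (simp add: j_eq)
qed

text \<open>Test pairs with one vanishing component separate the two equations. \<open>F\<close>
  agrees with \<open>lift u + z\<close> only almost everywhere, so the pair is returned along with
  it.\<close>

lemma ts_operatorE:
  assumes "(F, f) \<in> ts.T"
  obtains u z where "F \<in> H" "f \<in> H" "u \<in> H1_0 S" "z \<in> L2_S_per S U" "AE w in MSC. F w = lift u w + z w"
    "\<And>v. v \<in> H1_0 S \<Longrightarrow> hom_form S A u v = L2_inner MSC f (lift v)"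
    "\<And>b. b \<in> L2_S_per S U \<Longrightarrow> L2_inner MSC (Lt z) b = L2_inner MSC f b"
proof -
  from assms have "F \<in> H \<and> f \<in> H \<and> (\<exists>e\<in>D. (AE x in MSC. F x = two_scale_fun e x) \<and>
      (\<forall>e'\<in>D. two_scale_form S A a p e e' = L2_inner MSC f (two_scale_fun e')))"
    by (simp add: form_operator_def)
  then obtain e where e: "F \<in> H" "f \<in> H" "e \<in> D" "AE x in MSC. F x = two_scale_fun e x"
    "\<forall>e'\<in>D. two_scale_form S A a p e e' = L2_inner MSC f (two_scale_fun e')" by blast
  obtain u z where uz: "e = (u, z)" "u \<in> H1_0 S" "z \<in> L2_S_per S U" using e(3) by auto
  have z0: "(\<lambda>x. 0) \<in> H1_0 S" using test_H1_0[OF S_open zero_test_function] .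
  have hz: "hom_form S A u (\<lambda>x. 0) = 0"
    using hom_form_linear(2)[OF S_open H1_0_H1[OF S_open z0] H1_0_H1[OF S_open z0] H1_0_H1[OF S_open uz(2)], of A 0]
      hom_form_commute[OF S_open A H1_0_H1[OF S_open uz(2)] H1_0_H1[OF S_open z0]] by simp
  show ?thesis
  proof (rule that[OF e(1,2) uz(2,3)])
    show "AE w in MSC. F w = lift u w + z w" using e(4) by (simp add: uz(1) j_eq)
    show "hom_form S A u v = L2_inner MSC f (lift v)" if "v \<in> H1_0 S" for v
      using bspec[OF e(5), of "(v, \<lambda>w. 0)"] form_eq[OF e(3), of "(v, \<lambda>w. 0)"] that L2_S_per_zero by (simp add: uz(1) j_eq)
    show "L2_inner MSC (Lt z) b = L2_inner MSC f b" if "b \<in> L2_S_per S U" for b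
      using bspec[OF e(5), of "(\<lambda>x. 0, b)"] form_eq[OF e(3), of "(\<lambda>x. 0, b)"] that z0 hz by (simp add: uz(1) j_eq lift_def)
  qed
qed

section \<open>Bounds from below and resolvents of the soft operator\<close>

lemma soft_bounded_below:
  assumes "complex_of_real lam \<in> resolvent_set MC (L2_per U) soft.T"
  shows "\<exists>c>0. \<forall>z\<in>L2_per U. c * L2_inner MC z z \<le> L2_inner MC (\<lambda>y. L z y - lam * z y) (\<lambda>y. L z y - lam * z y)"
proof -
  obtain C where C: "C \<ge> 0" "\<And>F f. f \<in> L2_per U \<Longrightarrow> (F, \<lambda>x. lam * F x + f x) \<in> soft.T \<Longrightarrow> L2_inner MC F F \<le> C * L2_inner MC f f"
    by (rule soft.real_resolventD[OF assms]) (rule that; blast)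
  \<comment> \<open>\<open>C\<close> may be 0, so the reciprocal is taken of
    \<open>C + 1\<close>.\<close>
  have "1 / (C + 1) * L2_inner MC z z \<le> L2_inner MC (\<lambda>y. L z y - lam * z y) (\<lambda>y. L z y - lam * z y)" if z: "z \<in> L2_per U" for z
  proof -
    let ?f = "\<lambda>y. L z y - lam * z y"
    have f: "?f \<in> L2_per U" by (intro L2_per_diff L_mem L2_per_scale z)
    have "(z, \<lambda>x. lam * z x + ?f x) \<in> soft.T"
    proof (rule soft.operatorI[OF z])
      show "(\<lambda>x. lam * z x + ?f x) \<in> L2_per U" using L_mem[OF z] by simp
      show "soft_form a p z b = L2_inner MC (\<lambda>x. lam * z x + ?f x) b" if "b \<in> L2_per U" for b
        using soft_form_L[OF z that] by simp
    qed
    from C(2)[OF f this] have "L2_inner MC z z \<le> (C + 1) * L2_inner MC ?f ?f"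
      unfolding distrib_right using L2_inner_nonneg[of MC ?f] by linarith
    then show ?thesis using C(1) by (simp add: field_simps)
  qed
  moreover have "1 / (C + 1) > 0" using C(1) by simp
  ultimately show ?thesis by blast
qed

text \<open>Serves for \<open>L\<close> on the cell and for \<open>Lt\<close> on the product, both
  bounded and symmetric. The solution inherits the constant \<open>c\<close>, because
  \<open>T z - lam * z\<close> has the same norm as \<open>f\<close>.\<close>

lemma solvable_of_bounded_below:
  fixes M :: "'x measure" and V :: "('x \<Rightarrow> real) set"
  assumes hil: "semi_hilbert V (\<lambda>f g x. f x + g x) (\<lambda>c f x. c * f x) (L2_inner M)" and VL: "V \<subseteq> L2 M"
    and T: "\<And>u. u \<in> V \<Longrightarrow> T u \<in> V" "\<And>u v. u \<in> V \<Longrightarrow> v \<in> V \<Longrightarrow> L2_inner M (T u) v = L2_inner M u (T v)"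
      "\<And>u. u \<in> V \<Longrightarrow> L2_inner M (T u) (T u) \<le> K * L2_inner M u u"
    and c: "c > 0" "\<And>u. u \<in> V \<Longrightarrow> c * L2_inner M u u \<le> L2_inner M (\<lambda>x. T u x - lam * u x) (\<lambda>x. T u x - lam * u x)"
    and f: "f \<in> V"
  shows "\<exists>z\<in>V. (\<forall>b\<in>V. L2_inner M (T z) b = lam * L2_inner M z b + L2_inner M f b) \<and> c * L2_inner M z z \<le> L2_inner M f f"
proof -
  interpret semi_hilbert V "\<lambda>f g x. f x + g x" "\<lambda>c f x. c * f x" "L2_inner M" by (rule hil)
  have L: "u \<in> V \<Longrightarrow> u \<in> L2 M" for u using VL by blast
  let ?T = "\<lambda>u x. T u x - lam * u x"
  have TV: "?T u \<in> V" if u: "u \<in> V" for u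
    using add_closed[OF T(1)[OF u] scl_closed[OF u, of "- lam"]] by simp
  have Tl: "L2_inner M (?T u) v = L2_inner M (T u) v - lam * L2_inner M u v" if "u \<in> V" "v \<in> V" for u v
    using L2_inner_diff_left[OF L[OF T(1)[OF that(1)]] L2_scale[OF L[OF that(1)], of lam] L[OF that(2)]] by (simp add: L2_inner_scale_left)
  have "\<exists>z\<in>V. \<forall>v\<in>V. L2_inner M (?T z) v = L2_inner M f v"
  proof (rule symmetric_bounded_below_solvable[OF TV _ c _ f])
    show "L2_inner M (?T u) v = L2_inner M u (?T v)" if "u \<in> V" "v \<in> V" for u v
      using Tl[OF that] Tl[OF that(2,1)] T(2)[OF that] L2_inner_commute[of M u] L2_inner_commute[of M v u] by metis
    show "L2_inner M (?T u) (?T u) \<le> (2 * K + 2 * lam\<^sup>2) * L2_inner M u u" if u: "u \<in> V" for u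
      using L2_inner_diff_sq_le[OF L[OF T(1)[OF u]] L2_scale[OF L[OF u], of lam]] T(3)[OF u]
      by (simp add: L2_inner_scale_left L2_inner_scale_right algebra_simps power2_eq_square)
  qed
  then obtain z where z: "z \<in> V" "\<And>v. v \<in> V \<Longrightarrow> L2_inner M (?T z) v = L2_inner M f v" by blast
  have "L2_inner M (?T z) (?T z) = L2_inner M f (?T z)" by (rule z(2)[OF TV[OF z(1)]])
  also have "\<dots> = L2_inner M (?T z) f" by (rule L2_inner_commute)
  also have "\<dots> = L2_inner M f f" by (rule z(2)[OF f])
  finally have "c * L2_inner M z z \<le> L2_inner M f f" using c(2)[OF z(1)] by simp
  moreover have "L2_inner M (T z) b = lam * L2_inner M z b + L2_inner M f b" if "b \<in> V" for b
    using Tl[OF z(1) that] z(2)[OF that] by simp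
  ultimately show ?thesis using z(1) by blast
qed

lemma soft_resolventI:
  assumes c: "c > 0" "\<And>z. z \<in> L2_per U \<Longrightarrow> c * L2_inner MC z z \<le> L2_inner MC (\<lambda>y. L z y - lam * z y) (\<lambda>y. L z y - lam * z y)"
  shows "complex_of_real lam \<in> resolvent_set MC (L2_per U) soft.T"
proof (rule soft.real_resolventI[of _ "1 / c"])
  fix f assume f: "f \<in> L2_per U"
  have "L2_per U \<subseteq> L2 MC" using L2_perD(1) by blast
  from solvable_of_bounded_below[OF semi_hilbert_L2_per[OF U_open U_per] this L_mem L_symmetric L_bound c f]
  obtain z where z: "z \<in> L2_per U" and eq: "\<forall>b\<in>L2_per U. L2_inner MC (L z) b = lam * L2_inner MC z b + L2_inner MC f b"
    and bound: "c * L2_inner MC z z \<le> L2_inner MC f f" by auto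
  have "(z, \<lambda>x. lam * z x + f x) \<in> soft.T"
  proof (rule soft.operatorI[OF z])
    show "(\<lambda>x. lam * z x + f x) \<in> L2_per U" by (intro L2_per_add L2_per_scale z f)
    show "soft_form a p z b = L2_inner MC (\<lambda>x. lam * z x + f x) b" if b: "b \<in> L2_per U" for b
      using soft_form_L[OF z b] bspec[OF eq b] L2_inner_add_left[OF L2_scale[OF L2_perD(1)[OF z], of lam] L2_perD(1)[OF f] L2_perD(1)[OF b]]
      by (simp add: L2_inner_scale_left)
  qed
  then show "\<exists>F. (F, \<lambda>x. lam * F x + f x) \<in> soft.T \<and> L2_inner MC F F \<le> 1 / c * L2_inner MC f f"
    using bound c(1) by (intro exI[of _ z]) (simp add: field_simps)
qed

lemma tensor_self: "\<psi> \<in> L2 MX \<Longrightarrow> z \<in> L2 MC \<Longrightarrow> L2_inner MSC (tensor \<psi> z) (tensor \<psi> z) = L2_inner MX \<psi> \<psi> * L2_inner MC z z"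
  by (rule tensor_inner)

lemma inner_zero_of_null:
  assumes "f \<in> L2 M" "g \<in> L2 M" "L2_inner M f f = 0"
  shows "L2_inner M f g = 0"
  using L2_cauchy_schwarz[OF assms(1,2)] assms(3) by simp

text \<open>The defect of \<open>g\<close> in the cell problem
  \<open>(L - lam) g = indicat_real U\<close>. That its norm is zero says that \<open>g\<close> is
  the resolvent applied to the indicator, up to null sets.\<close>

definition cell_residual :: "real \<Rightarrow> (real^'d \<Rightarrow> real) \<Rightarrow> real^'d \<Rightarrow> real" where
  "cell_residual lam g y = L g y - lam * g y - indicat_real U y"

lemma cell_residual_L2_per: "g \<in> L2_per U \<Longrightarrow> cell_residual lam g \<in> L2_per U"
  unfolding cell_residual_def[abs_def] by (intro L2_per_diff L_mem L2_per_scale indicator_L2_per)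

text \<open>The first member of a pair in the operator relation equals an element of the form domain
  only almost everywhere; the chosen resolvent value \<open>F\<close> is exchanged for such an
  element with the same mean.\<close>

lemma cell_solution:
  assumes "(F, \<lambda>y. lam * F y + indicat_real U y) \<in> soft.T"
  obtains g where "g \<in> L2_per U" "(LINT y|MC. F y) = (LINT y|MC. g y)"
    "L2_inner MC (cell_residual lam g) (cell_residual lam g) = 0"
proof -
  let ?f = "\<lambda>y. lam * F y + indicat_real U y"
  from assms have "F \<in> L2_per U \<and> (\<exists>e\<in>L2_per U. (AE x in MC. F x = e x) \<and>
      (\<forall>e'\<in>L2_per U. soft_form a p e e' = L2_inner MC ?f e'))"
    by (simp add: form_operator_def)
  then obtain g where g: "F \<in> L2_per U" "g \<in> L2_per U" "AE x in MC. F x = g x"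
    "\<forall>b\<in>L2_per U. soft_form a p g b = L2_inner MC ?f b" by blast
  note FL = L2_perD(1)[OF g(1)] and gL = L2_perD(1)[OF g(2)] and IL = L2_perD(1)[OF indicator_L2_per]
    and LL = L2_perD(1)[OF L_mem[OF g(2)]]
  let ?r = "cell_residual lam g"
  have r: "?r \<in> L2_per U" by (rule cell_residual_L2_per[OF g(2)])
  note rL = L2_perD(1)[OF r]
  have "L2_inner MC (L g) ?r = lam * L2_inner MC F ?r + L2_inner MC (indicat_real U) ?r"
    using soft_form_L[OF g(2) r] bspec[OF g(4) r] L2_inner_add_left[OF L2_scale[OF FL] IL rL]
    by (simp add: L2_inner_scale_left)
  also have "L2_inner MC F ?r = L2_inner MC g ?r" by (rule L2_inner_cong_AE[OF FL gL rL g(3)])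
  finally have "L2_inner MC ?r ?r = 0"
    using L2_inner_diff_left[OF L2_diff[OF LL L2_scale[OF gL]] IL rL, of lam] L2_inner_diff_left[OF LL L2_scale[OF gL] rL, of lam]
    by (simp add: cell_residual_def[abs_def] L2_inner_scale_left)
  moreover have "(LINT y|MC. F y) = (LINT y|MC. g y)"
    by (rule integral_cong_AE[OF L2_measurable[OF FL] L2_measurable[OF gL] g(3)])
  ultimately show ?thesis using that g(2) by blast
qed

text \<open>The cell problem for \<open>g\<close> multiplied by \<open>u (x)\<close>. Its source is
  \<open>u\<close> times the indicator of \<open>U\<close> and may be replaced by
  \<open>lift u\<close>, since \<open>b\<close> vanishes off \<open>U\<close>.\<close>

lemma Lt_tensor_cell_solution:
  assumes g: "g \<in> L2_per U" and r: "L2_inner MC (cell_residual lam g) (cell_residual lam g) = 0"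
    and u: "u \<in> L2 MX" and b: "b \<in> L2_S_per S U"
  shows "L2_inner MSC (Lt (tensor u g)) b = lam * L2_inner MSC (tensor u g) b + L2_inner MSC (lift u) b"
proof -
  note gL = L2_perD(1)[OF g] and IL = L2_perD(1)[OF indicator_L2_per] and LL = L2_perD(1)[OF L_mem[OF g]]
    and bL = L2_S_perD(1)[OF b] and rL = L2_perD(1)[OF cell_residual_L2_per[OF g, of lam]]
  note t = tensor_L2[OF u LL] tensor_L2[OF u gL] tensor_L2[OF u IL]
  have "L2_inner MSC (tensor u (cell_residual lam g)) b = 0"
    by (rule inner_zero_of_null[OF tensor_L2[OF u rL] bL]) (simp add: tensor_self[OF u rL] r)
  also have "tensor u (cell_residual lam g) = (\<lambda>w. tensor u (L g) w - lam * tensor u g w - tensor u (indicat_real U) w)"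
    by (simp add: fun_eq_iff tensor_def cell_residual_def algebra_simps)
  also have "L2_inner MSC \<dots> b = L2_inner MSC (tensor u (L g)) b - lam * L2_inner MSC (tensor u g) b - L2_inner MSC (lift u) b"
    using L2_inner_diff_left[OF L2_diff[OF t(1) L2_scale[OF t(2)]] t(3) bL, of lam] L2_inner_diff_left[OF t(1) L2_scale[OF t(2)] bL, of lam]
    by (simp add: L2_inner_scale_left inner_tensor_U[OF u b])
  finally show ?thesis by (simp add: Lt_tensor)
qed

lemma ts_rhs_lift:
  assumes u: "u \<in> L2 MX" and z: "z \<in> L2 MSC" and f: "f \<in> L2 MSC" and b: "b \<in> L2 MSC"
  shows "L2_inner MSC (\<lambda>w. lam * (lift u w + z w) + f w) b
      = lam * L2_inner MSC (lift u) b + lam * L2_inner MSC z b + L2_inner MSC f b"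
  unfolding L2_inner_add_left[OF L2_scale[OF L2_add[OF lift_L2[OF u] z]] f b] L2_inner_scale_left
    L2_inner_add_left[OF lift_L2[OF u] z b] by (simp add: distrib_left)

lemma combine_inner:
  assumes z: "z \<in> L2 MSC" and w: "w \<in> L2 MSC" and b: "b \<in> L2 MSC"
  shows "L2_inner MSC (\<lambda>x. z x + c * w x) b = L2_inner MSC z b + c * L2_inner MSC w b"
  using L2_inner_add_left[OF z L2_scale[OF w] b, of c] by (simp add: L2_inner_scale_left)

lemma Lt_combine:
  assumes z: "z \<in> L2_S_per S U" and w: "w \<in> L2_S_per S U" and b: "b \<in> L2_S_per S U"
  shows "L2_inner MSC (Lt (\<lambda>x. z x + c * w x)) b = L2_inner MSC (Lt z) b + c * L2_inner MSC (Lt w) b"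
  using semi_inner.ip_add_left[OF semi_inner_Lt z L2_S_per_scale[OF w] b, of c] semi_inner.ip_scl_left[OF semi_inner_Lt w b, of c]
  by simp

lemma two_scale_resolvent_of_hom:
  assumes soft: "complex_of_real lam \<in> resolvent_set MC (L2_per U) soft.T"
    and g: "g \<in> L2_per U" and r: "L2_inner MC (cell_residual lam g) (cell_residual lam g) = 0"
    and hom: "complex_of_real (lam + lam\<^sup>2 * (LINT y|MC. g y)) \<in> resolvent_set MX (L2 MX) hom.T" (is "complex_of_real ?\<beta> \<in> _")
  shows "complex_of_real lam \<in> resolvent_set MSC H ts.T"
proof -
  obtain c where c: "c > 0" "\<forall>z\<in>L2_per U. c * L2_inner MC z z \<le> L2_inner MC (\<lambda>y. L z y - lam * z y) (\<lambda>y. L z y - lam * z y)"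
    using soft_bounded_below[OF soft] by blast
  have below: "c * L2_inner MSC z z \<le> L2_inner MSC (\<lambda>w. Lt z w - lam * z w) (\<lambda>w. Lt z w - lam * z w)"
    if "z \<in> L2_S_per S U" for z
    by (rule Lt_bounded_below[OF c(1) bspec[OF c(2)] that])
  obtain Ch where Ch: "Ch \<ge> 0"
    and ex: "\<And>h. h \<in> L2 MX \<Longrightarrow> \<exists>F. (F, \<lambda>x. ?\<beta> * F x + h x) \<in> hom.T"
    and bd: "\<And>F h. h \<in> L2 MX \<Longrightarrow> (F, \<lambda>x. ?\<beta> * F x + h x) \<in> hom.T \<Longrightarrow> L2_inner MX F F \<le> Ch * L2_inner MX h h"
    by (rule hom.real_resolventD[OF hom]) (rule that; blast)
  note gL = L2_perD(1)[OF g]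
  \<comment> \<open>\<open>kh\<close> bounds the norm square of \<open>u\<close>: the source
    \<open>h\<close> collects the mean of \<open>f\<close> and \<open>lam\<close> times the mean of
    \<open>z0\<close>, whose norm square is at most \<open>1 / c\<close> times that of
    \<open>f\<close>. \<open>C\<close> then adds the two parts of \<open>z\<close>.\<close>
  define kh where "kh = Ch * (2 + 2 * lam\<^sup>2 * (1 / c))"
  define C where "C = 2 * kh + 4 * (1 / c) + 4 * lam\<^sup>2 * L2_inner MC g g * kh"
  show ?thesis
  proof (rule ts.real_resolventI[of _ C])
    fix f assume fH: "f \<in> H"
    have f: "f \<in> L2 MSC" by (rule H_L2[OF fH])
    let ?f = "cut_U f"
    \<comment> \<open>\<open>f\<close> need not vanish off \<open>U\<close>. Cutting it off changes
      none of its pairings with microscopic test functions and yields a source in their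
      space.\<close>
    have f': "?f \<in> L2_S_per S U" by (rule cut_U_mem[OF f])
    have cut: "AE w in MSC. ?f w = indicat_real U (snd w) * f w"
      using AE_space by eventually_elim (simp add: cut_U_cell)
    have fb: "L2_inner MSC ?f b = L2_inner MSC f b" if b: "b \<in> L2_S_per S U" for b
      unfolding L2_inner_def
    proof (rule integral_cong_AE)
      show "AE w in MSC. ?f w * b w = f w * b w"
        using cut L2_S_perD(3)[OF b] by eventually_elim (auto simp: indicator_def)
    qed (use L2_measurable[OF f] L2_measurable[OF L2_S_perD(1)[OF f']] L2_measurable[OF L2_S_perD(1)[OF b]] in auto)
    have ff: "L2_inner MSC ?f ?f \<le> L2_inner MSC f f"
    proof (rule L2_inner_mono[OF f L2_S_perD(1)[OF f']])
      show "AE w in MSC. \<bar>?f w\<bar> \<le> \<bar>f w\<bar>" using cut by eventually_elim (auto simp: indicator_def)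
    qed
    have sub: "L2_S_per S U \<subseteq> L2 MSC" using L2_S_perD(1) by blast
    from solvable_of_bounded_below[OF semi_hilbert_L2_S_per sub Lt_L2(1) Lt_symmetric Lt_L2(2) c(1) below f']
    obtain z0 where z0: "z0 \<in> L2_S_per S U"
      and z0_eq: "\<forall>b\<in>L2_S_per S U. L2_inner MSC (Lt z0) b = lam * L2_inner MSC z0 b + L2_inner MSC ?f b"
      and z0_bd: "c * L2_inner MSC z0 z0 \<le> L2_inner MSC ?f ?f" by auto
    note z0L = L2_S_perD(1)[OF z0]
    define h where "h x = avg f x + lam * avg z0 x" for x
    have hL: "h \<in> L2 MX" unfolding h_def[abs_def] by (intro L2_add L2_scale avg_L2 f z0L)
    obtain F where F: "(F, \<lambda>x. ?\<beta> * F x + h x) \<in> hom.T" using ex[OF hL] by blast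
    from F have "F \<in> L2 MX \<and> (\<exists>e\<in>H1_0 S. (AE x in MX. F x = e x) \<and>
      (\<forall>v\<in>H1_0 S. hom_form S A e v = L2_inner MX (\<lambda>x. ?\<beta> * F x + h x) v))"
      by (simp add: form_operator_def)
    then obtain u where u: "F \<in> L2 MX" "u \<in> H1_0 S" "AE x in MX. F x = u x"
      "\<forall>v\<in>H1_0 S. hom_form S A u v = L2_inner MX (\<lambda>x. ?\<beta> * F x + h x) v" by blast
    have uL: "u \<in> L2 MX" by (rule H1_0_L2[OF u(2)])
    have Fu: "L2_inner MX F v = L2_inner MX u v" if "v \<in> L2 MX" for v by (rule L2_inner_cong_AE[OF u(1) uL that u(3)])
    have u_eq: "hom_form S A u v = ?\<beta> * L2_inner MX u v + L2_inner MX (avg f) v + lam * L2_inner MX (avg z0) v" if v: "v \<in> H1_0 S" for v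
    proof -
      have vL: "v \<in> L2 MX" by (rule H1_0_L2[OF v])
      have "L2_inner MX h v = L2_inner MX (avg f) v + lam * L2_inner MX (avg z0) v"
        unfolding h_def[abs_def] using L2_inner_add_left[OF avg_L2(1)[OF f] L2_scale[OF avg_L2(1)[OF z0L]] vL, of lam]
        by (simp add: L2_inner_scale_left)
      then show ?thesis
        using bspec[OF u(4) v] L2_inner_add_left[OF L2_scale[OF u(1)] hL vL, of ?\<beta>] Fu[OF vL] by (simp add: L2_inner_scale_left)
    qed
    have u_bd: "L2_inner MX u u \<le> Ch * L2_inner MX h h"
      using bd[OF hL F] Fu[OF u(1)] Fu[OF uL] L2_inner_commute[of MX u F] by simp
    have tg: "tensor u g \<in> L2_S_per S U" by (rule tensor_mem[OF uL g])
    define z where "z w = z0 w + lam * tensor u g w" for w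
    have z: "z \<in> L2_S_per S U" unfolding z_def[abs_def] by (intro L2_S_per_add L2_S_per_scale z0 tg)
    note zL = L2_S_perD(1)[OF z] and tgL = L2_S_perD(1)[OF tg]
    let ?F = "\<lambda>w. lift u w + z w"
    have "(?F, \<lambda>w. lam * ?F w + f w) \<in> ts.T"
    proof (rule ts_operatorI[OF u(2) z])
      show "(\<lambda>w. lam * ?F w + f w) \<in> H" by (intro H_add H_scale H_I uL z fH)
      fix v assume v: "v \<in> H1_0 S"
      have vL: "v \<in> L2 MX" by (rule H1_0_L2[OF v])
      \<comment> \<open>The part \<open>lam * tensor u g\<close> of \<open>z\<close> has mean
        \<open>lam * (LINT y|MC. g y)\<close> times \<open>u\<close>; the further factor
        \<open>lam\<close> in the equation makes this the second term of the Zhikov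
        function.\<close>
      have "L2_inner MSC z (lift v) = L2_inner MX (avg z0) v + lam * ((LINT y|MC. g y) * L2_inner MX u v)"
        unfolding z_def[abs_def] combine_inner[OF z0L tgL lift_L2[OF vL]] inner_lift[OF z0L vL] avg_tensor[OF gL uL vL] ..
      then show "hom_form S A u v = L2_inner MSC (\<lambda>w. lam * ?F w + f w) (lift v)"
        unfolding ts_rhs_lift[OF uL zL f lift_L2[OF vL]] u_eq[OF v] inner_lift_lift[OF uL vL] inner_lift[OF f vL]
        by (simp add: algebra_simps power2_eq_square)
    next
      fix b assume b: "b \<in> L2_S_per S U"
      note bL = L2_S_perD(1)[OF b]
      have "L2_inner MSC (Lt z) b = L2_inner MSC (Lt z0) b + lam * L2_inner MSC (Lt (tensor u g)) b"
        unfolding z_def[abs_def] by (rule Lt_combine[OF z0 tg b])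
      moreover have "L2_inner MSC z b = L2_inner MSC z0 b + lam * L2_inner MSC (tensor u g) b"
        unfolding z_def[abs_def] by (rule combine_inner[OF z0L tgL bL])
      ultimately show "L2_inner MSC (Lt z) b = L2_inner MSC (\<lambda>w. lam * ?F w + f w) b"
        unfolding ts_rhs_lift[OF uL zL f bL] using bspec[OF z0_eq b] fb[OF b] Lt_tensor_cell_solution[OF g r uL b]
        by (simp add: algebra_simps)
    qed
    moreover have "L2_inner MSC ?F ?F \<le> C * L2_inner MSC f f"
    proof -
      let ?n = "L2_inner MSC f f"
      have 0: "L2_inner MSC z0 z0 \<le> 1 / c * ?n" using z0_bd ff c(1) by (simp add: field_simps)
      have "L2_inner MX h h \<le> 2 * L2_inner MX (avg f) (avg f) + 2 * (lam\<^sup>2 * L2_inner MX (avg z0) (avg z0))"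
        unfolding h_def[abs_def] using L2_inner_sum_sq_le[OF avg_L2(1)[OF f] L2_scale[OF avg_L2(1)[OF z0L]], of lam]
        by (simp add: L2_inner_scale_left L2_inner_scale_right power2_eq_square mult.assoc)
      also have "\<dots> \<le> 2 * ?n + 2 * (lam\<^sup>2 * (1 / c * ?n))"
        using avg_L2(2)[OF f] avg_L2(2)[OF z0L] 0 by (intro add_mono mult_left_mono) auto
      finally have "Ch * L2_inner MX h h \<le> Ch * (2 * ?n + 2 * (lam\<^sup>2 * (1 / c * ?n)))" using Ch by (rule mult_left_mono)
      then have u1: "L2_inner MX u u \<le> kh * ?n" using u_bd unfolding kh_def by (simp add: algebra_simps)
      have "L2_inner MSC z z \<le> 2 * L2_inner MSC z0 z0 + 2 * (lam\<^sup>2 * (L2_inner MC g g * L2_inner MX u u))"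
        unfolding z_def[abs_def] using L2_inner_sum_sq_le[OF z0L L2_scale[OF tgL], of lam] tensor_self[OF uL gL]
        by (simp add: L2_inner_scale_left L2_inner_scale_right power2_eq_square mult_ac)
      also have "\<dots> \<le> 2 * (1 / c * ?n) + 2 * (lam\<^sup>2 * (L2_inner MC g g * (kh * ?n)))"
        using 0 u1 by (intro add_mono mult_left_mono) auto
      finally have "L2_inner MSC ?F ?F \<le> 2 * (kh * ?n) + 2 * (2 * (1 / c * ?n) + 2 * (lam\<^sup>2 * (L2_inner MC g g * (kh * ?n))))"
        using L2_inner_sum_sq_le[OF lift_L2[OF uL] zL] inner_lift_lift[OF uL uL] u1 by simp
      also have "\<dots> = C * ?n" unfolding C_def by (simp add: algebra_simps)
      finally show ?thesis .
    qed
    ultimately show "\<exists>F. (F, \<lambda>x. lam * F x + f x) \<in> ts.T \<and> L2_inner MSC F F \<le> C * L2_inner MSC f f" by blast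
  qed
qed

lemma hom_resolvent_of_two_scale:
  assumes soft: "complex_of_real lam \<in> resolvent_set MC (L2_per U) soft.T"
    and g: "g \<in> L2_per U" and r: "L2_inner MC (cell_residual lam g) (cell_residual lam g) = 0"
    and ts: "complex_of_real lam \<in> resolvent_set MSC H ts.T"
  shows "complex_of_real (lam + lam\<^sup>2 * (LINT y|MC. g y)) \<in> resolvent_set MX (L2 MX) hom.T" (is "complex_of_real ?\<beta> \<in> _")
proof -
  obtain c where c: "c > 0" "\<forall>z\<in>L2_per U. c * L2_inner MC z z \<le> L2_inner MC (\<lambda>y. L z y - lam * z y) (\<lambda>y. L z y - lam * z y)"
    using soft_bounded_below[OF soft] by blast
  obtain C where C: "C \<ge> 0"
    and ex: "\<And>h. h \<in> H \<Longrightarrow> \<exists>F. (F, \<lambda>x. lam * F x + h x) \<in> ts.T"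
    and bd: "\<And>F h. h \<in> H \<Longrightarrow> (F, \<lambda>x. lam * F x + h x) \<in> ts.T \<Longrightarrow> L2_inner MSC F F \<le> C * L2_inner MSC h h"
    by (rule ts.real_resolventD[OF ts]) (rule that; blast)
  note gL = L2_perD(1)[OF g]
  show ?thesis
  \<comment> \<open>\<open>ksum\<close> recovers \<open>u\<close> from the sum, \<open>C\<close> is
    the two-scale resolvent bound, and \<open>1 / \<theta>\<close> is the ratio of the norm squares
    of \<open>tensor k n\<close> and \<open>h\<close>.\<close>
  proof (rule hom.real_resolventI[of _ "ksum * C / \<theta>"])
    fix h assume h: "h \<in> L2 MX"
    \<comment> \<open>\<open>\<theta>\<close> is the integral of \<open>n\<close>, so
      \<open>tensor k n\<close> has mean \<open>h\<close>, while it is orthogonal to all microscopic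
      test functions.\<close>
    define k where "k x = 1 / \<theta> * h x" for x
    have k: "k \<in> L2 MX" unfolding k_def[abs_def] by (rule L2_scale[OF h])
    let ?f = "tensor k n"
    have fH: "?f \<in> H" by (rule H_tensor_n[OF k])
    note fL = H_L2[OF fH]
    obtain F where F: "(F, \<lambda>w. lam * F w + ?f w) \<in> ts.T" using ex[OF fH] by blast
    obtain u z where FH: "F \<in> H" and u: "u \<in> H1_0 S" and z: "z \<in> L2_S_per S U" and Fuz: "AE w in MSC. F w = lift u w + z w"
      and macro: "\<And>v. v \<in> H1_0 S \<Longrightarrow> hom_form S A u v = L2_inner MSC (\<lambda>w. lam * F w + ?f w) (lift v)"
      and micro: "\<And>b. b \<in> L2_S_per S U \<Longrightarrow> L2_inner MSC (Lt z) b = L2_inner MSC (\<lambda>w. lam * F w + ?f w) b"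
      by (rule ts_operatorE[OF F]) (rule that; blast)
    have uL: "u \<in> L2 MX" by (rule H1_0_L2[OF u])
    note zL = L2_S_perD(1)[OF z] and FL = H_L2[OF FH]
    let ?F = "\<lambda>w. lift u w + z w"
    have F'L: "?F \<in> L2 MSC" by (rule L2_add[OF lift_L2[OF uL] zL])
    have rhs: "L2_inner MSC (\<lambda>w. lam * F w + ?f w) b = lam * L2_inner MSC (lift u) b + lam * L2_inner MSC z b + L2_inner MSC ?f b"
      if b: "b \<in> L2 MSC" for b
    proof -
      have "L2_inner MSC F b = L2_inner MSC ?F b" by (rule L2_inner_cong_AE[OF FL F'L b Fuz])
      then show ?thesis
        using L2_inner_add_left[OF L2_scale[OF FL] fL b, of lam] L2_inner_add_left[OF lift_L2[OF uL] zL b]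
        by (simp add: L2_inner_scale_left distrib_left)
    qed
    have tg: "tensor u g \<in> L2_S_per S U" by (rule tensor_mem[OF uL g])
    \<comment> \<open>What \<open>z\<close> has in excess of \<open>lam * tensor u g\<close> solves
      the homogeneous microscopic equation, so by the bound from below it has norm zero.\<close>
    define w where "w x = z x + - lam * tensor u g x" for x
    have w: "w \<in> L2_S_per S U" unfolding w_def[abs_def] by (intro L2_S_per_add L2_S_per_scale z tg)
    note tgL = L2_S_perD(1)[OF tg] and wL = L2_S_perD(1)[OF w] and LwL = L2_S_perD(1)[OF Lt_L2(1)[OF w]]
    have weq: "L2_inner MSC (Lt w) b = lam * L2_inner MSC w b" if b: "b \<in> L2_S_per S U" for b
    proof -
      note bL = L2_S_perD(1)[OF b]
      have 1: "L2_inner MSC (Lt w) b = L2_inner MSC (Lt z) b + - lam * L2_inner MSC (Lt (tensor u g)) b"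
        unfolding w_def[abs_def] by (rule Lt_combine[OF z tg b])
      have 2: "L2_inner MSC w b = L2_inner MSC z b + - lam * L2_inner MSC (tensor u g) b"
        unfolding w_def[abs_def] by (rule combine_inner[OF zL tgL bL])
      show ?thesis
        unfolding 1 2 micro[OF b] rhs[OF bL] inner_tensor_n[OF k b] Lt_tensor_cell_solution[OF g r uL b]
        by (simp add: algebra_simps)
    qed
    let ?r = "\<lambda>x. Lt w x - lam * w x"
    have rm: "?r \<in> L2_S_per S U" by (intro L2_S_per_diff L2_S_per_scale Lt_L2(1) w)
    have "L2_inner MSC ?r ?r = 0"
      using L2_inner_diff_left[OF LwL L2_scale[OF wL] L2_S_perD(1)[OF rm], of lam] weq[OF rm] by (simp add: L2_inner_scale_left)
    then have "c * L2_inner MSC w w \<le> 0" using Lt_bounded_below[OF c(1) bspec[OF c(2)] w] by simp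
    then have "L2_inner MSC w w = 0" using c(1) L2_inner_nonneg[of MSC w] by (simp add: mult_le_0_iff)
    note w0 = inner_zero_of_null[OF wL _ this]
    have ueq: "hom_form S A u v = L2_inner MX (\<lambda>x. ?\<beta> * u x + h x) v" if v: "v \<in> H1_0 S" for v
    proof -
      have vL: "v \<in> L2 MX" by (rule H1_0_L2[OF v])
      have "L2_inner MSC w (lift v) = L2_inner MSC z (lift v) + - lam * L2_inner MSC (tensor u g) (lift v)"
        unfolding w_def[abs_def] by (rule combine_inner[OF zL tgL lift_L2[OF vL]])
      then have 1: "L2_inner MSC z (lift v) = lam * ((LINT y|MC. g y) * L2_inner MX u v)"
        using w0[OF lift_L2[OF vL]] avg_tensor[OF gL uL vL] by simp
      have 2: "L2_inner MSC ?f (lift v) = L2_inner MX h v"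
        unfolding avg_tensor[OF n_L2 k vL] integral_n unfolding k_def[abs_def] L2_inner_scale_left using theta_pos by simp
      show ?thesis
        unfolding macro[OF v] rhs[OF lift_L2[OF vL]] 1 2 inner_lift_lift[OF uL vL]
          L2_inner_add_left[OF L2_scale[OF uL] h vL] L2_inner_scale_left
        by (simp add: algebra_simps power2_eq_square)
    qed
    have "(u, \<lambda>x. ?\<beta> * u x + h x) \<in> hom.T"
      by (rule hom.operatorI[OF u L2_add[OF L2_scale[OF uL] h] ueq])
    moreover have "L2_inner MX u u \<le> ksum * C / \<theta> * L2_inner MX h h"
    proof -
      have "L2_inner MX u u \<le> ksum * L2_inner MSC ?F ?F"
        using direct_sum_bound[OF uL z] L2_inner_nonneg[of MSC z] by linarith
      also have "L2_inner MSC ?F ?F = L2_inner MSC F F"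
        using L2_inner_cong_AE[OF FL F'L FL Fuz] L2_inner_cong_AE[OF FL F'L F'L Fuz] L2_inner_commute[of MSC F ?F] by simp
      also have "ksum * \<dots> \<le> ksum * (C * L2_inner MSC ?f ?f)"
        using bd[OF fH F] ksum_pos by (intro mult_left_mono) auto
      also have "L2_inner MSC ?f ?f = L2_inner MX h h / \<theta>"
        unfolding tensor_self[OF k n_L2] unfolding k_def[abs_def] L2_inner_scale_left L2_inner_scale_right using theta_pos by simp
      finally show ?thesis by (simp add: mult.assoc)
    qed
    ultimately show "\<exists>F. (F, \<lambda>x. ?\<beta> * F x + h x) \<in> hom.T \<and> L2_inner MX F F \<le> ksum * C / \<theta> * L2_inner MX h h" by blast
  qed
qed

text \<open>A microscopic profile \<open>z\<close> is tested on the two-scale level by \<open>\<psi> z\<close> with \<open>\<psi> = (A\<^sub>h\<^sub>o\<^sub>m - \<lambda>) \<phi>\<close>, the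
  macroscopic part \<open>\<lambda> \<langle>z\<rangle> \<phi>\<close> compensating the mean of \<open>z\<close>. Its contribution to the right-hand side is
  negligible once \<open>\<psi>\<close> is large compared with \<open>\<phi>\<close>.\<close>

lemma soft_resolvent_of_two_scale:
  assumes ts: "complex_of_real lam \<in> resolvent_set MSC H ts.T"
  shows "complex_of_real lam \<in> resolvent_set MC (L2_per U) soft.T"
proof -
  obtain C where C: "C \<ge> 0"
    and bd: "\<And>F h. h \<in> H \<Longrightarrow> (F, \<lambda>x. lam * F x + h x) \<in> ts.T \<Longrightarrow> L2_inner MSC F F \<le> C * L2_inner MSC h h"
    by (rule ts.real_resolventD[OF ts]) (rule that; blast)
  let ?I = "indicat_real U"
  note IL = L2_perD(1)[OF indicator_L2_per]
  define nI where "nI = L2_inner MC ?I ?I"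
  define K where "K = ksum * C"
  \<comment> \<open>The constants are those of the estimate
    \<open>P2 * Z \<le> K1 * (P2 * F0) + K2 * (Q2 * Z)\<close> proved below, where \<open>P2\<close>
    and \<open>Q2\<close> are the norm squares of \<open>\<psi>\<close> and \<open>\<phi>\<close>,
    and \<open>Z\<close> and \<open>F0\<close> those of a profile and of its image under
    \<open>L - lam\<close>.\<close>
  define K1 where "K1 = K * (2 + 8 / \<theta>)"
  define K2 where "K2 = K * (lam^4 * nI * (4 + 8 / \<theta>))"
  have K: "0 \<le> K" using C ksum_pos by (simp add: K_def)
  have K1: "0 \<le> K1" using K theta_pos by (simp add: K1_def)
  have nI: "0 \<le> nI" by (simp add: nI_def)
  have K2: "0 \<le> K2" using K theta_pos nI by (simp add: K2_def)
  \<comment> \<open>The norm square of \<open>neg_lap A \<phi>\<close> is at most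
    \<open>2 * P2 + 2 * (lam\<^sup>2 * Q2)\<close>, so this factor ensures
    \<open>2 * (K2 * Q2) < P2\<close>. The same \<open>\<phi>\<close> serves all profiles.\<close>
  obtain \<phi> where \<phi>: "\<phi> \<in> test_functions S"
    and big: "L2_inner MX (neg_lap A \<phi>) (neg_lap A \<phi>) > (4 * K2 + 2 * lam\<^sup>2) * L2_inner MX \<phi> \<phi>"
    using neg_lap_unbounded[OF S_open A S_ne] by blast
  have \<phi>0: "\<phi> \<in> H1_0 S" by (rule test_H1_0[OF S_open \<phi>])
  have \<phi>L: "\<phi> \<in> L2 MX" by (rule H1_0_L2[OF \<phi>0])
  have nL: "neg_lap A \<phi> \<in> L2 MX" by (rule neg_lap_L2[OF S_open \<phi>])
  define \<psi> where "\<psi> x = neg_lap A \<phi> x - lam * \<phi> x" for x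
  have \<psi>L: "\<psi> \<in> L2 MX" unfolding \<psi>_def[abs_def] by (intro L2_diff L2_scale nL \<phi>L)
  define P2 where "P2 = L2_inner MX \<psi> \<psi>"
  define Q2 where "Q2 = L2_inner MX \<phi> \<phi>"
  have nlap: "neg_lap A \<phi> = (\<lambda>x. \<psi> x + lam * \<phi> x)" by (simp add: fun_eq_iff \<psi>_def)
  have "L2_inner MX (neg_lap A \<phi>) (neg_lap A \<phi>) \<le> 2 * P2 + 2 * (lam\<^sup>2 * Q2)"
    unfolding nlap P2_def Q2_def using L2_inner_sum_sq_le[OF \<psi>L L2_scale[OF \<phi>L], of lam]
    by (simp add: L2_inner_scale_left L2_inner_scale_right power2_eq_square mult.assoc)
  with big have P2: "2 * (K2 * Q2) < P2" unfolding Q2_def[symmetric] by (simp add: distrib_right)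
  have Q2: "0 \<le> Q2" by (simp add: Q2_def)
  have "0 \<le> K2 * Q2" using K2 Q2 by simp
  with P2 have P2p: "0 < P2" by linarith
  have key: "L2_inner MC z z \<le> 2 * K1 * L2_inner MC (\<lambda>y. L z y - lam * z y) (\<lambda>y. L z y - lam * z y)"
    if z: "z \<in> L2_per U" for z
  proof -
    define f0 where "f0 y = L z y - lam * z y" for y
    have f0: "f0 \<in> L2_per U" unfolding f0_def[abs_def] by (intro L2_per_diff L_mem L2_per_scale z)
    note zL = L2_perD(1)[OF z] and f0L = L2_perD(1)[OF f0]
    define m where "m = (LINT y|MC. z y)"
    define m0 where "m0 = (LINT y|MC. f0 y)"
    define mU where "mU = (LINT y|MC. ?I y)"
    \<comment> \<open>For \<open>u = lam * m * \<phi>\<close> all terms of the macroscopic equation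
      cancel except the mean of the source, which therefore has to vanish. The part
      \<open>tensor k n\<close> achieves this unseen by the microscopic equation:
      \<open>\<theta> * k\<close> is minus the mean of the other two parts of
      \<open>f\<close>.\<close>
    define k where "k x = lam\<^sup>2 * m * mU / \<theta> * \<phi> x + - m0 / \<theta> * \<psi> x" for x
    have kL: "k \<in> L2 MX" unfolding k_def[abs_def] by (intro L2_add L2_scale \<psi>L \<phi>L)
    define u where "u x = lam * m * \<phi> x" for x
    have u: "u \<in> H1_0 S" unfolding u_def[abs_def] by (intro test_H1_0[OF S_open] test_functions_cmult \<phi>)
    have uL: "u \<in> L2 MX" by (rule H1_0_L2[OF u])
    define zz where "zz = tensor \<psi> z"
    have zz: "zz \<in> L2_S_per S U" unfolding zz_def by (rule tensor_mem[OF \<psi>L z])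
    note zzL = L2_S_perD(1)[OF zz]
    let ?t0 = "tensor \<psi> f0" and ?tU = "tensor \<phi> ?I" and ?tn = "tensor k n"
    note t0 = tensor_mem[OF \<psi>L f0] and tU = tensor_mem[OF \<phi>L indicator_L2_per]
    note L' = L2_S_perD(1)[OF t0] L2_S_perD(1)[OF tU] tensor_L2[OF kL n_L2]
    \<comment> \<open>The three parts are the intended source, the compensation of
      \<open>lam * u\<close> on the soft phase, and the correction of the mean.\<close>
    define f where "f w = ?t0 w + (- (lam\<^sup>2 * m) * ?tU w + ?tn w)" for w
    have fH: "f \<in> H" unfolding f_def[abs_def] by (intro H_add H_scale H_tensor_n[OF kL] H_per[OF t0] H_per[OF tU])
    note fL = H_L2[OF fH]
    have fb: "L2_inner MSC f b = L2_inner MSC ?t0 b - lam\<^sup>2 * m * L2_inner MSC ?tU b + L2_inner MSC ?tn b" if b: "b \<in> L2 MSC" for b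
      unfolding f_def[abs_def] L2_inner_add_left[OF L'(1) L2_add[OF L2_scale[OF L'(2)] L'(3)] b]
        L2_inner_add_left[OF L2_scale[OF L'(2)] L'(3) b] L2_inner_scale_left by simp
    let ?F = "\<lambda>w. lift u w + zz w"
    have T: "(?F, \<lambda>w. lam * ?F w + f w) \<in> ts.T"
    proof (rule ts_operatorI[OF u zz])
      show "(\<lambda>w. lam * ?F w + f w) \<in> H" by (intro H_add H_scale H_I uL zz fH)
      fix v assume v: "v \<in> H1_0 S"
      have vL: "v \<in> L2 MX" by (rule H1_0_L2[OF v])
      let ?a = "L2_inner MX \<phi> v" and ?b = "L2_inner MX \<psi> v"
      have kv: "\<theta> * L2_inner MX k v = lam\<^sup>2 * m * mU * ?a - m0 * ?b"
        unfolding k_def[abs_def] L2_inner_add_left[OF L2_scale[OF \<phi>L] L2_scale[OF \<psi>L] vL] L2_inner_scale_left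
        using theta_pos by (simp add: field_simps)
      have "hom_form S A u v = lam * m * hom_form S A \<phi> v"
        unfolding u_def[abs_def] using \<phi>0 v H1_0_H1[OF S_open] by (intro hom_form_linear(2)[OF S_open, of \<phi> \<phi>]) auto
      also have "hom_form S A \<phi> v = L2_inner MX (neg_lap A \<phi>) v"
        by (rule hom_form_test[OF S_open \<phi> H1_0_H1[OF S_open v]])
      also have "\<dots> = ?b + lam * ?a"
        unfolding nlap L2_inner_add_left[OF \<psi>L L2_scale[OF \<phi>L] vL] L2_inner_scale_left ..
      finally have lhs: "hom_form S A u v = lam * m * (?b + lam * ?a)" .
      show "hom_form S A u v = L2_inner MSC (\<lambda>w. lam * ?F w + f w) (lift v)"
        unfolding ts_rhs_lift[OF uL zzL fL lift_L2[OF vL]] fb[OF lift_L2[OF vL]]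
        unfolding zz_def avg_tensor[OF zL \<psi>L vL]
          avg_tensor[OF f0L \<psi>L vL] avg_tensor[OF IL \<phi>L vL] avg_tensor[OF n_L2 kL vL] integral_n inner_lift_lift[OF uL vL]
          kv lhs m_def[symmetric] m0_def[symmetric] mU_def[symmetric]
        unfolding u_def[abs_def] L2_inner_scale_left by (simp add: algebra_simps power2_eq_square)
    next
      fix b assume b: "b \<in> L2_S_per S U"
      note bL = L2_S_perD(1)[OF b]
      have "Lt zz = (\<lambda>w. ?t0 w + lam * zz w)"
        unfolding zz_def Lt_tensor by (simp add: fun_eq_iff tensor_def f0_def algebra_simps)
      then have 1: "L2_inner MSC (Lt zz) b = L2_inner MSC ?t0 b + lam * L2_inner MSC zz b"
        using combine_inner[OF L'(1) zzL bL, of lam] by simp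
      have 2: "lift u = (\<lambda>w. (lam * m) * lift \<phi> w)" by (simp add: fun_eq_iff lift_def u_def)
      show "L2_inner MSC (Lt zz) b = L2_inner MSC (\<lambda>w. lam * ?F w + f w) b"
        unfolding ts_rhs_lift[OF uL zzL fL bL] fb[OF bL] inner_tensor_n[OF kL b] inner_tensor_U[OF \<phi>L b] 1
        unfolding 2 L2_inner_scale_left by (simp add: power2_eq_square)
    qed
    define Z where "Z = L2_inner MC z z"
    define F0 where "F0 = L2_inner MC f0 f0"
    have "L2_inner MX u u + L2_inner MSC zz zz \<le> ksum * L2_inner MSC ?F ?F" by (rule direct_sum_bound[OF uL zz])
    also have "\<dots> \<le> ksum * (C * L2_inner MSC f f)" using bd[OF fH T] ksum_pos by (intro mult_left_mono) auto
    finally have 1: "P2 * Z \<le> K * L2_inner MSC f f"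
      using L2_inner_nonneg[of MX u] tensor_self[OF \<psi>L zL] unfolding zz_def P2_def Z_def K_def mult.assoc by linarith
    have mm: "m\<^sup>2 \<le> Z" "m0\<^sup>2 \<le> F0" "mU\<^sup>2 \<le> nI"
      unfolding m_def m0_def mU_def Z_def F0_def nI_def by (intro mean_sq_le zL f0L IL)+
    have sq: "L2_inner M (\<lambda>x. c * g x) (\<lambda>x. c * g x) = c\<^sup>2 * L2_inner M g g" for M :: "'x measure" and c g
      by (simp add: L2_inner_scale_left L2_inner_scale_right power2_eq_square)
    have 2: "L2_inner MSC f f \<le> 2 * (P2 * F0) + 2 * (2 * ((lam\<^sup>2 * m)\<^sup>2 * (Q2 * nI)) + 2 * (L2_inner MX k k * \<theta>))"
    proof -
      have "L2_inner MSC (\<lambda>w. - (lam\<^sup>2 * m) * ?tU w + ?tn w) (\<lambda>w. - (lam\<^sup>2 * m) * ?tU w + ?tn w)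
          \<le> 2 * ((lam\<^sup>2 * m)\<^sup>2 * (Q2 * nI)) + 2 * (L2_inner MX k k * \<theta>)"
        using L2_inner_sum_sq_le[OF L2_scale[OF L'(2), of "- (lam\<^sup>2 * m)"] L'(3)]
        unfolding sq tensor_self[OF kL n_L2] tensor_self[OF \<phi>L IL] Q2_def nI_def by simp
      moreover have "L2_inner MSC ?t0 ?t0 = P2 * F0" unfolding P2_def F0_def by (rule tensor_self[OF \<psi>L f0L])
      moreover have "x \<le> 2 * y' + 2 * t'" if "x \<le> 2 * y + 2 * t" "t \<le> t'" "y = y'" for x y t y' t' :: real
        using that by linarith
      ultimately show ?thesis
        using L2_inner_sum_sq_le[OF L'(1) L2_add[OF L2_scale[OF L'(2)] L'(3)], of "- (lam\<^sup>2 * m)"]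
        unfolding f_def[abs_def] by blast
    qed
    have 3: "L2_inner MX k k \<le> 2 * ((lam\<^sup>2 * m * mU / \<theta>)\<^sup>2 * Q2) + 2 * ((- m0 / \<theta>)\<^sup>2 * P2)"
      using L2_inner_sum_sq_le[OF L2_scale[OF \<phi>L, of "lam\<^sup>2 * m * mU / \<theta>"] L2_scale[OF \<psi>L, of "- m0 / \<theta>"]]
      unfolding sq k_def[abs_def] P2_def Q2_def .
    have m2: "m\<^sup>2 * mU\<^sup>2 \<le> Z * nI" using mm by (intro mult_mono) (auto simp: Z_def)
    have 4: "(lam\<^sup>2 * m * mU / \<theta>)\<^sup>2 * Q2 \<le> lam^4 * (Z * nI) / \<theta>\<^sup>2 * Q2"
    proof -
      have "(lam\<^sup>2 * m * mU / \<theta>)\<^sup>2 * Q2 = lam^4 * (m\<^sup>2 * mU\<^sup>2) / \<theta>\<^sup>2 * Q2"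
        by (simp add: power_mult_distrib power_divide flip: power_mult)
      also have "\<dots> \<le> lam^4 * (Z * nI) / \<theta>\<^sup>2 * Q2"
        using m2 Q2 by (intro mult_right_mono divide_right_mono mult_left_mono) auto
      finally show ?thesis .
    qed
    have 5: "(- m0 / \<theta>)\<^sup>2 * P2 \<le> F0 / \<theta>\<^sup>2 * P2"
      using mm(2) P2p by (intro mult_right_mono) (auto simp: power_divide intro: divide_right_mono)
    have "L2_inner MX k k * \<theta> \<le> (2 * (lam^4 * (Z * nI) / \<theta>\<^sup>2 * Q2) + 2 * (F0 / \<theta>\<^sup>2 * P2)) * \<theta>"
      using 3 4 5 theta_pos by (intro mult_right_mono) auto
    also have "\<dots> = 2 * (lam^4 * (Z * nI) * Q2) / \<theta> + 2 * (F0 * P2) / \<theta>"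
      using theta_pos by (simp add: field_simps power2_eq_square)
    finally have 6: "L2_inner MX k k * \<theta> \<le> 2 * (lam^4 * (Z * nI) * Q2) / \<theta> + 2 * (F0 * P2) / \<theta>" .
    have 7: "(lam\<^sup>2 * m)\<^sup>2 * (Q2 * nI) \<le> lam^4 * Z * (Q2 * nI)"
    proof -
      have "(lam\<^sup>2 * m)\<^sup>2 * (Q2 * nI) = lam^4 * m\<^sup>2 * (Q2 * nI)" by (simp add: power_mult_distrib flip: power_mult)
      also have "\<dots> \<le> lam^4 * Z * (Q2 * nI)" using mm(1) Q2 nI by (intro mult_right_mono mult_left_mono) auto
      finally show ?thesis .
    qed
    have "L2_inner MSC f f \<le> 2 * (P2 * F0) + 4 * (lam^4 * Z * (Q2 * nI)) + 4 * (2 * (lam^4 * (Z * nI) * Q2) / \<theta> + 2 * (F0 * P2) / \<theta>)"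
    proof -
      have "x \<le> y + 4 * s' + 4 * t'" if "x \<le> y + 2 * (2 * s + 2 * t)" "t \<le> t'" "s \<le> s'" for x y s t s' t' :: real
        using that by (simp add: distrib_left)
      then show ?thesis using 2 6 7 by blast
    qed
    also have "\<dots> = (2 + 8 / \<theta>) * (P2 * F0) + (lam^4 * nI * (4 + 8 / \<theta>)) * (Q2 * Z)"
      by (simp add: algebra_simps)
    finally have "K * L2_inner MSC f f \<le> K * \<dots>" using K by (rule mult_left_mono)
    from order_trans[OF 1 this] have "P2 * Z \<le> K1 * (P2 * F0) + K2 * (Q2 * Z)"
      unfolding K1_def K2_def mult.assoc[of K] distrib_left[of K "_ * (P2 * F0)"] .
    moreover have "2 * (K2 * (Q2 * Z)) \<le> P2 * Z"
      using mult_right_mono[OF less_imp_le[OF P2], of Z] by (simp add: mult.assoc Z_def)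
    \<comment> \<open>The term with \<open>K2\<close> is at most half of \<open>P2 * Z\<close> and
      is absorbed; dividing by \<open>P2\<close> then removes the macroscopic factor.\<close>
    ultimately have "P2 * Z \<le> P2 * (2 * K1 * F0)" by (simp add: mult_ac)
    then have "Z \<le> 2 * K1 * F0" using P2p by simp
    then show ?thesis unfolding Z_def F0_def f0_def[abs_def] .
  qed
  show ?thesis
  proof (rule soft_resolventI[of "1 / (2 * K1 + 1)"])
    show "1 / (2 * K1 + 1) > 0" using K1 by simp
    fix z assume z: "z \<in> L2_per U"
    let ?N = "L2_inner MC (\<lambda>y. L z y - lam * z y) (\<lambda>y. L z y - lam * z y)"
    have "L2_inner MC z z \<le> (2 * K1 + 1) * ?N"
      unfolding distrib_right using key[OF z] L2_inner_nonneg[of MC "\<lambda>y. L z y - lam * z y"] by linarith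
    then show "1 / (2 * K1 + 1) * L2_inner MC z z \<le> ?N"
      using K1 by (simp add: field_simps)
  qed
qed

text \<open>Non-real points lie in the resolvent sets of the two-scale and of the soft operator. At
  a real point outside the soft spectrum, the two implications between the two-scale and the
  homogenized resolvent are combined; a real point of the soft spectrum is handled by the
  contrapositive of \<open>soft_resolvent_of_two_scale\<close>.\<close>

theorem spectrum_two_scale:
  "Sp_two_scale S U A a p =
    complex_of_real ` {lam. complex_of_real lam \<notin> Sp_soft U a p \<and> complex_of_real (zhikov_beta U a p lam) \<in> Sp_hom S A}
    \<union> Sp_soft U a p"
proof -
  have beta: "\<exists>g. g \<in> L2_per U \<and> L2_inner MC (cell_residual lam g) (cell_residual lam g) = 0 \<and>
      zhikov_beta U a p lam = lam + lam\<^sup>2 * (LINT y|MC. g y)"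
    if soft: "complex_of_real lam \<in> resolvent_set MC (L2_per U) soft.T" for lam
  proof -
    have "\<exists>F. (F, \<lambda>y. lam * F y + indicat_real U y) \<in> soft.T"
      by (rule soft.real_resolventD[OF soft]) (use indicator_L2_per in blast)
    then have "(resolvent soft.T lam (indicat_real U), \<lambda>y. lam * resolvent soft.T lam (indicat_real U) y + indicat_real U y) \<in> soft.T"
      unfolding resolvent_def by (rule someI_ex)
    from cell_solution[OF this] obtain g where "g \<in> L2_per U" "L2_inner MC (cell_residual lam g) (cell_residual lam g) = 0"
      "(LINT y|MC. resolvent soft.T lam (indicat_real U) y) = (LINT y|MC. g y)" by metis
    then show ?thesis unfolding zhikov_beta_def operator_eqs by auto
  qed
  have sp: "mu \<in> Sp_two_scale S U A a p \<longleftrightarrow> mu \<notin> resolvent_set MSC H ts.T"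
    "mu \<in> Sp_soft U a p \<longleftrightarrow> mu \<notin> resolvent_set MC (L2_per U) soft.T"
    "mu \<in> Sp_hom S A \<longleftrightarrow> mu \<notin> resolvent_set MX (L2 MX) hom.T" for mu
    by (simp_all add: Sp_two_scale_def Sp_soft_def Sp_hom_def spectrum_def operator_eqs)
  have real: "complex_of_real lam \<in> Sp_two_scale S U A a p \<longleftrightarrow>
      complex_of_real lam \<in> Sp_soft U a p \<or> complex_of_real (zhikov_beta U a p lam) \<in> Sp_hom S A" for lam
  proof (cases "complex_of_real lam \<in> resolvent_set MC (L2_per U) soft.T")
    case True
    from beta[OF True] obtain g where g: "g \<in> L2_per U" "L2_inner MC (cell_residual lam g) (cell_residual lam g) = 0"
      "zhikov_beta U a p lam = lam + lam\<^sup>2 * (LINT y|MC. g y)" by blast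
    show ?thesis unfolding sp g(3)
      using True two_scale_resolvent_of_hom[OF True g(1,2)] hom_resolvent_of_two_scale[OF True g(1,2)] by blast
  next
    case False
    then show ?thesis unfolding sp using soft_resolvent_of_two_scale[of lam] by blast
  qed
  have im: "mu \<in> complex_of_real ` {lam. P lam} \<longleftrightarrow> Im mu = 0 \<and> P (Re mu)" for mu P
    by (auto simp: image_iff complex_eq_iff intro!: exI[of _ "Re mu"])
  show ?thesis
  proof (rule set_eqI)
    fix mu :: complex
    show "mu \<in> Sp_two_scale S U A a p \<longleftrightarrow> mu \<in> complex_of_real ` {lam. complex_of_real lam \<notin> Sp_soft U a p \<and>
        complex_of_real (zhikov_beta U a p lam) \<in> Sp_hom S A} \<union> Sp_soft U a p"
    proof (cases "Im mu = 0")
      case True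
      then have mu: "mu = complex_of_real (Re mu)" by (simp add: complex_eq_iff)
      show ?thesis unfolding Un_iff im using True real[of "Re mu"] mu by auto
    next
      case False
      then show ?thesis unfolding Un_iff im sp
        using ts.nonreal_in_resolvent_set[OF False] soft.nonreal_in_resolvent_set[OF False] by simp
    qed
  qed
qed

end

theorem theorem2p9:
  fixes Ystiff Ysoft S :: "(real^'d) set"
    and a :: "real^'d \<Rightarrow> real"
    and Lam p :: "real^'d \<Rightarrow> real^'d \<Rightarrow> real"
    and X :: "'d \<Rightarrow> real^'d \<Rightarrow> real"
    and r_a c_a :: real
  assumes "geometry Ystiff Ysoft"
    and "convolution_kernel a r_a c_a"
    and "coefficients Ystiff Lam p"
    and "stiff_connected Ystiff r_a"
    and "\<forall>i. corrector Ystiff a Lam i (X i)"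
    and "S = UNIV \<or> (bounded S \<and> open S \<and> S \<noteq> {} \<and> lipschitz_set S)"
  shows "Sp_two_scale S Ysoft (A_hom a Lam X) a p =
    complex_of_real ` {lam. complex_of_real lam \<notin> Sp_soft Ysoft a p \<and>
        complex_of_real (zhikov_beta Ysoft a p lam) \<in> Sp_hom S (A_hom a Lam X)}
    \<union> Sp_soft Ysoft a p"
proof -
  obtain cA where cA: "coercive_matrix (A_hom a Lam X) cA" using A_hom_coercive[OF assms(1-5)] by blast
  have Y: "open Ystiff" "open Ysoft" "periodic_set Ysoft" "Ystiff \<inter> Ysoft = {}" "Ystiff \<noteq> {}"
    using assms(1) by (auto simp: geometry_def)
  have S: "open S" "S \<noteq> {}" using assms(6) by auto
  have an: "\<And>x. 0 \<le> a x" and ae: "\<And>x. a (- x) = a x" using assms(2) by (auto simp: convolution_kernel_def)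
  obtain w \<alpha>1 \<alpha>2 where w: "0 < \<alpha>1" "\<And>x y. p x y = w x y * (1 - indicat_real Ystiff x * indicat_real Ystiff y)"
    "\<And>x y. \<alpha>1 < w x y" "\<And>x y. w x y < \<alpha>2" and pc: "periodic_coefficient p"
    using assms(3) unfolding coefficients_def by blast
  have p: "0 \<le> p x y" "p x y \<le> \<alpha>2" for x y
    using w(1) w(3)[of x y] w(4)[of x y] unfolding w(2)[of x y] by (auto simp: indicator_def)
  \<comment> \<open>If almost all of the cell were soft, then by periodicity so would be almost all
    of the space, and in particular some point of the open, nonempty stiff phase, which is disjoint
    from the soft one.\<close>
  have "\<not> (AE y in lebesgue_on cell. y \<in> Ysoft)"
  proof
    assume "AE y in lebesgue_on cell. y \<in> Ysoft"
    then have "AE y in lebesgue. y \<in> Ysoft" by (rule periodic_AE[OF Y(3)[unfolded periodic_set_def]])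
    from open_Int_AE_ex[OF Y(1) Y(5) this] show False using Y(4) by blast
  qed
  then interpret two_scale_problem a p \<alpha>2 Ysoft S "A_hom a Lam X" cA
    by unfold_locales (use an ae pc p Y S cA convolution_kernel_integrable[OF assms(2)] in auto)
  show ?thesis by (rule spectrum_two_scale)
qed

end
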